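(* Let $\omega_0$ and $\omega_1$ be germs at $0$ of smooth (respectively $\mathbb R$-analytic) singular symplectic forms on $\mathbb R^4$ with a common structurally smooth Martinet hypersurface $\Sigma_2$ at $0$, let $\iota:\Sigma_2\hookrightarrow\mathbb R^4$ be the inclusion, and suppose $\operatorname{rank}(\iota^{*}\omega_0|_0)=\operatorname{rank}(\iota^{*}\omega_1|_0)=0$. If $\iota^{*}\omega_0=\iota^{*}\omega_1=\sigma$ and the two generators of the ideal $I(\sigma)$ form a regular sequence of length $2$, then there exists a smooth (respectively $\mathbb R$-analytic) diffeomorphism-germ $\Psi:(\mathbb R^4,0)\to(\mathbb R^4,0)$ such that $\Psi^{*}\omega_1=\omega_0$.
   Context: A closed $2$-form-germ $\omega$ at $0$ on $\mathbb R^{4}$ is a singular symplectic form-germ if its Martinet hypersurface $\Sigma_2(\omega)=\{p:\omega^2|_p=0\}$ (where $\omega^2=\omega\wedge\omega$) is nowhere dense. Write $\omega^2=f\,\Omega$ with $\Omega$ the germ at $0$ of a volume form, so $\Sigma_2(\omega)=\{f=0\}$; it is structurally smooth at $0$ if $f(0)=0$ and $df|_0\ne0$. "Common Martinet hypersurface" means $\Sigma_2(\omega_0)=\Sigma_2(\omega_1)=\Sigma_2$. The ideal $I(\sigma)$: in local coordinates $(x,y,z)$ on $\Sigma_2\cong\mathbb R^3$ write $\sigma=a\,dy\wedge dz+b\,dz\wedge dx+c\,dx\wedge dy$. Then $I(\sigma)=\langle a,b,c\rangle$ is the ideal generated by $a,b,c$ in the ring of smooth (respectively $\mathbb R$-analytic)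 function-germs at $0$ on $\Sigma_2$; it does not depend on the coordinates. If $\sigma=\iota^{*}\omega$ is the pullback, under the inclusion $\iota:\Sigma_2\hookrightarrow\mathbb R^4$, of a smooth (respectively $\mathbb R$-analytic) singular symplectic form-germ $\omega$ at $0$ on $\mathbb R^4$ whose Martinet hypersurface $\Sigma_2$ is structurally smooth at $0$, and $\operatorname{rank}(\sigma|_0)=0$, then $\sigma$ satisfies $\alpha\wedge\sigma=0$ for some contact $1$-form-germ $\alpha$ on $\Sigma_2$, and consequently $I(\sigma)$ is generated by two function-germs; "the two generators of $I(\sigma)$" refers to such a pair. A sequence $a_1,\dots,a_r$ of elements of a proper ideal $I$ of a ring $R$ is regular if $a_1$ is a non-zero-divisor of $R$ and $a_i$ is a non-zero-divisor of $R/\langle a_1,\dots,a_{i-1}\rangle$ for $i=2,\dots,r$; its length is $r$. *)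

theory Defs
  imports "HOL-Analysis.Analysis" "HOL-Algebra.QuotRing"
begin

section \<open>Smooth and real-analytic germs of functions and maps\<close>

text \<open>
  Germs at \<open>0\<close> of functions, maps and forms are given by representatives: total functions on
  \<open>real ^ 'n\<close> whose values matter only near \<open>0\<close>. Identities between germs therefore always hold
  ``eventually in \<open>nhds 0\<close>''.

  The two parallel readings ``smooth'' and ``(respectively) real-analytic'' are covered by a
  parameter of type \<open>regularity\<close>.
\<close>

datatype regularity = Smooth | Analytic

text \<open>\<open>Ck_on k f U\<close> is meant for open sets \<open>U\<close>.\<close>

primrec Ck_on :: "nat \<Rightarrow> (real ^ 'n \<Rightarrow> real) \<Rightarrow> (real ^ 'n) set \<Rightarrow> bool" where
  "Ck_on 0 f U \<longleftrightarrow> continuous_on U f"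
| "Ck_on (Suc k) f U \<longleftrightarrow> f differentiable_on U \<and>
     (\<forall>i. Ck_on k (\<lambda>x. frechet_derivative f (at x) (axis i 1)) U)"

definition smooth_on :: "(real ^ 'n \<Rightarrow> real) \<Rightarrow> (real ^ 'n) set \<Rightarrow> bool" where
  "smooth_on f U \<longleftrightarrow> (\<forall>k. Ck_on k f U)"

text \<open>The coefficients of the power series are indexed by multi-indices \<open>\<alpha> :: 'n \<Rightarrow> nat\<close>.\<close>

definition real_analytic_on :: "(real ^ 'n \<Rightarrow> real) \<Rightarrow> (real ^ 'n) set \<Rightarrow> bool" where
  "real_analytic_on f U \<longleftrightarrow>
     (\<forall>p\<in>U. \<exists>c :: ('n \<Rightarrow> nat) \<Rightarrow> real. \<exists>\<epsilon>>0. \<forall>x\<in>ball p \<epsilon>.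
        ((\<lambda>\<alpha>. c \<alpha> * (\<Prod>i\<in>UNIV. (x $ i - p $ i) ^ \<alpha> i)) has_sum f x) UNIV)"

fun regular_on :: "regularity \<Rightarrow> (real ^ 'n \<Rightarrow> real) \<Rightarrow> (real ^ 'n) set \<Rightarrow> bool" where
  "regular_on Smooth f U \<longleftrightarrow> smooth_on f U"
| "regular_on Analytic f U \<longleftrightarrow> real_analytic_on f U"

definition fun_germ :: "regularity \<Rightarrow> (real ^ 'n \<Rightarrow> real) \<Rightarrow> bool" where
  "fun_germ r f \<longleftrightarrow> (\<exists>U. open U \<and> 0 \<in> U \<and> regular_on r f U)"

definition map_germ :: "regularity \<Rightarrow> (real ^ 'm \<Rightarrow> real ^ 'n) \<Rightarrow> bool" where
  "map_germ r F \<longleftrightarrow> (\<forall>i. fun_germ r (\<lambda>x. F x $ i))"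

definition diffeo_germ :: "regularity \<Rightarrow> (real ^ 'n \<Rightarrow> real ^ 'n) \<Rightarrow> bool" where
  "diffeo_germ r F \<longleftrightarrow> map_germ r F \<and> F 0 = 0 \<and>
     (\<exists>G. map_germ r G \<and> G 0 = 0 \<and>
        (\<forall>\<^sub>F x in nhds 0. G (F x) = x) \<and> (\<forall>\<^sub>F y in nhds 0. F (G y) = y))"


section \<open>The ring of function-germs\<close>

definition germ0 :: "(real ^ 'n \<Rightarrow> real) \<Rightarrow> (real ^ 'n \<Rightarrow> real) set" where
  "germ0 f = {g. \<forall>\<^sub>F x in nhds 0. g x = f x}"

definition germ_ring :: "regularity \<Rightarrow> (real ^ 'n \<Rightarrow> real) set ring" where
  "germ_ring r =
     \<lparr>carrier = {germ0 f | f. fun_germ r f},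
      mult = (\<lambda>A B. {h. \<exists>f\<in>A. \<exists>g\<in>B. \<forall>\<^sub>F x in nhds 0. h x = f x * g x}),
      one = germ0 (\<lambda>_. 1),
      zero = germ0 (\<lambda>_. 0),
      add = (\<lambda>A B. {h. \<exists>f\<in>A. \<exists>g\<in>B. \<forall>\<^sub>F x in nhds 0. h x = f x + g x})\<rparr>"


section \<open>Regular sequences\<close>

definition non_zero_divisor :: "('a, 'b) ring_scheme \<Rightarrow> 'a \<Rightarrow> bool" where
  "non_zero_divisor R a \<longleftrightarrow> a \<in> carrier R \<and>
     (\<forall>b\<in>carrier R. a \<otimes>\<^bsub>R\<^esub> b = \<zero>\<^bsub>R\<^esub> \<longrightarrow> b = \<zero>\<^bsub>R\<^esub>)"

definition regular_sequence :: "('a, 'b) ring_scheme \<Rightarrow> 'a set \<Rightarrow> 'a list \<Rightarrow> bool" where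
  "regular_sequence R I as \<longleftrightarrow>
     ideal I R \<and> I \<noteq> carrier R \<and> set as \<subseteq> I \<and> as \<noteq> [] \<and>
     non_zero_divisor R (as ! 0) \<and>
     (\<forall>i. 1 \<le> i \<and> i < length as \<longrightarrow>
        (let J = Idl\<^bsub>R\<^esub> (set (take i as))
         in non_zero_divisor (R Quot J) (J +>\<^bsub>R\<^esub> (as ! i))))"


section \<open>Differential 2-forms\<close>

type_synonym 'n two_form = "real ^ 'n \<Rightarrow> real ^ 'n \<Rightarrow> real ^ 'n \<Rightarrow> real"

definition two_form_germ :: "regularity \<Rightarrow> 'n::finite two_form \<Rightarrow> bool" where
  "two_form_germ r \<omega> \<longleftrightarrow>
     (\<forall>\<^sub>F p in nhds 0. bilinear (\<omega> p) \<and> (\<forall>u. \<omega> p u u = 0)) \<and>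
     (\<forall>i j. fun_germ r (\<lambda>p. \<omega> p (axis i 1) (axis j 1)))"

text \<open>The invariant formula for \<open>d\<omega>(u, v, w)\<close> on constant vector fields, whose brackets vanish.\<close>

definition ext_deriv :: "'n::finite two_form \<Rightarrow>
    real ^ 'n \<Rightarrow> real ^ 'n \<Rightarrow> real ^ 'n \<Rightarrow> real ^ 'n \<Rightarrow> real" where
  "ext_deriv \<omega> p u v w =
     frechet_derivative (\<lambda>q. \<omega> q v w) (at p) u
   - frechet_derivative (\<lambda>q. \<omega> q u w) (at p) v
   + frechet_derivative (\<lambda>q. \<omega> q u v) (at p) w"

definition closed_germ :: "'n::finite two_form \<Rightarrow> bool" where
  "closed_germ \<omega> \<longleftrightarrow> (\<forall>\<^sub>F p in nhds 0. \<forall>u v w. ext_deriv \<omega> p u v w = 0)"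

definition pullback :: "(real ^ 'm \<Rightarrow> real ^ 'n) \<Rightarrow> 'n::finite two_form \<Rightarrow> 'm::finite two_form" where
  "pullback F \<omega> q u v =
     \<omega> (F q) (frechet_derivative F (at q) u) (frechet_derivative F (at q) v)"

definition two_form_germ_eq :: "'n::finite two_form \<Rightarrow> 'n two_form \<Rightarrow> bool" where
  "two_form_germ_eq \<omega> \<eta> \<longleftrightarrow> (\<forall>\<^sub>F p in nhds 0. \<forall>u v. \<omega> p u v = \<eta> p u v)"

definition form_rank :: "(real ^ 'n \<Rightarrow> real ^ 'n \<Rightarrow> real) \<Rightarrow> nat" where
  "form_rank B = rank (\<chi> i j. B (axis i 1) (axis j 1))"

text \<open>The wedge product of two alternating bilinear forms, as the sum over all \<open>(2,2)\<close>-shuffles.\<close>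

definition wedge :: "('v \<Rightarrow> 'v \<Rightarrow> real) \<Rightarrow> ('v \<Rightarrow> 'v \<Rightarrow> real) \<Rightarrow>
    'v \<Rightarrow> 'v \<Rightarrow> 'v \<Rightarrow> 'v \<Rightarrow> real" where
  "wedge B C u v w x =
     B u v * C w x - B u w * C v x + B u x * C v w
   + B v w * C u x - B v x * C u w + B w x * C u v"


section \<open>Singular symplectic forms and Martinet hypersurfaces\<close>

definition martinet :: "4 two_form \<Rightarrow> (real ^ 4) set" where
  "martinet \<omega> = {p. \<forall>u v w x. wedge (\<omega> p) (\<omega> p) u v w x = 0}"

definition nowhere_dense_germ :: "(real ^ 'n) set \<Rightarrow> bool" where
  "nowhere_dense_germ S \<longleftrightarrow> (\<exists>U. open U \<and> 0 \<in> U \<and> interior (closure (S \<inter> U)) = {})"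

definition set_germ_eq :: "(real ^ 'n) set \<Rightarrow> (real ^ 'n) set \<Rightarrow> bool" where
  "set_germ_eq S T \<longleftrightarrow> (\<forall>\<^sub>F p in nhds 0. p \<in> S \<longleftrightarrow> p \<in> T)"

definition singular_symplectic :: "regularity \<Rightarrow> 4 two_form \<Rightarrow> bool" where
  "singular_symplectic r \<omega> \<longleftrightarrow>
     two_form_germ r \<omega> \<and> closed_germ \<omega> \<and> nowhere_dense_germ (martinet \<omega>)"

text \<open>
  Every 4-form on \<open>\<real>\<^sup>4\<close> is a function \<open>h\<close> times \<open>dx\<^sub>1 \<and> dx\<^sub>2 \<and> dx\<^sub>3 \<and> dx\<^sub>4\<close>, the determinant;
  it is the germ of a volume form iff \<open>h 0 \<noteq> 0\<close>.
\<close>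

definition volume_form_germ :: "regularity \<Rightarrow>
    (real ^ 4 \<Rightarrow> real ^ 4 \<Rightarrow> real ^ 4 \<Rightarrow> real ^ 4 \<Rightarrow> real ^ 4 \<Rightarrow> real) \<Rightarrow> bool" where
  "volume_form_germ r \<Omega> \<longleftrightarrow>
     (\<exists>h. fun_germ r h \<and> h 0 \<noteq> 0 \<and>
        (\<forall>\<^sub>F p in nhds 0. \<forall>u v w x.
           \<Omega> p u v w x = h p * det (vector [u, v, w, x] :: real ^ 4 ^ 4)))"

definition structurally_smooth :: "regularity \<Rightarrow> 4 two_form \<Rightarrow> bool" where
  "structurally_smooth r \<omega> \<longleftrightarrow>
     (\<exists>f \<Omega>. fun_germ r f \<and> volume_form_germ r \<Omega> \<and>
        (\<forall>\<^sub>F p in nhds 0. \<forall>u v w x. wedge (\<omega> p) (\<omega> p) u v w x = f p * \<Omega> p u v w x) \<and>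
        f 0 = 0 \<and> frechet_derivative f (at 0) \<noteq> (\<lambda>_. 0))"

text \<open>
  \<open>hypersurface_chart r S \<phi>\<close>: near \<open>0\<close>, \<open>\<phi>\<close> is a regular parametrization of the hypersurface
  germ \<open>S\<close>, that is, the inclusion of \<open>S\<close> in \<open>\<real>\<^sup>4\<close> expressed in local coordinates \<open>(x, y, z)\<close> on \<open>S\<close>
  centred at \<open>0\<close>. In these coordinates the pullback to \<open>S\<close> of a form \<open>\<omega>\<close> is \<open>pullback \<phi> \<omega>\<close>, and the
  ring of function-germs on \<open>S\<close> is \<open>germ_ring r\<close> on \<open>real ^ 3\<close>.
\<close>

definition hypersurface_chart ::
    "regularity \<Rightarrow> (real ^ 4) set \<Rightarrow> (real ^ 3 \<Rightarrow> real ^ 4) \<Rightarrow> bool" where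
  "hypersurface_chart r S \<phi> \<longleftrightarrow>
     map_germ r \<phi> \<and> \<phi> 0 = 0 \<and> inj (frechet_derivative \<phi> (at 0)) \<and>
     (\<exists>U V \<psi>. open U \<and> 0 \<in> U \<and> open V \<and> 0 \<in> V \<and> homeomorphism U (S \<inter> V) \<phi> \<psi>)"

text \<open>
  If \<open>\<sigma> = a dy \<and> dz + b dz \<and> dx + c dx \<and> dy\<close>, then \<open>a = \<sigma>(\<partial>\<^sub>y, \<partial>\<^sub>z)\<close>, \<open>b = \<sigma>(\<partial>\<^sub>z, \<partial>\<^sub>x)\<close> and
  \<open>c = \<sigma>(\<partial>\<^sub>x, \<partial>\<^sub>y)\<close>.
\<close>

definition coeff_ideal :: "regularity \<Rightarrow> 3 two_form \<Rightarrow> (real ^ 3 \<Rightarrow> real) set set" where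
  "coeff_ideal r \<sigma> =
     Idl\<^bsub>germ_ring r\<^esub> {germ0 (\<lambda>q. \<sigma> q (axis 2 1) (axis 3 1)),
                       germ0 (\<lambda>q. \<sigma> q (axis 3 1) (axis 1 1)),
                       germ0 (\<lambda>q. \<sigma> q (axis 1 1) (axis 2 1))}"

end

theory Submission
  imports Defs "HOL-Complex_Analysis.Cauchy_Integral_Formula"
begin

text \<open>
  Straighten the hypersurface to \<open>x\<^sub>1 = 0\<close>. There \<open>\<omega>\<^sub>i\<close> is given by its tangential part \<open>\<sigma>\<close>, with coefficient
  vector \<open>s\<close>, and its normal part, a vector field \<open>a\<^sub>i\<close> with \<open>a\<^sub>i \<bullet> s = 0\<close>; closedness gives \<open>div s = 0\<close> and
  \<open>\<partial>\<^sub>1 s = curl a\<^sub>i\<close>, so that \<open>a\<^sub>i \<bullet> curl a\<^sub>i\<close> at \<open>0\<close> is the transversal derivative of the Pfaffian and does not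
  vanish. Since the generators of \<open>I(\<sigma>)\<close> form a regular sequence, their syzygies are trivial; hence \<open>a\<^sub>0\<close> and
  \<open>a\<^sub>1\<close> are parallel at \<open>0\<close>, and \<open>a\<^sub>t \<bullet> curl a\<^sub>t \<noteq> 0\<close> at \<open>0\<close> for every \<open>a\<^sub>t = (1 - t) a\<^sub>0 + t a\<^sub>1\<close>, once the side of the
  hypersurface is chosen so that \<open>a\<^sub>0\<close> and \<open>a\<^sub>1\<close> point in the same direction.

  Moser's method then applies to \<open>\<omega>\<^sub>t = (1 - t) \<omega>\<^sub>0 + t \<omega>\<^sub>1\<close>. The relative Poincare lemma gives
  \<open>\<omega>\<^sub>1 - \<omega>\<^sub>0 = d(x\<^sub>1 h)\<close>; the Pfaffian of \<open>\<omega>\<^sub>t\<close> is \<open>x\<^sub>1\<close> times a unit, so \<open>\<omega>\<^sub>t(X\<^sub>t, -) = - x\<^sub>1 h\<close> has a solution that is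
  smooth (analytic) across the hypersurface, and \<open>X\<^sub>t\<close> vanishes at \<open>0\<close> because \<open>h\<close> is parallel to \<open>a\<^sub>t\<close> there. The time-one
  flow of \<open>X\<^sub>t\<close> is the required diffeomorphism; its analyticity comes from integrating the
  holomorphic extension of the field.
\<close>

text \<open>The crux is nondegeneracy along the whole path. Write
  \<open>a\<^sub>i = c\<^sub>i n\<close> at \<open>0\<close> and let \<open>A\<^sub>i\<close> be the
  derivative of \<open>a\<^sub>i\<close> there. The transversal derivative of the Pfaffian of
  \<open>\<omega>\<^sub>t\<close> at \<open>0\<close> is a quadratic polynomial in t, which might
  vanish inside the interval although it is nonzero at both ends. Regularity and
  \<open>div s = 0\<close> force \<open>c\<^sub>0 (n \<bullet> curl A\<^sub>1) = c\<^sub>1 (n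
  \<bullet> curl A\<^sub>0)\<close>. Hence \<open>c\<^sub>0\<close> times this polynomial is
  \<open>c\<^sub>t\<^sup>2 (n \<bullet> curl A\<^sub>0)\<close> with
  \<open>c\<^sub>t = (1 - t) c\<^sub>0 + t c\<^sub>1\<close>: a square times a fixed nonzero number,
  and equal signs of \<open>c\<^sub>0\<close> and \<open>c\<^sub>1\<close> keep
  \<open>c\<^sub>t\<close> away from 0. Both regularities follow one argument. What distinguishes
  them is enclosed in a class of time-dependent families of germs, only continuous in time, that is
  closed under arithmetic, composition, partial derivatives, time integrals and flows. Division by
  x_1 and primitives come from integrals in an auxiliary time, inverse mappings from flows.\<close>

abbreviation (input) cont_family :: "'a::topological_space set \<Rightarrow> (real \<Rightarrow> 'a \<Rightarrow> 'b::topological_space) \<Rightarrow> bool" where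
  "cont_family U F \<equiv> continuous_on ({0..1} \<times> U) (\<lambda>(t, x). F t x)"

abbreviation (input) has_gradient :: "('k::real_normed_field ^ 'n \<Rightarrow> 'k) \<Rightarrow> ('n \<Rightarrow> 'k) \<Rightarrow> 'k ^ 'n \<Rightarrow> bool" where
  "has_gradient f g x \<equiv> (f has_derivative (\<lambda>h. \<Sum>i\<in>UNIV. g i * h $ i)) (at x)"

abbreviation (input) near_0 :: "('a::{topological_space, zero} \<Rightarrow> bool) \<Rightarrow> bool" (binder "\<forall>\<^sub>0" 10) where
  "near_0 P \<equiv> eventually P (nhds 0)"

section \<open>Ordinary differential equations with parameters\<close>

text \<open>Compactness of the time interval: finitely many product neighbourhoods inside the open
  set cover \<open>{0..1}\<close> times the point, and the least of their radii serves all times.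
  Passages from a condition at \<open>0\<close> for each t to a ball independent of t rest on
  this.\<close>

lemma tube_unit_interval:
  fixes f :: "real \<times> 'a::metric_space \<Rightarrow> 'b::topological_space"
  assumes cont: "continuous_on ({0..1} \<times> U) f" and U: "open U" "x0 \<in> U" and V: "open V"
    and in_V: "\<And>t. t \<in> {0..1} \<Longrightarrow> f (t, x0) \<in> V"
  obtains e where "e > 0" "ball x0 e \<subseteq> U" "\<And>t x. t \<in> {0..1} \<Longrightarrow> x \<in> ball x0 e \<Longrightarrow> f (t, x) \<in> V"
proof -
  obtain W where W: "open W" "W \<inter> ({0..1} \<times> U) = f -` V \<inter> ({0..1} \<times> U)"
    using cont V unfolding continuous_on_open_invariant by metis
  have "\<exists>d>0. \<exists>e>0. \<forall>s x. \<bar>s - t\<bar> < d \<longrightarrow> x \<in> ball x0 e \<longrightarrow> (s, x) \<in> W" if t: "t \<in> {0..1}" for t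
  proof -
    have "(t, x0) \<in> W" using W in_V t U by auto
    then obtain A B where AB: "open A" "open B" "t \<in> A" "x0 \<in> B" "A \<times> B \<subseteq> W"
      using W(1) open_prod_elim by (metis mem_Times_iff fst_conv snd_conv)
    obtain d where "d > 0" "ball t d \<subseteq> A" using AB openE by blast
    moreover obtain e where "e > 0" "ball x0 e \<subseteq> B" using AB openE by blast
    ultimately show ?thesis using AB(5)
      by (intro exI[of _ d] conjI exI[of _ e]) (auto simp: dist_real_def abs_minus_commute subset_iff)
  qed
  then obtain d e where de: "\<And>t. t \<in> {0..1} \<Longrightarrow> d t > 0 \<and> e t > 0 \<and>
      (\<forall>s x. \<bar>s - t\<bar> < d t \<longrightarrow> x \<in> ball x0 (e t) \<longrightarrow> (s, x) \<in> W)" by metis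
  have "{0..1} \<subseteq> (\<Union>t\<in>{0..1}. ball t (d t))" using de by force
  then obtain C where C: "C \<subseteq> {0..1}" "finite C" "{0..1} \<subseteq> (\<Union>t\<in>C. ball t (d t))"
    using compactE_image[of "{0..1::real}" "{0..1}" "\<lambda>t. ball t (d t)"] by auto
  obtain e0 where e0: "e0 > 0" "ball x0 e0 \<subseteq> U" using U openE by blast
  define e1 where "e1 = Min (insert e0 (e ` C))"
  have e1: "e1 > 0" "e1 \<le> e0" "\<And>t. t \<in> C \<Longrightarrow> e1 \<le> e t"
    using C de e0 by (auto simp: e1_def)
  show ?thesis
  proof (rule that[of e1])
    show "e1 > 0" "ball x0 e1 \<subseteq> U" using e1 e0 by auto
    fix t x assume tx: "t \<in> {0..1::real}" "x \<in> ball x0 e1"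
    then obtain s where s: "s \<in> C" "t \<in> ball s (d s)" using C by auto
    then have "(t, x) \<in> W" using de[of s] C(1) tx(2) e1(3)[of s]
      by (auto simp: dist_real_def abs_minus_commute subset_iff)
    moreover have "x \<in> U" using tx(2) e1(2) e0(2) by (auto simp: subset_iff)
    ultimately show "f (t, x) \<in> V" using W(2) tx(1) by blast
  qed
qed

text \<open>The tube lemma for the pair of \<open>f (t, x)\<close> and \<open>f (t, x0)\<close> and
  the neighbourhood of the diagonal of width \<epsilon>.\<close>

lemma uniform_continuity_in_parameter:
  fixes f :: "real \<times> 'a::metric_space \<Rightarrow> 'b::metric_space"
  assumes cont: "continuous_on ({0..1} \<times> U) f" and U: "open U" "x0 \<in> U" and "\<epsilon> > 0"
  obtains e where "e > 0" "ball x0 e \<subseteq> U"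
    "\<And>t x. t \<in> {0..1} \<Longrightarrow> x \<in> ball x0 e \<Longrightarrow> dist (f (t, x)) (f (t, x0)) < \<epsilon>"
proof -
  let ?V = "{p::'b \<times> 'b. dist (fst p) (snd p) < \<epsilon>}"
  have c: "continuous_on ({0..1} \<times> U) (\<lambda>p. (f p, f (fst p, x0)))"
    by (intro continuous_intros cont continuous_on_compose2[OF cont]) (use U in auto)
  have "open ?V" by (intro open_Collect_less continuous_intros)
  then show ?thesis
    using tube_unit_interval[OF c U, of ?V] that \<open>\<epsilon> > 0\<close> by auto
qed

text \<open>Suited to solutions of differential equations: continuity in time is immediate for a
  single trajectory, and Gronwall estimates compare two trajectories uniformly in time.\<close>

lemma joint_continuousI:
  fixes f :: "real \<Rightarrow> 'a::metric_space \<Rightarrow> 'b::metric_space"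
  assumes U: "open U" and t: "\<And>x. x \<in> U \<Longrightarrow> continuous_on {0..1} (\<lambda>t. f t x)"
    and x: "\<And>x0 \<epsilon>. x0 \<in> U \<Longrightarrow> \<epsilon> > 0 \<Longrightarrow>
      \<exists>e>0. \<forall>t\<in>{0..1}. \<forall>x\<in>ball x0 e \<inter> U. dist (f t x) (f t x0) < \<epsilon>"
  shows "cont_family U f"
  unfolding continuous_on_iff
proof (safe, clarsimp)
  fix t0 :: real and x0 and \<epsilon> :: real assume a: "0 \<le> t0" "t0 \<le> 1" "x0 \<in> U" "0 < \<epsilon>"
  obtain e where e: "e > 0" "\<forall>t\<in>{0..1}. \<forall>x\<in>ball x0 e \<inter> U. dist (f t x) (f t x0) < \<epsilon>/2"
    using x[of x0 "\<epsilon>/2"] a by auto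
  obtain d where d: "d > 0" "\<forall>t\<in>{0..1}. dist t t0 < d \<longrightarrow> dist (f t x0) (f t0 x0) < \<epsilon>/2"
    using t[of x0] a unfolding continuous_on_iff
    by (metis atLeastAtMost_iff half_gt_zero)
  show "\<exists>d>0. \<forall>t\<in>{0..1}. \<forall>x\<in>U. dist (t, x) (t0, x0) < d \<longrightarrow> dist (f t x) (f t0 x0) < \<epsilon>"
  proof (intro exI[of _ "min d e"] conjI ballI impI)
    show "min d e > 0" using d e by auto
    fix t x assume tx: "t \<in> {0..1::real}" "x \<in> U" "dist (t, x) (t0, x0) < min d e"
    have tx': "dist t t0 < d" "x \<in> ball x0 e \<inter> U"
      using dist_fst_le[of "(t,x)" "(t0,x0)"] dist_snd_le[of "(t,x)" "(t0,x0)"] tx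
      by (auto simp: dist_commute)
    have "dist (f t x) (f t x0) < \<epsilon>/2" "dist (f t0 x0) (f t x0) < \<epsilon>/2"
      using d(2) e(2) tx(1) tx' by (blast, metis dist_commute)
    then show "dist (f t x) (f t0 x0) < \<epsilon>" by (rule dist_triangle_half_l)
  qed
qed

text \<open>Proved without iteration, by looking at the maximum point s of
  \<open>w t * exp (- 2 * L * t)\<close>. With twice the rate \<open>L\<close> in the weight, the
  integral term at s is at most half the difference of \<open>w s\<close> and the maximum, so the
  inequality at s bounds the maximum by 2 \<epsilon>.\<close>

lemma gronwall:
  fixes w :: "real \<Rightarrow> real"
  assumes cont: "continuous_on {0..1} w" and L: "L > 0" and \<epsilon>: "\<epsilon> \<ge> 0"
    and le: "\<And>t. t \<in> {0..1} \<Longrightarrow> w t \<le> \<epsilon> + L * integral {0..t} w"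
    and t: "t \<in> {0..1}"
  shows "w t \<le> 2 * \<epsilon> * exp (2 * L)"
proof -
  define g where "g = (\<lambda>t. w t * exp (- 2 * L * t))"
  have "continuous_on {0..1} g" unfolding g_def by (intro continuous_intros cont)
  then obtain s where s: "s \<in> {0..1}" "\<And>t. t \<in> {0..1} \<Longrightarrow> g t \<le> g s"
    using continuous_attains_sup[of "{0..1::real}" g] by force
  have w_le: "w t \<le> g s * exp (2 * L * t)" if "t \<in> {0..1}" for t
  proof -
    have "w t = g t * exp (2 * L * t)" by (simp add: g_def mult.assoc flip: exp_add)
    then show ?thesis using s(2)[OF that] by simp
  qed
  have int: "((\<lambda>r. g s * exp (2 * L * r)) has_integral
      g s * exp (2 * L * s) / (2 * L) - g s * exp (2 * L * 0) / (2 * L)) {0..s}"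
    using L s by (intro fundamental_theorem_of_calculus)
      (auto intro!: derivative_eq_intros simp flip: has_real_derivative_iff_has_vector_derivative)
  have "w integrable_on {0..s}"
    using s by (intro integrable_continuous_real continuous_on_subset[OF cont]) auto
  then have "integral {0..s} w \<le> g s * exp (2 * L * s) / (2 * L) - g s * exp (2 * L * 0) / (2 * L)"
    using s w_le by (intro has_integral_le[OF integrable_integral int]) auto
  then have "L * integral {0..s} w \<le> L * (g s * exp (2 * L * s) / (2 * L) - g s / (2 * L))"
    using L by (intro mult_left_mono) auto
  with le[OF s(1)] have "w s \<le> \<epsilon> + L * (g s * exp (2 * L * s) / (2 * L) - g s / (2 * L))" by linarith
  also have "\<dots> = \<epsilon> + (w s - g s) / 2" using L
    by (simp add: g_def field_simps flip: exp_add)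
  finally have "g s \<le> 2 * \<epsilon> - w s" by (simp add: field_simps)
  moreover have "g s \<le> 2 * \<epsilon>"
  proof (cases "w s \<ge> 0")
    case True then show ?thesis using calculation by simp
  next
    case False then have "g s \<le> 0" by (simp add: g_def mult_nonpos_nonneg)
    then show ?thesis using \<epsilon> by simp
  qed
  ultimately have "w t \<le> 2 * \<epsilon> * exp (2 * L * t)"
    using w_le[OF t] by (smt (verit) exp_ge_zero mult_right_mono)
  also have "\<dots> \<le> 2 * \<epsilon> * exp (2 * L)" using t L \<epsilon> by (intro mult_left_mono) auto
  finally show ?thesis .
qed

text \<open>The form in which the estimate is applied: \<open>c\<close> carries the difference of
  the initial data and \<delta> the error in the equation.\<close>

lemma gronwall_norm:
  fixes w f :: "real \<Rightarrow> 'b::banach"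
  assumes cont: "continuous_on {0..1} w" "continuous_on {0..1} f" and L: "L > 0" and nonneg: "\<epsilon> \<ge> 0" "\<delta> \<ge> 0"
    and eq: "\<And>t. t \<in> {0..1} \<Longrightarrow> w t = c t + integral {0..t} f"
    and c: "\<And>t. t \<in> {0..1} \<Longrightarrow> norm (c t) \<le> \<epsilon>"
    and f: "\<And>t. t \<in> {0..1} \<Longrightarrow> norm (f t) \<le> L * norm (w t) + \<delta>"
    and t: "t \<in> {0..1}"
  shows "norm (w t) \<le> 2 * (\<epsilon> + \<delta>) * exp (2 * L)"
proof (rule gronwall[where w="\<lambda>t. norm (w t)"])
  show "continuous_on {0..1} (\<lambda>t. norm (w t))" by (intro continuous_intros cont)
  fix t :: real assume t: "t \<in> {0..1}"
  have sub: "{0..t} \<subseteq> {0..1}" using t by auto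
  have i1: "f integrable_on {0..t}" "(\<lambda>s. norm (w s)) integrable_on {0..t}"
    "(\<lambda>s. L * norm (w s) + \<delta>) integrable_on {0..t}"
    by (intro integrable_continuous_real continuous_intros continuous_on_subset[OF _ sub] cont)+
  have "norm (integral {0..t} f) \<le> integral {0..t} (\<lambda>s. L * norm (w s) + \<delta>)"
    using sub f by (intro integral_norm_bound_integral i1) auto
  also have "\<dots> = L * integral {0..t} (\<lambda>s. norm (w s)) + \<delta> * t"
    using integrable_on_cmult_left[OF i1(2), of L] t by (subst integral_add) auto
  finally have "norm (integral {0..t} f) \<le> L * integral {0..t} (\<lambda>s. norm (w s)) + \<delta>"
    using t nonneg by (smt (verit) mult_left_le atLeastAtMost_iff)
  then show "norm (w t) \<le> (\<epsilon> + \<delta>) + L * integral {0..t} (\<lambda>s. norm (w s))"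
    unfolding eq[OF t] using c[OF t] norm_triangle_ineq[of "c t" "integral {0..t} f"] by linarith
qed (use assms in auto)

text \<open>The forcing \<open>c\<close> is an arbitrary continuous function instead of an initial
  value, because equations obtained by differentiating in a parameter have a time-dependent
  inhomogeneity. The Lipschitz bound on the whole space makes the solution live on all of
  \<open>{0..1}\<close>.\<close>

lemma picard_exists:
  fixes f :: "real \<Rightarrow> 'b::banach \<Rightarrow> 'b"
  assumes f: "cont_family UNIV f" and L: "L > 0"
    and lip: "\<And>t y z. t \<in> {0..1} \<Longrightarrow> norm (f t y - f t z) \<le> L * norm (y - z)"
    and c: "continuous_on {0..1} c"
  obtains y where "continuous_on {0..1} y"
    "\<And>t. t \<in> {0..1} \<Longrightarrow> y t = c t + integral {0..t} (\<lambda>s. f s (y s))"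
proof -
  define u where "u = rec_nat c (\<lambda>m v t. c t + integral {0..t} (\<lambda>s. f s (v s)))"
  have u0: "u 0 = c" and uS: "\<And>m. u (Suc m) = (\<lambda>t. c t + integral {0..t} (\<lambda>s. f s (u m s)))"
    by (simp_all add: u_def)
  have f_cont: "continuous_on {0..1} (\<lambda>s. f s (v s))" if "continuous_on {0..1} v" for v
    using continuous_on_compose2[OF f, of "{0..1}" "\<lambda>s. (s, v s)"] that
    by (auto simp: continuous_on_Pair continuous_on_id image_subset_iff)
  have f_int: "(\<lambda>s. f s (v s)) integrable_on {0..t}" if "continuous_on {0..1} v" "t \<in> {0..1}" for v t
    by (intro integrable_continuous_real continuous_on_subset[OF f_cont[OF that(1)]]) (use that in auto)
  have u_cont: "continuous_on {0..1} (u m)" for m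
  proof (induction m)
    case (Suc m)
    show ?case unfolding uS
      by (intro continuous_intros c indefinite_integral_continuous_1 integrable_continuous_real f_cont Suc)
  qed (simp add: u0 c)
  have "compact ((\<lambda>t. u 1 t - u 0 t) ` {0..1})"
    by (intro compact_continuous_image continuous_intros u_cont) auto
  then have "\<exists>C>0. \<forall>t\<in>{0..1}. norm (u 1 t - u 0 t) \<le> C"
    using compact_imp_bounded[of "(\<lambda>t. u 1 t - u 0 t) ` {0..1}"] unfolding bounded_pos by blast
  then obtain C where C: "\<And>t. t \<in> {0..1} \<Longrightarrow> norm (u 1 t - u 0 t) \<le> C" "C > 0" by blast
  \<comment> \<open>The weight \<open>exp (2 * L * t)\<close> makes every integration gain the
    factor 1/2, whatever the size of \<open>L\<close>; the interval is never subdivided.\<close>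
  have step: "norm (u (Suc m) t - u m t) \<le> C * (1/2)^m * exp (2 * L * t)" if "t \<in> {0..1}" for m t
    using that
  proof (induction m arbitrary: t)
    case 0
    have "norm (u 1 t - u 0 t) \<le> C * 1" using C 0 by simp
    also have "\<dots> \<le> C * exp (2 * L * t)" using 0 L C by (intro mult_left_mono) auto
    finally show ?case by simp
  next
    case (Suc m)
    have int: "((\<lambda>r. L * (C * (1/2)^m * exp (2 * L * r))) has_integral
      L * (C * (1/2)^m * exp (2 * L * t) / (2 * L)) - L * (C * (1/2)^m * exp (2 * L * 0) / (2 * L))) {0..t}"
      using L Suc.prems by (intro fundamental_theorem_of_calculus)
        (auto intro!: derivative_eq_intros simp flip: has_real_derivative_iff_has_vector_derivative)
    have "u (Suc (Suc m)) t - u (Suc m) t = integral {0..t} (\<lambda>s. f s (u (Suc m) s) - f s (u m s))"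
      unfolding uS[of "Suc m"] uS[of m] using f_int[OF u_cont[of "Suc m"] Suc.prems] f_int[OF u_cont[of m] Suc.prems]
      by (simp add: integral_diff uS)
    also have "norm \<dots> \<le> integral {0..t} (\<lambda>r. L * (C * (1/2)^m * exp (2 * L * r)))"
    proof (rule integral_norm_bound_integral)
      show "(\<lambda>s. f s (u (Suc m) s) - f s (u m s)) integrable_on {0..t}"
        by (intro integrable_diff f_int u_cont Suc.prems)
      show "(\<lambda>r. L * (C * (1/2)^m * exp (2 * L * r))) integrable_on {0..t}" using int by blast
      fix s assume "s \<in> {0..t}"
      then have s: "s \<in> {0..1}" using Suc.prems by auto
      show "norm (f s (u (Suc m) s) - f s (u m s)) \<le> L * (C * (1/2)^m * exp (2 * L * s))"
        using lip[OF s] Suc.IH[OF s] L by (meson mult_left_mono order_trans less_imp_le)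
    qed
    also have "\<dots> = C * (1/2)^Suc m * exp (2 * L * t) - C * (1/2)^Suc m"
      unfolding integral_unique[OF int] using L by simp
    also have "\<dots> \<le> C * (1/2)^Suc m * exp (2 * L * t)" using C by simp
    finally show ?case .
  qed
  have ul: "uniform_limit {0..1} (\<lambda>n t. \<Sum>i<n. u (Suc i) t - u i t) (\<lambda>t. \<Sum>i. u (Suc i) t - u i t) sequentially"
  proof (rule Weierstrass_m_test)
    fix n t assume t: "t \<in> {0..1::real}"
    have "norm (u (Suc n) t - u n t) \<le> C * (1/2)^n * exp (2 * L * t)" using step t by blast
    also have "\<dots> \<le> C * (1/2)^n * exp (2 * L)" using t C L by (intro mult_left_mono) auto
    finally show "norm (u (Suc n) t - u n t) \<le> C * exp (2 * L) * (1/2)^n" by (simp add: mult_ac)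
  qed (intro summable_mult summable_geometric, simp)
  define y where "y = (\<lambda>t. u 0 t + (\<Sum>i. u (Suc i) t - u i t))"
  have ul: "uniform_limit {0..1} u y sequentially"
  proof -
    have "uniform_limit {0..1} (\<lambda>n t. u 0 t + (\<Sum>i<n. u (Suc i) t - u i t)) y sequentially"
      unfolding y_def by (intro uniform_limit_intros ul)
    moreover have "u 0 t + (\<Sum>i<n. u (Suc i) t - u i t) = u n t" for n t
      using sum_lessThan_telescope[of "\<lambda>i. u i t" n] by simp
    ultimately show ?thesis by simp
  qed
  have y: "continuous_on {0..1} y"
    by (rule uniform_limit_theorem[OF _ ul]) (auto simp: u_cont)
  show ?thesis
  proof (rule that[OF y])
    fix t :: real assume t: "t \<in> {0..1}"
    have l1: "(\<lambda>m. u (Suc m) t) \<longlonglongrightarrow> y t"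
      using tendsto_uniform_limitI[OF ul t] by (rule LIMSEQ_Suc)
    have "(\<lambda>m. integral {0..t} (\<lambda>s. f s (u m s))) \<longlonglongrightarrow> integral {0..t} (\<lambda>s. f s (y s))"
    proof (rule LIMSEQ_I)
      fix r :: real assume r: "r > 0"
      have "\<forall>\<^sub>F n in sequentially. \<forall>s\<in>{0..1}. dist (u n s) (y s) < r / (2 * L)"
        using r L by (intro uniform_limitD[OF ul]) simp
      then obtain N where N: "\<And>n s. n \<ge> N \<Longrightarrow> s \<in> {0..1} \<Longrightarrow> dist (u n s) (y s) < r / (2 * L)"
        unfolding eventually_sequentially by blast
      show "\<exists>no. \<forall>n\<ge>no. norm (integral {0..t} (\<lambda>s. f s (u n s)) - integral {0..t} (\<lambda>s. f s (y s))) < r"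
      proof (intro exI allI impI)
        fix n assume n: "n \<ge> N"
        have "norm (integral {0..t} (\<lambda>s. f s (u n s) - f s (y s))) \<le> integral {0..t} (\<lambda>s. r / 2)"
        proof (rule integral_norm_bound_integral)
          show "(\<lambda>s. f s (u n s) - f s (y s)) integrable_on {0..t}"
            by (intro integrable_diff f_int u_cont y t)
          fix s assume "s \<in> {0..t}"
          then have s: "s \<in> {0..1}" using t by auto
          have "norm (f s (u n s) - f s (y s)) \<le> L * norm (u n s - y s)" using lip s by blast
          also have "\<dots> \<le> L * (r / (2 * L))"
            using N[OF n s] L by (intro mult_left_mono) (auto simp: dist_norm)
          finally show "norm (f s (u n s) - f s (y s)) \<le> r / 2" using L by simp
        qed auto
        also have "\<dots> \<le> r / 2" using t r by (simp add: mult_left_le_one_le)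
        finally show "norm (integral {0..t} (\<lambda>s. f s (u n s)) - integral {0..t} (\<lambda>s. f s (y s))) < r"
          using r f_int[OF u_cont[of n] t] f_int[OF y t] by (simp add: integral_diff)
      qed
    qed
    then have "(\<lambda>m. u (Suc m) t) \<longlonglongrightarrow> c t + integral {0..t} (\<lambda>s. f s (y s))"
      unfolding uS by (intro tendsto_intros)
    with l1 show "y t = c t + integral {0..t} (\<lambda>s. f s (y s))" by (rule LIMSEQ_unique)
  qed
qed

text \<open>Serves two cases: dependence of a flow on its initial point, where
  \<open>c t x = x\<close>, and dependence of a linear system on a parameter. \<open>Z\<close>
  solves the equation linearized along \<open>y\<close>. The linearization errors of
  \<open>c\<close> and \<open>F\<close> are assumed small uniformly in time, and two Gronwall
  estimates bound first the increment of \<open>y\<close> and then the remainder.\<close>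

lemma ode_parameter_derivative:
  fixes y :: "real \<Rightarrow> 'a::real_normed_vector \<Rightarrow> 'b::banach" and F :: "real \<Rightarrow> 'a \<Rightarrow> 'b \<Rightarrow> 'b"
  assumes U: "open U" "x \<in> U"
    and y: "\<And>x'. x' \<in> U \<Longrightarrow> continuous_on {0..1} (\<lambda>t. y t x')"
    and F: "\<And>x'. x' \<in> U \<Longrightarrow> continuous_on {0..1} (\<lambda>s. F s x' (y s x'))"
    and eq: "\<And>x' t. x' \<in> U \<Longrightarrow> t \<in> {0..1} \<Longrightarrow> y t x' = c t x' + integral {0..t} (\<lambda>s. F s x' (y s x'))"
    and c': "\<And>\<epsilon>::real. \<epsilon> > 0 \<Longrightarrow> \<exists>\<delta>>0. \<forall>t\<in>{0..1}. \<forall>h. norm h < \<delta> \<longrightarrow>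
      norm (c t (x + h) - c t x - c' t h) \<le> \<epsilon> * norm h"
    and F': "\<And>\<epsilon>::real. \<epsilon> > 0 \<Longrightarrow> \<exists>\<delta>>0. \<forall>s\<in>{0..1}. \<forall>h. norm h < \<delta> \<longrightarrow>
      norm (F s (x + h) (y s (x + h)) - F s x (y s x) - Dx s h - Dy s (y s (x + h) - y s x))
        \<le> \<epsilon> * (norm h + norm (y s (x + h) - y s x))"
    and M: "\<And>s h. s \<in> {0..1} \<Longrightarrow> norm (c' s h) \<le> M * norm h"
      "\<And>s h. s \<in> {0..1} \<Longrightarrow> norm (Dx s h) \<le> M * norm h"
      "\<And>s k. s \<in> {0..1} \<Longrightarrow> norm (Dy s k) \<le> M * norm k"
    and Dy: "\<And>s k l. s \<in> {0..1} \<Longrightarrow> Dy s (k - l) = Dy s k - Dy s l"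
    and Z: "\<And>h. continuous_on {0..1} (\<lambda>t. Z t h)"
      "\<And>h. continuous_on {0..1} (\<lambda>s. Dx s h + Dy s (Z s h))"
      "\<And>t h. t \<in> {0..1} \<Longrightarrow> Z t h = c' t h + integral {0..t} (\<lambda>s. Dx s h + Dy s (Z s h))"
    and "\<epsilon> > 0"
  shows "\<exists>\<delta>>0. \<forall>t\<in>{0..1}. \<forall>h. norm h < \<delta> \<longrightarrow> norm (y t (x + h) - y t x - Z t h) \<le> \<epsilon> * norm h"
proof -
  define M1 where "M1 = \<bar>M\<bar> + 1"
  have M1: "M1 > 0" "M \<le> M1" "1 + M \<le> M1" by (auto simp: M1_def)
  \<comment> \<open>\<open>C\<close> and \<open>K\<close> are the constants of the two Gronwall
    estimates, for the increment of \<open>y\<close> and for the remainder; \<eta> is chosen so that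
    the second estimate gives exactly \<epsilon>.\<close>
  define C where "C = 2 * (M1 + M1) * exp (2 * M1)"
  have C: "C > 0" using M1 by (simp add: C_def)
  define K where "K = 2 * (2 + C) * exp (2 * M1)"
  have K: "K > 0" using C by (simp add: K_def)
  define \<eta> where "\<eta> = \<epsilon> / K"
  have \<eta>: "\<eta> > 0" using \<open>\<epsilon> > 0\<close> K by (simp add: \<eta>_def)
  \<comment> \<open>Bounded by 1, so that the first estimate holds with constants independent of
    \<epsilon>.\<close>
  define \<mu> where "\<mu> = min 1 \<eta>"
  have \<mu>: "\<mu> > 0" "\<mu> \<le> 1" "\<mu> \<le> \<eta>" using \<eta> by (auto simp: \<mu>_def)
  obtain d0 where d0: "d0 > 0" "ball x d0 \<subseteq> U" using U openE by blast
  obtain d1 where d1: "d1 > 0" "\<And>t (h::'a). t \<in> {0..1} \<Longrightarrow> norm h < d1 \<Longrightarrow>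
      norm (c t (x + h) - c t x - c' t h) \<le> \<mu> * norm h"
    using c'[OF \<mu>(1)] by auto
  obtain d2 where d2: "d2 > 0" "\<And>s (h::'a). s \<in> {0..1} \<Longrightarrow> norm h < d2 \<Longrightarrow>
      norm (F s (x + h) (y s (x + h)) - F s x (y s x) - Dx s h - Dy s (y s (x + h) - y s x))
        \<le> \<mu> * (norm h + norm (y s (x + h) - y s x))"
    using F'[OF \<mu>(1)] by auto
  define \<delta> where "\<delta> = min d0 (min d1 d2)"
  have \<delta>: "\<delta> > 0" "\<delta> \<le> d0" "\<delta> \<le> d1" "\<delta> \<le> d2" using d0 d1 d2 by (auto simp: \<delta>_def)
  show ?thesis
  proof (intro exI[of _ \<delta>] conjI ballI allI impI \<delta>(1))
    fix t :: real and h :: 'a assume t: "t \<in> {0..1}" and h: "norm h < \<delta>"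
    have xh: "x + h \<in> U" using h \<delta> d0 by (auto simp: dist_norm subset_iff)
    define k where "k = (\<lambda>t. y t (x + h) - y t x)"
    define G where "G = (\<lambda>s. F s (x + h) (y s (x + h)) - F s x (y s x))"
    have k_cont: "continuous_on {0..1} k" unfolding k_def by (intro continuous_intros y xh U)
    have G_cont: "continuous_on {0..1} G" unfolding G_def by (intro continuous_intros F xh U)
    have k_eq: "k t = (c t (x + h) - c t x) + integral {0..t} G" if t: "t \<in> {0..1}" for t
    proof -
      have sub: "{0..t} \<subseteq> {0..1}" using t by auto
      have "(\<lambda>s. F s x' (y s x')) integrable_on {0..t}" if "x' \<in> U" for x'
        by (rule integrable_continuous_real[OF continuous_on_subset[OF F[OF that] sub]])
      from this[OF xh] this[OF U(2)] show ?thesis unfolding k_def G_def eq[OF xh t] eq[OF U(2) t]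
        by (simp add: integral_diff)
    qed
    have G_le: "norm (G s - Dx s h - Dy s (k s)) \<le> \<mu> * (norm h + norm (k s))" if "s \<in> {0..1}" for s
      using d2(2)[OF that, of h] h \<delta> by (simp add: k_def G_def)
    have c_le: "norm (c t (x + h) - c t x - c' t h) \<le> \<mu> * norm h" if "t \<in> {0..1}" for t
      using d1(2)[OF that, of h] h \<delta> by simp
    have min_le: "\<mu> * a \<le> a" "\<mu> * a \<le> \<eta> * a" if "a \<ge> 0" for a
      using mult_right_mono[of "\<mu>" 1 a] mult_right_mono[of "\<mu>" \<eta> a] that \<mu> by auto
    have k_le: "norm (k t) \<le> C * norm h" if t: "t \<in> {0..1}" for t
    proof -
      have "norm (k t) \<le> 2 * (M1 * norm h + M1 * norm h) * exp (2 * M1)"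
      proof (rule gronwall_norm[where f=G and c="\<lambda>t. c t (x + h) - c t x"])
        show "continuous_on {0..1} k" "continuous_on {0..1} G" by (fact k_cont G_cont)+
        show "M1 > 0" "M1 * norm h \<ge> 0" "M1 * norm h \<ge> 0" using M1 by simp_all
        fix t :: real assume t: "t \<in> {0..1}"
        show "k t = c t (x + h) - c t x + integral {0..t} G" by (fact k_eq[OF t])
        have "norm (c t (x + h) - c t x) \<le> norm (c t (x + h) - c t x - c' t h) + norm (c' t h)"
          by (metis diff_add_cancel norm_triangle_ineq)
        also have "\<dots> \<le> norm h + M * norm h"
          using c_le[OF t] M(1)[OF t, of h] min_le(1)[of "norm h", OF norm_ge_zero] by linarith
        also have "\<dots> \<le> M1 * norm h"
          using mult_right_mono[of "1 + M" M1 "norm h"] M1 by (simp add: algebra_simps)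
        finally show "norm (c t (x + h) - c t x) \<le> M1 * norm h" .
        have "norm (G t) \<le> norm (G t - Dx t h - Dy t (k t)) + norm (Dx t h) + norm (Dy t (k t))"
          using norm_triangle_ineq[of "G t - Dx t h - Dy t (k t)" "Dx t h + Dy t (k t)"]
            norm_triangle_ineq[of "Dx t h" "Dy t (k t)"] by simp
        also have "\<dots> \<le> (norm h + norm (k t)) + M * norm h + M * norm (k t)"
          using G_le[OF t] M(2)[OF t, of h] M(3)[OF t, of "k t"] min_le(1)[of "norm h + norm (k t)", OF add_nonneg_nonneg[OF norm_ge_zero norm_ge_zero]] by linarith
        also have "\<dots> \<le> M1 * norm (k t) + M1 * norm h"
          using mult_right_mono[of "1 + M" M1 "norm h"] mult_right_mono[of "1 + M" M1 "norm (k t)"] M1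
          by (simp add: distrib_right)
        finally show "norm (G t) \<le> M1 * norm (k t) + M1 * norm h" .
      qed (fact t)
      also have "\<dots> = C * norm h" unfolding C_def by simp
      finally show ?thesis .
    qed
    define w where "w = (\<lambda>t. k t - Z t h)"
    define E where "E = (\<lambda>s. G s - (Dx s h + Dy s (Z s h)))"
    have "norm (w t) \<le> 2 * (\<eta> * norm h + \<eta> * (1 + C) * norm h) * exp (2 * M1)"
    proof (rule gronwall_norm[where f=E and c="\<lambda>t. c t (x + h) - c t x - c' t h"])
      show "continuous_on {0..1} w" "continuous_on {0..1} E" unfolding w_def E_def
        by (intro continuous_intros k_cont G_cont Z)+
      show "M1 > 0" "\<eta> * norm h \<ge> 0" "\<eta> * (1 + C) * norm h \<ge> 0" using M1 \<eta> C by simp_all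
      fix t :: real assume t: "t \<in> {0..1}"
      have sub: "{0..t} \<subseteq> {0..1}" using t by auto
      have "G integrable_on {0..t}" "(\<lambda>s. Dx s h + Dy s (Z s h)) integrable_on {0..t}"
        by (intro integrable_continuous_real continuous_on_subset[OF _ sub] G_cont Z)+
      then show "w t = c t (x + h) - c t x - c' t h + integral {0..t} E"
        unfolding w_def E_def k_eq[OF t] Z(3)[OF t] by (simp add: integral_diff)
      show "norm (c t (x + h) - c t x - c' t h) \<le> \<eta> * norm h"
        using c_le[OF t] min_le(2)[of "norm h", OF norm_ge_zero] by linarith
      have E: "E t = (G t - Dx t h - Dy t (k t)) + Dy t (w t)"
        unfolding w_def Dy[OF t] E_def by simp
      have "norm (E t) \<le> \<mu> * (norm h + norm (k t)) + M * norm (w t)"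
        unfolding E using G_le[OF t] M(3)[OF t, of "w t"] norm_triangle_ineq[of "G t - Dx t h - Dy t (k t)" "Dy t (w t)"]
        by linarith
      also have "\<dots> \<le> \<eta> * (norm h + C * norm h) + M1 * norm (w t)"
      proof -
        have "\<mu> * (norm h + norm (k t)) \<le> \<eta> * (norm h + C * norm h)"
          using k_le[OF t] \<eta> \<mu> by (intro mult_mono) auto
        moreover have "M * norm (w t) \<le> M1 * norm (w t)" using M1 by (intro mult_right_mono) auto
        ultimately show ?thesis by linarith
      qed
      finally show "norm (E t) \<le> M1 * norm (w t) + \<eta> * (1 + C) * norm h" by (simp add: algebra_simps)
    qed (fact t)
    also have "\<dots> = \<eta> * K * norm h" unfolding K_def by (simp add: algebra_simps)
    also have "\<dots> = \<epsilon> * norm h" unfolding \<eta>_def using K by simp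
    finally show "norm (y t (x + h) - y t x - Z t h) \<le> \<epsilon> * norm h" by (simp add: w_def k_def)
  qed
qed

section \<open>Uniform linearization along curves and existence of local flows\<close>

lemma linear_uniform_bound:
  fixes D :: "real \<Rightarrow> 'c::topological_space \<Rightarrow> 'a::euclidean_space \<Rightarrow> 'b::real_normed_vector"
  assumes K: "compact K" and D: "\<And>h. cont_family K (\<lambda>t x. D t x h)"
    and lin: "\<And>t x. t \<in> {0..1} \<Longrightarrow> x \<in> K \<Longrightarrow> linear (D t x)"
  obtains L where "L > 0" "\<And>t x h. t \<in> {0..1} \<Longrightarrow> x \<in> K \<Longrightarrow> norm (D t x h) \<le> L * norm h"
proof -
  have "\<exists>B>0. \<forall>p\<in>{0..1}\<times>K. norm ((\<lambda>(t, x). D t x b) p) \<le> B" for b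
  proof -
    have "compact ((\<lambda>(t, x). D t x b) ` ({0..1} \<times> K))"
      by (intro compact_continuous_image D compact_Times K) auto
    then show ?thesis
      using compact_imp_bounded[of "(\<lambda>(t, x). D t x b) ` ({0..1} \<times> K)"] unfolding bounded_pos by blast
  qed
  then obtain B where B: "\<And>b. B b > 0" "\<And>b p. p\<in>{0..1}\<times>K \<Longrightarrow> norm ((\<lambda>(t, x). D t x b) p) \<le> B b"
    by metis
  show ?thesis
  proof (rule that[of "1 + (\<Sum>b\<in>Basis. B b)"])
    show "1 + (\<Sum>b\<in>Basis. B b) > 0"
      by (intro add_pos_nonneg sum_nonneg) (auto intro: less_imp_le B)
    fix t x and h :: 'a assume tx: "t \<in> {0..1::real}" "x \<in> K"
    have "D t x h = D t x (\<Sum>b\<in>Basis. (h \<bullet> b) *\<^sub>R b)" by (simp add: euclidean_representation)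
    also have "\<dots> = (\<Sum>b\<in>Basis. (h \<bullet> b) *\<^sub>R D t x b)"
      using lin[OF tx] by (simp add: linear_sum linear_scale)
    also have "norm \<dots> \<le> (\<Sum>b\<in>Basis. norm h * B b)"
    proof (rule sum_norm_le)
      fix b :: 'a assume b: "b \<in> Basis"
      show "norm ((h \<bullet> b) *\<^sub>R D t x b) \<le> norm h * B b"
        using B(2)[of "(t, x)" b] tx Basis_le_norm[OF b, of h] by (auto intro!: mult_mono)
    qed
    also have "\<dots> \<le> (1 + (\<Sum>b\<in>Basis. B b)) * norm h"
      by (simp add: sum_distrib_left[symmetric] sum_distrib_right[symmetric] algebra_simps)
    finally show "norm (D t x h) \<le> (1 + (\<Sum>b\<in>Basis. B b)) * norm h" .
  qed
qed

text \<open>The mean value inequality on balls around the points of the curve. Compactness of time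
  gives one radius on which the derivative varies little, tested on the finitely many basis
  vectors.\<close>

lemma uniform_linearization:
  fixes X :: "real \<Rightarrow> 'a::euclidean_space \<Rightarrow> 'b::real_normed_vector"
  assumes V: "open V" and y: "continuous_on {0..1} y" "\<And>s. s \<in> {0..1} \<Longrightarrow> y s \<in> V"
    and X: "\<And>s z. s \<in> {0..1} \<Longrightarrow> z \<in> V \<Longrightarrow> (X s has_derivative D s z) (at z)"
    and D: "\<And>h. cont_family V (\<lambda>s z. D s z h)" and "\<epsilon> > 0"
  obtains d where "d > 0" "\<And>s v. s \<in> {0..1} \<Longrightarrow> norm v < d \<Longrightarrow> y s + v \<in> V"
    "\<And>s v. s \<in> {0..1} \<Longrightarrow> norm v < d \<Longrightarrow>
      norm (X s (y s + v) - X s (y s) - D s (y s) v) \<le> \<epsilon> * norm v"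
proof -
  have lin: "linear (D s z)" if "s \<in> {0..1}" "z \<in> V" for s z
    using X[OF that] has_derivative_linear by blast
  have cp: "continuous_on ({0..1} \<times> UNIV) (\<lambda>p. y (fst p) + snd p)"
    by (intro continuous_intros continuous_on_compose2[OF y(1)]) auto
  obtain d0 where d0: "d0 > 0" "\<And>s v. s \<in> {0..1} \<Longrightarrow> v \<in> ball 0 d0 \<Longrightarrow> y s + v \<in> V"
    using tube_unit_interval[OF cp open_UNIV _ V, of 0] y(2) by (auto simp del: mem_ball)
  \<comment> \<open>The tolerance is distributed over the basis vectors in the expansion of a
    direction.\<close>
  define \<eta> where "\<eta> = \<epsilon> / DIM('a)"
  have \<eta>: "\<eta> > 0" using \<open>\<epsilon> > 0\<close> by (simp add: \<eta>_def)
  have "\<exists>d>0. d \<le> d0 \<and> (\<forall>s\<in>{0..1}. \<forall>v. norm v < d \<longrightarrow> norm (D s (y s + v) b - D s (y s) b) < \<eta>)" for b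
  proof -
    have c: "continuous_on ({0..1} \<times> ball 0 d0) (\<lambda>p. (\<lambda>(s, z). D s z b) (fst p, y (fst p) + snd p))"
      by (rule continuous_on_compose2[OF D])
        (use d0 in \<open>auto intro!: continuous_intros continuous_on_compose2[OF y(1)] simp del: mem_ball\<close>)
    obtain d where "d > 0" "ball 0 d \<subseteq> ball (0::'a) d0"
      "\<And>s v. s \<in> {0..1} \<Longrightarrow> v \<in> ball 0 d \<Longrightarrow> dist (D s (y s + v) b) (D s (y s + 0) b) < \<eta>"
      using uniform_continuity_in_parameter[OF c open_ball centre_in_ball[THEN iffD2, OF d0(1)] \<eta>]
      by (simp del: mem_ball) blast
    then show ?thesis using d0(1)
      by (intro exI[of _ "min d d0"]) (auto simp: dist_norm)
  qed
  then obtain dd where dd: "\<And>b. dd b > 0" "\<And>b. dd b \<le> d0"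
    "\<And>b s v. s \<in> {0..1} \<Longrightarrow> norm v < dd b \<Longrightarrow> norm (D s (y s + v) b - D s (y s) b) < \<eta>" by metis
  define d where "d = Min (dd ` (Basis :: 'a set))"
  have d: "d > 0" "\<And>b. b \<in> Basis \<Longrightarrow> d \<le> dd b" using dd by (auto simp: d_def)
  have d_le: "d \<le> d0" using dd(2) d(2) SOME_Basis order_trans by blast
  show ?thesis
  proof (rule that[OF d(1)])
    fix s v assume s: "s \<in> {0..1::real}" and v: "norm (v::'a) < d"
    show V': "y s + v \<in> V" using d0(2)[OF s, of v] v d_le by auto
    let ?S = "ball (y s) d"
    have S_V: "z \<in> V" if "z \<in> ?S" for z
      using d0(2)[OF s, of "z - y s"] that d_le by (auto simp: dist_norm norm_minus_commute)
    have "norm (X s (y s + v) - X s (y s) - D s (y s) (y s + v - y s)) \<le> norm (y s + v - y s) * \<epsilon>"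
    proof (rule differentiable_bound_linearization[where S="?S"])
      show "y s + t *\<^sub>R (y s + v - y s) \<in> ?S" if "t \<in> {0..1}" for t :: real
      proof -
        have "norm (t *\<^sub>R v) \<le> norm v" using that by (simp add: mult_left_le_one_le)
        then show ?thesis using v by (simp add: dist_norm)
      qed
      show "y s \<in> ?S" using d by simp
      fix z assume z: "z \<in> ?S"
      show "(X s has_derivative D s z) (at z within ?S)"
        using X[OF s S_V[OF z]] by (rule has_derivative_at_withinI)
      have zV: "z \<in> V" "y s \<in> V" using S_V z y(2) s by auto
      have z': "norm (z - y s) < d" using z by (simp add: dist_norm norm_minus_commute)
      have "onorm (\<lambda>h. D s z h - D s (y s) h) \<le> \<epsilon>"
      proof (rule onorm_bound)
        fix h :: 'a
        have l: "linear (\<lambda>h. D s z h - D s (y s) h)" by (intro linear_compose_sub lin s zV)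
        have "D s z h - D s (y s) h = (\<lambda>h. D s z h - D s (y s) h) (\<Sum>b\<in>Basis. (h \<bullet> b) *\<^sub>R b)"
          by (simp add: euclidean_representation)
        also have "\<dots> = (\<Sum>b\<in>Basis. (h \<bullet> b) *\<^sub>R (D s z b - D s (y s) b))"
          by (subst linear_sum[OF l]) (simp add: linear_scale[OF l])
        also have "norm \<dots> \<le> (\<Sum>b\<in>(Basis::'a set). norm h * \<eta>)"
        proof (rule sum_norm_le)
          fix b :: 'a assume b: "b \<in> Basis"
          have "norm (D s (y s + (z - y s)) b - D s (y s) b) < \<eta>"
            using dd(3)[OF s, of "z - y s" b] d(2)[OF b] z' by linarith
          then show "norm ((h \<bullet> b) *\<^sub>R (D s z b - D s (y s) b)) \<le> norm h * \<eta>"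
            using Basis_le_norm[OF b, of h] by (auto intro!: mult_mono)
        qed
        also have "\<dots> = \<epsilon> * norm h" by (simp add: \<eta>_def)
        finally show "norm (D s z h - D s (y s) h) \<le> \<epsilon> * norm h" .
      qed (use \<open>\<epsilon> > 0\<close> in auto)
      then show "onorm (D s z - D s (y s)) \<le> \<epsilon>" by (simp add: fun_diff_def)
    qed
    then show "norm (X s (y s + v) - X s (y s) - D s (y s) v) \<le> \<epsilon> * norm v"
      by (simp add: mult.commute)
  qed
qed

text \<open>Solutions are described by integral equations. Trajectories and their competitors in
  \<open>flow_unique\<close> stay in the ball of radius \<open>R/2\<close>, well inside the domain
  of the field; \<open>linear_unique\<close> is recorded because complex linearity of
  \<open>Z\<close> is later derived from it.\<close>

locale local_flow =
  fixes R :: real and X :: "real \<Rightarrow> 'a::euclidean_space \<Rightarrow> 'a" and D :: "real \<Rightarrow> 'a \<Rightarrow> 'a \<Rightarrow> 'a"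
    and e :: real and \<phi> :: "real \<Rightarrow> 'a \<Rightarrow> 'a" and Z :: "real \<Rightarrow> 'a \<Rightarrow> 'a \<Rightarrow> 'a"
  assumes radius: "e > 0" "e \<le> R"
    and in_ball: "\<And>t x. t \<in> {0..1} \<Longrightarrow> x \<in> ball 0 e \<Longrightarrow> \<phi> t x \<in> ball 0 (R/2)"
    and joint_cont: "cont_family (ball 0 e) \<phi>"
    and flow_eq: "\<And>t x. t \<in> {0..1} \<Longrightarrow> x \<in> ball 0 e \<Longrightarrow> \<phi> t x = x + integral {0..t} (\<lambda>s. X s (\<phi> s x))"
    and flow_deriv: "\<And>t x. t \<in> {0..1} \<Longrightarrow> x \<in> ball 0 e \<Longrightarrow> (\<phi> t has_derivative Z t x) (at x)"
    and deriv_cont: "\<And>x h. x \<in> ball 0 e \<Longrightarrow> continuous_on {0..1} (\<lambda>t. Z t x h)"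
    and deriv_eq: "\<And>t x h. t \<in> {0..1} \<Longrightarrow> x \<in> ball 0 e \<Longrightarrow>
      Z t x h = h + integral {0..t} (\<lambda>s. D s (\<phi> s x) (Z s x h))"
    and flow_unique: "\<And>u x t. continuous_on {0..1} u \<Longrightarrow> (\<And>t. t \<in> {0..1} \<Longrightarrow> u t \<in> ball 0 (R/2)) \<Longrightarrow>
      (\<And>t. t \<in> {0..1} \<Longrightarrow> u t = x + integral {0..t} (\<lambda>s. X s (u s))) \<Longrightarrow> x \<in> ball 0 e \<Longrightarrow>
      t \<in> {0..1} \<Longrightarrow> u t = \<phi> t x"
    and linear_unique: "\<And>w x t. x \<in> ball 0 e \<Longrightarrow> continuous_on {0..1} w \<Longrightarrow>
      (\<And>t. t \<in> {0..1} \<Longrightarrow> w t = integral {0..t} (\<lambda>s. D s (\<phi> s x) (w s))) \<Longrightarrow> t \<in> {0..1} \<Longrightarrow> w t = 0"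

text \<open>Trajectories of a field on a ball may leave the ball. Composed with the closest-point
  projection onto a smaller closed ball, the field becomes globally Lipschitz; since it vanishes at
  \<open>0\<close>, Gronwall keeps trajectories that start near \<open>0\<close> where the
  projection is the identity, so the flow exists there up to time one.\<close>

theorem flow_exists:
  fixes X :: "real \<Rightarrow> 'a::euclidean_space \<Rightarrow> 'a" and D :: "real \<Rightarrow> 'a \<Rightarrow> 'a \<Rightarrow> 'a"
  assumes R: "R > 0"
    and X: "cont_family (ball 0 R) X"
    and D: "\<And>t x. t \<in> {0..1} \<Longrightarrow> x \<in> ball 0 R \<Longrightarrow> (X t has_derivative D t x) (at x)"
    and D_cont: "\<And>h. cont_family (ball 0 R) (\<lambda>t x. D t x h)"
    and X0: "\<And>t. t \<in> {0..1} \<Longrightarrow> X t 0 = 0"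
  obtains e \<phi> Z where "local_flow R X D e \<phi> Z"
proof -
  define \<rho> where "\<rho> = R / 2"
  have \<rho>: "\<rho> > 0" "\<rho> < R" using R by (auto simp: \<rho>_def)
  let ?C = "cball (0::'a) \<rho>"
  have sub: "?C \<subseteq> ball 0 R" using \<rho> by auto
  have linD: "linear (D t x)" if "t \<in> {0..1}" "x \<in> ball 0 R" for t x
    using D[OF that] has_derivative_linear by blast
  obtain L where L: "L > 0" "\<And>t x h. t \<in> {0..1} \<Longrightarrow> x \<in> ?C \<Longrightarrow> norm (D t x h) \<le> L * norm h"
    using linear_uniform_bound[of ?C D]
      continuous_on_subset[OF D_cont, of "{0..1} \<times> ?C"] linD sub by (auto simp: subset_iff)
  have X_lip: "norm (X t y - X t z) \<le> L * norm (y - z)" if "t \<in> {0..1}" "y \<in> ?C" "z \<in> ?C" for t y z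
  proof (rule differentiable_bound[OF _ _ _ that(2,3)])
    show "convex ?C" by simp
    fix x assume x: "x \<in> ?C"
    then show "(X t has_derivative D t x) (at x within ?C)"
      using D[OF that(1)] sub has_derivative_at_withinI by blast
    show "onorm (D t x) \<le> L" using L x that by (intro onorm_bound) auto
  qed
  let ?P = "closest_point ?C"
  have P: "?P y \<in> ?C" for y using \<rho> by (intro closest_point_in_set) auto
  have P_self: "?P y = y" if "y \<in> ?C" for y using that by (rule closest_point_self)
  have P_lip: "norm (?P y - ?P z) \<le> norm (y - z)" for y z
    using closest_point_lipschitz[of ?C y z] \<rho> by (auto simp: dist_norm)
  have P_cont: "continuous_on UNIV ?P" using \<rho> by (intro continuous_on_closest_point) auto
  define f where "f = (\<lambda>t y. X t (?P y))"
  have f_cont: "cont_family UNIV f"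
  proof -
    have "continuous_on ({0..1} \<times> UNIV) (\<lambda>p. (\<lambda>(t, x). X t x) (fst p, ?P (snd p)))"
      by (rule continuous_on_compose2[OF X])
        (use P sub in \<open>auto intro!: continuous_intros continuous_on_compose2[OF P_cont] simp del: mem_ball mem_cball\<close>)
    then show ?thesis by (simp add: f_def case_prod_beta)
  qed
  have f_lip: "norm (f t y - f t z) \<le> L * norm (y - z)" if "t \<in> {0..1}" for t y z
    using X_lip[OF that P P, of y z] P_lip[of y z] L(1) unfolding f_def
    by (meson mult_left_mono order_trans less_imp_le)
  have f0: "f t 0 = 0" if "t \<in> {0..1}" for t using X0[OF that] P_self[of 0] \<rho> by (simp add: f_def)
  have "\<exists>y. continuous_on {0..1} y \<and> (\<forall>t\<in>{0..1}. y t = x + integral {0..t} (\<lambda>s. f s (y s)))" for x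
    using picard_exists[OF f_cont L(1) f_lip continuous_on_const[of _ x]] by metis
  then obtain \<psi> where \<psi>: "\<And>x. continuous_on {0..1} (\<psi> x)"
    "\<And>x t. t \<in> {0..1} \<Longrightarrow> \<psi> x t = x + integral {0..t} (\<lambda>s. f s (\<psi> x s))" by metis
  define \<phi> where "\<phi> = (\<lambda>t x. \<psi> x t)"
  note \<phi> = \<psi>[folded \<phi>_def]
  have \<phi>: "\<And>x. continuous_on {0..1} (\<lambda>t. \<phi> t x)"
    "\<And>x t. t \<in> {0..1} \<Longrightarrow> \<phi> t x = x + integral {0..t} (\<lambda>s. f s (\<phi> s x))"
    using \<psi> by (simp_all add: \<phi>_def)
  have f_path: "continuous_on {0..1} (\<lambda>s. f s (u s))" if "continuous_on {0..1} u" for u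
    using continuous_on_compose2[OF f_cont, of "{0..1}" "\<lambda>s. (s, u s)"] that
    by (auto simp: continuous_on_Pair continuous_on_id image_subset_iff)
  have f_int: "(\<lambda>s. f s (u s)) integrable_on {0..t}" if "continuous_on {0..1} u" "t \<in> {0..1}" for u t
    by (intro integrable_continuous_real continuous_on_subset[OF f_path[OF that(1)]]) (use that in auto)
  have compare: "norm (u t - \<phi> t x) \<le> 2 * norm (x' - x) * exp (2 * L)"
    if "continuous_on {0..1} u" "\<And>t. t \<in> {0..1} \<Longrightarrow> u t = x' + integral {0..t} (\<lambda>s. f s (u s))"
      "t \<in> {0..1}" for u x x' t
  proof -
    have "norm (u t - \<phi> t x) \<le> 2 * (norm (x' - x) + 0) * exp (2 * L)"
    proof (rule gronwall_norm[where f="\<lambda>s. f s (u s) - f s (\<phi> s x)" and c="\<lambda>_. x' - x"])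
      show "continuous_on {0..1} (\<lambda>t. u t - \<phi> t x)" "continuous_on {0..1} (\<lambda>s. f s (u s) - f s (\<phi> s x))"
        by (intro continuous_intros f_path \<phi> that)+
      fix t :: real assume t: "t \<in> {0..1}"
      show "u t - \<phi> t x = x' - x + integral {0..t} (\<lambda>s. f s (u s) - f s (\<phi> s x))"
        unfolding that(2)[OF t] \<phi>(2)[OF t] using f_int[OF that(1) t] f_int[OF \<phi>(1) t]
        by (simp add: integral_diff)
      show "norm (f t (u t) - f t (\<phi> t x)) \<le> L * norm (u t - \<phi> t x) + 0"
        using f_lip[OF t] by simp
    qed (use L that in auto)
    then show ?thesis by simp
  qed
  have \<phi>_lip: "norm (\<phi> t x' - \<phi> t x) \<le> 2 * norm (x' - x) * exp (2 * L)" if "t \<in> {0..1}" for t x x'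
    by (rule compare) (use \<phi> that in auto)
  \<comment> \<open>Chosen so that the Gronwall bound \<open>2 * e * exp (2 * L)\<close> on
    trajectories from \<open>ball 0 e\<close> equals \<open>\<rho> / 2\<close>.\<close>
  define e where "e = \<rho> * exp (- 2 * L) / 4"
  have e: "e > 0" "2 * e * exp (2 * L) = \<rho> / 2" using \<rho>
    by (auto simp: e_def simp flip: exp_add)
  have "e * 1 \<le> e * exp (2 * L)" using e(1) L(1) by (intro mult_left_mono) auto
  with e have e_le: "e \<le> \<rho> / 2" by linarith
  have \<phi>_bound: "norm (\<phi> t x) < \<rho>" if "t \<in> {0..1}" "x \<in> ball 0 e" for t x
  proof -
    have "norm (0 - \<phi> t x) \<le> 2 * norm (0 - x) * exp (2 * L)"
    proof (rule compare)
      fix t :: real assume "t \<in> {0..1}"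
      then have "integral {0..t} (\<lambda>s. f s 0) = integral {0..t} (\<lambda>s. 0)"
        by (intro integral_cong) (auto simp: f0)
      then show "0 = 0 + integral {0..t} (\<lambda>s. f s 0)" by simp
    qed (use that in auto)
    also have "\<dots> \<le> 2 * e * exp (2 * L)" using that by (intro mult_right_mono) auto
    finally show ?thesis using e \<rho> by simp
  qed
  have f_X: "integral {0..t} (\<lambda>s. f s (u s)) = integral {0..t} (\<lambda>s. X s (u s))"
    if "\<And>s. s \<in> {0..1} \<Longrightarrow> norm (u s) < \<rho>" "t \<in> {0..1}" for u t
    using that by (intro integral_cong) (auto simp: f_def P_self less_imp_le)
  have \<phi>_eq: "\<phi> t x = x + integral {0..t} (\<lambda>s. X s (\<phi> s x))" if "t \<in> {0..1}" "x \<in> ball 0 e" for t x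
    using \<phi>(2)[OF that(1), of x] f_X[of "\<lambda>s. \<phi> s x" t] \<phi>_bound[OF _ that(2)] that(1) by simp
  have \<phi>_joint: "cont_family (ball 0 e) \<phi>"
  proof (rule joint_continuousI)
    fix x0 and \<epsilon> :: real assume "\<epsilon> > 0"
    show "\<exists>e'>0. \<forall>t\<in>{0..1}. \<forall>x\<in>ball x0 e' \<inter> ball 0 e. dist (\<phi> t x) (\<phi> t x0) < \<epsilon>"
    proof (intro exI[of _ "\<epsilon> / (2 * exp (2 * L))"] conjI ballI)
      fix t x assume t: "t \<in> {0..1::real}" and x: "x \<in> ball x0 (\<epsilon> / (2 * exp (2 * L))) \<inter> ball 0 e"
      have "dist (\<phi> t x) (\<phi> t x0) \<le> 2 * norm (x - x0) * exp (2 * L)"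
        using \<phi>_lip[OF t] by (simp add: dist_norm)
      also have "\<dots> < \<epsilon>" using x by (simp add: dist_norm norm_minus_commute field_simps)
      finally show "dist (\<phi> t x) (\<phi> t x0) < \<epsilon>" .
    qed (use \<open>\<epsilon> > 0\<close> in simp)
  qed (use \<phi> in auto)
  \<comment> \<open>Continuity jointly in s and z is recovered from continuity for fixed directions
    by expanding z in the basis.\<close>
  have D_path: "cont_family UNIV (\<lambda>s z. D s (\<phi> s x) z)" if x: "x \<in> ball 0 e" for x
  proof -
    have c: "continuous_on ({0..1} \<times> (UNIV::'a set)) (\<lambda>p. (\<lambda>(t, x). D t x b) (fst p, \<phi> (fst p) x))" for b
      by (rule continuous_on_compose2[OF D_cont])
        (use \<phi>_bound[OF _ x] \<rho> in \<open>force intro!: continuous_intros continuous_on_compose2[OF \<phi>(1)]\<close>)+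
    have "continuous_on ({0..1} \<times> UNIV) (\<lambda>p. \<Sum>b\<in>Basis. (snd p \<bullet> b) *\<^sub>R D (fst p) (\<phi> (fst p) x) b)"
      using c by (auto intro!: continuous_intros)
    then show ?thesis
    proof (rule continuous_on_eq)
      fix p assume "p \<in> {0..1::real} \<times> (UNIV::'a set)"
      then obtain s z where p: "p = (s, z)" "s \<in> {0..1}" by auto
      have l: "linear (D s (\<phi> s x))" using linD[OF p(2)] \<phi>_bound[OF p(2) x] \<rho> by simp
      have "D s (\<phi> s x) z = D s (\<phi> s x) (\<Sum>b\<in>Basis. (z \<bullet> b) *\<^sub>R b)" by (simp add: euclidean_representation)
      then show "(\<Sum>b\<in>Basis. (snd p \<bullet> b) *\<^sub>R D (fst p) (\<phi> (fst p) x) b) = (\<lambda>(s, z). D s (\<phi> s x) z) p"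
        using p l by (simp add: linear_sum linear_scale)
    qed
  qed
  have L': "norm (D t (\<phi> t x) h) \<le> L * norm h" "linear (D t (\<phi> t x))"
    if "t \<in> {0..1}" "x \<in> ball 0 e" for t x h
    using L(2)[OF that(1), of "\<phi> t x" h] linD[OF that(1)] \<phi>_bound[OF that] \<rho> by auto
  have "\<exists>y. continuous_on {0..1} y \<and> (\<forall>t\<in>{0..1}. y t = h + integral {0..t} (\<lambda>s. D s (\<phi> s x) (y s)))"
    if x: "x \<in> ball 0 e" for x h
  proof -
    have "norm (D t (\<phi> t x) y - D t (\<phi> t x) z) \<le> L * norm (y - z)" if "t \<in> {0..1}" for t y z
      using L'(1)[OF that x, of "y - z"] linear_diff[OF L'(2)[OF that x]] by simp
    then show ?thesis
      using picard_exists[OF D_path[OF x] L(1) _ continuous_on_const[of _ h]] by metis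
  qed
  then obtain \<zeta> where \<zeta>: "\<And>x h. x \<in> ball 0 e \<Longrightarrow> continuous_on {0..1} (\<zeta> x h)"
    "\<And>x h t. x \<in> ball 0 e \<Longrightarrow> t \<in> {0..1} \<Longrightarrow> \<zeta> x h t = h + integral {0..t} (\<lambda>s. D s (\<phi> s x) (\<zeta> x h s))"
    by metis
  define Z where "Z = (\<lambda>t x h. \<zeta> x h t)"
  have Z: "\<And>x h. x \<in> ball 0 e \<Longrightarrow> continuous_on {0..1} (\<lambda>t. Z t x h)"
    "\<And>x h t. x \<in> ball 0 e \<Longrightarrow> t \<in> {0..1} \<Longrightarrow> Z t x h = h + integral {0..t} (\<lambda>s. D s (\<phi> s x) (Z s x h))"
    using \<zeta> by (simp_all add: Z_def)
  have DZ_cont: "continuous_on {0..1} (\<lambda>s. D s (\<phi> s x) (v s))" if "x \<in> ball 0 e" "continuous_on {0..1} v" for x v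
    using continuous_on_compose2[OF D_path[OF that(1)], of "{0..1}" "\<lambda>s. (s, v s)"] that
    by (auto simp: continuous_on_Pair continuous_on_id image_subset_iff)
  have DZ_int: "(\<lambda>s. D s (\<phi> s x) (v s)) integrable_on {0..t}"
    if "x \<in> ball 0 e" "continuous_on {0..1} v" "t \<in> {0..1}" for x v t
    by (intro integrable_continuous_real continuous_on_subset[OF DZ_cont[OF that(1,2)]]) (use that in auto)
  have zero: "w t = 0" if x: "x \<in> ball 0 e" and w: "continuous_on {0..1} w"
    "\<And>t. t \<in> {0..1} \<Longrightarrow> w t = integral {0..t} (\<lambda>s. D s (\<phi> s x) (w s))" and t: "t \<in> {0..1}" for w x t
  proof -
    have "norm (w t) \<le> 2 * (0 + 0) * exp (2 * L)"
      by (rule gronwall_norm[where c="\<lambda>_. 0", OF w(1) DZ_cont[OF x w(1)]]) (use w L(1) L'(1)[OF _ x] t in auto)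
    then show ?thesis by simp
  qed
  \<comment> \<open>The solutions \<open>Z t x h\<close> were chosen separately for each h. Their
    linearity follows from uniqueness, since the defect solves the homogeneous equation with zero
    initial value.\<close>
  have Z_lin: "linear (Z t x)" if x: "x \<in> ball 0 e" and t: "t \<in> {0..1}" for x t
  proof (rule linearI)
    fix h k :: 'a and r :: real
    have "Z t x (h + k) - (Z t x h + Z t x k) = 0"
    proof (rule zero[OF x _ _ t])
      show "continuous_on {0..1} (\<lambda>t. Z t x (h + k) - (Z t x h + Z t x k))" by (intro continuous_intros Z x)
      fix t :: real assume t: "t \<in> {0..1}"
      have "integral {0..t} (\<lambda>s. D s (\<phi> s x) (Z s x (h + k) - (Z s x h + Z s x k))) =
        integral {0..t} (\<lambda>s. D s (\<phi> s x) (Z s x (h + k)) - (D s (\<phi> s x) (Z s x h) + D s (\<phi> s x) (Z s x k)))"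
        using t by (intro integral_cong) (simp add: linear_diff[OF L'(2)[OF _ x]] linear_add[OF L'(2)[OF _ x]])
      then show "Z t x (h + k) - (Z t x h + Z t x k) =
          integral {0..t} (\<lambda>s. D s (\<phi> s x) (Z s x (h + k) - (Z s x h + Z s x k)))"
        using DZ_int[OF x Z(1)[OF x] t] Z(2)[OF x t, of "h + k"] Z(2)[OF x t, of h] Z(2)[OF x t, of k]
        by (simp add: integral_diff integral_add integrable_add)
    qed
    then show "Z t x (h + k) = Z t x h + Z t x k" by simp
    have "Z t x (r *\<^sub>R h) - r *\<^sub>R Z t x h = 0"
    proof (rule zero[OF x _ _ t])
      show "continuous_on {0..1} (\<lambda>t. Z t x (r *\<^sub>R h) - r *\<^sub>R Z t x h)" by (intro continuous_intros Z x)
      fix t :: real assume t: "t \<in> {0..1}"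
      have "integral {0..t} (\<lambda>s. D s (\<phi> s x) (Z s x (r *\<^sub>R h) - r *\<^sub>R Z s x h)) =
        integral {0..t} (\<lambda>s. D s (\<phi> s x) (Z s x (r *\<^sub>R h)) - r *\<^sub>R D s (\<phi> s x) (Z s x h))"
        using t by (intro integral_cong) (simp add: linear_diff[OF L'(2)[OF _ x]] linear_scale[OF L'(2)[OF _ x]])
      then show "Z t x (r *\<^sub>R h) - r *\<^sub>R Z t x h =
          integral {0..t} (\<lambda>s. D s (\<phi> s x) (Z s x (r *\<^sub>R h) - r *\<^sub>R Z s x h))"
        using DZ_int[OF x Z(1)[OF x] t] Z(2)[OF x t, of "r *\<^sub>R h"] Z(2)[OF x t, of h]
        by (simp add: integral_diff integrable_cmul scaleR_right_distrib)
    qed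
    then show "Z t x (r *\<^sub>R h) = r *\<^sub>R Z t x h" by simp
  qed
  have \<phi>_deriv: "(\<phi> t has_derivative Z t x) (at x)" if t: "t \<in> {0..1}" and x: "x \<in> ball 0 e" for t x
    unfolding has_derivative_at_alt
  proof (intro conjI allI impI)
    show "bounded_linear (Z t x)" using Z_lin[OF x t] by (simp add: linear_conv_bounded_linear)
    fix \<epsilon> :: real assume "\<epsilon> > 0"
    have "\<exists>\<delta>>0. \<forall>t\<in>{0..1}. \<forall>h. norm h < \<delta> \<longrightarrow> norm (\<phi> t (x + h) - \<phi> t x - Z t x h) \<le> \<epsilon> * norm h"
    proof (rule ode_parameter_derivative[where F="\<lambda>s x y. X s y" and U="ball 0 e" and c="\<lambda>t x. x"
          and c'="\<lambda>t h. h" and Dx="\<lambda>s h. 0" and Dy="\<lambda>s k. D s (\<phi> s x) k" and M="max 1 L"])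
      fix x' :: 'a assume x': "x' \<in> ball 0 e"
      show "continuous_on {0..1} (\<lambda>t. \<phi> t x')" by (rule \<phi>)
      show "continuous_on {0..1} (\<lambda>s. X s (\<phi> s x'))"
        by (rule continuous_on_eq[OF f_path[OF \<phi>(1)[of x']]])
          (use \<phi>_bound[OF _ x'] in \<open>auto simp: f_def P_self less_imp_le\<close>)
      show "\<phi> t x' = x' + integral {0..t} (\<lambda>s. X s (\<phi> s x'))" if "t \<in> {0..1}" for t
        using \<phi>_eq[OF that x'] .
    next
      fix \<epsilon> :: real assume "\<epsilon> > 0"
      show "\<exists>\<delta>>0. \<forall>t\<in>{0..1::real}. \<forall>h. norm h < \<delta> \<longrightarrow> norm (x + h - x - h) \<le> \<epsilon> * norm h"
        using \<open>\<epsilon> > 0\<close> by (intro exI[of _ 1]) simp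
      obtain d where d: "d > 0" "\<And>s v. s \<in> {0..1} \<Longrightarrow> norm v < d \<Longrightarrow>
          norm (X s (\<phi> s x + v) - X s (\<phi> s x) - D s (\<phi> s x) v) \<le> \<epsilon> * norm v"
      proof (rule uniform_linearization[OF open_ball \<phi>(1)[of x] _ D D_cont \<open>\<epsilon> > 0\<close>])
        show "\<phi> s x \<in> ball 0 R" if "s \<in> {0..1}" for s using \<phi>_bound[OF that x] \<rho> by simp
      qed blast+
      show "\<exists>\<delta>>0. \<forall>s\<in>{0..1}. \<forall>h. norm h < \<delta> \<longrightarrow>
        norm (X s (\<phi> s (x + h)) - X s (\<phi> s x) - 0 - D s (\<phi> s x) (\<phi> s (x + h) - \<phi> s x))
          \<le> \<epsilon> * (norm h + norm (\<phi> s (x + h) - \<phi> s x))"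
      proof (intro exI[of _ "d / (2 * exp (2 * L))"] conjI ballI allI impI)
        fix s and h :: 'a assume s: "s \<in> {0..1::real}" and h: "norm h < d / (2 * exp (2 * L))"
        let ?v = "\<phi> s (x + h) - \<phi> s x"
        have "norm ?v \<le> 2 * norm (x + h - x) * exp (2 * L)" by (rule \<phi>_lip[OF s])
        also have "\<dots> < d" using h by (simp add: field_simps)
        finally have "norm (X s (\<phi> s (x + h)) - X s (\<phi> s x) - D s (\<phi> s x) ?v) \<le> \<epsilon> * norm ?v"
          using d(2)[OF s, of ?v] by simp
        also have "\<dots> \<le> \<epsilon> * (norm h + norm ?v)" using \<open>\<epsilon> > 0\<close> by simp
        finally show "norm (X s (\<phi> s (x + h)) - X s (\<phi> s x) - 0 - D s (\<phi> s x) ?v) \<le> \<epsilon> * (norm h + norm ?v)"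
          by simp
      qed (use d in simp)
    next
      fix s and h :: 'a assume s: "s \<in> {0..1::real}"
      show "norm h \<le> max 1 L * norm h" using mult_right_mono[of 1 "max 1 L" "norm h"] by simp
      show "norm (0::'a) \<le> max 1 L * norm h" using L by simp
      show "norm (D s (\<phi> s x) h) \<le> max 1 L * norm h"
        using L'(1)[OF s x, of h] mult_right_mono[of L "max 1 L" "norm h"] by simp
      show "D s (\<phi> s x) (h - k) = D s (\<phi> s x) h - D s (\<phi> s x) k" for k
        using linear_diff[OF L'(2)[OF s x]] .
      show "Z s x h = h + integral {0..s} (\<lambda>s. 0 + D s (\<phi> s x) (Z s x h))"
        using Z(2)[OF x s] by simp
    next
      fix h :: 'a
      show "continuous_on {0..1} (\<lambda>t. Z t x h)" by (rule Z[OF x])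
      show "continuous_on {0..1} (\<lambda>s. 0 + D s (\<phi> s x) (Z s x h))"
        using DZ_cont[OF x Z(1)[OF x]] by simp
    qed (use x \<open>\<epsilon> > 0\<close> in auto)
    then obtain \<delta> where "\<delta> > 0" "\<And>h. norm h < \<delta> \<Longrightarrow> norm (\<phi> t (x + h) - \<phi> t x - Z t x h) \<le> \<epsilon> * norm h"
      using t by blast
    then show "\<exists>d>0. \<forall>y. norm (y - x) < d \<longrightarrow>
        norm (\<phi> t y - \<phi> t x - Z t x (y - x)) \<le> \<epsilon> * norm (y - x)"
      by (metis add.commute diff_add_cancel)
  qed
  show ?thesis
  proof (rule that[OF local_flow.intro])
    show "e > 0" "e \<le> R" using e e_le \<rho> by auto
    show "\<phi> t x \<in> ball 0 (R/2)" if "t \<in> {0..1}" "x \<in> ball 0 e" for t x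
      using \<phi>_bound[OF that] by (simp add: \<rho>_def)
    show "u t = \<phi> t x" if u: "continuous_on {0..1} u" "\<And>t. t \<in> {0..1} \<Longrightarrow> u t \<in> ball 0 (R/2)"
      "\<And>t. t \<in> {0..1} \<Longrightarrow> u t = x + integral {0..t} (\<lambda>s. X s (u s))" "t \<in> {0..1}" for u x t
    proof -
      have "u t = x + integral {0..t} (\<lambda>s. f s (u s))" if "t \<in> {0..1}" for t
        using u(3)[OF that] f_X[of u t] u(2) that by (simp add: \<rho>_def)
      from compare[OF u(1) this u(4), of x] show ?thesis by simp
    qed
    show "Z t x h = h + integral {0..t} (\<lambda>s. D s (\<phi> s x) (Z s x h))"
      if "t \<in> {0..1}" "x \<in> ball 0 e" for t x h using Z(2)[OF that(2,1)] .
  qed (fact \<phi>_joint \<phi>_eq \<phi>_deriv Z(1) zero)+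
qed

section \<open>Smooth families of functions\<close>

text \<open>Components may lie in any Euclidean space, so that real and complex vectors are covered
  at once.\<close>

lemma has_derivative_vec_nthI:
  fixes f :: "'a::real_normed_vector \<Rightarrow> 'b::euclidean_space ^ 'n"
  assumes "\<And>i. ((\<lambda>x. f x $ i) has_derivative (\<lambda>h. f' h $ i)) (at x within S)"
  shows "(f has_derivative f') (at x within S)"
proof -
  have "\<forall>u\<in>Basis. ((\<lambda>x. f x \<bullet> u) has_derivative (\<lambda>h. f' h \<bullet> u)) (at x within S)"
  proof
    fix u :: "'b ^ 'n" assume "u \<in> Basis"
    then obtain i b where u: "u = axis i b" by (auto simp: Basis_vec_def)
    have "((\<lambda>x. f x $ i \<bullet> b) has_derivative (\<lambda>h. f' h $ i \<bullet> b)) (at x within S)"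
      by (rule has_derivative_inner_left[OF assms])
    then show "((\<lambda>x. f x \<bullet> u) has_derivative (\<lambda>h. f' h \<bullet> u)) (at x within S)"
      by (simp add: u inner_axis)
  qed
  then show ?thesis unfolding has_derivative_componentwise_within[of f] .
qed

text \<open>Derivatives are taken in space only and are jointly continuous; in time only continuity
  is required. The gradient is existentially quantified, so that a computed derivative can be
  supplied as witness.\<close>

primrec jet_on :: "nat \<Rightarrow> (real \<Rightarrow> real ^ 'n \<Rightarrow> real) \<Rightarrow> (real ^ 'n) set \<Rightarrow> bool" where
  "jet_on 0 f U \<longleftrightarrow> cont_family U f"
| "jet_on (Suc k) f U \<longleftrightarrow> cont_family U f \<and>
     (\<exists>g. (\<forall>t\<in>{0..1}. \<forall>x\<in>U. has_gradient (f t) (\<lambda>i. g i t x) x) \<and>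
       (\<forall>i. jet_on k (g i) U))"

declare jet_on.simps(2) [simp del]

lemma jet_on_SucI:
  assumes "cont_family U f"
    and "\<And>t x. t \<in> {0..1} \<Longrightarrow> x \<in> U \<Longrightarrow> has_gradient (f t) (\<lambda>i. g i t x) x"
    and "\<And>i. jet_on k (g i) U"
  shows "jet_on (Suc k) f U"
  using assms unfolding jet_on.simps by blast

lemma jet_on_SucE:
  assumes "jet_on (Suc k) f U"
  obtains g where "\<And>t x. t \<in> {0..1} \<Longrightarrow> x \<in> U \<Longrightarrow> has_gradient (f t) (\<lambda>i. g i t x) x"
    and "\<And>i. jet_on k (g i) U"
  using assms unfolding jet_on.simps by blast

lemma jet_on_continuous: "jet_on k f U \<Longrightarrow> cont_family U f"
  by (cases k) (auto simp: jet_on.simps)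

lemma jet_on_Suc_D: "jet_on (Suc k) f U \<Longrightarrow> jet_on k f U"
proof (induction k arbitrary: f)
  case (Suc k)
  obtain g where g: "\<And>t x. t \<in> {0..1} \<Longrightarrow> x \<in> U \<Longrightarrow> has_gradient (f t) (\<lambda>i. g i t x) x"
    "\<And>i. jet_on (Suc k) (g i) U" using Suc.prems by (rule jet_on_SucE) (rule that)
  show ?case by (rule jet_on_SucI[OF jet_on_continuous[OF Suc.prems] g(1) Suc.IH[OF g(2)]])
qed (simp add: jet_on_continuous)

lemma jet_on_subset: "jet_on k f U \<Longrightarrow> V \<subseteq> U \<Longrightarrow> jet_on k f V"
proof (induction k arbitrary: f)
  case 0
  then show ?case by (auto intro: continuous_on_subset)
next
  case (Suc k)
  have c: "cont_family V f"
    by (rule continuous_on_subset[OF jet_on_continuous[OF Suc.prems(1)]]) (use Suc.prems in auto)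
  obtain g where g: "\<And>t x. t \<in> {0..1} \<Longrightarrow> x \<in> U \<Longrightarrow> has_gradient (f t) (\<lambda>i. g i t x) x"
    "\<And>i. jet_on k (g i) U" using Suc.prems(1) by (rule jet_on_SucE) (rule that)
  show ?case
    by (rule jet_on_SucI[OF c g(1) Suc.IH[OF g(2) Suc.prems(2)]]) (use Suc.prems(2) in blast)+
qed

lemma jet_on_cong:
  assumes "open U" and eq: "\<And>t x. t \<in> {0..1} \<Longrightarrow> x \<in> U \<Longrightarrow> f t x = g t x" and f: "jet_on k f U"
  shows "jet_on k g U"
proof -
  have c: "cont_family U g"
    by (rule continuous_on_eq[OF jet_on_continuous[OF f]]) (auto simp: eq)
  show ?thesis
  proof (cases k)
    case (Suc j)
    obtain d where d: "\<And>t x. t \<in> {0..1} \<Longrightarrow> x \<in> U \<Longrightarrow> has_gradient (f t) (\<lambda>i. d i t x) x"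
      "\<And>i. jet_on j (d i) U" using f[unfolded Suc] by (rule jet_on_SucE) (rule that)
    show ?thesis unfolding Suc
    proof (rule jet_on_SucI[OF c _ d(2)])
      fix t x assume tx: "t \<in> {0..1::real}" "x \<in> U"
      then show "has_gradient (g t) (\<lambda>i. d i t x) x"
        by (intro has_derivative_transform_within_open[OF d(1)[OF tx] \<open>open U\<close> tx(2)] eq)
    qed
  qed (use c in auto)
qed

lemma jet_on_time: "continuous_on {0..1} c \<Longrightarrow> jet_on k (\<lambda>t x. c t) U"
proof (induction k arbitrary: c)
  case 0
  then show ?case by (auto simp: case_prod_beta intro!: continuous_intros continuous_on_compose2[OF 0])
next
  case (Suc k)
  have "cont_family U (\<lambda>t x. c t)"
    by (auto simp: case_prod_beta intro!: continuous_intros continuous_on_compose2[OF Suc.prems])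
  then show ?case
    by (rule jet_on_SucI[where g="\<lambda>i t x. 0"]) (use Suc.IH[OF continuous_on_const[of _ 0]] in auto)
qed

lemma jet_on_coordinate: "jet_on k (\<lambda>t x. x $ i) U"
proof (cases k)
  case (Suc j)
  have "continuous_on ({0..1} \<times> U) (\<lambda>(t::real, x). x $ i)"
    by (auto simp: case_prod_beta intro!: continuous_intros)
  moreover have "has_gradient (\<lambda>x. x $ i) (\<lambda>j. (if j = i then 1 else 0)) x"
    for x :: "real ^ 'a"
  proof -
    have "(\<Sum>j\<in>UNIV. (if j = i then 1 else 0) * h $ j) = h $ i" for h :: "real ^ 'a"
      by (simp add: if_distrib[of "\<lambda>c. c * _"] cong: if_cong)
    then show ?thesis by (simp add: bounded_linear_imp_has_derivative bounded_linear_vec_nth)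
  qed
  moreover have "jet_on j (\<lambda>t x. if l = i then 1 else 0) U" for l by (rule jet_on_time) simp
  ultimately show ?thesis unfolding Suc by (rule jet_on_SucI)
qed (auto simp: case_prod_beta intro!: continuous_intros)

lemma jet_on_add: "jet_on k f U \<Longrightarrow> jet_on k g U \<Longrightarrow> jet_on k (\<lambda>t x. f t x + g t x) U"
proof (induction k arbitrary: f g)
  case 0
  then show ?case by (auto simp: case_prod_beta intro!: continuous_intros)
next
  case (Suc k)
  obtain f' where f': "\<And>t x. t \<in> {0..1} \<Longrightarrow> x \<in> U \<Longrightarrow> has_gradient (f t) (\<lambda>i. f' i t x) x"
    "\<And>i. jet_on k (f' i) U" using Suc.prems(1) by (rule jet_on_SucE) (rule that)
  obtain g' where g': "\<And>t x. t \<in> {0..1} \<Longrightarrow> x \<in> U \<Longrightarrow> has_gradient (g t) (\<lambda>i. g' i t x) x"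
    "\<And>i. jet_on k (g' i) U" using Suc.prems(2) by (rule jet_on_SucE) (rule that)
  have "cont_family U (\<lambda>t x. f t x + g t x)"
    using jet_on_continuous[OF Suc.prems(1)] jet_on_continuous[OF Suc.prems(2)]
    by (auto simp: case_prod_beta intro!: continuous_intros)
  then show ?case
  proof (rule jet_on_SucI)
    show "has_gradient (\<lambda>x. f t x + g t x) (\<lambda>i. (f' i t x + g' i t x)) x"
      if "t \<in> {0..1}" "x \<in> U" for t x
      using has_derivative_add[OF f'(1)[OF that] g'(1)[OF that]] by (simp add: distrib_right sum.distrib)
    show "jet_on k (\<lambda>t x. f' i t x + g' i t x) U" for i using f'(2) g'(2) by (rule Suc.IH)
  qed
qed

lemma jet_on_mult: "jet_on k f U \<Longrightarrow> jet_on k g U \<Longrightarrow> jet_on k (\<lambda>t x. f t x * g t x) U"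
proof (induction k arbitrary: f g)
  case 0
  then show ?case by (auto simp: case_prod_beta intro!: continuous_intros)
next
  case (Suc k)
  obtain f' where f': "\<And>t x. t \<in> {0..1} \<Longrightarrow> x \<in> U \<Longrightarrow> has_gradient (f t) (\<lambda>i. f' i t x) x"
    "\<And>i. jet_on k (f' i) U" using Suc.prems(1) by (rule jet_on_SucE) (rule that)
  obtain g' where g': "\<And>t x. t \<in> {0..1} \<Longrightarrow> x \<in> U \<Longrightarrow> has_gradient (g t) (\<lambda>i. g' i t x) x"
    "\<And>i. jet_on k (g' i) U" using Suc.prems(2) by (rule jet_on_SucE) (rule that)
  have "cont_family U (\<lambda>t x. f t x * g t x)"
    using jet_on_continuous[OF Suc.prems(1)] jet_on_continuous[OF Suc.prems(2)]
    by (auto simp: case_prod_beta intro!: continuous_intros)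
  then show ?case
  proof (rule jet_on_SucI)
    fix t x assume "t \<in> {0..1::real}" "x \<in> U"
    then have "((\<lambda>x. f t x * g t x) has_derivative
      (\<lambda>h. f t x * (\<Sum>i\<in>UNIV. g' i t x * h $ i) + (\<Sum>i\<in>UNIV. f' i t x * h $ i) * g t x)) (at x)"
      using f'(1) g'(1) by (intro has_derivative_mult) auto
    moreover have "(\<lambda>h. f t x * (\<Sum>i\<in>UNIV. g' i t x * h $ i) + (\<Sum>i\<in>UNIV. f' i t x * h $ i) * g t x)
        = (\<lambda>h. \<Sum>i\<in>UNIV. (f t x * g' i t x + f' i t x * g t x) * h $ i)"
      by (simp add: algebra_simps sum.distrib sum_distrib_left)
    ultimately show "has_gradient (\<lambda>x. f t x * g t x) (\<lambda>i. (f t x * g' i t x + f' i t x * g t x)) x" by simp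
  next
    fix i show "jet_on k (\<lambda>t x. f t x * g' i t x + f' i t x * g t x) U"
      by (intro jet_on_add Suc.IH f'(2) g'(2) jet_on_Suc_D[OF Suc.prems(1)] jet_on_Suc_D[OF Suc.prems(2)])
  qed
qed

lemma jet_on_sum: "(\<And>i. i \<in> I \<Longrightarrow> jet_on k (f i) U) \<Longrightarrow> jet_on k (\<lambda>t x. \<Sum>i\<in>I. f i t x) U"
proof (induction I rule: infinite_finite_induct)
  case (insert i I)
  then show ?case using jet_on_add[of k "f i" U "\<lambda>t x. \<Sum>i\<in>I. f i t x"] by simp
qed (use jet_on_time[of "\<lambda>_. 0"] in auto)

text \<open>The gradient of the inverse contains the inverse again, now required to one order less,
  which is what the induction provides.\<close>

lemma jet_on_inverse:
  "jet_on k f U \<Longrightarrow> (\<And>t x. t \<in> {0..1} \<Longrightarrow> x \<in> U \<Longrightarrow> f t x \<noteq> 0) \<Longrightarrow> jet_on k (\<lambda>t x. inverse (f t x)) U"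
proof (induction k)
  case 0
  then show ?case by (auto simp: case_prod_beta intro!: continuous_intros)
next
  case (Suc k)
  obtain f' where f': "\<And>t x. t \<in> {0..1} \<Longrightarrow> x \<in> U \<Longrightarrow> has_gradient (f t) (\<lambda>i. f' i t x) x"
    "\<And>i. jet_on k (f' i) U" using Suc.prems(1) by (rule jet_on_SucE) (rule that)
  let ?g = "\<lambda>i t x. (- 1) * (inverse (f t x) * (f' i t x * inverse (f t x)))"
  have "cont_family U (\<lambda>t x. inverse (f t x))"
    using jet_on_continuous[OF Suc.prems(1)] Suc.prems(2)
    by (auto simp: case_prod_beta intro!: continuous_intros)
  then show ?case
  proof (rule jet_on_SucI)
    fix t x assume tx: "t \<in> {0..1::real}" "x \<in> U"
    have "((\<lambda>x. inverse (f t x)) has_derivative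
      (\<lambda>h. - (inverse (f t x) * (\<Sum>i\<in>UNIV. f' i t x * h $ i) * inverse (f t x)))) (at x)"
      using Suc.prems(2)[OF tx] f'(1)[OF tx] by (rule Deriv.has_derivative_inverse)
    moreover have "(\<lambda>h. - (inverse (f t x) * (\<Sum>i\<in>UNIV. f' i t x * h $ i) * inverse (f t x)))
        = (\<lambda>h. \<Sum>i\<in>UNIV. ?g i t x * h $ i)"
      by (simp add: sum_negf sum_distrib_left sum_distrib_right mult_ac)
    ultimately show "has_gradient (\<lambda>x. inverse (f t x)) (\<lambda>i. ?g i t x) x"
      by simp
  next
    fix i show "jet_on k (?g i) U"
      by (intro jet_on_mult jet_on_time Suc.IH[OF jet_on_Suc_D] f'(2) continuous_on_const Suc.prems)
  qed
qed

text \<open>By the chain rule the partial derivatives of the composite involve those of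
  \<open>f\<close> composed with \<open>g\<close>, so \<open>f\<close> is generalized in the
  induction while \<open>g\<close> stays fixed.\<close>

lemma jet_on_compose:
  fixes f :: "real \<Rightarrow> real ^ 'n \<Rightarrow> real" and g :: "real \<Rightarrow> real ^ 'm \<Rightarrow> real ^ 'n"
  assumes "jet_on k f V" "\<And>j. jet_on k (\<lambda>t x. g t x $ j) U" "\<And>t x. t \<in> {0..1} \<Longrightarrow> x \<in> U \<Longrightarrow> g t x \<in> V"
  shows "jet_on k (\<lambda>t x. f t (g t x)) U"
  using assms
proof (induction k arbitrary: f)
  have c: "cont_family U (\<lambda>t x. f t (g t x))"
    if "jet_on k f V" "\<And>j. jet_on k (\<lambda>t x. g t x $ j) U" for f k
  proof -
    have "continuous_on ({0..1} \<times> U) (\<lambda>p. \<chi> j. g (fst p) (snd p) $ j)"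
      using jet_on_continuous[OF that(2)] by (intro continuous_on_vec_lambda) (simp add: case_prod_beta)
    then have "continuous_on ({0..1} \<times> U) (\<lambda>p. (\<lambda>(t, x). f t x) (fst p, g (fst p) (snd p)))"
      using assms(3) by (intro continuous_on_compose2[OF jet_on_continuous[OF that(1)]])
        (auto intro!: continuous_intros)
    then show ?thesis by (simp add: case_prod_beta)
  qed
  { case 0
    then show ?case using c[of 0 f] by simp
  next
    case (Suc k)
    obtain f' where f': "\<And>t x. t \<in> {0..1} \<Longrightarrow> x \<in> V \<Longrightarrow> has_gradient (f t) (\<lambda>i. f' i t x) x"
      "\<And>i. jet_on k (f' i) V" using Suc.prems(1) by (rule jet_on_SucE) (rule that)
    have "\<forall>j. \<exists>g'. (\<forall>t\<in>{0..1}. \<forall>x\<in>U. has_gradient (\<lambda>x. g t x $ j) (\<lambda>i. g' i t x) x)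
      \<and> (\<forall>i. jet_on k (g' i) U)" using Suc.prems(2) unfolding jet_on.simps by blast
    from choice[OF this] obtain g' where
      "\<forall>j. (\<forall>t\<in>{0..1}. \<forall>x\<in>U. has_gradient (\<lambda>x. g t x $ j) (\<lambda>i. g' j i t x) x)
      \<and> (\<forall>i. jet_on k (g' j i) U)" ..
    then have g': "\<And>j t x. t \<in> {0..1} \<Longrightarrow> x \<in> U \<Longrightarrow> has_gradient (\<lambda>x. g t x $ j) (\<lambda>i. g' j i t x) x"
      "\<And>i j. jet_on k (g' j i) U" by simp_all
    let ?d = "\<lambda>i t x. \<Sum>j\<in>UNIV. f' j t (g t x) * g' j i t x"
    show ?case
    proof (rule jet_on_SucI[OF c[OF Suc.prems(1,2)]])
      fix t x assume tx: "t \<in> {0..1::real}" "x \<in> U"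
      have "(g t has_derivative (\<lambda>h. \<chi> j. \<Sum>i\<in>UNIV. g' j i t x * h $ i)) (at x)"
        by (rule has_derivative_vec_nthI) (use g'(1)[OF tx] in simp)
      from has_derivative_compose[OF this f'(1)[OF tx(1) Suc.prems(3)[OF tx]]]
      have "((\<lambda>x. f t (g t x)) has_derivative
          (\<lambda>h. \<Sum>j\<in>UNIV. f' j t (g t x) * (\<chi> j. \<Sum>i\<in>UNIV. g' j i t x * h $ i) $ j)) (at x)" .
      moreover have "(\<Sum>j\<in>UNIV. f' j t (g t x) * (\<chi> j. \<Sum>i\<in>UNIV. g' j i t x * h $ i) $ j)
          = (\<Sum>i\<in>UNIV. ?d i t x * h $ i)" for h :: "real ^ 'm"
        by (simp add: sum_distrib_left sum_distrib_right mult.assoc) (rule sum.swap)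
      ultimately show "has_gradient (\<lambda>x. f t (g t x)) (\<lambda>i. ?d i t x) x" by simp
    next
      fix i show "jet_on k (?d i) U"
        by (rule jet_on_sum, rule jet_on_mult, rule Suc.IH[OF f'(2) jet_on_Suc_D[OF Suc.prems(2)] Suc.prems(3)])
          (assumption | rule g'(2))+
    qed
  }
qed

section \<open>Integrals in time and linear equations with parameters\<close>

lemma uniform_continuity_curried:
  fixes f :: "real \<Rightarrow> 'a::metric_space \<Rightarrow> 'b::metric_space"
  assumes "cont_family U f" "open U" "x0 \<in> U" "\<epsilon> > 0"
  shows "\<exists>e>0. \<forall>t\<in>{0..1}. \<forall>x\<in>ball x0 e. dist (f t x) (f t x0) < \<epsilon>"
proof -
  obtain e where "e > 0" "\<And>t x. t \<in> {0..1} \<Longrightarrow> x \<in> ball x0 e \<Longrightarrow>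
      dist ((\<lambda>(t, x). f t x) (t, x)) ((\<lambda>(t, x). f t x) (t, x0)) < \<epsilon>"
    by (rule uniform_continuity_in_parameter[OF assms]) (assumption | rule that)+
  then show ?thesis by auto
qed

lemma continuous_on_vecI:
  fixes f :: "'a::topological_space \<Rightarrow> 'b::topological_space ^ 'n"
  assumes "\<And>i. continuous_on S (\<lambda>x. f x $ i)"
  shows "continuous_on S f"
  using continuous_on_vec_lambda[of S "\<lambda>i x. f x $ i", OF assms] by simp

lemma continuous_on_matrix_vector_mult:
  fixes A :: "'a::topological_space \<Rightarrow> real ^ 'n ^ 'm"
  assumes A: "\<And>j l. continuous_on S (\<lambda>p. A p $ j $ l)" and v: "continuous_on S v"
  shows "continuous_on S (\<lambda>p. A p *v v p)"
  unfolding matrix_vector_mult_def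
  by (intro continuous_on_vec_lambda continuous_on_sum continuous_on_mult A continuous_on_component[OF v])

lemma continuous_on_time_integral:
  fixes f :: "real \<Rightarrow> 'a::metric_space \<Rightarrow> 'b::banach"
  assumes U: "open U" and f: "cont_family U f"
  shows "cont_family U (\<lambda>t x. integral {0..t} (\<lambda>s. f s x))"
proof (rule joint_continuousI[OF U])
  have slice: "continuous_on {0..1} (\<lambda>s. f s x)" if "x \<in> U" for x
    using continuous_on_compose2[OF f, of "{0..1}" "\<lambda>s. (s, x)"] that
    by (auto simp: continuous_on_Pair continuous_on_id image_subset_iff)
  show "continuous_on {0..1} (\<lambda>t. integral {0..t} (\<lambda>s. f s x))" if "x \<in> U" for x
    by (intro indefinite_integral_continuous_1 integrable_continuous_real slice that)
  fix x0 and \<epsilon> :: real assume x0: "x0 \<in> U" and "\<epsilon> > 0"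
  obtain e where e: "e > 0" "\<And>t x. t \<in> {0..1} \<Longrightarrow> x \<in> ball x0 e \<Longrightarrow> dist (f t x) (f t x0) < \<epsilon> / 2"
    using uniform_continuity_curried[OF f U x0, of "\<epsilon> / 2"] \<open>\<epsilon> > 0\<close> by (auto simp del: mem_ball)
  show "\<exists>e>0. \<forall>t\<in>{0..1}. \<forall>x\<in>ball x0 e \<inter> U.
      dist (integral {0..t} (\<lambda>s. f s x)) (integral {0..t} (\<lambda>s. f s x0)) < \<epsilon>"
  proof (intro exI[of _ e] conjI ballI e(1))
    fix t x assume t: "t \<in> {0..1::real}" and x: "x \<in> ball x0 e \<inter> U"
    have sub: "{0..t} \<subseteq> {0..1}" using t by auto
    have int: "(\<lambda>s. f s x) integrable_on {0..t}" "(\<lambda>s. f s x0) integrable_on {0..t}"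
      using x x0 by (intro integrable_continuous_real continuous_on_subset[OF slice sub]; simp)+
    have "norm (integral {0..t} (\<lambda>s. f s x - f s x0)) \<le> integral {0..t} (\<lambda>s. \<epsilon> / 2)"
      using e(2) x sub by (intro integral_norm_bound_integral integrable_diff int)
        (auto simp: dist_norm less_imp_le simp del: mem_ball)
    also have "\<dots> < \<epsilon>"
    proof -
      have "t * (\<epsilon> / 2) \<le> 1 * (\<epsilon> / 2)" using t \<open>\<epsilon> > 0\<close> by (intro mult_right_mono) auto
      then show ?thesis using t \<open>\<epsilon> > 0\<close> by simp
    qed
    finally show "dist (integral {0..t} (\<lambda>s. f s x)) (integral {0..t} (\<lambda>s. f s x0)) < \<epsilon>"
      using int by (simp add: dist_norm integral_diff)
  qed
qed

text \<open>Differentiation under the integral sign. Along the constant curve at x,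
  \<open>uniform_linearization\<close> bounds the remainder for all times simultaneously, and
  integration up to \<open>t \<le> 1\<close> preserves the bound.\<close>

lemma jet_on_integral:
  assumes U: "open U"
  shows "jet_on k f U \<Longrightarrow> jet_on k (\<lambda>t x. integral {0..t} (\<lambda>s. f s x)) U"
proof (induction k arbitrary: f)
  case 0
  then show ?case using continuous_on_time_integral[OF U, of f] by simp
next
  case (Suc k)
  obtain g where g: "\<And>t x. t \<in> {0..1} \<Longrightarrow> x \<in> U \<Longrightarrow> has_gradient (f t) (\<lambda>i. g i t x) x"
    "\<And>i. jet_on k (g i) U" using Suc.prems by (rule jet_on_SucE) (rule that)
  note g_cont = jet_on_continuous[OF g(2)]
  have slice: "continuous_on {0..1} (\<lambda>s. F s x)" if "x \<in> U" "cont_family U F"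
    for x and F :: "real \<Rightarrow> real ^ 'a \<Rightarrow> real"
    using continuous_on_compose2[OF that(2), of "{0..1}" "\<lambda>s. (s, x)"] that
    by (auto simp: continuous_on_Pair continuous_on_id image_subset_iff)
  show ?case
  proof (rule jet_on_SucI[OF continuous_on_time_integral[OF U jet_on_continuous[OF Suc.prems]] _ Suc.IH[OF g(2)]])
    fix t x assume t: "t \<in> {0..1::real}" and x: "x \<in> U"
    have sub: "{0..t} \<subseteq> {0..1}" using t by auto
    have f_int: "(\<lambda>s. f s y) integrable_on {0..t}" if "y \<in> U" for y
      by (intro integrable_continuous_real continuous_on_subset[OF slice sub] jet_on_continuous[OF Suc.prems] that)
    have g_int: "(\<lambda>s. g i s x) integrable_on {0..t}" for i
      by (intro integrable_continuous_real continuous_on_subset[OF slice sub] g_cont x)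
    show "has_gradient (\<lambda>x. integral {0..t} (\<lambda>s. f s x)) (\<lambda>i. integral {0..t} (\<lambda>s. g i s x)) x"
      unfolding has_derivative_at_alt
    proof (intro conjI allI impI)
      show "bounded_linear (\<lambda>h. \<Sum>i\<in>UNIV. integral {0..t} (\<lambda>s. g i s x) * h $ i)"
        by (intro bounded_linear_sum bounded_linear_mult_right[THEN bounded_linear_compose] bounded_linear_vec_nth)
      fix \<epsilon> :: real assume "\<epsilon> > 0"
      have D: "cont_family U (\<lambda>s z. \<Sum>i\<in>UNIV. g i s z * h $ i)" for h
        using g_cont by (auto simp: case_prod_beta intro!: continuous_intros)
      obtain d where d: "d > 0" "\<And>(s::real) v. s \<in> {0..1} \<Longrightarrow> norm v < d \<Longrightarrow> x + v \<in> U"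
        "\<And>s v. s \<in> {0..1} \<Longrightarrow> norm v < d \<Longrightarrow>
          norm (f s (x + v) - f s x - (\<Sum>i\<in>UNIV. g i s x * v $ i)) \<le> \<epsilon> * norm v"
        by (rule uniform_linearization[OF U continuous_on_const[of _ x] x g(1) D \<open>\<epsilon> > 0\<close>]) (assumption | rule that)+
      show "\<exists>d>0. \<forall>y. norm (y - x) < d \<longrightarrow> norm (integral {0..t} (\<lambda>s. f s y) - integral {0..t} (\<lambda>s. f s x)
          - (\<Sum>i\<in>UNIV. integral {0..t} (\<lambda>s. g i s x) * (y - x) $ i)) \<le> \<epsilon> * norm (y - x)"
      proof (intro exI[of _ d] conjI allI impI d(1))
        fix y assume y: "norm (y - x) < d"
        have yU: "y \<in> U" using d(2)[of 0 "y - x"] y by simp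
        have e1: "integral {0..t} (\<lambda>s. \<Sum>i\<in>UNIV. g i s x * (y - x) $ i)
            = (\<Sum>i\<in>UNIV. integral {0..t} (\<lambda>s. g i s x) * (y - x) $ i)"
          by (subst integral_sum) (auto intro!: integrable_on_mult_left g_int)
        have i1: "(\<lambda>s. \<Sum>i\<in>UNIV. g i s x * (y - x) $ i) integrable_on {0..t}"
          by (intro integrable_sum integrable_on_mult_left g_int) auto
        have "norm (integral {0..t} (\<lambda>s. f s y - f s x - (\<Sum>i\<in>UNIV. g i s x * (y - x) $ i)))
            \<le> integral {0..t} (\<lambda>s. \<epsilon> * norm (y - x))"
          using d(3)[of _ "y - x"] y sub
          by (intro integral_norm_bound_integral integrable_diff f_int yU x i1) auto
        also have "\<dots> \<le> \<epsilon> * norm (y - x)"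
        proof -
          have "t * (\<epsilon> * norm (y - x)) \<le> 1 * (\<epsilon> * norm (y - x))"
            using t \<open>\<epsilon> > 0\<close> by (intro mult_right_mono) auto
          then show ?thesis using t by (simp add: ac_simps)
        qed
        finally show "norm (integral {0..t} (\<lambda>s. f s y) - integral {0..t} (\<lambda>s. f s x)
          - (\<Sum>i\<in>UNIV. integral {0..t} (\<lambda>s. g i s x) * (y - x) $ i)) \<le> \<epsilon> * norm (y - x)"
          using e1 by (simp add: integral_diff f_int yU x i1 integrable_diff del: vector_minus_component)
      qed
    qed
  qed
qed

text \<open>Induction on the order. The i-th partial derivative of a solution solves a system with
  the same matrix \<open>A\<close> and with a forcing formed from the derivatives of
  \<open>b\<close> and \<open>A\<close> and from \<open>y\<close> itself, all of one order less;
  hence \<open>b\<close> and \<open>y\<close> are generalized in the induction.\<close>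

lemma jet_on_linear_ode:
  fixes A :: "real \<Rightarrow> real ^ 'n \<Rightarrow> real ^ 'm ^ 'm" and b y :: "real \<Rightarrow> real ^ 'n \<Rightarrow> real ^ 'm"
  assumes U: "open U"
    and "\<And>j l. jet_on k (\<lambda>t x. A t x $ j $ l) U" and "\<And>j. jet_on k (\<lambda>t x. b t x $ j) U"
    and "\<And>x. x \<in> U \<Longrightarrow> continuous_on {0..1} (\<lambda>t. y t x)"
    and "\<And>t x. t \<in> {0..1} \<Longrightarrow> x \<in> U \<Longrightarrow> y t x = b t x + integral {0..t} (\<lambda>s. A s x *v y s x)"
  shows "jet_on k (\<lambda>t x. y t x $ j) U"
  using assms(2-)
proof (induction k arbitrary: b y j)
  have mat_cont: "cont_family U (\<lambda>t x. A t x *v v t x)"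
    if "\<And>j l. jet_on k (\<lambda>t x. A t x $ j $ l) U" "cont_family U v"
    for k A and v :: "real \<Rightarrow> real ^ 'n \<Rightarrow> real ^ 'm"
    using continuous_on_matrix_vector_mult[of "{0..1} \<times> U" "\<lambda>p. A (fst p) (snd p)" "\<lambda>p. v (fst p) (snd p)"]
      jet_on_continuous[OF that(1)] that(2) by (simp add: case_prod_beta)
  have vec_cont: "cont_family U v" if "\<And>j. jet_on k (\<lambda>t x. v t x $ j) U"
    for k and v :: "real \<Rightarrow> real ^ 'n \<Rightarrow> real ^ 'm"
    using jet_on_continuous[OF that] by (intro continuous_on_vecI) (auto simp: case_prod_beta)
  have slice: "continuous_on {0..1} (\<lambda>s. F s x)" if "x \<in> U" "cont_family U F"
    for x and F :: "real \<Rightarrow> real ^ 'n \<Rightarrow> 'z::topological_space"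
    using continuous_on_compose2[OF that(2), of "{0..1}" "\<lambda>s. (s, x)"] that
    by (auto simp: continuous_on_Pair continuous_on_id image_subset_iff)
  have Ay_slice: "continuous_on {0..1} (\<lambda>s. A s x *v v s)"
    if "\<And>j l. jet_on k (\<lambda>t x. A t x $ j $ l) U" "x \<in> U" "continuous_on {0..1} v" for k A x and v :: "real \<Rightarrow> real ^ 'm"
  proof -
    have "continuous_on {0..1} (\<lambda>s. A s x $ j $ l)" for j l
      using slice[OF that(2) jet_on_continuous[OF that(1)]] .
    then show ?thesis using that(3) by (rule continuous_on_matrix_vector_mult)
  qed
  have A_bound: "\<exists>L>0. \<forall>t\<in>{0..1}. \<forall>x\<in>K. \<forall>v. norm (A t x *v v) \<le> L * norm v"
    if "\<And>j l. jet_on k (\<lambda>t x. A t x $ j $ l) U" "compact K" "K \<subseteq> U" for k K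
  proof -
    have c: "cont_family K (\<lambda>t x. A t x *v h)" for h
      by (rule continuous_on_subset[OF mat_cont[OF that(1) vec_cont[OF jet_on_time]]]) (use that(3) in auto)
    obtain L where "L > 0" "\<And>t x h. t \<in> {0..1} \<Longrightarrow> x \<in> K \<Longrightarrow> norm (A t x *v h) \<le> L * norm h"
      by (rule linear_uniform_bound[OF \<open>compact K\<close> c matrix_vector_mul_linear]) (assumption | rule that)+
    then show ?thesis by blast
  qed
  \<comment> \<open>The difference of two solutions solves the equation at x up to the error
    \<open>(A t x - A t x0) *v y t x0\<close>, which is small uniformly in time.\<close>
  { case 0
    have A: "\<And>j l. jet_on 0 (\<lambda>t x. A t x $ j $ l) U" and b: "\<And>j. jet_on 0 (\<lambda>t x. b t x $ j) U" by fact+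
    have "cont_family U y"
    proof (rule joint_continuousI[OF U 0(3)])
      fix x0 and \<epsilon> :: real assume x0: "x0 \<in> U" and "\<epsilon> > 0"
      obtain r where r: "r > 0" "cball x0 r \<subseteq> U" using U x0 open_contains_cball by blast
      obtain L where L: "L > 0" "\<And>t x v. t \<in> {0..1} \<Longrightarrow> x \<in> cball x0 r \<Longrightarrow> norm (A t x *v v) \<le> L * norm v"
        using A_bound[OF A compact_cball r(2)] by blast
      define \<eta> where "\<eta> = \<epsilon> / (5 * exp (2 * L))"
      have \<eta>: "\<eta> > 0" "4 * \<eta> * exp (2 * L) < \<epsilon>" using \<open>\<epsilon> > 0\<close> by (auto simp: \<eta>_def field_simps)
      obtain e1 where e1: "e1 > 0" "\<And>t x. t \<in> {0..1} \<Longrightarrow> x \<in> ball x0 e1 \<Longrightarrow> dist (b t x) (b t x0) < \<eta>"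
        using uniform_continuity_curried[OF vec_cont[OF b] U x0 \<eta>(1)] by blast
      have "cont_family U (\<lambda>t x. y t x0)"
        using continuous_on_compose2[OF 0(3)[OF x0] continuous_on_fst[OF continuous_on_id], of "{0..1} \<times> U"]
        by (auto simp: case_prod_beta)
      from mat_cont[OF A this] obtain e2 where e2: "e2 > 0" "\<And>t x. t \<in> {0..1} \<Longrightarrow> x \<in> ball x0 e2 \<Longrightarrow>
          dist (A t x *v y t x0) (A t x0 *v y t x0) < \<eta>"
        using uniform_continuity_curried[OF _ U x0 \<eta>(1), of "\<lambda>t x. A t x *v y t x0"] by blast
      show "\<exists>e>0. \<forall>t\<in>{0..1}. \<forall>x\<in>ball x0 e \<inter> U. dist (y t x) (y t x0) < \<epsilon>"
      proof (intro exI[of _ "min r (min e1 e2)"] conjI ballI)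
        fix t x assume t: "t \<in> {0..1::real}" and "x \<in> ball x0 (min r (min e1 e2)) \<inter> U"
        then have x: "x \<in> cball x0 r" "x \<in> ball x0 e1" "x \<in> ball x0 e2" "x \<in> U" by auto
        have "norm (y t x - y t x0) \<le> 2 * (\<eta> + \<eta>) * exp (2 * L)"
        proof (rule gronwall_norm[where f="\<lambda>s. A s x *v y s x - A s x0 *v y s x0" and c="\<lambda>t. b t x - b t x0"])
          show c: "continuous_on {0..1} (\<lambda>t. y t x - y t x0)"
            "continuous_on {0..1} (\<lambda>s. A s x *v y s x - A s x0 *v y s x0)"
            by (intro continuous_intros 0(3) Ay_slice[OF A] x x0)+
          fix t :: real assume t: "t \<in> {0..1}"
          have i: "(\<lambda>s. A s z *v y s z) integrable_on {0..t}" if "z \<in> U" for z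
            using t by (intro integrable_continuous_real continuous_on_subset[OF Ay_slice[OF A that 0(3)[OF that]]]) auto
          show "y t x - y t x0 = b t x - b t x0 + integral {0..t} (\<lambda>s. A s x *v y s x - A s x0 *v y s x0)"
            unfolding 0(4)[OF t x(4)] 0(4)[OF t x0] by (simp add: integral_diff i x x0)
          show "norm (b t x - b t x0) \<le> \<eta>" using e1(2)[OF t x(2)] by (simp add: dist_norm)
          have "A t x *v y t x - A t x0 *v y t x0 = A t x *v (y t x - y t x0) + (A t x *v y t x0 - A t x0 *v y t x0)"
            by (simp add: matrix_vector_mult_diff_distrib)
          also have "norm \<dots> \<le> L * norm (y t x - y t x0) + \<eta>"
            using L(2)[OF t x(1)] e2(2)[OF t x(3)] by (intro norm_triangle_mono) (auto simp: dist_norm)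
          finally show "norm (A t x *v y t x - A t x0 *v y t x0) \<le> L * norm (y t x - y t x0) + \<eta>" .
        qed (use L \<eta> t in auto)
        then show "dist (y t x) (y t x0) < \<epsilon>" using \<eta> by (simp add: dist_norm)
      qed (use r e1 e2 in auto)
    qed
    then show ?case by (auto simp: case_prod_beta intro!: continuous_intros)
  next
    case (Suc k)
    have A: "\<And>j l. jet_on k (\<lambda>t x. A t x $ j $ l) U" and b: "\<And>j. jet_on k (\<lambda>t x. b t x $ j) U"
      using Suc.prems(1,2) jet_on_Suc_D by blast+
    note y = Suc.prems(3)
    note y_eq = Suc.prems(4)
    have y_jet: "jet_on k (\<lambda>t x. y t x $ j) U" for j by (rule Suc.IH[OF A b y y_eq])
    note y_cont = vec_cont[OF y_jet]
    let ?D = "\<lambda>f g. (\<forall>t\<in>{0..1}. \<forall>x\<in>U. has_gradient (f t) (\<lambda>i. g i t x) x) \<and> (\<forall>i. jet_on k (g i) U)"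
    have "\<forall>p. \<exists>g. ?D (\<lambda>t x. A t x $ fst p $ snd p) g" using Suc.prems(1) unfolding jet_on.simps by blast
    from choice[OF this] obtain A0 where "\<forall>p. ?D (\<lambda>t x. A t x $ fst p $ snd p) (A0 p)" ..
    then have A0: "\<And>j l t x. t \<in> {0..1} \<Longrightarrow> x \<in> U \<Longrightarrow> has_gradient (\<lambda>x. A t x $ j $ l) (\<lambda>i. A0 (j, l) i t x) x"
      "\<And>j l i. jet_on k (A0 (j, l) i) U" by auto
    have "\<forall>j. \<exists>g. ?D (\<lambda>t x. b t x $ j) g" using Suc.prems(2) unfolding jet_on.simps by blast
    from choice[OF this] obtain b0 where "\<forall>j. ?D (\<lambda>t x. b t x $ j) (b0 j)" ..
    then have b0: "\<And>j t x. t \<in> {0..1} \<Longrightarrow> x \<in> U \<Longrightarrow> has_gradient (\<lambda>x. b t x $ j) (\<lambda>i. b0 j i t x) x"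
      "\<And>j i. jet_on k (b0 j i) U" by auto
    define A' where "A' = (\<lambda>i t x. \<chi> j l. A0 (j, l) i t x)"
    define b' where "b' = (\<lambda>i t x. \<chi> j. b0 j i t x)"
    have A'_jet: "jet_on k (\<lambda>t x. A' i t x $ j $ l) U" for i j l using A0(2) by (simp add: A'_def)
    have b'_jet: "jet_on k (\<lambda>t x. b' i t x $ j) U" for i j using b0(2) by (simp add: b'_def)
    have A'y_jet: "jet_on k (\<lambda>t x. (A' i t x *v y t x) $ j) U" for i j
      unfolding matrix_vector_mult_def vec_lambda_beta
      by (intro jet_on_sum jet_on_mult A'_jet y_jet)
    note A'y_cont = vec_cont[OF A'y_jet]
    \<comment> \<open>Inhomogeneity of the equation for the i-th partial derivative: the equation of
      \<open>y\<close> is differentiated formally, and the term in which \<open>y\<close> itself is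
      differentiated becomes the unknown.\<close>
    define c where "c = (\<lambda>i t x. b' i t x + integral {0..t} (\<lambda>s. A' i s x *v y s x))"
    have int_nth: "integral {0..t} (\<lambda>s. A' i s x *v y s x) $ j = integral {0..t} (\<lambda>s. (A' i s x *v y s x) $ j)"
      if "t \<in> {0..1}" "x \<in> U" for i t x j
      using that by (intro integral_component_eq_cart[symmetric] integrable_continuous_real
          continuous_on_subset[OF slice[OF that(2) A'y_cont]]) auto
    have c_jet: "jet_on k (\<lambda>t x. c i t x $ j) U" for i j
    proof (rule jet_on_cong[OF U])
      show "jet_on k (\<lambda>t x. b' i t x $ j + integral {0..t} (\<lambda>s. (A' i s x *v y s x) $ j)) U"
        by (intro jet_on_add b'_jet jet_on_integral[OF U] A'y_jet)
    qed (simp add: c_def int_nth)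
    have "\<exists>z. continuous_on {0..1} z \<and> (\<forall>t\<in>{0..1}. z t = c i t x + integral {0..t} (\<lambda>s. A s x *v z s))"
      if x: "x \<in> U" for i x
    proof -
      obtain L where L: "L > 0" "\<And>t v. t \<in> {0..1} \<Longrightarrow> norm (A t x *v v) \<le> L * norm v"
        using A_bound[OF A compact_sing[of x]] x by auto
      have c1: "cont_family UNIV (\<lambda>s v. A s x *v v)"
      proof -
        have "continuous_on ({0..1} \<times> (UNIV :: (real ^ 'm) set)) (\<lambda>p. A (fst p) x $ j $ l)" for j l
          by (rule continuous_on_compose2[OF slice[OF x jet_on_continuous[OF A]] continuous_on_fst[OF continuous_on_id]]) auto
        from continuous_on_matrix_vector_mult[OF this continuous_on_snd[OF continuous_on_id]]
        show ?thesis by (simp add: case_prod_beta)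
      qed
      have lip: "norm (A t x *v v - A t x *v w) \<le> L * norm (v - w)" if "t \<in> {0..1}" for t v w
        using L(2)[OF that, of "v - w"] by (simp add: matrix_vector_mult_diff_distrib)
      obtain z where "continuous_on {0..1} z" "\<And>t. t \<in> {0..1} \<Longrightarrow> z t = c i t x + integral {0..t} (\<lambda>s. A s x *v z s)"
        by (rule picard_exists[OF c1 L(1) lip slice[OF x vec_cont[OF c_jet]]]) (assumption | rule that)+
      then show ?thesis by blast
    qed
    then have "\<forall>p. \<exists>z. snd p \<in> U \<longrightarrow> continuous_on {0..1} z \<and>
        (\<forall>t\<in>{0..1}. z t = c (fst p) t (snd p) + integral {0..t} (\<lambda>s. A s (snd p) *v z s))" by blast
    from choice[OF this] obtain z0 where z0: "\<forall>p. snd p \<in> U \<longrightarrow> continuous_on {0..1} (z0 p) \<and>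
        (\<forall>t\<in>{0..1}. z0 p t = c (fst p) t (snd p) + integral {0..t} (\<lambda>s. A s (snd p) *v z0 p s))" ..
    define z where "z = (\<lambda>i t x. z0 (i, x) t)"
    have z: "\<And>i x. x \<in> U \<Longrightarrow> continuous_on {0..1} (\<lambda>t. z i t x)"
      "\<And>i t x. t \<in> {0..1} \<Longrightarrow> x \<in> U \<Longrightarrow> z i t x = c i t x + integral {0..t} (\<lambda>s. A s x *v z i s x)"
      using z0 by (auto simp: z_def)
    have z_jet: "jet_on k (\<lambda>t x. z i t x $ j) U" for i j by (rule Suc.IH[OF A c_jet z])
    note z_cont = vec_cont[OF z_jet]
    have A_deriv: "((\<lambda>x. A s x *v v) has_derivative (\<lambda>h. \<Sum>i\<in>UNIV. h $ i *\<^sub>R (A' i s x *v v))) (at x)"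
      if "s \<in> {0..1}" "x \<in> U" for s x v
    proof (rule has_derivative_vec_nthI)
      fix j
      have "((\<lambda>x. \<Sum>l\<in>UNIV. A s x $ j $ l * v $ l) has_derivative
          (\<lambda>h. \<Sum>l\<in>UNIV. (\<Sum>i\<in>UNIV. A0 (j, l) i s x * h $ i) * v $ l)) (at x)"
        by (intro has_derivative_sum has_derivative_mult_left A0(1) that)
      moreover have "(\<Sum>l\<in>UNIV. (\<Sum>i\<in>UNIV. A0 (j, l) i s x * h $ i) * v $ l)
          = (\<Sum>i\<in>UNIV. h $ i *\<^sub>R (A' i s x *v v)) $ j" for h
        by (simp add: A'_def matrix_vector_mult_def sum_component sum_distrib_left sum_distrib_right mult_ac)
           (rule sum.swap)
      ultimately show "((\<lambda>x. (A s x *v v) $ j) has_derivative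
          (\<lambda>h. (\<Sum>i\<in>UNIV. h $ i *\<^sub>R (A' i s x *v v)) $ j)) (at x)"
        by (simp add: matrix_vector_mult_def)
    qed
    have b_deriv: "(b s has_derivative (\<lambda>h. \<Sum>i\<in>UNIV. h $ i *\<^sub>R b' i s x)) (at x)"
      if "s \<in> {0..1}" "x \<in> U" for s x
      by (rule has_derivative_vec_nthI) (use b0(1)[OF that] in \<open>simp add: b'_def sum_component mult.commute\<close>)
    have key: "\<exists>\<delta>>0. \<forall>t\<in>{0..1}. \<forall>h. norm h < \<delta> \<longrightarrow>
        norm (y t (x + h) - y t x - (\<Sum>i\<in>UNIV. h $ i *\<^sub>R z i t x)) \<le> \<epsilon> * norm h"
      if x: "x \<in> U" and "\<epsilon> > 0" for x and \<epsilon> :: real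
    proof -
      obtain L where L: "L > 0" "\<And>t v. t \<in> {0..1} \<Longrightarrow> norm (A t x *v v) \<le> L * norm v"
        using A_bound[OF A compact_sing[of x]] x by auto
      have c': "continuous_on ({0..1} \<times> {x}) (\<lambda>(t, x). \<Sum>i\<in>UNIV. h $ i *\<^sub>R b' i t x)"
        "continuous_on ({0..1} \<times> {x}) (\<lambda>(t, x). \<Sum>i\<in>UNIV. h $ i *\<^sub>R (A' i t x *v y t x))" for h
        using continuous_on_subset[OF vec_cont[OF b'_jet], of "{0..1} \<times> {x}"]
          continuous_on_subset[OF A'y_cont, of "{0..1} \<times> {x}"] x
        by (auto simp: case_prod_beta intro!: continuous_intros)
      have lin: "linear (\<lambda>h. \<Sum>i\<in>UNIV. h $ i *\<^sub>R (v i :: real ^ 'm))" for v :: "'n \<Rightarrow> real ^ 'm"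
        by (rule linearI) (simp_all add: sum.distrib scaleR_add_left scaleR_sum_right)
      obtain M1 where M1: "M1 > 0" "\<And>t z h. t \<in> {0..1} \<Longrightarrow> z \<in> {x} \<Longrightarrow>
          norm (\<Sum>i\<in>UNIV. h $ i *\<^sub>R b' i t z) \<le> M1 * norm h"
        by (rule linear_uniform_bound[OF compact_sing[of x] c'(1) lin]) (assumption | rule that)+
      obtain M2 where M2: "M2 > 0" "\<And>t z h. t \<in> {0..1} \<Longrightarrow> z \<in> {x} \<Longrightarrow>
          norm (\<Sum>i\<in>UNIV. h $ i *\<^sub>R (A' i t z *v y t z)) \<le> M2 * norm h"
        by (rule linear_uniform_bound[OF compact_sing[of x] c'(2) lin]) (assumption | rule that)+
      define M where "M = max L (max M1 M2)"
      have M: "L \<le> M" "M1 \<le> M" "M2 \<le> M" by (auto simp: M_def)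
      show ?thesis
      proof (rule ode_parameter_derivative[where U=U and F="\<lambda>s x v. A s x *v v" and c=b and M=M
            and c'="\<lambda>t h. \<Sum>i\<in>UNIV. h $ i *\<^sub>R b' i t x" and Dy="\<lambda>s v. A s x *v v"
            and Dx="\<lambda>s h. \<Sum>i\<in>UNIV. h $ i *\<^sub>R (A' i s x *v y s x)"])
        fix x' assume x': "x' \<in> U"
        show "continuous_on {0..1} (\<lambda>t. y t x')" "continuous_on {0..1} (\<lambda>s. A s x' *v y s x')"
          by (rule y[OF x'] Ay_slice[OF A x' y[OF x']])+
      next
        fix x' and t :: real assume "x' \<in> U" "t \<in> {0..1}"
        then show "y t x' = b t x' + integral {0..t} (\<lambda>s. A s x' *v y s x')" by (intro y_eq)
      next
        fix \<epsilon> :: real assume "\<epsilon> > 0"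
        have Db: "cont_family U (\<lambda>s z. \<Sum>i\<in>UNIV. h $ i *\<^sub>R b' i s z)" for h
          using vec_cont[OF b'_jet] by (auto simp: case_prod_beta intro!: continuous_intros)
        obtain d where "d > 0" "\<And>s v. s \<in> {0..1} \<Longrightarrow> norm v < d \<Longrightarrow>
            norm (b s (x + v) - b s x - (\<Sum>i\<in>UNIV. v $ i *\<^sub>R b' i s x)) \<le> \<epsilon> * norm v"
          by (rule uniform_linearization[OF U continuous_on_const[of _ x] x b_deriv Db \<open>\<epsilon> > 0\<close>]) (assumption | rule that)+
        then show "\<exists>\<delta>>0. \<forall>t\<in>{0..1}. \<forall>h. norm h < \<delta> \<longrightarrow>
            norm (b t (x + h) - b t x - (\<Sum>i\<in>UNIV. h $ i *\<^sub>R b' i t x)) \<le> \<epsilon> * norm h" by blast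
        have DA: "cont_family U (\<lambda>s z. \<Sum>i\<in>UNIV. h $ i *\<^sub>R (A' i s z *v y s x))" for h
        proof -
          have "cont_family U (\<lambda>t z. y t x)"
            using continuous_on_compose2[OF y[OF x] continuous_on_fst[OF continuous_on_id], of "{0..1} \<times> U"]
            by (auto simp: case_prod_beta)
          from mat_cont[OF A'_jet this] show ?thesis
            by (auto simp: case_prod_beta intro!: continuous_intros)
        qed
        obtain d1 where d1: "d1 > 0" "\<And>s v. s \<in> {0..1} \<Longrightarrow> norm v < d1 \<Longrightarrow>
            norm (A s (x + v) *v y s x - A s x *v y s x - (\<Sum>i\<in>UNIV. v $ i *\<^sub>R (A' i s x *v y s x))) \<le> \<epsilon> * norm v"
          by (rule uniform_linearization[OF U continuous_on_const[of _ x] x A_deriv DA \<open>\<epsilon> > 0\<close>]) (assumption | rule that)+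
        have "cont_family U A"
          using jet_on_continuous[OF A] by (intro continuous_on_vecI) (auto simp: case_prod_beta)
        \<comment> \<open>The operator norm of a matrix is at most the number of its entries times a
          bound on the entries.\<close>
        moreover define \<eta> where "\<eta> = \<epsilon> / (CARD('m) * CARD('m))"
        moreover have \<eta>: "\<eta> > 0" using \<open>\<epsilon> > 0\<close> by (simp add: \<eta>_def)
        ultimately obtain d2 where d2: "d2 > 0" "\<And>t z. t \<in> {0..1} \<Longrightarrow> z \<in> ball x d2 \<Longrightarrow> dist (A t z) (A t x) < \<eta>"
          using uniform_continuity_curried[OF _ U x, of "\<lambda>t x. A t x" \<eta>] by blast
        show "\<exists>\<delta>>0. \<forall>s\<in>{0..1}. \<forall>h. norm h < \<delta> \<longrightarrow>
          norm (A s (x + h) *v y s (x + h) - A s x *v y s x - (\<Sum>i\<in>UNIV. h $ i *\<^sub>R (A' i s x *v y s x))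
            - A s x *v (y s (x + h) - y s x)) \<le> \<epsilon> * (norm h + norm (y s (x + h) - y s x))"
        proof (intro exI[of _ "min d1 d2"] conjI ballI allI impI)
          fix s and h :: "real ^ 'n" assume s: "s \<in> {0..1::real}" and h: "norm h < min d1 d2"
          let ?k = "y s (x + h) - y s x"
          have "\<bar>(A s (x + h) - A s x) $ i $ j\<bar> \<le> \<eta>" for i j
          proof -
            have "norm (A s (x + h) - A s x) < \<eta>" using d2(2)[OF s, of "x + h"] h by (simp add: dist_norm)
            then show ?thesis
              using component_le_norm_cart[of "(A s (x + h) - A s x) $ i" j]
                Finite_Cartesian_Product.norm_nth_le[of "A s (x + h) - A s x" i] by linarith
          qed
          from onorm_le_matrix_component[OF this] have "onorm ((*v) (A s (x + h) - A s x)) \<le> \<epsilon>"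
            by (simp add: \<eta>_def)
          then have k_le: "norm ((A s (x + h) - A s x) *v ?k) \<le> \<epsilon> * norm ?k"
            using onorm[OF matrix_vector_mul_bounded_linear, of "A s (x + h) - A s x" ?k]
            by (meson mult_right_mono norm_ge_zero order_trans)
          \<comment> \<open>The increment is taken in two stages: \<open>A\<close> varies against
            the fixed vector \<open>y s x\<close>, and the mixed term is the small increment of
            \<open>A\<close> applied to the increment of \<open>y\<close>.\<close>
          have split: "A s (x + h) *v y s (x + h) - A s x *v y s x - (\<Sum>i\<in>UNIV. h $ i *\<^sub>R (A' i s x *v y s x))
            - A s x *v ?k = (A s (x + h) *v y s x - A s x *v y s x - (\<Sum>i\<in>UNIV. h $ i *\<^sub>R (A' i s x *v y s x)))
              + (A s (x + h) - A s x) *v ?k"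
            by (simp add: matrix_vector_mult_diff_distrib matrix_vector_mult_diff_rdistrib)
          show "norm (A s (x + h) *v y s (x + h) - A s x *v y s x
              - (\<Sum>i\<in>UNIV. h $ i *\<^sub>R (A' i s x *v y s x)) - A s x *v ?k) \<le> \<epsilon> * (norm h + norm ?k)"
            unfolding split distrib_left using d1(2)[OF s, of h] h k_le by (intro norm_triangle_mono) auto
        qed (use d1 d2 in auto)
      next
        fix s h assume s: "s \<in> {0..1::real}"
        show "norm (\<Sum>i\<in>UNIV. h $ i *\<^sub>R b' i s x) \<le> M * norm h"
          using M1(2)[OF s singletonI, of h] mult_right_mono[OF M(2), of "norm h"] by simp
        show "norm (\<Sum>i\<in>UNIV. h $ i *\<^sub>R (A' i s x *v y s x)) \<le> M * norm h"
          using M2(2)[OF s singletonI, of h] mult_right_mono[OF M(3), of "norm h"] by simp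
      next
        fix s and v w :: "real ^ 'm" assume s: "s \<in> {0..1::real}"
        show "norm (A s x *v v) \<le> M * norm v"
          using L(2)[OF s, of v] mult_right_mono[OF M(1), of "norm v"] by simp
        show "A s x *v (v - w) = A s x *v v - A s x *v w" by (simp add: matrix_vector_mult_diff_distrib)
      next
        fix h :: "real ^ 'n"
        show "continuous_on {0..1} (\<lambda>t. \<Sum>i\<in>UNIV. h $ i *\<^sub>R z i t x)"
          by (intro continuous_intros z x)
        then show "continuous_on {0..1} (\<lambda>s. (\<Sum>i\<in>UNIV. h $ i *\<^sub>R (A' i s x *v y s x)) + A s x *v (\<Sum>i\<in>UNIV. h $ i *\<^sub>R z i s x))"
          by (intro continuous_on_add continuous_on_sum continuous_on_scaleR continuous_on_const
                Ay_slice[OF A x] slice[OF x A'y_cont] z(1)[OF x])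
      next
        fix t and h :: "real ^ 'n" assume t: "t \<in> {0..1::real}"
        have i1: "(\<lambda>s. A' i s x *v y s x) integrable_on {0..t}" for i
          using t by (intro integrable_continuous_real continuous_on_subset[OF slice[OF x A'y_cont]]) auto
        have i2: "(\<lambda>s. A s x *v z i s x) integrable_on {0..t}" for i
          using t by (intro integrable_continuous_real continuous_on_subset[OF Ay_slice[OF A x z(1)[OF x]]]) auto
        have "(\<Sum>i\<in>UNIV. h $ i *\<^sub>R z i t x) = (\<Sum>i\<in>UNIV. h $ i *\<^sub>R b' i t x)
            + (\<Sum>i\<in>UNIV. h $ i *\<^sub>R integral {0..t} (\<lambda>s. A' i s x *v y s x + A s x *v z i s x))"
          using z(2)[OF t x] by (simp add: c_def integral_add i1 i2 scaleR_add_right sum.distrib)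
        also have "(\<Sum>i\<in>UNIV. h $ i *\<^sub>R integral {0..t} (\<lambda>s. A' i s x *v y s x + A s x *v z i s x))
            = integral {0..t} (\<lambda>s. \<Sum>i\<in>UNIV. h $ i *\<^sub>R (A' i s x *v y s x + A s x *v z i s x))"
          by (subst integral_sum) (auto intro!: integrable_cmul integrable_add i1 i2)
        also have "(\<lambda>s. \<Sum>i\<in>UNIV. h $ i *\<^sub>R (A' i s x *v y s x + A s x *v z i s x))
            = (\<lambda>s. (\<Sum>i\<in>UNIV. h $ i *\<^sub>R (A' i s x *v y s x)) + A s x *v (\<Sum>i\<in>UNIV. h $ i *\<^sub>R z i s x))"
          by (simp add: scaleR_add_right sum.distrib linear_sum[OF matrix_vector_mul_linear]
              linear_scale[OF matrix_vector_mul_linear])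
        finally show "(\<Sum>i\<in>UNIV. h $ i *\<^sub>R z i t x) = (\<Sum>i\<in>UNIV. h $ i *\<^sub>R b' i t x) + integral {0..t}
          (\<lambda>s. (\<Sum>i\<in>UNIV. h $ i *\<^sub>R (A' i s x *v y s x)) + A s x *v (\<Sum>i\<in>UNIV. h $ i *\<^sub>R z i s x))" .
      qed (use U x \<open>\<epsilon> > 0\<close> in auto)
    qed
    have y_deriv: "(y t has_derivative (\<lambda>h. \<Sum>i\<in>UNIV. h $ i *\<^sub>R z i t x)) (at x)" if t: "t \<in> {0..1}" and x: "x \<in> U" for t x
      unfolding has_derivative_at_alt
    proof (intro conjI allI impI)
      show "bounded_linear (\<lambda>h. \<Sum>i\<in>UNIV. h $ i *\<^sub>R z i t x)"
        by (intro bounded_linear_sum bounded_linear_scaleR_left[THEN bounded_linear_compose] bounded_linear_vec_nth)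
      fix \<epsilon> :: real assume "\<epsilon> > 0"
      obtain \<delta> where \<delta>: "\<delta> > 0" "\<And>h. norm h < \<delta> \<Longrightarrow>
          norm (y t (x + h) - y t x - (\<Sum>i\<in>UNIV. h $ i *\<^sub>R z i t x)) \<le> \<epsilon> * norm h"
        using key[OF x \<open>\<epsilon> > 0\<close>] t by blast
      show "\<exists>d>0. \<forall>x'. norm (x' - x) < d \<longrightarrow>
          norm (y t x' - y t x - (\<Sum>i\<in>UNIV. (x' - x) $ i *\<^sub>R z i t x)) \<le> \<epsilon> * norm (x' - x)"
      proof (intro exI[of _ \<delta>] conjI allI impI \<delta>(1))
        fix x' assume "norm (x' - x) < \<delta>"
        from \<delta>(2)[OF this] show "norm (y t x' - y t x - (\<Sum>i\<in>UNIV. (x' - x) $ i *\<^sub>R z i t x)) \<le> \<epsilon> * norm (x' - x)"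
          by (simp del: vector_minus_component)
      qed
    qed
    have "has_gradient (\<lambda>x. y t x $ j) (\<lambda>i. z i t x $ j) x"
      if "t \<in> {0..1}" "x \<in> U" for t x j
      using bounded_linear.has_derivative[OF bounded_linear_vec_nth y_deriv[OF that], of j]
      by (simp add: sum_component mult.commute)
    then show ?case
      by (rule jet_on_SucI[OF jet_on_continuous[OF y_jet] _ z_jet])
  }
qed

text \<open>The definition allows a different gradient for each order. On an open set gradients are
  unique, so the one obtained for order 1 has every order.\<close>

lemma jet_on_all_derivative:
  assumes U: "open U" and f: "\<And>k. jet_on k f U"
  obtains g where "\<And>t x. t \<in> {0..1} \<Longrightarrow> x \<in> U \<Longrightarrow> has_gradient (f t) (\<lambda>i. g i t x) x"
    and "\<And>i k. jet_on k (g i) U"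
proof -
  obtain g where g: "\<And>t x. t \<in> {0..1} \<Longrightarrow> x \<in> U \<Longrightarrow> has_gradient (f t) (\<lambda>i. g i t x) x"
    "\<And>i. jet_on 0 (g i) U" using f[of "Suc 0"] by (rule jet_on_SucE) (rule that)
  have "jet_on k (g i) U" for i k
  proof -
    obtain g' where g': "\<And>t x. t \<in> {0..1} \<Longrightarrow> x \<in> U \<Longrightarrow> has_gradient (f t) (\<lambda>i. g' i t x) x"
      "\<And>i. jet_on k (g' i) U" using f[of "Suc k"] by (rule jet_on_SucE) (rule that)
    show ?thesis
    proof (rule jet_on_cong[OF U _ g'(2)])
      fix t x assume "t \<in> {0..1::real}" "x \<in> U"
      then have "(\<lambda>h. \<Sum>i\<in>UNIV. g' i t x * h $ i) = (\<lambda>h. \<Sum>i\<in>UNIV. g i t x * h $ i)"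
        using g g' by (intro has_derivative_unique[of "f t" _ x])
      from fun_cong[OF this, of "axis i 1"] show "g' i t x = g i t x"
        by (simp add: axis_def if_distrib[of "\<lambda>c. _ * c"] cong: if_cong)
    qed
  qed
  with g(1) show ?thesis by (rule that)
qed

text \<open>Bootstrap: when the flow has order k, so have the coefficients of the variational
  equation along it, hence its solutions \<open>Z\<close>, which are the partial derivatives of the
  flow; so the flow has order \<open>Suc k\<close>.\<close>

lemma jet_on_flow:
  fixes X \<phi> :: "real \<Rightarrow> real ^ 'n \<Rightarrow> real ^ 'n"
  assumes U: "open U" and X: "\<And>j k. jet_on k (\<lambda>t x. X t x $ j) V"
    and X': "\<And>t x j. t \<in> {0..1} \<Longrightarrow> x \<in> V \<Longrightarrow> has_gradient (\<lambda>x. X t x $ j) (\<lambda>i. g j i t x) x"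
    and g: "\<And>i j k. jet_on k (g j i) V"
    and \<phi>: "cont_family U \<phi>" "\<And>t x. t \<in> {0..1} \<Longrightarrow> x \<in> U \<Longrightarrow> \<phi> t x \<in> V"
    and \<phi>': "\<And>t x. t \<in> {0..1} \<Longrightarrow> x \<in> U \<Longrightarrow> (\<phi> t has_derivative Z t x) (at x)"
    and Z: "\<And>x h. x \<in> U \<Longrightarrow> continuous_on {0..1} (\<lambda>t. Z t x h)"
      "\<And>t x h. t \<in> {0..1} \<Longrightarrow> x \<in> U \<Longrightarrow>
        Z t x h = h + integral {0..t} (\<lambda>s. (\<chi> j l. g j l s (\<phi> s x)) *v Z s x h)"
  shows "jet_on k (\<lambda>t x. \<phi> t x $ j) U"
proof (induction k arbitrary: j)
  case 0
  show ?case using continuous_on_component[OF \<phi>(1)] by (simp add: case_prod_beta)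
next
  case (Suc k)
  show ?case
  proof (rule jet_on_SucI[where g="\<lambda>i t x. Z t x (axis i 1) $ j"])
    show "cont_family U (\<lambda>t x. \<phi> t x $ j)" by (rule jet_on_continuous[OF Suc])
    show "has_gradient (\<lambda>x. \<phi> t x $ j) (\<lambda>i. Z t x (axis i 1) $ j) x"
      if "t \<in> {0..1}" "x \<in> U" for t x
    proof -
      have lin: "linear (Z t x)" using \<phi>'[OF that] has_derivative_linear by blast
      have "Z t x h $ j = (\<Sum>i\<in>UNIV. Z t x (axis i 1) $ j * h $ i)" for h
      proof -
        have "Z t x h = Z t x (\<Sum>i\<in>UNIV. h $ i *\<^sub>R axis i 1)"
          using basis_expansion[of h] by (simp add: scalar_mult_eq_scaleR)
        then show ?thesis
          by (simp add: linear_sum[OF lin] linear_scale[OF lin] sum_component mult.commute)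
      qed
      then have eq: "(\<lambda>h. Z t x h $ j) = (\<lambda>h. \<Sum>i\<in>UNIV. Z t x (axis i 1) $ j * h $ i)" by blast
      show ?thesis unfolding eq[symmetric]
        by (rule bounded_linear.has_derivative[OF bounded_linear_vec_nth \<phi>'[OF that]])
    qed
    fix i show "jet_on k (\<lambda>t x. Z t x (axis i 1) $ j) U"
    proof (rule jet_on_linear_ode[OF U _ _ Z])
      show "jet_on k (\<lambda>t x. (\<chi> j l. g j l t (\<phi> t x)) $ j $ l) U" for j l
        using jet_on_compose[OF g Suc \<phi>(2)] by simp
      show "jet_on k (\<lambda>t x. axis i 1 $ j) U" for j :: 'n by (rule jet_on_time) simp
    qed
  qed
qed

section \<open>Holomorphic families of functions\<close>

text \<open>
  Real-analytic germs are treated through their holomorphic extensions. Joint continuity together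
  with holomorphy in each variable separately is preserved by all constructions below and implies
  complex differentiability.
\<close>

definition hol_family :: "real \<Rightarrow> (real \<Rightarrow> complex ^ 'n \<Rightarrow> complex) \<Rightarrow> bool" where
  "hol_family R F \<longleftrightarrow> cont_family (ball 0 R) F \<and>
     (\<forall>t\<in>{0..1}. \<forall>z\<in>ball 0 R. \<forall>i. (\<lambda>u. F t (z + axis i u)) field_differentiable (at 0))"

lemma hol_family_continuous: "hol_family R F \<Longrightarrow> cont_family (ball 0 R) F"
  and hol_family_differentiable: "hol_family R F \<Longrightarrow> t \<in> {0..1} \<Longrightarrow> z \<in> ball 0 R \<Longrightarrow>
    (\<lambda>u. F t (z + axis i u)) field_differentiable (at 0)"
  by (auto simp: hol_family_def)

lemma hol_family_subset: "hol_family R F \<Longrightarrow> R' \<le> R \<Longrightarrow> hol_family R' F"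
  unfolding hol_family_def by (auto intro: continuous_on_subset)

lemma axis_add: "axis i (u + v) = axis i u + (axis i v :: 'a::comm_monoid_add ^ 'n)"
  by (simp add: vec_eq_iff axis_def)

lemma norm_axis_complex: "norm (axis i (u::complex)) = cmod u"
  by (simp add: norm_eq_sqrt_inner inner_axis_axis)

lemma continuous_on_axis [continuous_intros]:
  fixes f :: "'a::topological_space \<Rightarrow> 'b::{topological_space, zero}"
  shows "continuous_on S f \<Longrightarrow> continuous_on S (\<lambda>x. axis i (f x))"
proof (rule continuous_on_vecI)
  fix j assume "continuous_on S f"
  then show "continuous_on S (\<lambda>x. axis i (f x) $ j)" by (cases "j = i") (simp_all add: axis_def)
qed

lemma slice_field_differentiable:
  fixes F :: "complex ^ 'n \<Rightarrow> complex"
  assumes "(\<lambda>u. F (z + axis i w + axis i u)) field_differentiable (at 0)"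
  shows "(\<lambda>u. F (z + axis i u)) field_differentiable (at w)"
proof -
  obtain d where "((\<lambda>u. F (z + axis i w + axis i u)) has_field_derivative d) (at (w - w))"
    using assms by (auto simp: field_differentiable_def)
  moreover have "((\<lambda>u. u - w) has_field_derivative 1) (at w)"
    by (auto intro!: derivative_eq_intros)
  ultimately have "((\<lambda>u. F (z + axis i w + axis i (u - w))) has_field_derivative d * 1) (at w)"
    by (rule DERIV_chain2)
  then show ?thesis by (auto simp: field_differentiable_def add.assoc simp flip: axis_add)
qed

lemma hol_family_slice:
  assumes "hol_family R F" "t \<in> {0..1}" "norm z + d \<le> R"
  shows "(\<lambda>u. F t (z + axis i u)) holomorphic_on ball 0 d"
  unfolding holomorphic_on_def
proof
  fix w :: complex assume "w \<in> ball 0 d"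
  then have "z + axis i w \<in> ball 0 R"
    using norm_triangle_ineq[of z "axis i w"] assms(3) by (simp add: norm_axis_complex)
  from slice_field_differentiable[OF hol_family_differentiable[OF assms(1,2) this]]
  show "(\<lambda>u. F t (z + axis i u)) field_differentiable at w within ball 0 d"
    by (rule field_differentiable_at_within)
qed

text \<open>Cauchy's formula on the circle of radius d. The velocity of the parametrization cancels
  one of the two powers in the denominator. From an integral over a fixed interval, joint continuity
  and holomorphy of the derivative can be read off.\<close>

lemma cauchy_partial_derivative:
  assumes F: "hol_family R F" and t: "t \<in> {0..1}" and z: "norm z + d < R" and d: "d > 0"
  shows "((\<lambda>u. F t (z + axis i u)) has_field_derivative
    integral {0..1} (\<lambda>x. F t (z + axis i (d * exp (2 * of_real pi * \<i> * of_real x)))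
      / (d * exp (2 * of_real pi * \<i> * of_real x)))) (at 0)"
proof -
  let ?f = "\<lambda>u. F t (z + axis i u)"
  have hol: "?f holomorphic_on ball 0 (R - norm z)" by (rule hol_family_slice[OF F t]) simp
  have "continuous_on (cball 0 d) ?f" "?f holomorphic_on ball 0 d"
    using hol z by (auto intro!: holomorphic_on_imp_continuous_on intro: holomorphic_on_subset)
  from Cauchy_derivative_integral_circlepath(2)[OF this, of 0] d
  have "(?f has_field_derivative 1 / (2 * of_real pi * \<i>) *
      contour_integral (circlepath 0 d) (\<lambda>u. ?f u / u\<^sup>2)) (at 0)" by simp
  moreover have "contour_integral (circlepath 0 d) (\<lambda>u. ?f u / u\<^sup>2) = 2 * of_real pi * \<i> * integral {0..1}
      (\<lambda>x. (?f (d * exp (2 * of_real pi * \<i> * of_real x)) / (d * exp (2 * of_real pi * \<i> * of_real x))))"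
    unfolding contour_integral_integral integral_mult_right[symmetric] using d
    unfolding vector_derivative_circlepath
    by (intro integral_cong) (simp add: circlepath power2_eq_square field_simps)
  ultimately show ?thesis by simp
qed

lemma hol_family_partials:
  fixes F :: "real \<Rightarrow> complex ^ 'n \<Rightarrow> complex"
  assumes F: "hol_family R F" and R': "R' < R"
  obtains G where "\<And>i. hol_family R' (G i)"
    "\<And>i t z. t \<in> {0..1} \<Longrightarrow> z \<in> ball 0 R' \<Longrightarrow> ((\<lambda>u. F t (z + axis i u)) has_field_derivative G i t z) (at 0)"
proof -
  \<comment> \<open>One \<open>d\<close> is left for the displacement in direction j, and one for
    each of two Cauchy circles: that of \<open>G i\<close>, and that of \<open>G j\<close>, the
    derivative of the integrand.\<close>
  define d where "d = (R - R') / 3"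
  have d: "d > 0" "R' + d + d + d = R" using R' by (auto simp: d_def field_simps)
  define c where "c = (\<lambda>x. of_real d * exp (2 * of_real pi * \<i> * of_real x) :: complex)"
  have c: "cmod (c x) = d" "c x \<noteq> 0" for x using d by (auto simp: c_def norm_mult)
  have c_cont: "continuous_on S c" for S unfolding c_def by (intro continuous_intros)
  define G where "G = (\<lambda>i t z. integral {0..1} (\<lambda>x. F t (z + axis i (c x)) / c x))"
  have G: "((\<lambda>u. F t (z + axis i u)) has_field_derivative G i t z) (at 0)"
    if "t \<in> {0..1}" "z \<in> ball 0 (R' + d + d)" for i t z
    using cauchy_partial_derivative[OF F that(1) _ d(1), of z i] that(2) d(2) by (simp add: G_def c_def)
  have in_ball: "z + axis i (c x) \<in> ball 0 R" if "z \<in> ball 0 (R' + d + d)" for z and i :: 'n and x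
    using norm_triangle_ineq[of z "axis i (c x)"] that d by (simp add: norm_axis_complex c)
  have in_ball': "z + axis j u + axis i (c x) \<in> ball 0 (R' + d + d)" if "z \<in> ball 0 R'" "u \<in> ball 0 d"
    for z and i j :: 'n and x and u :: complex
    using norm_triangle_ineq[of "z + axis j u" "axis i (c x)"] norm_triangle_ineq[of z "axis j u"] that d
    by (simp add: norm_axis_complex c)
  have F_slice: "continuous_on {0..1} (\<lambda>x. F t (z + axis i (c x)) / c x)"
    if "t \<in> {0..1}" "z \<in> ball 0 (R' + d + d)" for i t z
  proof -
    have "continuous_on {0..1} (\<lambda>x. (\<lambda>(t, z). F t z) (t, z + axis i (c x)))"
      by (rule continuous_on_compose2[OF hol_family_continuous[OF F]])
        (use in_ball[OF that(2)] that(1) in \<open>auto intro!: continuous_intros c_cont simp del: mem_ball\<close>)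
    then show ?thesis using c(2) by (auto intro!: continuous_intros c_cont)
  qed
  have G_cont: "cont_family (ball 0 (R' + d + d)) (\<lambda>t z. G i t z)" for i
  proof -
    have "continuous_on (({0..1} \<times> ball 0 (R' + d + d)) \<times> cbox 0 1)
        (\<lambda>q. (\<lambda>(t, z). F t z) (fst (fst q), snd (fst q) + axis i (c (snd q))))"
      by (rule continuous_on_compose2[OF hol_family_continuous[OF F]])
        (use in_ball in \<open>auto intro!: continuous_intros continuous_on_compose2[OF c_cont[of UNIV]] simp del: mem_ball\<close>)
    then have "continuous_on (({0..1} \<times> ball 0 (R' + d + d)) \<times> cbox 0 1)
        (\<lambda>(p, x). F (fst p) (snd p + axis i (c x)) / c x)"
      using c(2) by (auto simp: case_prod_beta intro!: continuous_intros continuous_on_compose2[OF c_cont[of UNIV]])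
    from integral_continuous_on_param[OF this] show ?thesis by (simp add: G_def case_prod_beta)
  qed
  have "(\<lambda>u. G i t (z + axis j u)) field_differentiable (at 0)" if t: "t \<in> {0..1}" and z: "z \<in> ball 0 R'" for i j t z
  proof -
    have "(\<lambda>u. integral (cbox 0 1) (\<lambda>x. F t (z + axis j u + axis i (c x)) / c x)) holomorphic_on ball 0 d"
    proof (rule leibniz_rule_holomorphic)
      fix u :: complex and x assume u: "u \<in> ball 0 d"
      have "((\<lambda>v. F t (z + axis j u + axis i (c x) + axis j v)) has_field_derivative
          G j t (z + axis j u + axis i (c x))) (at (u - u))"
        using G[OF t in_ball'[OF z u]] by simp
      moreover have "((\<lambda>v. v - u) has_field_derivative 1) (at u)" by (auto intro!: derivative_eq_intros)
      ultimately have "((\<lambda>v. F t (z + axis j u + axis i (c x) + axis j (v - u))) has_field_derivative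
          G j t (z + axis j u + axis i (c x)) * 1) (at u)" by (rule DERIV_chain2)
      moreover have "z + axis j u + axis i (c x) + axis j (v - u) = z + axis j v + axis i (c x)" for v
        using axis_add[of j u "v - u"] by (simp add: algebra_simps)
      ultimately have "((\<lambda>v. F t (z + axis j v + axis i (c x))) has_field_derivative
          G j t (z + axis j u + axis i (c x))) (at u)" by simp
      then show "((\<lambda>v. F t (z + axis j v + axis i (c x)) / c x) has_field_derivative
          G j t (z + axis j u + axis i (c x)) / c x) (at u within ball 0 d)"
        by (rule has_field_derivative_at_within[OF DERIV_cdivide])
    next
      fix u :: complex assume "u \<in> ball 0 d"
      then have "z + axis j u \<in> ball 0 (R' + d + d)"
        using norm_triangle_ineq[of z "axis j u"] z d by (simp add: norm_axis_complex)
      from integrable_continuous_real[OF F_slice[OF t this]]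
      show "(\<lambda>x. F t (z + axis j u + axis i (c x)) / c x) integrable_on cbox 0 1" by simp
    next
      have "continuous_on (ball 0 d \<times> cbox 0 1)
          (\<lambda>q. (\<lambda>(t, z). G j t z) (t, z + axis j (fst q) + axis i (c (snd q))))"
        by (rule continuous_on_compose2[OF G_cont])
          (use in_ball'[OF z] t in \<open>auto intro!: continuous_intros continuous_on_compose2[OF c_cont[of UNIV]] simp del: mem_ball\<close>)
      then show "continuous_on (ball 0 d \<times> cbox 0 1) (\<lambda>(u, x). G j t (z + axis j u + axis i (c x)) / c x)"
        using c(2) by (auto simp: case_prod_beta intro!: continuous_intros continuous_on_compose2[OF c_cont[of UNIV]])
    qed simp
    then have "(\<lambda>u. G i t (z + axis j u)) holomorphic_on ball 0 d" by (simp add: G_def)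
    then show ?thesis using d by (simp add: holomorphic_on_imp_differentiable_at)
  qed
  moreover have "cont_family (ball 0 R') (\<lambda>t z. G i t z)" for i
    by (rule continuous_on_subset[OF G_cont]) (use d in auto)
  ultimately have "hol_family R' (G i)" for i by (simp add: hol_family_def)
  then show ?thesis using d by (intro that[of G] G) auto
qed

text \<open>The classical argument from continuous partial derivatives, in complex variables: one
  coordinate is moved at a time, with the mean value inequality on a disc of that
  coordinate.\<close>

lemma has_derivative_of_partials:
  fixes f :: "complex ^ 'n \<Rightarrow> complex"
  assumes S: "open S" "z \<in> S" and g: "\<And>i. continuous_on S (g i)"
    and f: "\<And>i y. y \<in> S \<Longrightarrow> ((\<lambda>u. f (y + axis i u)) has_field_derivative g i y) (at 0)"
  shows "has_gradient f (\<lambda>i. g i z) z"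
proof -
  \<comment> \<open>\<open>r A h\<close> keeps the coordinates of h that lie in \<open>A\<close>;
    the induction adds them one at a time.\<close>
  define r where "r = (\<lambda>A (h :: complex ^ 'n). \<chi> i. if i \<in> A then h $ i else 0)"
  have claim: "\<forall>\<epsilon>>0. \<exists>\<delta>>0. \<forall>h::complex ^ 'n. norm h < \<delta> \<longrightarrow>
      norm (f (z + r A h) - f z - (\<Sum>i\<in>A. g i z * h $ i)) \<le> \<epsilon> * norm h" for A
    using finite[of A]
  proof (induction A rule: finite_induct)
    case empty
    have "r {} h = 0" for h by (simp add: r_def vec_eq_iff)
    then show ?case by (auto intro: exI[of _ 1])
  next
    case (insert i A)
    show ?case
    proof (intro allI impI)
      fix \<epsilon> :: real assume "\<epsilon> > 0"
      then obtain \<delta>1 where \<delta>1: "\<delta>1 > 0" "\<And>h::complex ^ 'n. norm h < \<delta>1 \<Longrightarrow>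
          norm (f (z + r A h) - f z - (\<Sum>i\<in>A. g i z * h $ i)) \<le> \<epsilon>/2 * norm h"
        using insert.IH by (meson half_gt_zero)
      have "isCont (g i) z" using g S continuous_on_eq_continuous_at by blast
      then obtain \<delta>2 where \<delta>2: "\<delta>2 > 0" "\<And>y. dist y z < \<delta>2 \<Longrightarrow> dist (g i y) (g i z) < \<epsilon>/2"
        using \<open>\<epsilon> > 0\<close> unfolding continuous_at_eps_delta by (meson half_gt_zero)
      obtain \<delta>3 where \<delta>3: "\<delta>3 > 0" "ball z \<delta>3 \<subseteq> S" using S openE by blast
      show "\<exists>\<delta>>0. \<forall>h::complex ^ 'n. norm h < \<delta> \<longrightarrow>
          norm (f (z + r (insert i A) h) - f z - (\<Sum>i\<in>insert i A. g i z * h $ i)) \<le> \<epsilon> * norm h"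
      proof (intro exI[of _ "min \<delta>1 (min \<delta>2 \<delta>3)"] conjI allI impI)
        fix h :: "complex ^ 'n" assume h: "norm h < min \<delta>1 (min \<delta>2 \<delta>3)"
        define p where "p = z + r A h"
        have near: "norm (p + axis i u - z) \<le> norm h" if "cmod u \<le> cmod (h $ i)" for u :: complex
          unfolding p_def using insert.hyps that
          by (intro norm_le_componentwise_cart) (auto simp: r_def axis_def)
        have S': "p + axis i u \<in> S" and g': "norm (g i (p + axis i u) - g i z) \<le> \<epsilon>/2"
          if "cmod u \<le> cmod (h $ i)" for u :: complex
        proof -
          have "dist (p + axis i u) z < \<delta>3" "dist (p + axis i u) z < \<delta>2"
            using near[OF that] h by (auto simp: dist_norm)
          then show "p + axis i u \<in> S" "norm (g i (p + axis i u) - g i z) \<le> \<epsilon>/2"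
            using \<delta>2(2)[of "p + axis i u"] \<delta>3(2) by (auto simp: dist_norm subset_iff norm_minus_commute)
        qed
        \<comment> \<open>Subtracting the linear term leaves a function of one complex variable
          whose derivative is at most \<open>\<epsilon>/2\<close> on the disc of radius
          \<open>cmod (h $ i)\<close>.\<close>
        define \<psi> where "\<psi> = (\<lambda>u. f (p + axis i u) - g i z * u)"
        have "norm (\<psi> (h $ i) - \<psi> 0) \<le> \<epsilon>/2 * norm (h $ i - 0)"
        proof (rule field_differentiable_bound[where S="cball 0 (cmod (h $ i))"])
          fix u :: complex assume "u \<in> cball 0 (cmod (h $ i))"
          then have u: "cmod u \<le> cmod (h $ i)" by simp
          have "((\<lambda>v. f (p + axis i u + axis i v)) has_field_derivative g i (p + axis i u)) (at (u - u))"
            using f[OF S'[OF u]] by simp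
          moreover have "((\<lambda>v. v - u) has_field_derivative 1) (at u)" by (auto intro!: derivative_eq_intros)
          ultimately have "((\<lambda>v. f (p + axis i u + axis i (v - u))) has_field_derivative g i (p + axis i u) * 1) (at u)"
            by (rule DERIV_chain2)
          then have "((\<lambda>v. f (p + axis i v)) has_field_derivative g i (p + axis i u)) (at u)"
            by (simp add: add.assoc flip: axis_add)
          then have "(\<psi> has_field_derivative g i (p + axis i u) - g i z) (at u)"
            unfolding \<psi>_def by (auto intro!: derivative_eq_intros)
          then show "(\<psi> has_field_derivative g i (p + axis i u) - g i z) (at u within cball 0 (cmod (h $ i)))"
            by (rule has_field_derivative_at_within)
          show "norm (g i (p + axis i u) - g i z) \<le> \<epsilon>/2" by (rule g'[OF u])
        qed auto
        moreover have "p + axis i (h $ i) = z + r (insert i A) h"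
          using insert.hyps by (auto simp: p_def r_def axis_def vec_eq_iff)
        ultimately have "norm (f (z + r (insert i A) h) - f p - g i z * h $ i) \<le> \<epsilon>/2 * norm (h $ i)"
          by (simp add: \<psi>_def p_def axis_def algebra_simps zero_vec_def[symmetric])
        also have "\<dots> \<le> \<epsilon>/2 * norm h"
          using \<open>\<epsilon> > 0\<close> Finite_Cartesian_Product.norm_nth_le[of h i] by (intro mult_left_mono) auto
        finally have "norm ((f p - f z - (\<Sum>i\<in>A. g i z * h $ i)) +
            (f (z + r (insert i A) h) - f p - g i z * h $ i)) \<le> \<epsilon>/2 * norm h + \<epsilon>/2 * norm h"
          using \<delta>1(2)[of h] h unfolding p_def by (intro norm_triangle_mono) auto
        moreover have "(f p - f z - (\<Sum>i\<in>A. g i z * h $ i)) + (f (z + r (insert i A) h) - f p - g i z * h $ i)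
            = f (z + r (insert i A) h) - f z - (\<Sum>i\<in>insert i A. g i z * h $ i)"
          using insert.hyps by simp
        ultimately show "norm (f (z + r (insert i A) h) - f z - (\<Sum>i\<in>insert i A. g i z * h $ i)) \<le> \<epsilon> * norm h"
          by simp
      qed (use \<delta>1 \<delta>2 \<delta>3 in auto)
    qed
  qed
  have rU: "r UNIV h = h" for h by (simp add: r_def vec_eq_iff)
  show ?thesis unfolding has_derivative_at_alt
  proof (intro conjI allI impI)
    show "bounded_linear (\<lambda>h. \<Sum>i\<in>UNIV. g i z * h $ i)"
      by (intro bounded_linear_sum bounded_linear_mult_right[THEN bounded_linear_compose] bounded_linear_vec_nth)
    fix \<epsilon> :: real assume "\<epsilon> > 0"
    then obtain \<delta> where \<delta>: "\<delta> > 0" "\<And>h::complex ^ 'n. norm h < \<delta> \<Longrightarrow>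
        norm (f (z + h) - f z - (\<Sum>i\<in>UNIV. g i z * h $ i)) \<le> \<epsilon> * norm h"
      using claim[of UNIV] unfolding rU by blast
    show "\<exists>d>0. \<forall>y. norm (y - z) < d \<longrightarrow>
        norm (f y - f z - (\<Sum>i\<in>UNIV. g i z * (y - z) $ i)) \<le> \<epsilon> * norm (y - z)"
    proof (intro exI[of _ \<delta>] conjI allI impI \<delta>(1))
      fix y assume "norm (y - z) < \<delta>"
      from \<delta>(2)[OF this] show "norm (f y - f z - (\<Sum>i\<in>UNIV. g i z * (y - z) $ i)) \<le> \<epsilon> * norm (y - z)"
        by (simp del: vector_minus_component)
    qed
  qed
qed

section \<open>Closure properties of holomorphic families\<close>

lemma hol_familyI:
  assumes "cont_family (ball 0 R) F"
    and "\<And>t z i. t \<in> {0..1} \<Longrightarrow> z \<in> ball 0 R \<Longrightarrow> (\<lambda>u. F t (z + axis i u)) field_differentiable (at 0)"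
  shows "hol_family R F"
  using assms unfolding hol_family_def by blast

lemma hol_family_time:
  assumes "continuous_on {0..1} c"
  shows "hol_family R (\<lambda>t z. c t)"
proof (rule hol_familyI)
  have "continuous_on ({0..1} \<times> ball 0 R) (\<lambda>p. c (fst p))"
    by (rule continuous_on_compose2[OF assms continuous_on_fst[OF continuous_on_id]]) auto
  then show "cont_family (ball 0 R) (\<lambda>t z. c t)" by (simp add: case_prod_beta)
qed (rule field_differentiable_const)

lemma hol_family_coordinate: "hol_family R (\<lambda>t z. z $ i)"
proof (rule hol_familyI)
  show "(\<lambda>u. (z + axis j u) $ i) field_differentiable (at 0)" for z :: "complex ^ 'a" and j
  proof (cases "i = j")
    case True
    then have "(\<lambda>u. (z + axis j u) $ i) = (\<lambda>u. z $ i + u)" by (simp add: axis_def)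
    then show ?thesis by (simp add: field_differentiable_add field_differentiable_const field_differentiable_ident)
  next
    case False
    then have "(\<lambda>u. (z + axis j u) $ i) = (\<lambda>u. z $ i)" by (simp add: axis_def)
    then show ?thesis by (simp add: field_differentiable_const)
  qed
  show "continuous_on ({0..1} \<times> ball 0 R) (\<lambda>(t::real, z). z $ i)"
    unfolding case_prod_beta by (intro continuous_intros)
qed

lemma hol_family_add:
  assumes F: "hol_family R F" and G: "hol_family R G"
  shows "hol_family R (\<lambda>t z. F t z + G t z)"
proof (rule hol_familyI)
  show "cont_family (ball 0 R) (\<lambda>t z. F t z + G t z)"
    using continuous_on_add[OF hol_family_continuous[OF F] hol_family_continuous[OF G]]
    by (simp add: case_prod_beta)
qed (rule field_differentiable_add[OF hol_family_differentiable[OF F] hol_family_differentiable[OF G]])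

lemma hol_family_mult:
  assumes F: "hol_family R F" and G: "hol_family R G"
  shows "hol_family R (\<lambda>t z. F t z * G t z)"
proof (rule hol_familyI)
  show "cont_family (ball 0 R) (\<lambda>t z. F t z * G t z)"
    using continuous_on_mult[OF hol_family_continuous[OF F] hol_family_continuous[OF G]]
    by (simp add: case_prod_beta)
qed (rule field_differentiable_mult[OF hol_family_differentiable[OF F] hol_family_differentiable[OF G]])

lemma hol_family_inverse:
  assumes "hol_family R F" "\<And>t z. t \<in> {0..1} \<Longrightarrow> z \<in> ball 0 R \<Longrightarrow> F t z \<noteq> 0"
  shows "hol_family R (\<lambda>t z. inverse (F t z))"
proof (rule hol_familyI)
  show "cont_family (ball 0 R) (\<lambda>t z. inverse (F t z))"
    using continuous_on_inverse[OF hol_family_continuous[OF assms(1)]] assms(2) by (auto simp: case_prod_beta)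
  fix t z and i :: 'a assume tz: "t \<in> {0..1::real}" "z \<in> ball (0::complex ^ 'a) R"
  have "axis i (0::complex) = (0 :: complex ^ 'a)" by (simp add: axis_def vec_eq_iff)
  then have "F t (z + axis i 0) \<noteq> 0" using assms(2)[OF tz] by (simp only: add_0_right not_False_eq_True)
  then show "(\<lambda>u. inverse (F t (z + axis i u))) field_differentiable (at 0)"
    by (intro field_differentiable_inverse hol_family_differentiable[OF assms(1) tz])
qed

text \<open>Osgood's lemma: by Cauchy's formula the partial derivatives are themselves continuous,
  so separate holomorphy with joint continuity gives a complex linear derivative.\<close>

lemma hol_family_has_derivative:
  assumes "hol_family R F" "t \<in> {0..1}" "z \<in> ball 0 R"
  shows "\<exists>D. has_gradient (F t) D z"
proof -
  obtain R' where R': "norm z < R'" "R' < R" using assms(3) dense by auto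
  obtain G where G: "\<And>i. hol_family R' (G i)"
    "\<And>i t z. t \<in> {0..1} \<Longrightarrow> z \<in> ball 0 R' \<Longrightarrow> ((\<lambda>u. F t (z + axis i u)) has_field_derivative G i t z) (at 0)"
    by (rule hol_family_partials[OF assms(1) R'(2)]) (rule that)
  have c: "continuous_on (ball 0 R') (G i t)" for i
    using continuous_on_compose2[OF hol_family_continuous[OF G(1)], of "ball 0 R'" "\<lambda>z. (t, z)"] assms(2)
    by (auto simp: continuous_on_Pair continuous_on_id image_subset_iff)
  have "has_gradient (F t) (\<lambda>i. G i t z) z"
    using R' by (intro has_derivative_of_partials[of "ball 0 R'"] c G(2) assms(2)) auto
  then show ?thesis by (rule exI[of _ "\<lambda>i. G i t z"])
qed

text \<open>The chain rule along a slice moves all arguments of \<open>F\<close> at once and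
  therefore uses its full derivative, not only the partial ones.\<close>

lemma hol_family_compose:
  fixes F :: "real \<Rightarrow> complex ^ 'n \<Rightarrow> complex" and \<Gamma> :: "real \<Rightarrow> complex ^ 'm \<Rightarrow> complex ^ 'n"
  assumes F: "hol_family R F" and \<Gamma>: "\<And>j. hol_family R' (\<lambda>t z. \<Gamma> t z $ j)"
    and in_ball: "\<And>t z. t \<in> {0..1} \<Longrightarrow> z \<in> ball 0 R' \<Longrightarrow> \<Gamma> t z \<in> ball 0 R"
  shows "hol_family R' (\<lambda>t z. F t (\<Gamma> t z))"
proof (rule hol_familyI)
  have "continuous_on ({0..1} \<times> ball 0 R') (\<lambda>p. \<Gamma> (fst p) (snd p))"
    using hol_family_continuous[OF \<Gamma>] by (intro continuous_on_vecI) (simp add: case_prod_beta)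
  then have "continuous_on ({0..1} \<times> ball 0 R') (\<lambda>p. (\<lambda>(t, z). F t z) (fst p, \<Gamma> (fst p) (snd p)))"
    by (intro continuous_on_compose2[OF hol_family_continuous[OF F]] continuous_on_Pair continuous_on_fst
        continuous_on_id) (use in_ball in \<open>auto simp del: mem_ball\<close>)
  then show "cont_family (ball 0 R') (\<lambda>t z. F t (\<Gamma> t z))" by (simp add: case_prod_beta)
  fix t z i assume t: "t \<in> {0..1::real}" and z: "z \<in> ball (0::complex ^ 'm) R'"
  have "\<forall>j. \<exists>d. ((\<lambda>u. \<Gamma> t (z + axis i u) $ j) has_field_derivative d) (at 0)"
    using hol_family_differentiable[OF \<Gamma> t z] by (simp add: field_differentiable_def)
  from choice[OF this] obtain d where d: "\<And>j. ((\<lambda>u. \<Gamma> t (z + axis i u) $ j) has_field_derivative d j) (at 0)"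
    by blast
  have "((\<lambda>u. \<Gamma> t (z + axis i u)) has_derivative (\<lambda>h. \<chi> j. d j * h)) (at 0)"
    using d by (intro has_derivative_vec_nthI) (simp add: has_field_derivative_def)
  moreover obtain D where "has_gradient (F t) D ((\<Gamma> t (z + axis i 0)))"
    using hol_family_has_derivative[OF F t in_ball[OF t z]] by (auto simp: axis_def zero_vec_def[symmetric])
  ultimately have "((\<lambda>u. F t (\<Gamma> t (z + axis i u))) has_derivative (\<lambda>h. \<Sum>j\<in>UNIV. D j * (\<chi> j. d j * h) $ j)) (at 0)"
    by (rule has_derivative_compose)
  moreover have "(\<lambda>h. \<Sum>j\<in>UNIV. D j * (\<chi> j. d j * h) $ j) = (*) (\<Sum>j\<in>UNIV. D j * d j)"
    by (rule ext) (simp add: sum_distrib_right mult.assoc)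
  ultimately have "((\<lambda>u. F t (\<Gamma> t (z + axis i u))) has_field_derivative (\<Sum>j\<in>UNIV. D j * d j)) (at 0)"
    unfolding has_field_derivative_def by (simp only:)
  then show "(\<lambda>u. F t (\<Gamma> t (z + axis i u))) field_differentiable (at 0)"
    by (auto simp: field_differentiable_def)
qed

text \<open>The radius shrinks because the Leibniz rule asks for continuous partial derivatives,
  which Cauchy's formula supplies on a smaller ball.\<close>

lemma hol_family_integral:
  fixes F :: "real \<Rightarrow> complex ^ 'n \<Rightarrow> complex"
  assumes F: "hol_family R F" and R': "R' < R"
  shows "hol_family R' (\<lambda>t z. integral {0..t} (\<lambda>s. F s z))"
proof (rule hol_familyI)
  have F': "hol_family R' F" using hol_family_subset[OF F] R' by simp
  show "cont_family (ball 0 R') (\<lambda>t z. integral {0..t} (\<lambda>s. F s z))"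
    by (rule continuous_on_time_integral[OF open_ball hol_family_continuous[OF F']])
  define R1 where "R1 = (R + R') / 2"
  have R1: "R' < R1" "R1 < R" using R' by (auto simp: R1_def)
  obtain G where G: "\<And>i. hol_family R1 (G i)"
    "\<And>i t z. t \<in> {0..1} \<Longrightarrow> z \<in> ball 0 R1 \<Longrightarrow> ((\<lambda>u. F t (z + axis i u)) has_field_derivative G i t z) (at 0)"
    by (rule hol_family_partials[OF F R1(2)]) (rule that)
  fix t z i assume t: "t \<in> {0..1::real}" and z: "z \<in> ball (0::complex ^ 'n) R'"
  define d where "d = R1 - R'"
  have d: "d > 0" using R1 by (simp add: d_def)
  have in_ball: "z + axis i u \<in> ball 0 R1" if "u \<in> ball 0 d" for u
    using norm_triangle_ineq[of z "axis i u"] z that by (simp add: norm_axis_complex d_def)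
  have sub: "{0..t} \<subseteq> {0..1}" using t by auto
  have "(\<lambda>u. integral (cbox 0 t) (\<lambda>s. F s (z + axis i u))) holomorphic_on ball 0 d"
  proof (rule leibniz_rule_holomorphic)
    fix u :: complex and s :: real assume u: "u \<in> ball 0 d" and s: "s \<in> cbox 0 t"
    have s': "s \<in> {0..1}" using s sub by auto
    have "((\<lambda>v. F s (z + axis i u + axis i v)) has_field_derivative G i s (z + axis i u)) (at (u - u))"
      using G(2)[OF s' in_ball[OF u]] by simp
    moreover have "((\<lambda>v. v - u) has_field_derivative 1) (at u)" by (auto intro!: derivative_eq_intros)
    ultimately have "((\<lambda>v. F s (z + axis i u + axis i (v - u))) has_field_derivative G i s (z + axis i u) * 1) (at u)"
      by (rule DERIV_chain2)
    then have "((\<lambda>v. F s (z + axis i v)) has_field_derivative G i s (z + axis i u)) (at u)"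
      by (simp add: add.assoc flip: axis_add)
    then show "((\<lambda>v. F s (z + axis i v)) has_field_derivative G i s (z + axis i u)) (at u within ball 0 d)"
      by (rule has_field_derivative_at_within)
  next
    fix u :: complex assume u: "u \<in> ball 0 d"
    have "continuous_on {0..t} (\<lambda>s. (\<lambda>(t, z). F t z) (s, z + axis i u))"
      by (rule continuous_on_compose2[OF hol_family_continuous[OF F]])
        (use in_ball[OF u] sub R1 in \<open>auto intro!: continuous_on_Pair continuous_on_id continuous_on_const\<close>)
    then show "(\<lambda>s. F s (z + axis i u)) integrable_on cbox 0 t"
      using integrable_continuous_real by simp
  next
    have "continuous_on (ball 0 d \<times> cbox 0 t) (\<lambda>q. (\<lambda>(t, z). G i t z) (snd q, z + axis i (fst q)))"
      by (rule continuous_on_compose2[OF hol_family_continuous[OF G(1)]])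
        (use in_ball sub in \<open>auto intro!: continuous_intros simp del: mem_ball\<close>)
    then show "continuous_on (ball 0 d \<times> cbox 0 t) (\<lambda>(u, s). G i s (z + axis i u))"
      by (simp add: case_prod_beta)
  qed simp
  then show "(\<lambda>u. integral {0..t} (\<lambda>s. F s (z + axis i u))) field_differentiable (at 0)"
    using d by (simp add: holomorphic_on_imp_differentiable_at)
qed

section \<open>Real points of complex space\<close>

definition cvec :: "real ^ 'n \<Rightarrow> complex ^ 'n" where
  "cvec x = (\<chi> i. complex_of_real (x $ i))"

lemma cvec_nth [simp]: "cvec x $ i = complex_of_real (x $ i)"
  by (simp add: cvec_def)

lemma cvec_add: "cvec (x + y) = cvec x + cvec y"
  and cvec_0 [simp]: "cvec 0 = 0"
  by (simp_all add: vec_eq_iff)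

lemma norm_cvec [simp]: "norm (cvec x) = norm x"
  by (simp add: norm_vec_def)

lemma bounded_linear_cvec: "bounded_linear cvec"
  by (rule bounded_linear_intro[of _ 1]) (simp_all add: vec_eq_iff complex_eq_iff)

text \<open>At real points the imaginary part of \<open>F\<close> is constantly 0, so its derivative
  in real directions is 0 and the complex partial derivatives are real there.\<close>

lemma hol_family_real_partials:
  fixes F :: "real \<Rightarrow> complex ^ 'n \<Rightarrow> complex"
  assumes F: "hol_family R F" and R': "R' < R"
    and real: "\<And>t x. t \<in> {0..1} \<Longrightarrow> norm x < R \<Longrightarrow> F t (cvec x) = of_real (f t x)"
  obtains G g where "\<And>i. hol_family R' (G i)"
    "\<And>t z. t \<in> {0..1} \<Longrightarrow> z \<in> ball 0 R' \<Longrightarrow> has_gradient (F t) (\<lambda>i. G i t z) z"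
    "\<And>i t x. t \<in> {0..1} \<Longrightarrow> norm x < R' \<Longrightarrow> G i t (cvec x) = of_real (g i t x)"
    "\<And>t x. t \<in> {0..1} \<Longrightarrow> norm x < R' \<Longrightarrow> has_gradient (f t) (\<lambda>i. g i t x) x"
proof -
  obtain G where G: "\<And>i. hol_family R' (G i)"
    "\<And>i t z. t \<in> {0..1} \<Longrightarrow> z \<in> ball 0 R' \<Longrightarrow> ((\<lambda>u. F t (z + axis i u)) has_field_derivative G i t z) (at 0)"
    by (rule hol_family_partials[OF F R']) (rule that)
  have deriv: "has_gradient (F t) (\<lambda>i. G i t z) z"
    if "t \<in> {0..1}" "z \<in> ball 0 R'" for t z
  proof (rule has_derivative_of_partials[OF open_ball that(2)])
    show "continuous_on (ball 0 R') (G i t)" for i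
      using continuous_on_compose2[OF hol_family_continuous[OF G(1)], of "ball 0 R'" "\<lambda>z. (t, z)"] that(1)
      by (auto simp: continuous_on_Pair continuous_on_id image_subset_iff)
  qed (rule G(2)[OF that(1)])
  have both: "((\<lambda>x. complex_of_real (f t x)) has_derivative (\<lambda>h. \<Sum>i\<in>UNIV. G i t (cvec x) * of_real (h $ i))) (at x)"
    if t: "t \<in> {0..1}" and x: "norm x < R'" for t x
  proof (rule has_derivative_transform_within_open[of _ _ _ _ "ball 0 R'"])
    have "((\<lambda>x. F t (cvec x)) has_derivative (\<lambda>h. \<Sum>i\<in>UNIV. G i t (cvec x) * cvec h $ i)) (at x)"
      using x by (intro has_derivative_compose[OF bounded_linear_imp_has_derivative[OF bounded_linear_cvec]] deriv[OF t]) simp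
    then show "((\<lambda>x. F t (cvec x)) has_derivative (\<lambda>h. \<Sum>i\<in>UNIV. G i t (cvec x) * of_real (h $ i))) (at x)" by simp
  qed (use x R' real[OF t] in auto)
  have Im0: "Im (G i t (cvec x)) = 0" if t: "t \<in> {0..1}" and x: "norm x < R'" for i t x
  proof -
    have "((\<lambda>x. Im (complex_of_real (f t x))) has_derivative
        (\<lambda>h. Im (\<Sum>i\<in>UNIV. G i t (cvec x) * of_real (h $ i)))) (at x)"
      by (rule bounded_linear.has_derivative[OF bounded_linear_Im both[OF t x]])
    then have "(\<lambda>h. Im (\<Sum>i\<in>UNIV. G i t (cvec x) * of_real (h $ i))) = (\<lambda>h. 0)"
      by (intro has_derivative_unique[OF _ has_derivative_const[of 0]]) simp
    from fun_cong[OF this, of "axis i 1"] show ?thesis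
      by (simp add: axis_def if_distrib[of complex_of_real] if_distrib[of "\<lambda>c. _ * c"] cong: if_cong)
  qed
  show ?thesis
  proof (rule that[of G "\<lambda>i t x. Re (G i t (cvec x))"])
    fix t :: real and x :: "real ^ 'n" assume t: "t \<in> {0..1}" and x: "norm x < R'"
    show "G i t (cvec x) = of_real (Re (G i t (cvec x)))" for i
      using Im0[OF t x] by (simp add: complex_eq_iff)
    have "((\<lambda>x. Re (complex_of_real (f t x))) has_derivative
        (\<lambda>h. Re (\<Sum>i\<in>UNIV. G i t (cvec x) * of_real (h $ i)))) (at x)"
      by (rule bounded_linear.has_derivative[OF bounded_linear_Re both[OF t x]])
    then show "has_gradient (f t) (\<lambda>i. Re (G i t (cvec x))) x"
      by simp
  qed (use G deriv in auto)
qed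

section \<open>Power series and holomorphic extensions\<close>

lemma hol_family_continuous_slice:
  assumes "hol_family R F" "t \<in> {0..1}"
  shows "continuous_on (ball 0 R) (F t)"
proof -
  have "continuous_on (ball 0 R) (\<lambda>z. (\<lambda>(t, z). F t z) (t, z))"
    by (rule continuous_on_compose2[OF hol_family_continuous[OF assms(1)]])
      (use assms(2) in \<open>auto intro!: continuous_on_Pair continuous_on_const continuous_on_id\<close>)
  then show ?thesis by simp
qed

text \<open>Exponents supported in \<open>S\<close>, so that power series can be built up one
  variable at a time.\<close>

definition multi_indices :: "'n set \<Rightarrow> ('n \<Rightarrow> nat) set" where
  "multi_indices S = {\<alpha>. \<forall>i. i \<notin> S \<longrightarrow> \<alpha> i = 0}"

lemma multi_indices_UNIV [simp]: "multi_indices UNIV = UNIV"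
  and multi_indices_empty [simp]: "multi_indices {} = {\<lambda>_. 0}"
  by (auto simp: multi_indices_def)

lemma bij_betw_multi_indices_insert:
  assumes "i \<notin> S"
  shows "bij_betw (\<lambda>\<alpha>. (\<alpha> i, \<alpha>(i := 0))) (multi_indices (insert i S)) (UNIV \<times> multi_indices S)"
proof (rule bij_betw_byWitness[where f'="\<lambda>(k, \<alpha>). \<alpha>(i := k)"])
qed (use assms in \<open>auto simp: multi_indices_def fun_eq_iff\<close>)

lemma prod_fun_upd_other: "i \<notin> S \<Longrightarrow> (\<Prod>j\<in>S. f j ((\<alpha>(i := k)) j)) = (\<Prod>j\<in>S. f j (\<alpha> j))"
  by (intro prod.cong) auto

lemma summable_multi_geometric:
  fixes q :: "'n \<Rightarrow> real"
  assumes "finite S" and q: "\<And>i. 0 \<le> q i" "\<And>i. q i < 1"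
  shows "(\<lambda>\<alpha>. \<Prod>i\<in>S. q i ^ \<alpha> i) summable_on multi_indices S"
  using assms(1)
proof (induction S rule: finite_induct)
  case (insert i S)
  let ?f = "\<lambda>p. q i ^ fst p * (\<Prod>j\<in>S. q j ^ snd p j)"
  obtain s where s: "((\<lambda>\<alpha>. \<Prod>j\<in>S. q j ^ \<alpha> j) has_sum s) (multi_indices S)"
    using insert.IH by (auto simp: summable_on_def)
  have g: "(\<lambda>k. q i ^ k) summable_on UNIV"
    using norm_summable_imp_has_sum[OF _ summable_sums[OF summable_geometric[of "q i"]]] q[of i]
    by (auto simp: summable_on_def power_abs summable_geometric)
  have "?f summable_on (UNIV \<times> multi_indices S)"
  proof (rule summable_on_SigmaI)
    show "((\<lambda>\<alpha>. ?f (k, \<alpha>)) has_sum q i ^ k * s) (multi_indices S)" for k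
      using has_sum_cmult_right[OF s, of "q i ^ k"] by simp
    show "(\<lambda>k. q i ^ k * s) summable_on UNIV" by (rule summable_on_cmult_left[OF g])
    show "0 \<le> ?f (k, \<alpha>)" for k \<alpha> using q by (auto intro!: mult_nonneg_nonneg prod_nonneg)
  qed
  then have "(\<lambda>\<alpha>. ?f (\<alpha> i, \<alpha>(i := 0))) summable_on multi_indices (insert i S)"
    by (subst summable_on_reindex_bij_betw[OF bij_betw_multi_indices_insert[OF insert.hyps(2)]])
  moreover have "?f (\<alpha> i, \<alpha>(i := 0)) = (\<Prod>j\<in>insert i S. q j ^ \<alpha> j)" for \<alpha>
    using insert.hyps prod_fun_upd_other[OF insert.hyps(2), of "\<lambda>j m. q j ^ m" \<alpha> 0] by simp
  ultimately show ?case by simp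
qed simp

text \<open>Taylor coefficients as integrals over \<open>{0..1}\<close>: the velocity of the circle
  cancels one power, whence the exponent \<open>k\<close> in place of \<open>Suc k\<close>.\<close>

lemma cauchy_coefficients:
  assumes F: "hol_family R F" and t: "t \<in> {0..1}" and z: "norm z + r < R" and r: "r > 0" and w: "cmod w < r"
  shows "(\<lambda>k. integral {0..1} (\<lambda>x. F t (z + axis i (r * exp (2 * of_real pi * \<i> * of_real x)))
      / (r * exp (2 * of_real pi * \<i> * of_real x)) ^ k) * w ^ k) sums F t (z + axis i w)"
proof -
  let ?f = "\<lambda>u. F t (z + axis i u)"
  have hol: "?f holomorphic_on ball 0 (R - norm z)" by (rule hol_family_slice[OF F t]) simp
  have c: "continuous_on (cball 0 r) ?f" "?f holomorphic_on ball 0 r"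
    using hol z by (auto intro!: holomorphic_on_imp_continuous_on intro: holomorphic_on_subset)
  have "(deriv ^^ k) ?f 0 / fact k = integral {0..1} (\<lambda>x. F t (z + axis i (r * exp (2 * of_real pi * \<i> * of_real x)))
      / (r * exp (2 * of_real pi * \<i> * of_real x)) ^ k)" for k
  proof -
    have "contour_integral (circlepath 0 r) (\<lambda>u. ?f u / (u - 0) ^ Suc k) = 2 * of_real pi * \<i> *
      integral {0..1} (\<lambda>x. ?f (r * exp (2 * of_real pi * \<i> * of_real x)) / (r * exp (2 * of_real pi * \<i> * of_real x)) ^ k)"
      unfolding contour_integral_integral integral_mult_right[symmetric] using r
      unfolding vector_derivative_circlepath
      by (intro integral_cong) (simp add: circlepath field_simps)
    moreover have "(deriv ^^ k) ?f 0 = fact k / (2 * pi * \<i>) * contour_integral (circlepath 0 r) (\<lambda>u. ?f u / (u - 0) ^ Suc k)"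
      using Cauchy_higher_derivative_integral_circlepath(2)[OF c, of 0 k] r by simp
    ultimately show ?thesis by simp
  qed
  then show ?thesis using holomorphic_power_series[OF c(2), of w] w by simp
qed

text \<open>Induction on the set of variables. The coefficients of the expansion in one variable are
  Cauchy integrals, holomorphic in the other variables on a ball smaller by \<open>2 * r\<close>;
  this explains the condition on \<open>R\<close>. The Cauchy estimates give absolute summability,
  so the iterated series may be summed as a single series over multi-indices.\<close>

lemma multi_power_series:
  fixes F :: "complex ^ 'n \<Rightarrow> complex" and r R M :: real
  assumes "finite S" and r: "r > 0"
  shows "hol_family R (\<lambda>_. F) \<Longrightarrow> 2 * r * card S < R \<Longrightarrow> (\<And>z. z \<in> ball 0 R \<Longrightarrow> cmod (F z) \<le> M) \<Longrightarrow>
    \<exists>c. (\<forall>\<alpha>\<in>multi_indices S. cmod (c \<alpha>) \<le> M * (\<Prod>i\<in>S. (1/r) ^ \<alpha> i)) \<and>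
      (\<forall>z. (\<forall>i. cmod (z $ i) < r) \<longrightarrow>
        ((\<lambda>\<alpha>. c \<alpha> * (\<Prod>i\<in>S. z $ i ^ \<alpha> i)) has_sum F (\<chi> i. if i \<in> S then z $ i else 0)) (multi_indices S))"
  using assms(1)
proof (induction S arbitrary: F M R rule: finite_induct)
  case empty
  have z: "(\<chi> i. 0) = (0 :: complex ^ 'n)" by (simp add: vec_eq_iff)
  have "cmod (F 0) \<le> M" using empty by simp
  moreover have "((\<lambda>\<alpha>. F 0) has_sum F 0) {\<lambda>_::'n. 0::nat}"
    using has_sum_finite[of "{\<lambda>_::'n. 0::nat}" "\<lambda>_. F 0"] by simp
  ultimately show ?case by (intro exI[of _ "\<lambda>_. F 0"]) (simp add: z)
next
  case (insert i S)
  have card: "2 * r * card S < R - 2 * r" using insert.prems(2) insert.hyps by (simp add: algebra_simps)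
  define e where "e = (\<lambda>x. of_real r * exp (2 * of_real pi * \<i> * of_real x) :: complex)"
  have e: "cmod (e x) = r" "e x \<noteq> 0" for x using r by (auto simp: e_def norm_mult)
  have e_cont: "continuous_on A e" for A unfolding e_def by (intro continuous_intros)
  define c where "c = (\<lambda>k z. integral {0..1} (\<lambda>x. F (z + axis i (e x)) * inverse (e x ^ k)))"
  have in_ball: "z + axis i (e x) \<in> ball 0 R" if "z \<in> ball 0 (R - r)" for z x
    using norm_triangle_ineq[of z "axis i (e x)"] that by (simp add: norm_axis_complex e)
  \<comment> \<open>The angle x on the circle takes the place of time, so that closure under time
    integrals gives holomorphy of the coefficients \<open>c k\<close>.\<close>
  have shifted: "hol_family (R - r) (\<lambda>x z. F (z + axis i (e x)) * inverse (e x ^ k))" for k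
  proof (intro hol_family_mult hol_family_time hol_family_compose[OF insert.prems(1)] in_ball)
    fix j
    have "hol_family (R - r) (\<lambda>x z. z $ j + (if j = i then e x else 0))"
      by (intro hol_family_add hol_family_coordinate hol_family_time) (cases "j = i", auto simp: e_cont)
    then show "hol_family (R - r) (\<lambda>x z. (z + axis i (e x)) $ j)" by (simp add: axis_def)
  qed (auto intro!: continuous_intros e_cont simp: e)
  have c_hol: "hol_family (R - 2 * r) (\<lambda>_. c k)" for k
  proof -
    have h: "hol_family (R - 2 * r) (\<lambda>t z. integral {0..t} (\<lambda>x. F (z + axis i (e x)) * inverse (e x ^ k)))"
      by (rule hol_family_integral[OF shifted]) (use r in simp)
    have "continuous_on ({0..1::real} \<times> ball 0 (R - 2 * r)) (\<lambda>p. (\<lambda>(t, z). integral {0..t} (\<lambda>x. F (z + axis i (e x)) * inverse (e x ^ k))) (1, snd p))"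
      by (rule continuous_on_compose2[OF hol_family_continuous[OF h]])
        (auto intro!: continuous_on_Pair continuous_on_const continuous_on_snd continuous_on_id)
    then have "cont_family (ball 0 (R - 2 * r)) (\<lambda>t z. c k z)"
      by (simp add: c_def case_prod_beta)
    then show ?thesis
      using hol_family_differentiable[OF h, of 1] by (intro hol_familyI) (auto simp: c_def)
  qed
  have c_bound: "cmod (c k z) \<le> M * (1/r)^k" if z: "z \<in> ball 0 (R - 2 * r)" for k z
  proof -
    have z': "z \<in> ball 0 (R - r)" using z r by simp
    have "continuous_on {0..1} (\<lambda>x. (\<lambda>(t, z). F (z + axis i (e t)) * inverse (e t ^ k)) (x, z))"
      by (rule continuous_on_compose2[OF hol_family_continuous[OF shifted]])
        (use z' in \<open>auto intro!: continuous_on_Pair continuous_on_const continuous_on_id simp del: mem_ball\<close>)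
    then have i: "(\<lambda>x. F (z + axis i (e x)) * inverse (e x ^ k)) integrable_on {0..1}"
      by (intro integrable_continuous_real) simp
    have "cmod (c k z) \<le> integral {0..1} (\<lambda>x::real. M * (1/r)^k)"
      unfolding c_def
    proof (rule integral_norm_bound_integral[OF i])
      fix x :: real
      show "cmod (F (z + axis i (e x)) * inverse (e x ^ k)) \<le> M * (1/r)^k"
        using mult_right_mono[OF insert.prems(3)[OF in_ball[OF z'], of x], of "inverse (r ^ k)"] r
        by (simp add: norm_mult norm_inverse norm_power e divide_inverse power_inverse)
    qed (rule integrable_continuous_real, rule continuous_on_const)
    then show ?thesis by simp
  qed
  have "\<forall>k. \<exists>d. (\<forall>\<alpha>\<in>multi_indices S. cmod (d \<alpha>) \<le> M * (1/r)^k * (\<Prod>i\<in>S. (1/r) ^ \<alpha> i)) \<and>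
      (\<forall>z. (\<forall>i. cmod (z $ i) < r) \<longrightarrow>
        ((\<lambda>\<alpha>. d \<alpha> * (\<Prod>i\<in>S. z $ i ^ \<alpha> i)) has_sum c k (\<chi> i. if i \<in> S then z $ i else 0)) (multi_indices S))"
    using insert.IH[OF c_hol card c_bound] by blast
  from choice[OF this] obtain d where d: "\<And>k \<alpha>. \<alpha> \<in> multi_indices S \<Longrightarrow>
      cmod (d k \<alpha>) \<le> M * (1/r)^k * (\<Prod>i\<in>S. (1/r) ^ \<alpha> i)"
    "\<And>k z. (\<And>i. cmod (z $ i) < r) \<Longrightarrow>
        ((\<lambda>\<alpha>. d k \<alpha> * (\<Prod>i\<in>S. z $ i ^ \<alpha> i)) has_sum c k (\<chi> i. if i \<in> S then z $ i else 0)) (multi_indices S)"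
    by blast
  note bij = bij_betw_multi_indices_insert[OF insert.hyps(2)]
  show ?case
  proof (intro exI[of _ "\<lambda>\<alpha>. d (\<alpha> i) (\<alpha>(i := 0))"] conjI ballI allI impI)
    fix \<alpha> assume "\<alpha> \<in> multi_indices (insert i S)"
    then have "\<alpha>(i := 0) \<in> multi_indices S" using insert.hyps by (auto simp: multi_indices_def)
    from d(1)[OF this, of "\<alpha> i"]
    show "cmod (d (\<alpha> i) (\<alpha>(i := 0))) \<le> M * (\<Prod>i\<in>insert i S. (1/r) ^ \<alpha> i)"
      unfolding prod_fun_upd_other[OF insert.hyps(2), of "\<lambda>j m. (1/r) ^ m" \<alpha> 0]
      using insert.hyps by (simp add: mult.assoc)
  next
    fix z :: "complex ^ 'n" assume z: "\<forall>i. cmod (z $ i) < r"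
    define y where "y = (\<chi> i. if i \<in> S then z $ i else 0)"
    let ?f = "\<lambda>p. d (fst p) (snd p) * (\<Prod>j\<in>S. z $ j ^ snd p j) * z $ i ^ fst p"
    \<comment> \<open>Ratios of the geometric majorant that the Cauchy estimates provide.\<close>
    define q where "q = (\<lambda>j. cmod (z $ j) / r)"
    have q: "0 \<le> q j" "q j < 1" for j using z r by (auto simp: q_def)
    have M0: "M \<ge> 0"
    proof -
      have "0 \<le> 2 * r * real (card S)" using r by simp
      then have "R > 0" using card r by linarith
      then have "(0 :: complex ^ 'n) \<in> ball 0 R" by simp
      from insert.prems(3)[OF this] show ?thesis using norm_ge_zero[of "F 0"] by linarith
    qed
    have "norm y \<le> 2 * r * card S"
    proof -
      have "norm y \<le> (\<Sum>j\<in>UNIV. norm (y $ j))" by (simp add: norm_vec_def L2_set_le_sum)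
      also have "\<dots> = (\<Sum>j\<in>S. cmod (z $ j))"
        using sum.inter_restrict[of UNIV "\<lambda>j. cmod (z $ j)" S] by (simp add: y_def if_distrib cong: if_cong)
      also have "\<dots> \<le> (\<Sum>j\<in>S. r)" using z by (intro sum_mono) (auto intro: less_imp_le)
      also have "\<dots> \<le> 2 * r * card S" using r by simp
      finally show ?thesis .
    qed
    then have y: "norm y + r < R" using card r by linarith
    have "summable (\<lambda>k. norm (c k y * z $ i ^ k))"
    proof (rule summable_comparison_test)
      show "summable (\<lambda>k. M * q i ^ k)" using q[of i] by (intro summable_mult summable_geometric) auto
      have "norm (norm (c k y * z $ i ^ k)) \<le> M * q i ^ k" for k
        using mult_right_mono[OF c_bound[of y k], of "cmod (z $ i) ^ k"] \<open>norm y \<le> 2 * r * card S\<close> card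
        by (simp add: norm_mult norm_power q_def power_divide)
      then show "\<exists>N. \<forall>k\<ge>N. norm (norm (c k y * z $ i ^ k)) \<le> M * q i ^ k" by blast
    qed
    moreover have "(\<lambda>k. c k y * z $ i ^ k) sums F (y + axis i (z $ i))"
      using cauchy_coefficients[OF insert.prems(1), of 0 y r "z $ i" i] y r z
      by (simp add: c_def e_def divide_inverse)
    ultimately have outer: "((\<lambda>k. c k y * z $ i ^ k) has_sum F (y + axis i (z $ i))) UNIV"
      by (rule norm_summable_imp_has_sum)
    have "(\<lambda>\<alpha>. M * (\<Prod>j\<in>insert i S. q j ^ \<alpha> j)) summable_on multi_indices (insert i S)"
      by (intro summable_on_cmult_right summable_multi_geometric q) (use insert.hyps in auto)
    moreover have "cmod (?f (\<alpha> i, \<alpha>(i := 0))) \<le> M * (\<Prod>j\<in>insert i S. q j ^ \<alpha> j)"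
      if "\<alpha> \<in> multi_indices (insert i S)" for \<alpha>
    proof -
      have \<alpha>: "\<alpha>(i := 0) \<in> multi_indices S" using that insert.hyps by (auto simp: multi_indices_def)
      have "cmod (?f (\<alpha> i, \<alpha>(i := 0))) = cmod (d (\<alpha> i) (\<alpha>(i := 0))) * ((\<Prod>j\<in>S. cmod (z $ j) ^ \<alpha> j) * cmod (z $ i) ^ \<alpha> i)"
        using prod_fun_upd_other[OF insert.hyps(2), of "\<lambda>j m. z $ j ^ m" \<alpha> 0]
        by (simp add: norm_mult norm_power mult.assoc flip: prod_norm)
      also have "\<dots> \<le> M * (1/r)^\<alpha> i * (\<Prod>j\<in>S. (1/r) ^ (\<alpha>(i := 0)) j) * ((\<Prod>j\<in>S. cmod (z $ j) ^ \<alpha> j) * cmod (z $ i) ^ \<alpha> i)"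
        by (intro mult_right_mono d(1) \<alpha> mult_nonneg_nonneg prod_nonneg) auto
      also have "\<dots> = M * (\<Prod>j\<in>insert i S. q j ^ \<alpha> j)"
        using insert.hyps prod_fun_upd_other[OF insert.hyps(2), of "\<lambda>j m. (1/r) ^ m" \<alpha> 0]
        by (simp add: q_def power_divide prod_dividef divide_inverse prod.distrib power_mult_distrib prod_inversef power_inverse mult_ac)
      finally show ?thesis .
    qed
    ultimately have "(\<lambda>\<alpha>. norm (?f (\<alpha> i, \<alpha>(i := 0)))) summable_on multi_indices (insert i S)"
      by (rule Infinite_Sum.abs_summable_on_comparison_test')
    from abs_summable_summable[OF this]
    have "?f summable_on (UNIV \<times> multi_indices S)"
      by (subst (asm) summable_on_reindex_bij_betw[OF bij])
    moreover have "((\<lambda>\<alpha>. ?f (k, \<alpha>)) has_sum c k y * z $ i ^ k) (multi_indices S)" for k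
      using has_sum_cmult_left[OF d(2)[of z k], of "z $ i ^ k"] z by (simp add: y_def)
    ultimately have "(?f has_sum F (y + axis i (z $ i))) (UNIV \<times> multi_indices S)"
      using outer by (intro has_sum_SigmaI) auto
    then have "((\<lambda>\<alpha>. ?f (\<alpha> i, \<alpha>(i := 0))) has_sum F (y + axis i (z $ i))) (multi_indices (insert i S))"
      by (subst has_sum_reindex_bij_betw[OF bij])
    moreover have "?f (\<alpha> i, \<alpha>(i := 0)) = d (\<alpha> i) (\<alpha>(i := 0)) * (\<Prod>j\<in>insert i S. z $ j ^ \<alpha> j)" for \<alpha>
      using insert.hyps prod_fun_upd_other[OF insert.hyps(2), of "\<lambda>j m. z $ j ^ m" \<alpha> 0] by (simp add: mult_ac)
    moreover have "y + axis i (z $ i) = (\<chi> j. if j \<in> insert i S then z $ j else 0)"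
      using insert.hyps by (auto simp: y_def axis_def vec_eq_iff)
    ultimately show "((\<lambda>\<alpha>. d (\<alpha> i) (\<alpha>(i := 0)) * (\<Prod>j\<in>insert i S. z $ j ^ \<alpha> j)) has_sum
        F (\<chi> j. if j \<in> insert i S then z $ j else 0)) (multi_indices (insert i S))" by (simp only:)
  qed
qed

text \<open>The coefficients of the complex expansion about a real point are not known to be real.
  The monomials are real at real points, so replacing the coefficients by their real parts gives a
  series for the real function.\<close>

lemma real_analytic_on_of_holomorphic:
  fixes F :: "complex ^ 'n \<Rightarrow> complex"
  assumes F: "hol_family R (\<lambda>_. F)" and real: "\<And>x. norm x < R \<Longrightarrow> F (cvec x) = of_real (f x)"
  shows "real_analytic_on f (ball 0 R)"
  unfolding real_analytic_on_def
proof
  fix p :: "real ^ 'n" assume "p \<in> ball 0 R"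
  define R1 where "R1 = (R - norm p) / 2"
  have R1: "R1 > 0" "norm p + R1 < R" using \<open>p \<in> ball 0 R\<close> by (auto simp: R1_def field_simps)
  have shift: "cvec p + z \<in> ball 0 (norm p + R1)" if "z \<in> ball 0 R1" for z
    using norm_triangle_ineq[of "cvec p" z] that by simp
  have hol: "hol_family R1 (\<lambda>_ z. F (cvec p + z))"
  proof (rule hol_family_compose[OF F])
    show "hol_family R1 (\<lambda>t z. (cvec p + z) $ j)" for j
      using hol_family_add[OF hol_family_time[OF continuous_on_const] hol_family_coordinate] by simp
    show "cvec p + z \<in> ball 0 R" if "z \<in> ball 0 R1" for z using shift[OF that] R1 by simp
  qed
  have "compact ((\<lambda>z. F z) ` cball 0 (norm p + R1))"
    by (intro compact_continuous_image continuous_on_subset[OF hol_family_continuous_slice[OF F, of 0]]) (use R1 in auto)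
  then have "\<exists>M. \<forall>z\<in>cball 0 (norm p + R1). cmod (F z) \<le> M"
    using compact_imp_bounded[of "F ` cball 0 (norm p + R1)"] unfolding bounded_iff by blast
  then obtain M where M: "\<And>z. z \<in> cball 0 (norm p + R1) \<Longrightarrow> cmod (F z) \<le> M" by blast
  \<comment> \<open>Small enough for \<open>2 * r * CARD('n) < R1\<close>, the condition of
    \<open>multi_power_series\<close>.\<close>
  define r where "r = R1 / (3 * CARD('n))"
  have r: "r > 0" "2 * r * CARD('n) < R1" using R1 by (auto simp: r_def)
  obtain c where c: "\<And>z. (\<And>i. cmod (z $ i) < r) \<Longrightarrow>
      ((\<lambda>\<alpha>. c \<alpha> * (\<Prod>i\<in>UNIV. z $ i ^ \<alpha> i)) has_sum F (cvec p + z)) UNIV"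
  proof -
    have "cmod (F (cvec p + z)) \<le> M" if "z \<in> ball 0 R1" for z
      using M[of "cvec p + z"] shift[OF that] by simp
    from multi_power_series[OF finite[of UNIV] r(1) hol r(2) this] show ?thesis
      using that by auto
  qed
  show "\<exists>c. \<exists>\<epsilon>>0. \<forall>x\<in>ball p \<epsilon>. ((\<lambda>\<alpha>. c \<alpha> * (\<Prod>i\<in>UNIV. (x $ i - p $ i) ^ \<alpha> i)) has_sum f x) UNIV"
  proof (intro exI[of _ "\<lambda>\<alpha>. Re (c \<alpha>)"] exI[of _ "min r R1"] conjI ballI)
    fix x assume x: "x \<in> ball p (min r R1)"
    have "\<bar>(x - p) $ i\<bar> < r" for i
      using component_le_norm_cart[of "x - p" i] x by (simp add: dist_norm norm_minus_commute)
    then have "cmod (cvec (x - p) $ i) < r" for i by (simp only: cvec_nth norm_of_real)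
    then have "((\<lambda>\<alpha>. c \<alpha> * (\<Prod>i\<in>UNIV. cvec (x - p) $ i ^ \<alpha> i)) has_sum F (cvec p + cvec (x - p))) UNIV"
      by (rule c)
    from has_sum_Re[OF this]
    have "((\<lambda>\<alpha>. Re (c \<alpha> * (\<Prod>i\<in>UNIV. cvec (x - p) $ i ^ \<alpha> i))) has_sum Re (F (cvec x))) UNIV"
      by (simp flip: cvec_add)
    moreover have "(\<Prod>i\<in>UNIV. cvec (x - p) $ i ^ \<alpha> i) = complex_of_real (\<Prod>i\<in>UNIV. (x $ i - p $ i) ^ \<alpha> i)" for \<alpha>
      by simp
    moreover have "norm x < R"
      using norm_triangle_ineq[of p "x - p"] x R1 by (simp add: dist_norm norm_minus_commute)
    ultimately show "((\<lambda>\<alpha>. Re (c \<alpha>) * (\<Prod>i\<in>UNIV. (x $ i - p $ i) ^ \<alpha> i)) has_sum f x) UNIV"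
      using real by (simp del: of_real_prod of_real_diff)
  qed (use r R1 in auto)
qed

text \<open>Convergence at the single real point with all coordinates equal to \<open>R\<close> is
  absolute, and it dominates the complexified series wherever all coordinates have modulus at most
  \<open>R\<close>; the M-test then gives continuity and holomorphy.\<close>

lemma holomorphic_extension:
  fixes f :: "real ^ 'n \<Rightarrow> real"
  assumes f: "real_analytic_on f U" and "0 \<in> U"
  obtains R F where "R > 0" "hol_family R (\<lambda>_. F)" "\<And>x. norm x < R \<Longrightarrow> F (cvec x) = of_real (f x)"
proof -
  obtain c :: "('n \<Rightarrow> nat) \<Rightarrow> real" and \<epsilon> where \<epsilon>: "\<epsilon> > 0"
    and c: "\<And>x. x \<in> ball 0 \<epsilon> \<Longrightarrow> ((\<lambda>\<alpha>. c \<alpha> * (\<Prod>i\<in>UNIV. (x $ i - 0 $ i) ^ \<alpha> i)) has_sum f x) UNIV"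
    using f \<open>0 \<in> U\<close> unfolding real_analytic_on_def by blast
  \<comment> \<open>Makes the norm of the point with all coordinates \<open>R\<close> at most
    \<open>\<epsilon> / 2\<close>, inside the ball of convergence.\<close>
  define R where "R = \<epsilon> / (2 * CARD('n))"
  have R: "R > 0" using \<epsilon> by (simp add: R_def)
  have R_le: "R \<le> \<epsilon>"
  proof -
    have "real CARD('n) \<ge> 1" using zero_less_card_finite[where 'a='n] by linarith
    then have "\<epsilon> * 1 \<le> \<epsilon> * (2 * CARD('n))" using \<epsilon> by (intro mult_left_mono) linarith+
    then show ?thesis by (simp add: R_def divide_le_eq)
  qed
  define x0 :: "real ^ 'n" where "x0 = (\<chi> i. R)"
  have "norm x0 \<le> (\<Sum>i\<in>UNIV. norm (x0 $ i))" by (simp add: norm_vec_def L2_set_le_sum)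
  also have "\<dots> = \<epsilon> / 2" using \<epsilon> by (simp add: x0_def R_def)
  also have "\<dots> < \<epsilon>" using \<epsilon> by simp
  finally have "(\<lambda>\<alpha>. c \<alpha> * (\<Prod>i\<in>UNIV. R ^ \<alpha> i)) summable_on UNIV"
    using c[of x0] by (auto simp: summable_on_def x0_def)
  then have summ: "(\<lambda>\<alpha>. norm (c \<alpha> * (\<Prod>i\<in>UNIV. R ^ \<alpha> i))) summable_on UNIV"
    by (rule summable_on_iff_abs_summable_on_real[THEN iffD1])
  define T where "T = (\<lambda>\<alpha> (z :: complex ^ 'n). of_real (c \<alpha>) * (\<Prod>i\<in>UNIV. z $ i ^ \<alpha> i))"
  have T_le: "norm (T \<alpha> z) \<le> norm (c \<alpha> * (\<Prod>i\<in>UNIV. R ^ \<alpha> i))" if "z \<in> ball 0 R" for \<alpha> z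
  proof -
    have "cmod (z $ i) \<le> R" for i
      using Finite_Cartesian_Product.norm_nth_le[of z i] that by simp
    then have "(\<Prod>i\<in>UNIV. cmod (z $ i) ^ \<alpha> i) \<le> (\<Prod>i\<in>UNIV. R ^ \<alpha> i)"
      by (intro prod_mono) (auto intro!: power_mono)
    then show ?thesis using R
      by (simp add: T_def norm_mult abs_mult norm_power prod_nonneg mult_left_mono flip: prod_norm)
  qed
  have ul: "uniform_limit (ball 0 R) (\<lambda>A z. \<Sum>\<alpha>\<in>A. T \<alpha> z) (\<lambda>z. \<Sum>\<^sub>\<infinity>\<alpha>\<in>UNIV. T \<alpha> z) (finite_subsets_at_top UNIV)"
    by (rule Weierstrass_m_test_general[OF T_le summ])
  have T_cont: "continuous_on S (T \<alpha>)" for \<alpha> S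
    unfolding T_def by (intro continuous_intros)
  define F where "F = (\<lambda>z. \<Sum>\<^sub>\<infinity>\<alpha>\<in>UNIV. T \<alpha> z)"
  have F_cont: "continuous_on (ball 0 R) F"
    unfolding F_def by (rule uniform_limit_theorem[OF _ ul]) (auto intro!: always_eventually continuous_on_sum T_cont)
  show ?thesis
  proof (rule that[OF R, of F])
    show "hol_family R (\<lambda>_. F)"
    proof (rule hol_familyI)
      show "cont_family (ball 0 R) (\<lambda>t z. F z)"
        using continuous_on_compose2[OF F_cont continuous_on_snd[OF continuous_on_id], of "{0..1::real} \<times> ball 0 R"]
        by (simp add: case_prod_beta image_subset_iff)
      fix z :: "complex ^ 'n" and i assume z: "z \<in> ball 0 R"
      define d where "d = (R - norm z) / 2"
      have d: "d > 0" "norm z + d < R" using z by (auto simp: d_def field_simps)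
      have in_ball: "z + axis i u \<in> ball 0 R" if "u \<in> cball 0 d" for u
        using norm_triangle_ineq[of z "axis i u"] d that by (simp add: norm_axis_complex)
      have "(\<lambda>u. F (z + axis i u)) holomorphic_on ball 0 d"
      proof (rule holomorphic_uniform_limit)
        show "uniform_limit (cball 0 d) (\<lambda>A u. \<Sum>\<alpha>\<in>A. T \<alpha> (z + axis i u)) (\<lambda>u. F (z + axis i u)) (finite_subsets_at_top UNIV)"
        proof (rule uniform_limitI)
          fix \<epsilon>' :: real assume "\<epsilon>' > 0"
          from uniform_limitD[OF ul this]
          show "\<forall>\<^sub>F A in finite_subsets_at_top UNIV. \<forall>u\<in>cball 0 d.
              dist (\<Sum>\<alpha>\<in>A. T \<alpha> (z + axis i u)) (F (z + axis i u)) < \<epsilon>'"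
            unfolding F_def by (rule eventually_mono) (use in_ball in blast)
        qed
        have "(\<lambda>u. T \<alpha> (z + axis i u)) holomorphic_on UNIV" for \<alpha>
        proof -
          have "(\<lambda>u. (z + axis i u) $ j) holomorphic_on UNIV" for j
            by (cases "j = i") (auto simp: axis_def intro!: holomorphic_intros)
          then show ?thesis unfolding T_def by (intro holomorphic_intros) auto
        qed
        then have h: "(\<lambda>u. T \<alpha> (z + axis i u)) holomorphic_on S" for \<alpha> S
          by (rule holomorphic_on_subset) simp
        show "\<forall>\<^sub>F A in finite_subsets_at_top UNIV. continuous_on (cball 0 d) (\<lambda>u. \<Sum>\<alpha>\<in>A. T \<alpha> (z + axis i u)) \<and>
            (\<lambda>u. \<Sum>\<alpha>\<in>A. T \<alpha> (z + axis i u)) holomorphic_on ball 0 d"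
          by (intro always_eventually allI conjI holomorphic_on_imp_continuous_on holomorphic_on_sum h)
      qed auto
      then show "(\<lambda>u. F (z + axis i u)) field_differentiable (at 0)"
        using d by (simp add: holomorphic_on_imp_differentiable_at)
    qed
    fix x :: "real ^ 'n" assume "norm x < R"
    then have "((\<lambda>\<alpha>. c \<alpha> * (\<Prod>i\<in>UNIV. x $ i ^ \<alpha> i)) has_sum f x) UNIV"
      using c[of x] R_le by simp
    from has_sum_of_real[OF this, where 'a=complex]
    have "((\<lambda>\<alpha>. T \<alpha> (cvec x)) has_sum of_real (f x)) UNIV" by (simp add: T_def)
    then show "F (cvec x) = of_real (f x)" unfolding F_def by (rule infsumI)
  qed
qed

section \<open>Time-dependent families of germs\<close>

text \<open>The radius is common to all times, and in the smooth case also to all orders of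
  differentiation. In the analytic case it is the holomorphic extension, not the power series, that
  accompanies the family.\<close>

fun germ_family :: "regularity \<Rightarrow> (real \<Rightarrow> real ^ 'n \<Rightarrow> real) \<Rightarrow> bool" where
  "germ_family Smooth f \<longleftrightarrow> (\<exists>e>0. \<forall>k. jet_on k f (ball 0 e))"
| "germ_family Analytic f \<longleftrightarrow> (\<exists>R>0. \<exists>F. hol_family R F \<and>
     (\<forall>t\<in>{0..1}. \<forall>x. norm x < R \<longrightarrow> F t (cvec x) = of_real (f t x)))"

lemma germ_family_AnalyticE:
  assumes "germ_family Analytic f"
  obtains R F where "R > 0" "hol_family R F" "\<And>t x. t \<in> {0..1} \<Longrightarrow> norm x < R \<Longrightarrow> F t (cvec x) = of_real (f t x)"
  using assms by auto

lemma germ_family_AnalyticI: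
  assumes "R > 0" "hol_family R F" "\<And>t x. t \<in> {0..1} \<Longrightarrow> norm x < R \<Longrightarrow> F t (cvec x) = of_real (f t x)"
  shows "germ_family Analytic f"
  using assms unfolding germ_family.simps by blast

lemma germ_family_SmoothE:
  assumes "germ_family Smooth f"
  obtains e where "e > 0" "\<And>k. jet_on k f (ball 0 e)"
  using assms by auto

lemma germ_family_SmoothI: "e > 0 \<Longrightarrow> (\<And>k. jet_on k f (ball 0 e)) \<Longrightarrow> germ_family Smooth f"
  by auto

declare germ_family.simps [simp del]

lemma uniform_radius:
  fixes P :: "'i::finite \<Rightarrow> real \<Rightarrow> bool"
  assumes ex: "\<And>i. \<exists>e>0. P i e" and mono: "\<And>i e e'. P i e \<Longrightarrow> 0 < e' \<Longrightarrow> e' \<le> e \<Longrightarrow> P i e'"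
  shows "\<exists>e>0. \<forall>i. P i e"
proof -
  from ex have "\<forall>i. \<exists>e. e > 0 \<and> P i e" by blast
  from choice[OF this] obtain e where e: "\<And>i. e i > 0 \<and> P i (e i)" by blast
  define d where "d = Min (range e)"
  have d: "d > 0" "\<And>i. d \<le> e i" using e by (auto simp: d_def)
  have "P i d" for i using mono[of i "e i" d] e d by blast
  then show ?thesis using d by blast
qed

lemma germ_family_cong:
  assumes f: "germ_family r f" and e: "e > 0" "\<And>t x. t \<in> {0..1} \<Longrightarrow> x \<in> ball 0 e \<Longrightarrow> f t x = g t x"
  shows "germ_family r g"
proof (cases r)
  case Smooth
  obtain d where d: "d > 0" "\<And>k. jet_on k f (ball 0 d)" using f[unfolded Smooth] by (rule germ_family_SmoothE) (rule that)
  have "jet_on k g (ball 0 (min d e))" for k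
    by (rule jet_on_cong[OF open_ball _ jet_on_subset[OF d(2)]]) (use e in auto)
  then show ?thesis unfolding Smooth using d e by (intro germ_family_SmoothI[of "min d e"]) auto
next
  case Analytic
  obtain R F where F: "R > 0" "hol_family R F" "\<And>t x. t \<in> {0..1} \<Longrightarrow> norm x < R \<Longrightarrow> F t (cvec x) = of_real (f t x)"
    using f[unfolded Analytic] by (rule germ_family_AnalyticE) (rule that)
  show ?thesis unfolding Analytic
    by (rule germ_family_AnalyticI[of "min R e", OF _ hol_family_subset[OF F(2)]]) (use F e in auto)
qed

lemma jet_on_of_Ck_on:
  assumes U: "open U"
  shows "Ck_on k f U \<Longrightarrow> jet_on k (\<lambda>t. f) U"
proof (induction k arbitrary: f)
  case 0
  then have "continuous_on U f" by simp
  from continuous_on_compose2[OF this continuous_on_snd[OF continuous_on_id], of "{0..1::real} \<times> U"]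
  show ?case by (simp add: case_prod_beta image_subset_iff)
next
  case (Suc k)
  have diff: "f differentiable_on U" and parts: "\<And>i. Ck_on k (\<lambda>x. frechet_derivative f (at x) (axis i 1)) U"
    using Suc.prems by auto
  have "continuous_on U f" by (rule differentiable_imp_continuous_on[OF diff])
  from continuous_on_compose2[OF this continuous_on_snd[OF continuous_on_id], of "{0..1::real} \<times> U"]
  have c: "cont_family U (\<lambda>t x. f x)" by (simp add: case_prod_beta image_subset_iff)
  show ?case
  proof (rule jet_on_SucI[OF c _ Suc.IH[OF parts]])
    fix t x assume x: "x \<in> U"
    have "f differentiable (at x)" using diff x U by (simp add: differentiable_on_eq_differentiable_at)
    then have d: "(f has_derivative frechet_derivative f (at x)) (at x)" by (simp add: frechet_derivative_works)
    have lin: "linear (frechet_derivative f (at x))" using d has_derivative_linear by blast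
    have "frechet_derivative f (at x) h = (\<Sum>i\<in>UNIV. frechet_derivative f (at x) (axis i 1) * h $ i)" for h
    proof -
      have "frechet_derivative f (at x) h = frechet_derivative f (at x) (\<Sum>i\<in>UNIV. h $ i *\<^sub>R axis i 1)"
        using basis_expansion[of h] by (simp add: scalar_mult_eq_scaleR)
      then show ?thesis by (simp add: linear_sum[OF lin] linear_scale[OF lin] mult.commute)
    qed
    then have "frechet_derivative f (at x) = (\<lambda>h. \<Sum>i\<in>UNIV. frechet_derivative f (at x) (axis i 1) * h $ i)" by (rule ext)
    with d show "has_gradient f (\<lambda>i. frechet_derivative f (at x) (axis i 1)) x" by (rule subst[rotated])
  qed
qed

lemma Ck_on_of_jet_on:
  assumes U: "open U"
  shows "jet_on k (\<lambda>t. f) U \<Longrightarrow> Ck_on k f U"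
proof (induction k arbitrary: f)
  case 0
  from continuous_on_compose2[OF jet_on_continuous[OF this], of U "\<lambda>x. (0, x)"]
  show ?case by (simp add: continuous_on_Pair continuous_on_id image_subset_iff)
next
  case (Suc k)
  obtain g where g: "\<And>t x. t \<in> {0..1} \<Longrightarrow> x \<in> U \<Longrightarrow> has_gradient f (\<lambda>i. g i t x) x"
    "\<And>i. jet_on k (g i) U" using Suc.prems by (rule jet_on_SucE) (rule that)
  have fd: "frechet_derivative f (at x) (axis i 1) = g i t x" if "t \<in> {0..1}" "x \<in> U" for t x i
    by (simp add: frechet_derivative_at[OF g(1)[OF that], symmetric] axis_def if_distrib[of "\<lambda>c. _ * c"] cong: if_cong)
  have "f differentiable_on U"
    using g(1)[of 0] unfolding differentiable_on_def differentiable_def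
    by (meson atLeastAtMost_iff has_derivative_at_withinI order_refl zero_le_one)
  moreover have "Ck_on k (\<lambda>x. frechet_derivative f (at x) (axis i 1)) U" for i
    by (rule Suc.IH, rule jet_on_cong[OF U _ g(2)[of i]]) (simp add: fd)
  ultimately show ?case by simp
qed

lemma hol_family_at_time:
  assumes "hol_family R F" "t \<in> {0..1}"
  shows "hol_family R (\<lambda>_. F t)"
proof (rule hol_familyI)
  have "continuous_on ({0..1::real} \<times> ball 0 R) (\<lambda>p. F t (snd p))"
    by (rule continuous_on_compose2[OF hol_family_continuous_slice[OF assms] continuous_on_snd[OF continuous_on_id]]) auto
  then show "cont_family (ball 0 R) (\<lambda>_ z. F t z)" by (simp add: case_prod_beta)
qed (rule hol_family_differentiable[OF assms])

text \<open>Through this equivalence the closure properties of families become those of germs; its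
  analytic half is the passage between power series and holomorphic extensions.\<close>

lemma germ_family_constant_iff: "germ_family r (\<lambda>_. f) \<longleftrightarrow> fun_germ r f"
proof (cases r)
  case Smooth
  show ?thesis
  proof
    assume "germ_family r (\<lambda>_. f)"
    then obtain e where "e > 0" "\<And>k. jet_on k (\<lambda>_. f) (ball 0 e)" unfolding Smooth by (rule germ_family_SmoothE) (rule that)
    then show "fun_germ r f" unfolding fun_germ_def Smooth
      by (intro exI[of _ "ball 0 e"]) (simp add: smooth_on_def Ck_on_of_jet_on)
  next
    assume "fun_germ r f"
    then obtain U where U: "open U" "0 \<in> U" "smooth_on f U" unfolding fun_germ_def Smooth by auto
    obtain e where e: "e > 0" "ball 0 e \<subseteq> U" using U openE by blast
    have "jet_on k (\<lambda>_. f) (ball 0 e)" for k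
      by (rule jet_on_subset[OF jet_on_of_Ck_on[OF U(1)] e(2)]) (use U(3) in \<open>simp add: smooth_on_def\<close>)
    then show "germ_family r (\<lambda>_. f)" unfolding Smooth by (rule germ_family_SmoothI[OF e(1)])
  qed
next
  case Analytic
  show ?thesis
  proof
    assume "germ_family r (\<lambda>_. f)"
    then obtain R F where F: "R > 0" "hol_family R F" "\<And>t x. t \<in> {0..1} \<Longrightarrow> norm x < R \<Longrightarrow> F t (cvec x) = of_real (f x)"
      unfolding Analytic by (rule germ_family_AnalyticE) (rule that)
    have "real_analytic_on f (ball 0 R)"
      by (rule real_analytic_on_of_holomorphic[OF hol_family_at_time[OF F(2), of 0]]) (use F(3) in auto)
    then show "fun_germ r f" unfolding fun_germ_def Analytic using F(1) by (intro exI[of _ "ball 0 R"]) simp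
  next
    assume "fun_germ r f"
    then obtain U where U: "open U" "0 \<in> U" "real_analytic_on f U" unfolding fun_germ_def Analytic by auto
    obtain R F where "R > 0" "hol_family R (\<lambda>_. F)" "\<And>x. norm x < R \<Longrightarrow> F (cvec x) = of_real (f x)"
      by (rule holomorphic_extension[OF U(3,2)]) (rule that)
    then show "germ_family r (\<lambda>_. f)" unfolding Analytic by (rule germ_family_AnalyticI)
  qed
qed

lemma continuous_on_reparametrize:
  fixes f :: "real \<Rightarrow> 'a::topological_space \<Rightarrow> 'b::topological_space"
  assumes \<theta>: "continuous_on {0..1} \<theta>" "\<And>t. t \<in> {0..1} \<Longrightarrow> \<theta> t \<in> {0..1}"
    and f: "cont_family U f"
  shows "cont_family U (\<lambda>t x. f (\<theta> t) x)"
proof -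
  have "continuous_on ({0..1} \<times> U) (\<lambda>p. \<theta> (fst p))"
    by (rule continuous_on_compose2[OF \<theta>(1) continuous_on_fst[OF continuous_on_id]]) auto
  then have "continuous_on ({0..1} \<times> U) (\<lambda>p. (\<theta> (fst p), snd p))"
    by (rule continuous_on_Pair[OF _ continuous_on_snd[OF continuous_on_id]])
  moreover have "(\<lambda>p. (\<theta> (fst p), snd p)) ` ({0..1} \<times> U) \<subseteq> {0..1} \<times> U"
    using \<theta>(2) by (auto simp del: atLeastAtMost_iff)
  ultimately have "continuous_on ({0..1} \<times> U) (\<lambda>p. (\<lambda>(t, x). f t x) (\<theta> (fst p), snd p))"
    by (rule continuous_on_compose2[OF f])
  then show ?thesis by (simp add: case_prod_beta)
qed

lemma jet_on_reparametrize:
  assumes \<theta>: "continuous_on {0..1} \<theta>" "\<And>t. t \<in> {0..1} \<Longrightarrow> \<theta> t \<in> {0..1}"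
  shows "jet_on k f U \<Longrightarrow> jet_on k (\<lambda>t. f (\<theta> t)) U"
proof (induction k arbitrary: f)
  have c: "cont_family U (\<lambda>t x. f (\<theta> t) x)" if "jet_on k f U" for k f
  proof -
    show ?thesis by (rule continuous_on_reparametrize[OF \<theta> jet_on_continuous[OF that]])
  qed
  { case 0
    then show ?case using c[of 0 f] by simp
  next
    case (Suc k)
    obtain g where g: "\<And>t x. t \<in> {0..1} \<Longrightarrow> x \<in> U \<Longrightarrow> has_gradient (f t) (\<lambda>i. g i t x) x"
      "\<And>i. jet_on k (g i) U" using Suc.prems by (rule jet_on_SucE) (rule that)
    show ?case
      by (rule jet_on_SucI[OF c[OF Suc.prems] g(1)[OF \<theta>(2)] Suc.IH[OF g(2)]])
  }
qed

lemma hol_family_reparametrize: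
  assumes \<theta>: "continuous_on {0..1} \<theta>" "\<And>t. t \<in> {0..1} \<Longrightarrow> \<theta> t \<in> {0..1}" and F: "hol_family R F"
  shows "hol_family R (\<lambda>t. F (\<theta> t))"
proof (rule hol_familyI)
  show "cont_family (ball 0 R) (\<lambda>t x. F (\<theta> t) x)"
    by (rule continuous_on_reparametrize[OF \<theta> hol_family_continuous[OF F]])
qed (rule hol_family_differentiable[OF F \<theta>(2)])

text \<open>Applied with a constant \<theta>, which freezes the time, and with
  \<open>\<theta> t = 1 - t\<close>, which reverses it for the inverse flow.\<close>

lemma germ_family_reparametrize:
  assumes \<theta>: "continuous_on {0..1} \<theta>" "\<And>t. t \<in> {0..1} \<Longrightarrow> \<theta> t \<in> {0..1}" and f: "germ_family r f"
  shows "germ_family r (\<lambda>t. f (\<theta> t))"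
proof (cases r)
  case Smooth
  obtain d where d: "d > 0" "\<And>k. jet_on k f (ball 0 d)" using f[unfolded Smooth] by (rule germ_family_SmoothE) (rule that)
  show ?thesis unfolding Smooth
    by (rule germ_family_SmoothI[OF d(1) jet_on_reparametrize[OF \<theta> d(2)]])
next
  case Analytic
  obtain R F where F: "R > 0" "hol_family R F" "\<And>t x. t \<in> {0..1} \<Longrightarrow> norm x < R \<Longrightarrow> F t (cvec x) = of_real (f t x)"
    using f[unfolded Analytic] by (rule germ_family_AnalyticE) (rule that)
  show ?thesis unfolding Analytic
    by (rule germ_family_AnalyticI[OF F(1) hol_family_reparametrize[OF \<theta> F(2)] F(3)[OF \<theta>(2)]])
qed

lemma fun_germ_at_time: "germ_family r f \<Longrightarrow> t \<in> {0..1} \<Longrightarrow> fun_germ r (f t)"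
  using germ_family_reparametrize[of "\<lambda>_. t" r f] by (simp add: germ_family_constant_iff)

section \<open>Arithmetic, substitution, integration and differentiation of families of
  germs\<close>

lemma germ_family_time:
  assumes "continuous_on {0..1} c"
  shows "germ_family r (\<lambda>t x. c t)"
proof (cases r)
  case Smooth
  show ?thesis unfolding Smooth by (rule germ_family_SmoothI[of 1]) (use jet_on_time[OF assms] in auto)
next
  case Analytic
  show ?thesis unfolding Analytic
    by (rule germ_family_AnalyticI[of 1 "\<lambda>t z. of_real (c t)"]) (auto intro!: hol_family_time continuous_on_of_real assms)
qed

lemma germ_family_const: "germ_family r (\<lambda>t x. c)"
  by (rule germ_family_time) simp

lemma germ_family_coordinate: "germ_family r (\<lambda>t x. x $ i)"
proof (cases r)
  case Smooth
  show ?thesis unfolding Smooth by (rule germ_family_SmoothI[of 1]) (use jet_on_coordinate in auto)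
next
  case Analytic
  show ?thesis unfolding Analytic
    by (rule germ_family_AnalyticI[of 1 "\<lambda>t z. z $ i"]) (auto intro: hol_family_coordinate)
qed

lemma germ_family_add:
  assumes f: "germ_family r f" and g: "germ_family r g"
  shows "germ_family r (\<lambda>t x. f t x + g t x)"
proof (cases r)
  case Smooth
  obtain d where d: "d > 0" "\<And>k. jet_on k f (ball 0 d)" using f[unfolded Smooth] by (rule germ_family_SmoothE) (rule that)
  obtain e where e: "e > 0" "\<And>k. jet_on k g (ball 0 e)" using g[unfolded Smooth] by (rule germ_family_SmoothE) (rule that)
  have "jet_on k (\<lambda>t x. f t x + g t x) (ball 0 (min d e))" for k
    by (intro jet_on_add jet_on_subset[OF d(2)] jet_on_subset[OF e(2)]) auto
  then show ?thesis unfolding Smooth using d e by (intro germ_family_SmoothI[of "min d e"]) auto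
next
  case Analytic
  obtain R F where F: "R > 0" "hol_family R F" "\<And>t x. t \<in> {0..1} \<Longrightarrow> norm x < R \<Longrightarrow> F t (cvec x) = of_real (f t x)"
    using f[unfolded Analytic] by (rule germ_family_AnalyticE) (rule that)
  obtain S G where G: "S > 0" "hol_family S G" "\<And>t x. t \<in> {0..1} \<Longrightarrow> norm x < S \<Longrightarrow> G t (cvec x) = of_real (g t x)"
    using g[unfolded Analytic] by (rule germ_family_AnalyticE) (rule that)
  show ?thesis unfolding Analytic
    by (rule germ_family_AnalyticI[of "min R S" "\<lambda>t z. F t z + G t z", OF _ hol_family_add[OF hol_family_subset[OF F(2)] hol_family_subset[OF G(2)]]])
      (use F G in auto)
qed

lemma germ_family_mult:
  assumes f: "germ_family r f" and g: "germ_family r g"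
  shows "germ_family r (\<lambda>t x. f t x * g t x)"
proof (cases r)
  case Smooth
  obtain d where d: "d > 0" "\<And>k. jet_on k f (ball 0 d)" using f[unfolded Smooth] by (rule germ_family_SmoothE) (rule that)
  obtain e where e: "e > 0" "\<And>k. jet_on k g (ball 0 e)" using g[unfolded Smooth] by (rule germ_family_SmoothE) (rule that)
  have "jet_on k (\<lambda>t x. f t x * g t x) (ball 0 (min d e))" for k
    by (intro jet_on_mult jet_on_subset[OF d(2)] jet_on_subset[OF e(2)]) auto
  then show ?thesis unfolding Smooth using d e by (intro germ_family_SmoothI[of "min d e"]) auto
next
  case Analytic
  obtain R F where F: "R > 0" "hol_family R F" "\<And>t x. t \<in> {0..1} \<Longrightarrow> norm x < R \<Longrightarrow> F t (cvec x) = of_real (f t x)"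
    using f[unfolded Analytic] by (rule germ_family_AnalyticE) (rule that)
  obtain S G where G: "S > 0" "hol_family S G" "\<And>t x. t \<in> {0..1} \<Longrightarrow> norm x < S \<Longrightarrow> G t (cvec x) = of_real (g t x)"
    using g[unfolded Analytic] by (rule germ_family_AnalyticE) (rule that)
  show ?thesis unfolding Analytic
    by (rule germ_family_AnalyticI[of "min R S" "\<lambda>t z. F t z * G t z", OF _ hol_family_mult[OF hol_family_subset[OF F(2)] hol_family_subset[OF G(2)]]])
      (use F G in auto)
qed

lemma germ_family_cmult: "germ_family r f \<Longrightarrow> germ_family r (\<lambda>t x. c * f t x)"
  by (rule germ_family_mult[OF germ_family_const])

lemma germ_family_minus: "germ_family r f \<Longrightarrow> germ_family r (\<lambda>t x. - f t x)"
  using germ_family_cmult[of r f "- 1"] by simp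

lemma germ_family_diff: "germ_family r f \<Longrightarrow> germ_family r g \<Longrightarrow> germ_family r (\<lambda>t x. f t x - g t x)"
  using germ_family_add[OF _ germ_family_minus, of r f g] by simp

lemma germ_family_sum: "(\<And>i. i \<in> I \<Longrightarrow> germ_family r (f i)) \<Longrightarrow> germ_family r (\<lambda>t x. \<Sum>i\<in>I. f i t x)"
proof (induction I rule: infinite_finite_induct)
  case (insert i I)
  then show ?case using germ_family_add[of r "f i" "\<lambda>t x. \<Sum>i\<in>I. f i t x"] by simp
qed (use germ_family_const[of r 0] in auto)

lemma germ_family_prod: "(\<And>i. i \<in> I \<Longrightarrow> germ_family r (f i)) \<Longrightarrow> germ_family r (\<lambda>t x. \<Prod>i\<in>I. f i t x)"
proof (induction I rule: infinite_finite_induct)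
  case (insert i I)
  then show ?case using germ_family_mult[of r "f i" "\<lambda>t x. \<Prod>i\<in>I. f i t x"] by simp
qed (use germ_family_const[of r 1] in auto)

lemma germ_family_continuous:
  assumes "germ_family r f"
  obtains e where "e > 0" "cont_family (ball 0 e) f"
proof (cases r)
  case Smooth
  obtain d where d: "d > 0" "\<And>k. jet_on k f (ball 0 d)" using assms[unfolded Smooth] by (rule germ_family_SmoothE) (rule that)
  then show ?thesis using that jet_on_continuous by blast
next
  case Analytic
  obtain R F where F: "R > 0" "hol_family R F" "\<And>t x. t \<in> {0..1} \<Longrightarrow> norm x < R \<Longrightarrow> F t (cvec x) = of_real (f t x)"
    using assms[unfolded Analytic] by (rule germ_family_AnalyticE) (rule that)
  have "continuous_on ({0..1} \<times> ball 0 R) (\<lambda>p. (\<lambda>(t, z). F t z) (fst p, cvec (snd p)))"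
    by (rule continuous_on_compose2[OF hol_family_continuous[OF F(2)]])
      (auto intro!: continuous_on_Pair continuous_on_fst continuous_on_snd continuous_on_id
        bounded_linear.continuous_on[OF bounded_linear_cvec])
  from continuous_on_Re[OF this] have "continuous_on ({0..1} \<times> ball 0 R) (\<lambda>p. Re (F (fst p) (cvec (snd p))))" by simp
  then have "cont_family (ball 0 R) f"
    by (rule continuous_on_eq) (auto simp: F(3))
  then show ?thesis using F(1) that by blast
qed

text \<open>Nonvanishing at \<open>0\<close> spreads by the tube lemma to a ball valid for all
  times; in the analytic case to a complex ball, for the extension.\<close>

lemma germ_family_inverse:
  fixes f :: "real \<Rightarrow> real ^ 'n \<Rightarrow> real"
  assumes f: "germ_family r f" and nz: "\<And>t. t \<in> {0..1} \<Longrightarrow> f t 0 \<noteq> 0"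
  shows "germ_family r (\<lambda>t x. inverse (f t x))"
proof (cases r)
  case Smooth
  obtain d where d: "d > 0" "\<And>k. jet_on k f (ball 0 d)" using f[unfolded Smooth] by (rule germ_family_SmoothE) (rule that)
  obtain e where e: "e > 0" "\<And>t x. t \<in> {0..1} \<Longrightarrow> x \<in> ball 0 e \<Longrightarrow> (\<lambda>(t, x). f t x) (t, x) \<in> - {0}"
    by (rule tube_unit_interval[OF jet_on_continuous[OF d(2)[of 0]] open_ball, of 0 "- {0}"]) (use d nz that in auto)
  have "jet_on k (\<lambda>t x. inverse (f t x)) (ball 0 (min d e))" for k
    by (rule jet_on_inverse[OF jet_on_subset[OF d(2)]]) (use e in force)+
  then show ?thesis unfolding Smooth using d e by (intro germ_family_SmoothI[of "min d e"]) auto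
next
  case Analytic
  obtain R F where F: "R > 0" "hol_family R F" "\<And>t x. t \<in> {0..1} \<Longrightarrow> norm x < R \<Longrightarrow> F t (cvec x) = of_real (f t x)"
    using f[unfolded Analytic] by (rule germ_family_AnalyticE) (rule that)
  have nz': "F t 0 \<noteq> 0" if "t \<in> {0..1}" for t using F(3)[OF that, of 0] F(1) nz[OF that] by simp
  obtain e where e: "e > 0" "\<And>t x. t \<in> {0..1} \<Longrightarrow> x \<in> ball 0 e \<Longrightarrow> (\<lambda>(t, x). F t x) (t, x) \<in> - {0}"
    by (rule tube_unit_interval[OF hol_family_continuous[OF F(2)] open_ball, of 0 "- {0}"]) (use F nz' that in auto)
  show ?thesis unfolding Analytic
    by (rule germ_family_AnalyticI[of "min R e" "\<lambda>t z. inverse (F t z)", OF _ hol_family_inverse[OF hol_family_subset[OF F(2)]]])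
      (use F e in \<open>force+\<close>)
qed

lemma germ_family_vec_AnalyticE:
  fixes g :: "real \<Rightarrow> real ^ 'm \<Rightarrow> real ^ 'n"
  assumes g: "\<And>j. germ_family Analytic (\<lambda>t x. g t x $ j)"
  obtains R G where "R > 0" "\<And>j. hol_family R (\<lambda>t z. G t z $ j)" "\<And>t x. t \<in> {0..1} \<Longrightarrow> norm x < R \<Longrightarrow> G t (cvec x) = cvec (g t x)"
proof -
  have "\<exists>R>0. \<forall>j. \<exists>F. hol_family R F \<and> (\<forall>t\<in>{0..1}. \<forall>x. norm x < R \<longrightarrow> F t (cvec x) = of_real (g t x $ j))"
  proof (rule uniform_radius)
    show "\<exists>R>0. \<exists>F. hol_family R F \<and> (\<forall>t\<in>{0..1}. \<forall>x. norm x < R \<longrightarrow> F t (cvec x) = of_real (g t x $ j))" for j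
      using g[of j] unfolding germ_family.simps .
    fix j and R R' :: real assume "\<exists>F. hol_family R F \<and> (\<forall>t\<in>{0..1}. \<forall>x. norm x < R \<longrightarrow> F t (cvec x) = of_real (g t x $ j))"
      and "R' \<le> R"
    then show "\<exists>F. hol_family R' F \<and> (\<forall>t\<in>{0..1}. \<forall>x. norm x < R' \<longrightarrow> F t (cvec x) = of_real (g t x $ j))"
      using hol_family_subset by (meson less_le_trans)
  qed
  then obtain R where R: "R > 0" "\<forall>j. \<exists>F. hol_family R F \<and> (\<forall>t\<in>{0..1}. \<forall>x. norm x < R \<longrightarrow> F t (cvec x) = of_real (g t x $ j))"
    by blast
  from choice[OF R(2)] obtain F where F: "\<And>j. hol_family R (F j)"
    "\<And>j t x. t \<in> {0..1} \<Longrightarrow> norm x < R \<Longrightarrow> F j t (cvec x) = of_real (g t x $ j)" by blast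
  show ?thesis
    by (rule that[of R "\<lambda>t z. \<chi> j. F j t z"]) (use R(1) F in \<open>auto simp: vec_eq_iff\<close>)
qed

lemma germ_family_vec_SmoothE:
  fixes g :: "real \<Rightarrow> real ^ 'm \<Rightarrow> real ^ 'n"
  assumes g: "\<And>j. germ_family Smooth (\<lambda>t x. g t x $ j)"
  obtains R where "R > 0" "\<And>j k. jet_on k (\<lambda>t x. g t x $ j) (ball 0 R)"
proof -
  have "\<exists>R>0. \<forall>j. \<forall>k. jet_on k (\<lambda>t x. g t x $ j) (ball 0 R)"
  proof (rule uniform_radius)
    show "\<exists>R>0. \<forall>k. jet_on k (\<lambda>t x. g t x $ j) (ball 0 R)" for j
      using g[of j] unfolding germ_family.simps .
    fix j and R R' :: real assume "\<forall>k. jet_on k (\<lambda>t x. g t x $ j) (ball 0 R)" "R' \<le> R"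
    then show "\<forall>k. jet_on k (\<lambda>t x. g t x $ j) (ball 0 R')"
      using jet_on_subset[of _ _ "ball 0 R" "ball 0 R'"] subset_ball by blast
  qed
  then show ?thesis using that by blast
qed

text \<open>Since \<open>g t\<close> fixes \<open>0\<close> for every t, the tube lemma gives one
  ball that all \<open>g t\<close>, or their extensions, map into the domain of
  \<open>f\<close>.\<close>

lemma germ_family_compose:
  fixes f :: "real \<Rightarrow> real ^ 'n \<Rightarrow> real" and g :: "real \<Rightarrow> real ^ 'm \<Rightarrow> real ^ 'n"
  assumes f: "germ_family r f" and g: "\<And>j. germ_family r (\<lambda>t x. g t x $ j)"
    and g0: "\<And>t. t \<in> {0..1} \<Longrightarrow> g t 0 = 0"
  shows "germ_family r (\<lambda>t x. f t (g t x))"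
proof (cases r)
  case Smooth
  obtain d where d: "d > 0" "\<And>k. jet_on k f (ball 0 d)" using f[unfolded Smooth] by (rule germ_family_SmoothE) (rule that)
  obtain R where R: "R > 0" "\<And>j k. jet_on k (\<lambda>t x. g t x $ j) (ball 0 R)"
    using g[unfolded Smooth] by (rule germ_family_vec_SmoothE) (rule that)
  have c: "continuous_on ({0..1} \<times> ball 0 R) (\<lambda>p. g (fst p) (snd p))"
    using jet_on_continuous[OF R(2)] by (intro continuous_on_vecI) (simp add: case_prod_beta)
  obtain e where e: "e > 0" "ball 0 e \<subseteq> ball (0 :: real ^ 'm) R"
    "\<And>t x. t \<in> {0..1} \<Longrightarrow> x \<in> ball 0 e \<Longrightarrow> g (fst (t, x)) (snd (t, x)) \<in> ball 0 d"
    by (rule tube_unit_interval[OF c open_ball _ open_ball[of 0 d], of 0]) (use d R g0 that in auto)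
  have "jet_on k (\<lambda>t x. f t (g t x)) (ball 0 e)" for k
    by (rule jet_on_compose[OF d(2) jet_on_subset[OF R(2) e(2)]]) (use e(3) in auto)
  then show ?thesis unfolding Smooth by (rule germ_family_SmoothI[OF e(1)])
next
  case Analytic
  obtain R F where F: "R > 0" "hol_family R F" "\<And>t x. t \<in> {0..1} \<Longrightarrow> norm x < R \<Longrightarrow> F t (cvec x) = of_real (f t x)"
    using f[unfolded Analytic] by (rule germ_family_AnalyticE) (rule that)
  obtain S G where G: "S > 0" "\<And>j. hol_family S (\<lambda>t z. G t z $ j)"
    "\<And>t x. t \<in> {0..1} \<Longrightarrow> norm x < S \<Longrightarrow> G t (cvec x) = cvec (g t x)"
    using g[unfolded Analytic] by (rule germ_family_vec_AnalyticE) (rule that)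
  have c: "continuous_on ({0..1} \<times> ball 0 S) (\<lambda>p. G (fst p) (snd p))"
    using hol_family_continuous[OF G(2)] by (intro continuous_on_vecI) (simp add: case_prod_beta)
  have G0: "G t 0 = 0" if "t \<in> {0..1}" for t using G(3)[OF that, of 0] G(1) g0[OF that] by simp
  obtain e where e: "e > 0" "ball 0 e \<subseteq> ball (0 :: complex ^ 'm) S"
    "\<And>t x. t \<in> {0..1} \<Longrightarrow> x \<in> ball 0 e \<Longrightarrow> G (fst (t, x)) (snd (t, x)) \<in> ball 0 R"
    by (rule tube_unit_interval[OF c open_ball _ open_ball[of 0 R], of 0]) (use F G G0 that in auto)
  have e': "min e S > 0" "min e S \<le> S" using e(1) G(1) by auto
  show ?thesis unfolding Analytic
  proof (rule germ_family_AnalyticI[OF e'(1)])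
    show "hol_family (min e S) (\<lambda>t z. F t (G t z))"
      by (rule hol_family_compose[OF F(2) hol_family_subset[OF G(2) e'(2)]]) (use e(3) in auto)
    fix t :: real and x :: "real ^ 'm" assume t: "t \<in> {0..1}" and x: "norm x < min e S"
    have "G t (cvec x) \<in> ball 0 R" using e(3)[OF t, of "cvec x"] x by simp
    then have "norm (g t x) < R" using G(3)[OF t, of x] x by simp
    then show "F t (G t (cvec x)) = of_real (f t (g t x))" using G(3)[OF t, of x] F(3)[OF t] x by simp
  qed
qed

lemma germ_family_integral:
  assumes f: "germ_family r f"
  shows "germ_family r (\<lambda>t x. integral {0..t} (\<lambda>s. f s x))"
proof (cases r)
  case Smooth
  obtain d where d: "d > 0" "\<And>k. jet_on k f (ball 0 d)" using f[unfolded Smooth] by (rule germ_family_SmoothE) (rule that)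
  show ?thesis unfolding Smooth by (rule germ_family_SmoothI[OF d(1) jet_on_integral[OF open_ball d(2)]])
next
  case Analytic
  obtain R F where F: "R > 0" "hol_family R F" "\<And>t x. t \<in> {0..1} \<Longrightarrow> norm x < R \<Longrightarrow> F t (cvec x) = of_real (f t x)"
    using f[unfolded Analytic] by (rule germ_family_AnalyticE) (rule that)
  have R: "R / 2 > 0" "R / 2 < R" using F(1) by auto
  show ?thesis unfolding Analytic
  proof (rule germ_family_AnalyticI[OF R(1) hol_family_integral[OF F(2) R(2)]])
    fix t :: real and x :: "real ^ 'a" assume t: "t \<in> {0..1}" and x: "norm x < R / 2"
    have "integral {0..t} (\<lambda>s. F s (cvec x)) = integral {0..t} (\<lambda>s. of_real (f s x))"
      using F(3) x R t by (intro integral_cong) auto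
    also have "\<dots> = of_real (integral {0..t} (\<lambda>s. f s x))"
    proof -
      have "continuous_on {0..t} (\<lambda>s. (\<lambda>(t, z). F t z) (s, cvec x))"
        by (rule continuous_on_compose2[OF hol_family_continuous[OF F(2)]])
          (use x R t in \<open>auto intro!: continuous_on_Pair continuous_on_const continuous_on_id\<close>)
      from continuous_on_Re[OF this] have "continuous_on {0..t} (\<lambda>s. Re (F s (cvec x)))" by simp
      then have "continuous_on {0..t} (\<lambda>s. f s x)"
        by (rule continuous_on_eq) (use F(3) x R t in auto)
      from integral_linear[OF integrable_continuous_real[OF this] bounded_linear_of_real]
      show ?thesis by (simp add: o_def)
    qed
    finally show "integral {0..t} (\<lambda>s. F s (cvec x)) = of_real (integral {0..t} (\<lambda>s. f s x))" .
  qed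
qed

lemma germ_family_partials:
  assumes f: "germ_family r f"
  obtains e g where "e > 0" "\<And>i. germ_family r (g i)"
    "\<And>t x. t \<in> {0..1} \<Longrightarrow> x \<in> ball 0 e \<Longrightarrow> has_gradient (f t) (\<lambda>i. g i t x) x"
proof (cases r)
  case Smooth
  obtain d where d: "d > 0" "\<And>k. jet_on k f (ball 0 d)" using f[unfolded Smooth] by (rule germ_family_SmoothE) (rule that)
  obtain g where g: "\<And>t x. t \<in> {0..1} \<Longrightarrow> x \<in> ball 0 d \<Longrightarrow> has_gradient (f t) (\<lambda>i. g i t x) x"
    "\<And>i k. jet_on k (g i) (ball 0 d)" by (rule jet_on_all_derivative[OF open_ball d(2)]) (rule that)
  show ?thesis by (rule that[OF d(1) germ_family_SmoothI[OF d(1) g(2), folded Smooth] g(1)])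
next
  case Analytic
  obtain R F where F: "R > 0" "hol_family R F" "\<And>t x. t \<in> {0..1} \<Longrightarrow> norm x < R \<Longrightarrow> F t (cvec x) = of_real (f t x)"
    using f[unfolded Analytic] by (rule germ_family_AnalyticE) (rule that)
  have R: "R / 2 > 0" "R / 2 < R" using F(1) by auto
  obtain G g where G: "\<And>i. hol_family (R/2) (G i)"
    "\<And>i t x. t \<in> {0..1} \<Longrightarrow> norm x < R/2 \<Longrightarrow> G i t (cvec x) = of_real (g i t x)"
    "\<And>t x. t \<in> {0..1} \<Longrightarrow> norm x < R/2 \<Longrightarrow> has_gradient (f t) (\<lambda>i. g i t x) x"
    by (rule hol_family_real_partials[OF F(2) R(2) F(3)]) (assumption | rule that)+
  show ?thesis
    by (rule that[OF R(1) germ_family_AnalyticI[OF R(1) G(1) G(2), folded Analytic] G(3)]) auto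
qed

section \<open>Flows of families of germs\<close>

lemma linear_vector_scalar: "linear (\<lambda>v :: complex ^ 'n. c *s v)"
  by (rule linearI) (simp_all add: vec_eq_iff distrib_left)

text \<open>Seen over the reals, \<open>flow_exists\<close> gives a flow with a real linear
  derivative \<open>Z\<close>. The coefficients of the variational equation are complex linear, so
  \<open>Z t x (c *s h) - c *s Z t x h\<close> solves it with zero initial value and vanishes; hence
  \<open>Z\<close> is complex linear and the flow holomorphic.\<close>

lemma hol_family_flow:
  fixes X :: "real \<Rightarrow> complex ^ 'n \<Rightarrow> complex ^ 'n"
  assumes R: "R > 0" and X: "\<And>j. hol_family R (\<lambda>t z. X t z $ j)"
    and P: "\<And>j l. hol_family R (P j l)"
    and X': "\<And>j t z. t \<in> {0..1} \<Longrightarrow> z \<in> ball 0 R \<Longrightarrow> has_gradient (\<lambda>z. X t z $ j) (\<lambda>l. P j l t z) z"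
    and X0: "\<And>t. t \<in> {0..1} \<Longrightarrow> X t 0 = 0"
  obtains e \<psi> Z where "local_flow R X (\<lambda>t z h. (\<chi> j l. P j l t z) *v h) e \<psi> Z" "\<And>j. hol_family e (\<lambda>t z. \<psi> t z $ j)"
proof -
  define D where "D = (\<lambda>t z h. (\<chi> j l. P j l t z) *v h)"
  have D_nth: "D t z h $ j = (\<Sum>l\<in>UNIV. P j l t z * h $ l)" for t z h j
    by (simp add: D_def matrix_vector_mult_def)
  have D_scale: "D t z (c *s h) = c *s D t z h" for t z c h
    by (simp add: vec_eq_iff D_nth sum_distrib_left mult_ac)
  have D_diff: "D t z (h - k) = D t z h - D t z k" for t z h k
    by (simp add: D_def matrix_vector_mult_diff_distrib)
  have X_cont: "cont_family (ball 0 R) X"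
    using hol_family_continuous[OF X] by (intro continuous_on_vecI) (simp add: case_prod_beta)
  have X_deriv: "(X t has_derivative D t z) (at z)" if "t \<in> {0..1}" "z \<in> ball 0 R" for t z
    by (rule has_derivative_vec_nthI) (use X'[OF that] in \<open>simp add: D_nth\<close>)
  have D_cont: "cont_family (ball 0 R) (\<lambda>t z. D t z h)" for h
  proof (rule continuous_on_vecI)
    fix j
    have "continuous_on ({0..1} \<times> ball 0 R) (\<lambda>p. \<Sum>l\<in>UNIV. P j l (fst p) (snd p) * h $ l)"
      using hol_family_continuous[OF P]
      by (intro continuous_on_sum continuous_on_mult continuous_on_const) (simp add: case_prod_beta)
    then show "continuous_on ({0..1} \<times> ball 0 R) (\<lambda>x. (case x of (t, z) \<Rightarrow> D t z h) $ j)"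
      by (simp add: case_prod_beta D_nth)
  qed
  obtain e \<psi> Z where flow: "local_flow R X D e \<psi> Z"
    by (rule flow_exists[OF R X_cont X_deriv D_cont X0]) (assumption | rule that)+
  note e = local_flow.radius[OF flow]
    and \<psi> = local_flow.in_ball[OF flow] local_flow.joint_cont[OF flow] local_flow.flow_eq[OF flow] local_flow.flow_deriv[OF flow]
    and Z = local_flow.deriv_cont[OF flow] local_flow.deriv_eq[OF flow] and zero = local_flow.linear_unique[OF flow]
  have scale_lin: "bounded_linear (\<lambda>v :: complex ^ 'n. c *s v)" for c
    using linear_vector_scalar linear_conv_bounded_linear by blast
  have Z_scale: "Z t x (c *s h) = c *s Z t x h" if t: "t \<in> {0..1}" and x: "x \<in> ball 0 e" for t x c h
  proof -
    have DZ_int: "(\<lambda>s. D s (\<psi> s x) (Z s x h)) integrable_on {0..t}" if "t \<in> {0..1}" for t h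
    proof (rule integrable_continuous_real, rule continuous_on_vecI)
      fix j
      have slice: "continuous_on {0..1} (\<lambda>s. \<psi> s x)"
        using continuous_on_compose2[OF \<psi>(2) continuous_on_Pair[OF continuous_on_id continuous_on_const[of _ x]]] x
        by (simp add: image_subset_iff)
      have "continuous_on {0..1} (\<lambda>s. (\<lambda>(t, z). P j l t z) (s, \<psi> s x))" for l
      proof (rule continuous_on_compose2[OF hol_family_continuous[OF P] continuous_on_Pair[OF continuous_on_id slice]])
        show "(\<lambda>s. (s, \<psi> s x)) ` {0..1} \<subseteq> {0..1} \<times> ball 0 R"
          using \<psi>(1)[OF _ x] R by force
      qed
      then have "continuous_on {0..1} (\<lambda>s. \<Sum>l\<in>UNIV. P j l s (\<psi> s x) * Z s x h $ l)"
        using continuous_on_component[OF Z(1)[OF x]] by (intro continuous_on_sum continuous_on_mult) simp_all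
      then show "continuous_on {0..t} (\<lambda>s. D s (\<psi> s x) (Z s x h) $ j)"
        unfolding D_nth by (rule continuous_on_subset) (use that in auto)
    qed
    have "Z t x (c *s h) - c *s Z t x h = 0"
    proof (rule zero[OF x _ _ t])
      show "continuous_on {0..1} (\<lambda>t. Z t x (c *s h) - c *s Z t x h)"
        by (intro continuous_on_diff Z(1) x bounded_linear.continuous_on[OF scale_lin])
      fix t :: real assume t: "t \<in> {0..1}"
      have i2: "(\<lambda>s. c *s D s (\<psi> s x) (Z s x h)) integrable_on {0..t}"
        using integrable_linear[OF DZ_int[OF t] scale_lin] by (simp add: o_def)
      have "integral {0..t} (\<lambda>s. D s (\<psi> s x) (Z s x (c *s h) - c *s Z s x h))
          = integral {0..t} (\<lambda>s. D s (\<psi> s x) (Z s x (c *s h)) - c *s D s (\<psi> s x) (Z s x h))"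
        by (simp add: D_diff D_scale)
      also have "\<dots> = integral {0..t} (\<lambda>s. D s (\<psi> s x) (Z s x (c *s h))) - c *s integral {0..t} (\<lambda>s. D s (\<psi> s x) (Z s x h))"
        using integral_linear[OF DZ_int[OF t] scale_lin]
        by (subst integral_diff[OF DZ_int[OF t, of "c *s h"] i2]) (simp add: o_def)
      also have "\<dots> = Z t x (c *s h) - c *s Z t x h"
        unfolding Z(2)[OF t x, of "c *s h"] Z(2)[OF t x, of h]
        by (simp add: vector_add_ldistrib)
      finally show "Z t x (c *s h) - c *s Z t x h = integral {0..t} (\<lambda>s. D s (\<psi> s x) (Z s x (c *s h) - c *s Z s x h))" ..
    qed
    then show ?thesis by simp
  qed
  have "hol_family e (\<lambda>t z. \<psi> t z $ j)" for j
  proof (rule hol_familyI)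
    show "cont_family (ball 0 e) (\<lambda>t z. \<psi> t z $ j)"
      using continuous_on_component[OF \<psi>(2)] by (simp add: case_prod_beta)
    fix t z and i :: 'n assume t: "t \<in> {0..1::real}" and z: "z \<in> ball (0 :: complex ^ 'n) e"
    have ax: "axis i h = h *s axis i 1" for h :: complex by (simp add: vec_eq_iff axis_def)
    have "linear (axis i :: complex \<Rightarrow> complex ^ 'n)"
      by (rule linearI) (simp_all add: vec_eq_iff axis_def)
    then have bl: "bounded_linear (axis i :: complex \<Rightarrow> complex ^ 'n)" by (simp add: linear_conv_bounded_linear)
    have "((\<lambda>u. z + axis i u) has_derivative (\<lambda>h. axis i h)) (at 0)"
      using has_derivative_add[OF has_derivative_const[of z] bounded_linear_imp_has_derivative[OF bl]] by simp
    moreover have "(\<psi> t has_derivative Z t z) (at (z + axis i 0))"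
    proof -
      have "z + axis i 0 = z" by (simp add: vec_eq_iff axis_def)
      then show ?thesis using \<psi>(4)[OF t z] by (simp only:)
    qed
    ultimately have "((\<lambda>u. \<psi> t (z + axis i u)) has_derivative (\<lambda>h. Z t z (axis i h))) (at 0)"
      by (rule has_derivative_compose)
    from bounded_linear.has_derivative[OF bounded_linear_vec_nth this, of j]
    have "((\<lambda>u. \<psi> t (z + axis i u) $ j) has_derivative (\<lambda>h. Z t z (axis i h) $ j)) (at 0)" .
    moreover have "(\<lambda>h. Z t z (axis i h) $ j) = (*) (Z t z (axis i 1) $ j)"
      by (rule ext) (subst ax, simp add: Z_scale[OF t z])
    ultimately show "(\<lambda>u. \<psi> t (z + axis i u) $ j) field_differentiable (at 0)"
      by (auto simp: field_differentiable_def has_field_derivative_def)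
  qed
  then show ?thesis using flow[unfolded D_def] by (rule that[rotated])
qed

text \<open>The smooth case is the bootstrap of \<open>jet_on_flow\<close>. In the analytic case the
  extended field has a holomorphic flow, and uniqueness identifies it with the given real flow at
  real points. Regularity is asserted for every local flow of the field, since the flow itself is
  constructed only afterwards.\<close>

lemma flow_regularity:
  fixes X :: "real \<Rightarrow> real ^ 'n \<Rightarrow> real ^ 'n"
  assumes X: "\<And>j. germ_family r (\<lambda>t x. X t x $ j)" and X0: "\<And>t. t \<in> {0..1} \<Longrightarrow> X t 0 = 0"
  obtains R g where "R > 0" "cont_family (ball 0 R) X"
    "\<And>j l. cont_family (ball 0 R) (\<lambda>t x. g j l t x)"
    "\<And>j t x. t \<in> {0..1} \<Longrightarrow> x \<in> ball 0 R \<Longrightarrow> has_gradient (\<lambda>x. X t x $ j) (\<lambda>l. g j l t x) x"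
    "\<And>e \<phi> Z j. local_flow R X (\<lambda>t x h. (\<chi> j l. g j l t x) *v h) e \<phi> Z \<Longrightarrow> germ_family r (\<lambda>t x. \<phi> t x $ j)"
proof (cases r)
  case Smooth
  obtain R where R: "R > 0" "\<And>j k. jet_on k (\<lambda>t x. X t x $ j) (ball 0 R)"
    using X[unfolded Smooth] by (rule germ_family_vec_SmoothE) (rule that)
  let ?P = "\<lambda>j g. (\<forall>t\<in>{0..1}. \<forall>x\<in>ball 0 R. has_gradient (\<lambda>x. X t x $ j) (\<lambda>l. g l t x) x)
      \<and> (\<forall>l k. jet_on k (g l) (ball 0 R))"
  have "\<forall>j. \<exists>g. ?P j g"
  proof
    fix j
    obtain g where "\<And>t x. t \<in> {0..1} \<Longrightarrow> x \<in> ball 0 R \<Longrightarrow> has_gradient (\<lambda>x. X t x $ j) (\<lambda>l. g l t x) x"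
      "\<And>l k. jet_on k (g l) (ball 0 R)" by (rule jet_on_all_derivative[OF open_ball R(2)]) (rule that)
    then show "\<exists>g. ?P j g" by (intro exI[of _ g]) blast
  qed
  from choice[OF this] obtain g where g: "\<And>j t x. t \<in> {0..1} \<Longrightarrow> x \<in> ball 0 R \<Longrightarrow> has_gradient (\<lambda>x. X t x $ j) (\<lambda>l. g j l t x) x"
      "\<And>j l k. jet_on k (g j l) (ball 0 R)" by blast
  have half: "ball 0 (R/2) \<subseteq> ball (0 :: real ^ 'n) R" using R(1) by auto
  show ?thesis
  proof (rule that[OF R(1) _ _ g(1)])
    show "cont_family (ball 0 R) X"
      using jet_on_continuous[OF R(2)] by (intro continuous_on_vecI) (simp add: case_prod_beta)
    show "cont_family (ball 0 R) (\<lambda>t x. g j l t x)" for j l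
      by (rule jet_on_continuous[OF g(2)])
    fix e j and \<phi> :: "real \<Rightarrow> real ^ 'n \<Rightarrow> real ^ 'n" and Z
    assume flow: "local_flow R X (\<lambda>t x h. (\<chi> j l. g j l t x) *v h) e \<phi> Z"
    note e = local_flow.radius(1)[OF flow]
      and \<phi> = local_flow.in_ball[OF flow] local_flow.joint_cont[OF flow] local_flow.flow_deriv[OF flow]
      and Z = local_flow.deriv_cont[OF flow] local_flow.deriv_eq[OF flow]
    have range: "\<phi> t x \<in> ball 0 R" if "t \<in> {0..1}" "x \<in> ball 0 e" for t x
      using \<phi>(1)[OF that] half by blast
    have "jet_on k (\<lambda>t x. \<phi> t x $ j) (ball 0 e)" for k
      by (rule jet_on_flow[OF open_ball R(2) g(1) g(2) \<phi>(2) range \<phi>(3) Z])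
    then show "germ_family r (\<lambda>t x. \<phi> t x $ j)" unfolding Smooth by (rule germ_family_SmoothI[OF e])
  qed
next
  case Analytic
  obtain S F where S: "S > 0" and F: "\<And>j. hol_family S (\<lambda>t z. F t z $ j)"
    "\<And>t x. t \<in> {0..1} \<Longrightarrow> norm x < S \<Longrightarrow> F t (cvec x) = cvec (X t x)"
    using X[unfolded Analytic] by (rule germ_family_vec_AnalyticE) (rule that)
  define R where "R = S / 2"
  have R: "R > 0" "R < S" using S by (auto simp: R_def)
  have F_nth: "F t (cvec x) $ j = of_real (X t x $ j)" if "t \<in> {0..1}" "norm x < S" for t x j
    using F(2)[OF that] by simp
  let ?P = "\<lambda>j q. (\<forall>l. hol_family R (fst q l)) \<and>
      (\<forall>t\<in>{0..1}. \<forall>z\<in>ball 0 R. has_gradient (\<lambda>z. F t z $ j) (\<lambda>l. fst q l t z) z) \<and>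
      (\<forall>l. \<forall>t\<in>{0..1}. \<forall>x. norm x < R \<longrightarrow> fst q l t (cvec x) = of_real (snd q l t x)) \<and>
      (\<forall>t\<in>{0..1}. \<forall>x. norm x < R \<longrightarrow> has_gradient (\<lambda>x. X t x $ j) (\<lambda>l. snd q l t x) x)"
  have "\<forall>j. \<exists>q. ?P j q"
  proof
    fix j
    obtain G g where "\<And>l. hol_family R (G l)"
      "\<And>t z. t \<in> {0..1} \<Longrightarrow> z \<in> ball 0 R \<Longrightarrow> has_gradient (\<lambda>z. F t z $ j) (\<lambda>l. G l t z) z"
      "\<And>l t x. t \<in> {0..1} \<Longrightarrow> norm x < R \<Longrightarrow> G l t (cvec x) = of_real (g l t x)"
      "\<And>t x. t \<in> {0..1} \<Longrightarrow> norm x < R \<Longrightarrow> has_gradient (\<lambda>x. X t x $ j) (\<lambda>l. g l t x) x"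
      by (rule hol_family_real_partials[OF F(1) R(2) F_nth]) (assumption | rule that)+
    then show "\<exists>q. ?P j q"
      by (intro exI[of _ "(G, g)"]) simp
  qed
  from choice[OF this] obtain q where q: "\<And>j l. hol_family R (fst (q j) l)"
      "\<And>j t z. t \<in> {0..1} \<Longrightarrow> z \<in> ball 0 R \<Longrightarrow> has_gradient (\<lambda>z. F t z $ j) (\<lambda>l. fst (q j) l t z) z"
      "\<And>j l t x. t \<in> {0..1} \<Longrightarrow> norm x < R \<Longrightarrow> fst (q j) l t (cvec x) = of_real (snd (q j) l t x)"
      "\<And>j t x. t \<in> {0..1} \<Longrightarrow> norm x < R \<Longrightarrow> has_gradient (\<lambda>x. X t x $ j) (\<lambda>l. snd (q j) l t x) x"
    by blast
  have F0: "F t 0 = 0" if "t \<in> {0..1}" for t using F(2)[OF that, of 0] S X0[OF that] by simp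
  have F': "hol_family R (\<lambda>t z. F t z $ j)" for j
    by (rule hol_family_subset[OF F(1)]) (use R in simp)
  obtain e1 \<psi> Y where cflow: "local_flow R F (\<lambda>t z h. (\<chi> j l. fst (q j) l t z) *v h) e1 \<psi> Y"
    and \<psi>: "\<And>j. hol_family e1 (\<lambda>t z. \<psi> t z $ j)"
    by (rule hol_family_flow[OF R(1) F' q(1,2) F0]) (assumption | rule that)+
  note e1 = local_flow.radius(1)[OF cflow] and uniq = local_flow.flow_unique[OF cflow]
  have real_cont: "cont_family (ball 0 R) f"
    if "hol_family R G" "\<And>t x. t \<in> {0..1} \<Longrightarrow> norm x < R \<Longrightarrow> G t (cvec x) = of_real (f t x)"
    for G and f :: "real \<Rightarrow> real ^ 'n \<Rightarrow> real"
  proof -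
    have "continuous_on ({0..1} \<times> ball 0 R) (\<lambda>p. (\<lambda>(t, z). G t z) (fst p, cvec (snd p)))"
      by (rule continuous_on_compose2[OF hol_family_continuous[OF that(1)]])
        (auto intro!: continuous_on_Pair continuous_on_fst continuous_on_snd continuous_on_id
          bounded_linear.continuous_on[OF bounded_linear_cvec])
    from continuous_on_Re[OF this] have "continuous_on ({0..1} \<times> ball 0 R) (\<lambda>p. Re (G (fst p) (cvec (snd p))))" by simp
    then show ?thesis by (rule continuous_on_eq) (auto simp: that(2))
  qed
  have X_cont: "cont_family (ball 0 R) X"
  proof (rule continuous_on_vecI)
    fix j
    have "cont_family (ball 0 R) (\<lambda>t x. X t x $ j)"
      by (rule real_cont[OF hol_family_subset[OF F(1)] F_nth]) (use R in auto)
    then show "continuous_on ({0..1} \<times> ball 0 R) (\<lambda>p. (case p of (t, x) \<Rightarrow> X t x) $ j)"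
      by (simp add: case_prod_beta)
  qed
  show ?thesis
  proof (rule that[of R "\<lambda>j. snd (q j)", OF R(1) X_cont real_cont[OF q(1,3)]])
    show "has_gradient (\<lambda>x. X t x $ j) (\<lambda>l. snd (q j) l t x) x"
      if "t \<in> {0..1}" "x \<in> ball 0 R" for j t x using q(4) that by simp
    fix e j and \<phi> :: "real \<Rightarrow> real ^ 'n \<Rightarrow> real ^ 'n" and Z
    assume flow: "local_flow R X (\<lambda>t x h. (\<chi> j l. snd (q j) l t x) *v h) e \<phi> Z"
    note e = local_flow.radius(1)[OF flow]
      and \<phi> = local_flow.in_ball[OF flow] local_flow.joint_cont[OF flow] local_flow.flow_eq[OF flow]
    show "germ_family r (\<lambda>t x. \<phi> t x $ j)" unfolding Analytic
    proof (rule germ_family_AnalyticI[of "min e e1"])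
      show "min e e1 > 0" using e e1 by simp
      show "hol_family (min e e1) (\<lambda>t z. \<psi> t z $ j)" by (rule hol_family_subset[OF \<psi>]) simp
      fix t :: real and x :: "real ^ 'n" assume t: "t \<in> {0..1}" and "norm x < min e e1"
      then have x: "x \<in> ball 0 e" "cvec x \<in> ball 0 e1" by auto
      have slice: "continuous_on {0..1} (\<lambda>t. \<phi> t x)"
        using continuous_on_compose2[OF \<phi>(2) continuous_on_Pair[OF continuous_on_id continuous_on_const[of _ x]]] x
        by (simp add: image_subset_iff)
      \<comment> \<open>The real trajectory, regarded in complex space, is an integral curve of the
        extended field; hence the holomorphic flow extends the real one.\<close>
      have "cvec (\<phi> t x) = \<psi> t (cvec x)"
      proof (rule uniq[OF _ _ _ x(2) t])
        show "continuous_on {0..1} (\<lambda>t. cvec (\<phi> t x))"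
          by (rule bounded_linear.continuous_on[OF bounded_linear_cvec slice])
        show "cvec (\<phi> t x) \<in> ball 0 (R/2)" if "t \<in> {0..1}" for t using \<phi>(1)[OF that x(1)] by simp
        fix t :: real assume t: "t \<in> {0..1}"
        have "continuous_on {0..t} (\<lambda>s. (\<lambda>(t, x). X t x) (s, \<phi> s x))"
        proof (rule continuous_on_compose2[OF X_cont continuous_on_Pair[OF continuous_on_id]])
          show "continuous_on {0..t} (\<lambda>s. \<phi> s x)" by (rule continuous_on_subset[OF slice]) (use t in auto)
          show "(\<lambda>s. (s, \<phi> s x)) ` {0..t} \<subseteq> {0..1} \<times> ball 0 R" using \<phi>(1)[OF _ x(1)] t R(1) by force
        qed
        then have "(\<lambda>s. X s (\<phi> s x)) integrable_on {0..t}" by (intro integrable_continuous_real) simp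
        from integral_linear[OF this bounded_linear_cvec]
        have "cvec (integral {0..t} (\<lambda>s. X s (\<phi> s x))) = integral {0..t} (\<lambda>s. cvec (X s (\<phi> s x)))" by (simp add: o_def)
        also have "\<dots> = integral {0..t} (\<lambda>s. F s (cvec (\<phi> s x)))"
        proof (rule integral_cong)
          fix s assume "s \<in> {0..t}"
          then have s: "s \<in> {0..1}" using t by auto
          show "cvec (X s (\<phi> s x)) = F s (cvec (\<phi> s x))"
            using F(2)[OF s, of "\<phi> s x"] \<phi>(1)[OF s x(1)] R by simp
        qed
        finally show "cvec (\<phi> t x) = cvec x + integral {0..t} (\<lambda>s. F s (cvec (\<phi> s x)))"
          unfolding \<phi>(3)[OF t x(1)] by (simp add: cvec_add)
      qed
      then show "\<psi> t (cvec x) $ j = of_real (\<phi> t x $ j)" by (simp flip: cvec_nth)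
    qed
  qed
qed

text \<open>Counterpart of \<open>local_flow\<close> for germs: the integral equations are replaced
  by differential equations on \<open>{0..1}\<close>, one-sided at the ends, and the regularity of
  the flow is included.\<close>

locale flow_germ =
  fixes r :: regularity and X :: "real \<Rightarrow> real ^ 'n \<Rightarrow> real ^ 'n" and e \<rho> :: real
    and \<phi> :: "real \<Rightarrow> real ^ 'n \<Rightarrow> real ^ 'n" and Z D :: "real \<Rightarrow> real ^ 'n \<Rightarrow> real ^ 'n \<Rightarrow> real ^ 'n"
  assumes radius: "e > 0" "\<rho> > 0"
    and flow_family: "\<And>j. germ_family r (\<lambda>t x. \<phi> t x $ j)"
    and field_deriv: "\<And>t y. t \<in> {0..1} \<Longrightarrow> y \<in> ball 0 \<rho> \<Longrightarrow> (X t has_derivative D t y) (at y)"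
    and in_ball: "\<And>t x. t \<in> {0..1} \<Longrightarrow> x \<in> ball 0 e \<Longrightarrow> \<phi> t x \<in> ball 0 \<rho>"
    and flow_start: "\<And>x. x \<in> ball 0 e \<Longrightarrow> \<phi> 0 x = x" and flow_0: "\<And>t. t \<in> {0..1} \<Longrightarrow> \<phi> t 0 = 0"
    and flow_ode: "\<And>t x. t \<in> {0..1} \<Longrightarrow> x \<in> ball 0 e \<Longrightarrow>
      ((\<lambda>t. \<phi> t x) has_vector_derivative X t (\<phi> t x)) (at t within {0..1})"
    and flow_deriv: "\<And>t x. t \<in> {0..1} \<Longrightarrow> x \<in> ball 0 e \<Longrightarrow> (\<phi> t has_derivative Z t x) (at x)"
    and deriv_start: "\<And>x h. x \<in> ball 0 e \<Longrightarrow> Z 0 x h = h"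
    and deriv_ode: "\<And>t x h. t \<in> {0..1} \<Longrightarrow> x \<in> ball 0 e \<Longrightarrow>
      ((\<lambda>t. Z t x h) has_vector_derivative D t (\<phi> t x) (Z t x h)) (at t within {0..1})"
    and flow_unique: "\<And>u t. (\<And>t. t \<in> {0..1} \<Longrightarrow> u t \<in> ball 0 \<rho>) \<Longrightarrow>
      (\<And>t. t \<in> {0..1} \<Longrightarrow> (u has_vector_derivative X t (u t)) (at t within {0..1})) \<Longrightarrow>
      u 0 \<in> ball 0 e \<Longrightarrow> t \<in> {0..1} \<Longrightarrow> u t = \<phi> t (u 0)"

theorem germ_flow:
  fixes X :: "real \<Rightarrow> real ^ 'n \<Rightarrow> real ^ 'n"
  assumes X: "\<And>j. germ_family r (\<lambda>t x. X t x $ j)" and X0: "\<And>t. t \<in> {0..1} \<Longrightarrow> X t 0 = 0"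
  obtains e \<rho> \<phi> Z D where "flow_germ r X e \<rho> \<phi> Z D"
proof -
  obtain R g where R: "R > 0" and X_cont: "cont_family (ball 0 R) X"
    and g: "\<And>j l. cont_family (ball 0 R) (\<lambda>t x. g j l t x)"
      "\<And>j t x. t \<in> {0..1} \<Longrightarrow> x \<in> ball 0 R \<Longrightarrow> has_gradient (\<lambda>x. X t x $ j) (\<lambda>l. g j l t x) x"
    and reg: "\<And>e \<phi> Z j. local_flow R X (\<lambda>t x h. (\<chi> j l. g j l t x) *v h) e \<phi> Z \<Longrightarrow> germ_family r (\<lambda>t x. \<phi> t x $ j)"
    by (rule flow_regularity[OF X X0]) (assumption | rule that)+
  define D where "D = (\<lambda>t x h. (\<chi> j l. g j l t x) *v h)"
  have D_nth: "D t x h $ j = (\<Sum>l\<in>UNIV. g j l t x * h $ l)" for t x h j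
    by (simp add: D_def matrix_vector_mult_def)
  have X_deriv: "(X t has_derivative D t x) (at x)" if "t \<in> {0..1}" "x \<in> ball 0 R" for t x
    by (rule has_derivative_vec_nthI) (use g(2)[OF that] in \<open>simp add: D_nth\<close>)
  have D_cont: "cont_family (ball 0 R) (\<lambda>t x. D t x h)" for h
  proof (rule continuous_on_vecI)
    fix j
    have "continuous_on ({0..1} \<times> ball 0 R) (\<lambda>p. \<Sum>l\<in>UNIV. g j l (fst p) (snd p) * h $ l)"
      using g(1) by (intro continuous_on_sum continuous_on_mult continuous_on_const) (simp add: case_prod_beta)
    then show "continuous_on ({0..1} \<times> ball 0 R) (\<lambda>x. (case x of (t, z) \<Rightarrow> D t z h) $ j)"
      by (simp add: case_prod_beta D_nth)
  qed
  obtain e \<phi> Z where flow: "local_flow R X D e \<phi> Z"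
    by (rule flow_exists[OF R X_cont X_deriv D_cont X0]) (assumption | rule that)+
  note e = local_flow.radius[OF flow]
    and \<phi> = local_flow.in_ball[OF flow] local_flow.joint_cont[OF flow] local_flow.flow_eq[OF flow] local_flow.flow_deriv[OF flow]
    and Z = local_flow.deriv_cont[OF flow] local_flow.deriv_eq[OF flow] and uniq = local_flow.flow_unique[OF flow]
  have in_R: "\<phi> t x \<in> ball 0 R" if "t \<in> {0..1}" "x \<in> ball 0 e" for t x using \<phi>(1)[OF that] R by simp
  have slice: "continuous_on {0..1} (\<lambda>t. \<phi> t x)" if "x \<in> ball 0 e" for x
    using continuous_on_compose2[OF \<phi>(2) continuous_on_Pair[OF continuous_on_id continuous_on_const[of _ x]]] that
    by (simp add: image_subset_iff)
  have path: "continuous_on {0..1} (\<lambda>s. (s, \<phi> s x))" "(\<lambda>s. (s, \<phi> s x)) ` {0..1} \<subseteq> {0..1} \<times> ball 0 R"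
    if "x \<in> ball 0 e" for x
    by (intro continuous_on_Pair continuous_on_id slice that) (use in_R[OF _ that] in auto)
  have X_path: "continuous_on {0..1} (\<lambda>s. X s (\<phi> s x))" if "x \<in> ball 0 e" for x
    using continuous_on_compose2[OF X_cont path[OF that]] by simp
  have D_path: "continuous_on {0..1} (\<lambda>s. D s (\<phi> s x) (Z s x h))" if "x \<in> ball 0 e" for x h
  proof (rule continuous_on_vecI)
    fix j
    have "continuous_on {0..1} (\<lambda>s. g j l s (\<phi> s x))" for l
      using continuous_on_compose2[OF g(1) path[OF that]] by simp
    then show "continuous_on {0..1} (\<lambda>s. D s (\<phi> s x) (Z s x h) $ j)"
      unfolding D_nth using continuous_on_component[OF Z(1)[OF that]]
      by (intro continuous_on_sum continuous_on_mult)
  qed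
  show ?thesis
  proof (rule that[of e "R/2" \<phi> Z D], rule flow_germ.intro)
    show "e > 0" "R / 2 > 0" using e R by auto
    show "germ_family r (\<lambda>t x. \<phi> t x $ j)" for j
      by (rule reg[OF flow[unfolded D_def]])
    show "(X t has_derivative D t y) (at y)" if "t \<in> {0..1}" "y \<in> ball 0 (R/2)" for t y
      using X_deriv[OF that(1), of y] that(2) R by simp
    show "\<phi> t x \<in> ball 0 (R/2)" if "t \<in> {0..1}" "x \<in> ball 0 e" for t x by (rule \<phi>(1)[OF that])
    show "\<phi> 0 x = x" if "x \<in> ball 0 e" for x using \<phi>(3)[OF _ that, of 0] by simp
    show "Z 0 x h = h" if "x \<in> ball 0 e" for x h using Z(2)[OF _ that, of 0] by simp
    show "\<phi> t 0 = 0" if t: "t \<in> {0..1}" for t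
    proof -
      have "0 = \<phi> t 0"
      proof (rule uniq[of "\<lambda>_. 0", OF continuous_on_const _ _ _ t])
        fix t :: real assume t: "t \<in> {0..1}"
        have "integral {0..t} (\<lambda>s. X s 0) = integral {0..t} (\<lambda>s. 0)"
          using t by (intro integral_cong) (simp add: X0)
        then show "0 = 0 + integral {0..t} (\<lambda>s. X s 0)" by simp
      qed (use e R in auto)
      then show ?thesis by simp
    qed
    show "(\<phi> t has_derivative Z t x) (at x)" if "t \<in> {0..1}" "x \<in> ball 0 e" for t x by (rule \<phi>(4)[OF that])
    show "((\<lambda>t. \<phi> t x) has_vector_derivative X t (\<phi> t x)) (at t within {0..1})"
      if t: "t \<in> {0..1}" and x: "x \<in> ball 0 e" for t x
    proof -
      have "((\<lambda>t. x + integral {0..t} (\<lambda>s. X s (\<phi> s x))) has_vector_derivative X t (\<phi> t x)) (at t within {0..1})"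
        using has_vector_derivative_add[OF has_vector_derivative_const integral_has_vector_derivative[OF X_path[OF x] t], of x]
        by simp
      from has_vector_derivative_transform[OF t \<phi>(3)[OF _ x] this] show ?thesis .
    qed
    show "((\<lambda>t. Z t x h) has_vector_derivative D t (\<phi> t x) (Z t x h)) (at t within {0..1})"
      if t: "t \<in> {0..1}" and x: "x \<in> ball 0 e" for t x h
    proof -
      have "((\<lambda>t. h + integral {0..t} (\<lambda>s. D s (\<phi> s x) (Z s x h))) has_vector_derivative D t (\<phi> t x) (Z t x h)) (at t within {0..1})"
        using has_vector_derivative_add[OF has_vector_derivative_const integral_has_vector_derivative[OF D_path[OF x] t], of h]
        by simp
      from has_vector_derivative_transform[OF t Z(2)[OF _ x] this] show ?thesis .
    qed
    show "u t = \<phi> t (u 0)" if u: "\<And>t. t \<in> {0..1} \<Longrightarrow> u t \<in> ball 0 (R/2)"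
      "\<And>t. t \<in> {0..1} \<Longrightarrow> (u has_vector_derivative X t (u t)) (at t within {0..1})"
      "u 0 \<in> ball 0 e" "t \<in> {0..1}" for u t
    proof (rule uniq[OF _ u(1) _ u(3,4)])
      show "continuous_on {0..1} u"
        using u(2) has_vector_derivative_continuous continuous_on_eq_continuous_within by blast
      fix t :: real assume t: "t \<in> {0..1}"
      have "((\<lambda>s. X s (u s)) has_integral u t - u 0) {0..t}"
        using t by (intro fundamental_theorem_of_calculus)
          (auto intro: has_vector_derivative_within_subset[OF u(2)])
      then show "u t = u 0 + integral {0..t} (\<lambda>s. X s (u s))" by (simp add: integral_unique)
    qed
  qed
qed

section \<open>Germs of functions, maps and diffeomorphisms\<close>

lemma fun_germ_const: "fun_germ r (\<lambda>_. c)"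
  using germ_family_const[of r c] by (simp add: germ_family_constant_iff)

lemma fun_germ_coordinate: "fun_germ r (\<lambda>x. x $ i)"
  using germ_family_coordinate[of r i] by (simp add: germ_family_constant_iff)

lemma fun_germ_add: "fun_germ r f \<Longrightarrow> fun_germ r g \<Longrightarrow> fun_germ r (\<lambda>x. f x + g x)"
  using germ_family_add[of r "\<lambda>_. f" "\<lambda>_. g"] by (simp add: germ_family_constant_iff)

lemma fun_germ_mult: "fun_germ r f \<Longrightarrow> fun_germ r g \<Longrightarrow> fun_germ r (\<lambda>x. f x * g x)"
  using germ_family_mult[of r "\<lambda>_. f" "\<lambda>_. g"] by (simp add: germ_family_constant_iff)

lemma fun_germ_minus: "fun_germ r f \<Longrightarrow> fun_germ r (\<lambda>x. - f x)"
  using germ_family_minus[of r "\<lambda>_. f"] by (simp add: germ_family_constant_iff)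

lemma fun_germ_diff: "fun_germ r f \<Longrightarrow> fun_germ r g \<Longrightarrow> fun_germ r (\<lambda>x. f x - g x)"
  using germ_family_diff[of r "\<lambda>_. f" "\<lambda>_. g"] by (simp add: germ_family_constant_iff)

lemma fun_germ_sum: "(\<And>i. i \<in> I \<Longrightarrow> fun_germ r (f i)) \<Longrightarrow> fun_germ r (\<lambda>x. \<Sum>i\<in>I. f i x)"
  using germ_family_sum[of I r "\<lambda>i _. f i"] by (simp add: germ_family_constant_iff)

lemma fun_germ_cong:
  assumes "fun_germ r f" "\<forall>\<^sub>0x. f x = g x"
  shows "fun_germ r g"
proof -
  obtain e where e: "e > 0" "\<And>x. dist x 0 < e \<Longrightarrow> f x = g x"
    using assms(2) unfolding eventually_nhds_metric by blast
  have "germ_family r (\<lambda>_. g)"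
    by (rule germ_family_cong[OF _ e(1), of r "\<lambda>_. f"]) (use assms(1) e(2) in \<open>auto simp: germ_family_constant_iff\<close>)
  then show ?thesis by (simp add: germ_family_constant_iff)
qed

lemma fun_germ_compose:
  assumes "fun_germ r f" "map_germ r G" "G 0 = 0"
  shows "fun_germ r (\<lambda>x. f (G x))"
  using germ_family_compose[of r "\<lambda>_. f" "\<lambda>_. G"] assms by (simp add: germ_family_constant_iff map_germ_def)

lemma map_germ_compose:
  assumes "map_germ r F" "map_germ r G" "G 0 = 0"
  shows "map_germ r (\<lambda>x. F (G x))"
  unfolding map_germ_def
proof
  fix i show "fun_germ r (\<lambda>x. F (G x) $ i)"
    using fun_germ_compose[of r "\<lambda>x. F x $ i" G] assms by (simp add: map_germ_def)
qed

lemma fun_germ_partials: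
  assumes "fun_germ r f"
  obtains e g where "e > 0" "\<And>i. fun_germ r (g i)"
    "\<And>x. x \<in> ball 0 e \<Longrightarrow> has_gradient f (\<lambda>i. g i x) x"
proof -
  have f: "germ_family r (\<lambda>_. f)" using assms by (simp add: germ_family_constant_iff)
  obtain e g where "e > 0" "\<And>i. germ_family r (g i)"
    "\<And>t x. t \<in> {0..1} \<Longrightarrow> x \<in> ball 0 e \<Longrightarrow> has_gradient f (\<lambda>i. g i t x) x"
    by (rule germ_family_partials[OF f]) (rule that)
  then show ?thesis by (intro that[of e "\<lambda>i. g i 0"] fun_germ_at_time) auto
qed

lemma map_germ_jacobian:
  fixes F :: "real ^ 'm \<Rightarrow> real ^ 'n"
  assumes F: "map_germ r F"
  obtains e J where "e > 0" "\<And>i j. fun_germ r (\<lambda>x. J x $ i $ j)"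
    "\<And>x. x \<in> ball 0 e \<Longrightarrow> (F has_derivative (*v) (J x)) (at x)"
proof -
  have "\<exists>e>0. \<forall>i. \<exists>g. (\<forall>j. fun_germ r (g j)) \<and>
      (\<forall>x\<in>ball 0 e. has_gradient (\<lambda>x. F x $ i) (\<lambda>j. g j x) x)"
  proof (rule uniform_radius)
    fix i
    have "fun_germ r (\<lambda>x. F x $ i)" using F by (simp add: map_germ_def)
    then obtain e g where "e > 0" "\<And>j. fun_germ r (g j)"
      "\<And>x. x \<in> ball 0 e \<Longrightarrow> has_gradient (\<lambda>x. F x $ i) (\<lambda>j. g j x) x"
      by (rule fun_germ_partials) (rule that)
    then show "\<exists>e>0. \<exists>g. (\<forall>j. fun_germ r (g j)) \<and>
      (\<forall>x\<in>ball 0 e. has_gradient (\<lambda>x. F x $ i) (\<lambda>j. g j x) x)" by blast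
  next
    fix i and e e' :: real
    assume a: "\<exists>g. (\<forall>j. fun_germ r (g j)) \<and>
      (\<forall>x\<in>ball 0 e. has_gradient (\<lambda>x. F x $ i) (\<lambda>j. g j x) x)" and "e' \<le> e"
    have "ball 0 e' \<subseteq> ball (0 :: real ^ 'm) e" using \<open>e' \<le> e\<close> by (rule subset_ball)
    from a obtain g where "\<forall>j. fun_germ r (g j)"
      "\<forall>x\<in>ball 0 e. has_gradient (\<lambda>x. F x $ i) (\<lambda>j. g j x) x" by (elim exE conjE)
    then show "\<exists>g. (\<forall>j. fun_germ r (g j)) \<and>
      (\<forall>x\<in>ball 0 e'. has_gradient (\<lambda>x. F x $ i) (\<lambda>j. g j x) x)"
      using subsetD[OF \<open>ball 0 e' \<subseteq> ball 0 e\<close>] by (intro exI[of _ g] conjI ballI) (assumption | drule bspec)+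
  qed
  then obtain e where e: "e > 0" "\<forall>i. \<exists>g. (\<forall>j. fun_germ r (g j)) \<and>
      (\<forall>x\<in>ball 0 e. has_gradient (\<lambda>x. F x $ i) (\<lambda>j. g j x) x)" by blast
  from choice[OF e(2)] obtain g where g: "\<And>i j. fun_germ r (g i j)"
      "\<And>i x. x\<in>ball 0 e \<Longrightarrow> has_gradient (\<lambda>x. F x $ i) (\<lambda>j. g i j x) x" by blast
  show ?thesis
  proof (rule that[of e "\<lambda>x. \<chi> i j. g i j x"])
    show "(F has_derivative (*v) (\<chi> i j. g i j x)) (at x)" if "x \<in> ball 0 e" for x
      by (rule has_derivative_vec_nthI) (use g(2)[OF that] in \<open>simp add: matrix_vector_mult_def\<close>)
  qed (use e g in auto)
qed

text \<open>Continuity at \<open>0\<close> is what allows an identity of germs to be substituted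
  along a map that fixes \<open>0\<close>.\<close>

lemma map_germ_tendsto_0:
  assumes "map_germ r F" "F 0 = 0" "\<forall>\<^sub>0y. P y"
  shows "\<forall>\<^sub>0x. P (F x)"
proof -
  obtain e J where e: "e > 0" "\<And>i j. fun_germ r (\<lambda>x. J x $ i $ j)"
    "\<And>x. x \<in> ball 0 e \<Longrightarrow> (F has_derivative (*v) (J x)) (at x)"
    by (rule map_germ_jacobian[OF assms(1)]) (rule that)
  have "isCont F 0" by (rule has_derivative_continuous[OF e(3)]) (use e(1) in simp)
  then have "filterlim F (nhds (F 0)) (nhds 0)"
    unfolding isCont_def tendsto_at_iff_tendsto_nhds .
  then have "filterlim F (nhds 0) (nhds 0)" by (simp add: assms(2))
  then show ?thesis using assms(3) by (rule eventually_compose_filterlim[rotated])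
qed

lemma diffeo_germ_compose:
  assumes F: "diffeo_germ r F" and G: "diffeo_germ r G"
  shows "diffeo_germ r (\<lambda>x. F (G x))"
proof -
  obtain F' where F': "map_germ r F'" "F' 0 = 0" "\<forall>\<^sub>0x. F' (F x) = x" "\<forall>\<^sub>0y. F (F' y) = y"
    using F unfolding diffeo_germ_def by blast
  obtain G' where G': "map_germ r G'" "G' 0 = 0" "\<forall>\<^sub>0x. G' (G x) = x" "\<forall>\<^sub>0y. G (G' y) = y"
    using G unfolding diffeo_germ_def by blast
  have FG: "map_germ r F" "F 0 = 0" "map_germ r G" "G 0 = 0" using F G unfolding diffeo_germ_def by auto
  have "\<forall>\<^sub>0x. G' (F' (F (G x))) = x"
    using map_germ_tendsto_0[OF FG(3,4) F'(3)] G'(3) by eventually_elim simp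
  moreover have "\<forall>\<^sub>0x. F (G (G' (F' x))) = x"
    using map_germ_tendsto_0[OF F'(1,2) G'(4)] F'(4) by eventually_elim simp
  moreover have "map_germ r (\<lambda>x. F (G x))" by (rule map_germ_compose[OF FG(1,3,4)])
  moreover have "map_germ r (\<lambda>x. G' (F' x))" by (rule map_germ_compose[OF G'(1) F'(1,2)])
  moreover have "F (G 0) = 0" "G' (F' 0) = 0" using FG F'(2) G'(2) by simp_all
  ultimately show ?thesis
    unfolding diffeo_germ_def by (intro conjI exI[of _ "\<lambda>x. G' (F' x)"])
qed

lemma diffeo_germ_inverse:
  assumes F: "diffeo_germ r F"
  obtains G where "diffeo_germ r G" "\<forall>\<^sub>0x. G (F x) = x" "\<forall>\<^sub>0y. F (G y) = y"
proof -
  obtain G where G: "map_germ r G" "G 0 = 0" "\<forall>\<^sub>0x. G (F x) = x" "\<forall>\<^sub>0y. F (G y) = y"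
    using F unfolding diffeo_germ_def by (elim conjE exE)
  have "diffeo_germ r G"
    unfolding diffeo_germ_def using F G unfolding diffeo_germ_def by (intro conjI exI[of _ F]) simp_all
  then show ?thesis using G(3,4) by (rule that)
qed

lemma diffeo_germ_cong:
  assumes F: "diffeo_germ r F" and eq: "\<forall>\<^sub>0x. F x = F' x"
  shows "diffeo_germ r F'"
proof -
  obtain G where G: "map_germ r G" "G 0 = 0" "\<forall>\<^sub>0x. G (F x) = x" "\<forall>\<^sub>0y. F (G y) = y"
    using F unfolding diffeo_germ_def by blast
  have F0: "map_germ r F" "F 0 = 0" using F unfolding diffeo_germ_def by auto
  have "map_germ r F'" unfolding map_germ_def
  proof
    fix i show "fun_germ r (\<lambda>x. F' x $ i)"
      by (rule fun_germ_cong[of r "\<lambda>x. F x $ i"]) (use F0 eq in \<open>auto simp: map_germ_def elim: eventually_mono\<close>)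
  qed
  moreover have "F' 0 = 0" using eventually_nhds_x_imp_x[OF eq] F0 by simp
  moreover have "\<forall>\<^sub>0x. G (F' x) = x" using G(3) eq by eventually_elim simp
  moreover have "\<forall>\<^sub>0y. F' (G y) = y"
    using G(4) map_germ_tendsto_0[OF G(1,2) eq] by eventually_elim simp
  ultimately show ?thesis using G(1,2) unfolding diffeo_germ_def by blast
qed

section \<open>Flows as diffeomorphism-germs and the inverse function theorem\<close>

lemma germ_family_small:
  fixes \<phi> :: "real \<Rightarrow> real ^ 'm \<Rightarrow> real ^ 'n"
  assumes \<phi>: "\<And>j. germ_family r (\<lambda>t x. \<phi> t x $ j)" and \<phi>0: "\<And>t. t \<in> {0..1} \<Longrightarrow> \<phi> t 0 = 0" and "\<epsilon> > 0"
  obtains d where "d > 0" "\<And>t x. t \<in> {0..1} \<Longrightarrow> x \<in> ball 0 d \<Longrightarrow> \<phi> t x \<in> ball 0 \<epsilon>"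
proof -
  have "\<exists>e>0. \<forall>j. cont_family (ball 0 e) (\<lambda>t x. \<phi> t x $ j)"
  proof (rule uniform_radius)
    show "\<exists>e>0. cont_family (ball 0 e) (\<lambda>t x. \<phi> t x $ j)" for j
      using germ_family_continuous[OF \<phi>] by blast
    show "cont_family (ball 0 e') (\<lambda>t x. \<phi> t x $ j)"
      if "cont_family (ball 0 e) (\<lambda>t x. \<phi> t x $ j)" "e' \<le> e" for j and e e' :: real
      by (rule continuous_on_subset[OF that(1)]) (use that(2) in auto)
  qed
  then obtain e where e: "e > 0" "\<And>j. cont_family (ball 0 e) (\<lambda>t x. \<phi> t x $ j)" by blast
  have c: "continuous_on ({0..1} \<times> ball 0 e) (\<lambda>p. \<phi> (fst p) (snd p))"
    using e(2) by (intro continuous_on_vecI) (simp add: case_prod_beta)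
  obtain d where "d > 0" "ball 0 d \<subseteq> ball (0 :: real ^ 'm) e"
    "\<And>t x. t \<in> {0..1} \<Longrightarrow> x \<in> ball 0 d \<Longrightarrow> \<phi> (fst (t, x)) (snd (t, x)) \<in> ball 0 \<epsilon>"
    by (rule tube_unit_interval[OF c open_ball _ open_ball[of 0 \<epsilon>], of 0]) (use e(1) \<phi>0 \<open>\<epsilon> > 0\<close> that in auto)
  then show ?thesis using that by simp
qed

text \<open>For fixed x the curve \<open>\<phi> (1 - s) x\<close> solves the reversed equation,
  starts at \<open>\<phi> 1 x\<close> and ends at x, so uniqueness of the reversed flow applies. The
  initial ball is taken small enough for the curve to remain in the domain of that flow.\<close>

lemma reversed_flow_inverse:
  fixes X :: "real \<Rightarrow> real ^ 'n \<Rightarrow> real ^ 'n"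
  assumes F: "flow_germ r X e \<rho> \<phi> Z D" and G: "flow_germ r (\<lambda>t x. - X (1 - t) x) e' \<rho>' \<phi>' Z' D'"
  shows "\<forall>\<^sub>0x. \<phi>' 1 (\<phi> 1 x) = x"
proof -
  interpret F: flow_germ r X e \<rho> \<phi> Z D by (rule F)
  interpret G: flow_germ r "\<lambda>t x. - X (1 - t) x" e' \<rho>' \<phi>' Z' D' by (rule G)
  obtain d where d: "d > 0" "\<And>t x. t \<in> {0..1} \<Longrightarrow> x \<in> ball 0 d \<Longrightarrow> \<phi> t x \<in> ball 0 (min e' \<rho>')"
    by (rule germ_family_small[OF F.flow_family F.flow_0, of "min e' \<rho>'"]) (use G.radius that in auto)
  show ?thesis unfolding eventually_nhds_metric
  proof (intro exI[of _ "min d e"] conjI allI impI)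
    fix x :: "real ^ 'n" assume "dist x 0 < min d e"
    then have x: "x \<in> ball 0 d" "x \<in> ball 0 e" by (auto simp: dist_commute)
    let ?u = "\<lambda>s. \<phi> (1 - s) x"
    have "?u 1 = \<phi>' 1 (?u 0)"
    proof (rule G.flow_unique)
      show "?u s \<in> ball 0 \<rho>'" if "s \<in> {0..1}" for s using d(2)[OF _ x(1), of "1 - s"] that by simp
      show "?u 0 \<in> ball 0 e'" using d(2)[OF _ x(1), of 1] by simp
      fix s :: real assume s: "s \<in> {0..1}"
      have img: "(\<lambda>s::real. 1 - s) ` {0..1} = {0..1}" by simp
      have "((\<lambda>s. 1 - s) has_vector_derivative - 1) (at s within {0..1})"
        by (auto intro!: derivative_eq_intros)
      moreover have "((\<lambda>t. \<phi> t x) has_vector_derivative X (1 - s) (\<phi> (1 - s) x)) (at (1 - s) within (\<lambda>s. 1 - s) ` {0..1})"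
        unfolding img by (rule F.flow_ode) (use s x in auto)
      ultimately have "((\<lambda>t. \<phi> t x) \<circ> (\<lambda>s. 1 - s) has_vector_derivative (- 1) *\<^sub>R X (1 - s) (\<phi> (1 - s) x)) (at s within {0..1})"
        by (rule vector_diff_chain_within)
      then show "(?u has_vector_derivative - X (1 - s) (?u s)) (at s within {0..1})"
        by (simp add: o_def)
    qed simp
    then show "\<phi>' 1 (\<phi> 1 x) = x" using F.flow_start[OF x(2)] by simp
  qed (use d F.radius in auto)
qed

theorem flow_diffeo:
  assumes X: "\<And>j. germ_family r (\<lambda>t x. X t x $ j)" and X0: "\<And>t. t \<in> {0..1} \<Longrightarrow> X t 0 = 0"
    and F: "flow_germ r X e \<rho> \<phi> Z D"
  shows "diffeo_germ r (\<phi> 1)"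
proof -
  interpret F: flow_germ r X e \<rho> \<phi> Z D by (rule F)
  let ?Y = "\<lambda>t x. - X (1 - t) x"
  have Y: "germ_family r (\<lambda>t x. ?Y t x $ j)" for j
  proof -
    have "germ_family r (\<lambda>t x. X (1 - t) x $ j)"
      by (rule germ_family_reparametrize[OF _ _ X]) (auto intro!: continuous_intros)
    from germ_family_minus[OF this] show ?thesis by simp
  qed
  have Y0: "?Y t 0 = 0" if "t \<in> {0..1}" for t using X0[of "1 - t"] that by simp
  obtain e' \<rho>' \<phi>' Z' D' where G: "flow_germ r ?Y e' \<rho>' \<phi>' Z' D'" by (rule germ_flow[OF Y Y0]) (assumption | rule that)+
  interpret G: flow_germ r ?Y e' \<rho>' \<phi>' Z' D' by (rule G)
  \<comment> \<open>Reversing twice restores the field, so the same lemma gives the other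
    composite.\<close>
  have "(\<lambda>t x. - ?Y (1 - t) x) = X" by (simp add: fun_eq_iff)
  then have "\<forall>\<^sub>0x. \<phi> 1 (\<phi>' 1 x) = x"
    using F by (intro reversed_flow_inverse[OF G]) simp
  with reversed_flow_inverse[OF F G] show ?thesis
    unfolding diffeo_germ_def map_germ_def
    using fun_germ_at_time[OF F.flow_family, of 1] fun_germ_at_time[OF G.flow_family, of 1] F.flow_0[of 1] G.flow_0[of 1]
    by (intro conjI exI[of _ "\<phi>' 1"]) auto
qed

text \<open>
  The homotopy \<open>L + t (F - L)\<close> from the linear part \<open>L\<close> of \<open>F\<close> to \<open>F\<close> is trivialized by the flow of
  \<open>- (d(L + t (F - L)))\<inverse> (F - L)\<close>, which is computed by Cramer's rule.
\<close>

theorem inverse_function_germ: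
  fixes F :: "real ^ 'n \<Rightarrow> real ^ 'n"
  assumes F: "map_germ r F" "F 0 = 0" and F': "(F has_derivative (*v) A) (at 0)" and A: "invertible A"
  shows "diffeo_germ r F"
proof -
  obtain e0 J where e0: "e0 > 0" and J: "\<And>i j. fun_germ r (\<lambda>x. J x $ i $ j)"
    "\<And>x. x \<in> ball 0 e0 \<Longrightarrow> (F has_derivative (*v) (J x)) (at x)"
    by (rule map_germ_jacobian[OF F(1)]) (rule that)
  have "(*v) (J 0) = (*v) A" using has_derivative_unique[OF J(2)[of 0] F'] e0 by simp
  then have J0: "J 0 = A" by (simp add: matrix_eq fun_eq_iff)
  \<comment> \<open>\<open>M t\<close> is the space derivative of the homotopy from the linear part
    to \<open>F\<close>, and \<open>b\<close> is minus its time derivative.\<close>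
  define M where "M = (\<lambda>t x. A + t *\<^sub>R (J x - A))"
  define b where "b = (\<lambda>x. A *v x - F x)"
  define X where "X = (\<lambda>t x. \<chi> k. det (\<chi> i j. if j = k then b x $ i else M t x $ i $ j) * inverse (det (M t x)))"
  have M0: "M t 0 = A" for t by (simp add: M_def J0)
  have det_A: "det A \<noteq> 0" using A by (simp add: invertible_det_nz)
  have J_fam: "germ_family r (\<lambda>_ x. J x $ i $ j)" for i j using J(1) by (simp add: germ_family_constant_iff)
  have M_fam: "germ_family r (\<lambda>t x. M t x $ i $ j)" for i j
    unfolding M_def by simp (intro germ_family_add germ_family_const germ_family_mult germ_family_diff J_fam germ_family_time continuous_on_id)
  have b_fam: "germ_family r (\<lambda>t x. b x $ i)" for i
  proof -
    have "germ_family r (\<lambda>_ x. F x $ i)" using F(1) by (simp add: germ_family_constant_iff map_germ_def)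
    then show ?thesis unfolding b_def matrix_vector_mult_def
      by simp (intro germ_family_diff germ_family_sum germ_family_mult germ_family_const germ_family_coordinate)
  qed
  have det_fam: "germ_family r (\<lambda>t x. det (N t x))" if "\<And>i j. germ_family r (\<lambda>t x. N t x $ i $ j)"
    for N :: "real \<Rightarrow> real ^ 'n \<Rightarrow> real ^ 'n ^ 'n"
    unfolding det_def by (intro germ_family_sum germ_family_mult germ_family_const germ_family_prod that)
  have inv_fam: "germ_family r (\<lambda>t x. inverse (det (M t x)))"
    by (rule germ_family_inverse[OF det_fam[OF M_fam]]) (simp add: M0 det_A)
  have "germ_family r (\<lambda>t x. det (\<chi> i j. if j = k then b x $ i else M t x $ i $ j))" for k
  proof (rule det_fam)
    fix i j show "germ_family r (\<lambda>t x. (\<chi> i j. if j = k then b x $ i else M t x $ i $ j) $ i $ j)"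
      using b_fam[of i] M_fam[of i j] by (cases "j = k") simp_all
  qed
  then have X_fam: "germ_family r (\<lambda>t x. X t x $ k)" for k
    unfolding X_def by simp (intro germ_family_mult inv_fam)
  have solve: "M t x *v X t x = b x" if "det (M t x) \<noteq> 0" for t x
    using cramer[OF that, of "X t x" "b x"] by (simp add: X_def divide_inverse)
  have X0: "X t 0 = 0" for t
  proof -
    have "A *v X t 0 = A *v 0" using solve[of t 0] M0[of t] det_A F(2) by (simp add: b_def)
    then show ?thesis using A by (metis invertible_def matrix_left_invertible_injective injD)
  qed
  obtain e \<rho> \<phi> Z D where flow: "flow_germ r X e \<rho> \<phi> Z D" by (rule germ_flow[OF X_fam X0]) (assumption | rule that)+
  interpret flow_germ r X e \<rho> \<phi> Z D by (rule flow)
  have diffeo: "diffeo_germ r (\<phi> 1)" by (rule flow_diffeo[OF X_fam X0 flow])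
  obtain e1 where e1: "e1 > 0" "cont_family (ball 0 e1) (\<lambda>t x. det (M t x))"
    by (rule germ_family_continuous[OF det_fam[OF M_fam]]) (rule that)
  obtain e2 where e2: "e2 > 0" "\<And>t x. t \<in> {0..1} \<Longrightarrow> x \<in> ball 0 e2 \<Longrightarrow> (\<lambda>(t, x). det (M t x)) (t, x) \<in> - {0}"
    by (rule tube_unit_interval[OF e1(2) open_ball, of 0 "- {0}"]) (use e1(1) det_A M0 that in auto)
  obtain d where d: "d > 0" "\<And>t x. t \<in> {0..1} \<Longrightarrow> x \<in> ball 0 d \<Longrightarrow> \<phi> t x \<in> ball 0 (min e0 e2)"
    by (rule germ_family_small[OF flow_family flow_0, of "min e0 e2"]) (use e0 e2(1) that in auto)
  \<comment> \<open>The homotopy is constant along trajectories, because its derivative there is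
    \<open>M t y *v X t y - b y\<close> at the moving point y. Comparison of the times 0 and 1 shows
    that \<open>F\<close> after \<open>\<phi> 1\<close> is the linear map \<open>A\<close>, so
    \<open>F\<close> is \<open>A\<close> after the inverse of \<open>\<phi> 1\<close>.\<close>
  have key: "F (\<phi> 1 x) = A *v x" if x: "x \<in> ball 0 (min d e)" for x
  proof -
    let ?h = "\<lambda>t. A *v \<phi> t x + t *\<^sub>R (F (\<phi> t x) - A *v \<phi> t x)"
    have "(?h has_vector_derivative 0) (at t within {0..1})" if t: "t \<in> {0..1}" for t
    proof -
      have xe: "x \<in> ball 0 e" "x \<in> ball 0 d" using x by auto
      have y: "\<phi> t x \<in> ball 0 e0" "\<phi> t x \<in> ball 0 e2" using d(2)[OF t xe(2)] by auto
      note \<phi>' = flow_ode[OF t xe(1)]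
      have h1: "((\<lambda>t. A *v \<phi> t x) has_vector_derivative A *v X t (\<phi> t x)) (at t within {0..1})"
        by (rule bounded_linear.has_vector_derivative[OF matrix_vector_mul_bounded_linear \<phi>'])
      have "((F \<circ> (\<lambda>t. \<phi> t x)) has_derivative ((*v) (J (\<phi> t x)) \<circ> (\<lambda>s. s *\<^sub>R X t (\<phi> t x)))) (at t within {0..1})"
        using \<phi>' unfolding has_vector_derivative_def
        by (rule diff_chain_within) (rule has_derivative_at_withinI[OF J(2)[OF y(1)]])
      then have h2: "((\<lambda>t. F (\<phi> t x)) has_vector_derivative J (\<phi> t x) *v X t (\<phi> t x)) (at t within {0..1})"
        by (simp add: has_vector_derivative_def o_def matrix_vector_mult_scaleR)
      have "(?h has_vector_derivative A *v X t (\<phi> t x) + (t *\<^sub>R (J (\<phi> t x) *v X t (\<phi> t x) - A *v X t (\<phi> t x))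
          + 1 *\<^sub>R (F (\<phi> t x) - A *v \<phi> t x))) (at t within {0..1})"
        by (intro has_vector_derivative_add has_vector_derivative_scaleR has_vector_derivative_diff h1 h2 DERIV_ident)
      moreover have "A *v X t (\<phi> t x) + (t *\<^sub>R (J (\<phi> t x) *v X t (\<phi> t x) - A *v X t (\<phi> t x)) + 1 *\<^sub>R (F (\<phi> t x) - A *v \<phi> t x))
          = M t (\<phi> t x) *v X t (\<phi> t x) - b (\<phi> t x)"
        by (simp add: M_def b_def matrix_vector_mult_add_rdistrib matrix_vector_mult_diff_rdistrib scaleR_matrix_vector_assoc[symmetric])
      moreover have "det (M t (\<phi> t x)) \<noteq> 0" using e2(2)[OF t y(2)] by simp
      ultimately show ?thesis using solve[of t "\<phi> t x"] by simp
    qed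
    then obtain c where "\<And>t. t \<in> {0..1} \<Longrightarrow> ?h t = c"
      by (rule has_vector_derivative_zero_constant[rotated]) (use that in auto)
    from this[of 0] this[of 1] show ?thesis using flow_start[of x] x by simp
  qed
  obtain G where G: "diffeo_germ r G" "\<forall>\<^sub>0x. G (\<phi> 1 x) = x" "\<forall>\<^sub>0y. \<phi> 1 (G y) = y"
    by (rule diffeo_germ_inverse[OF diffeo]) (rule that)
  obtain A' where A': "A ** A' = mat 1" "A' ** A = mat 1" using A by (auto simp: invertible_def)
  have lin: "map_germ r ((*v) B)" for B :: "real ^ 'n ^ 'n"
    unfolding map_germ_def matrix_vector_mult_def by simp (intro allI fun_germ_sum fun_germ_mult fun_germ_const fun_germ_coordinate)
  have "diffeo_germ r ((*v) A)"
    unfolding diffeo_germ_def using lin A'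
    by (intro conjI exI[of _ "(*v) A'"]) (auto simp: matrix_vector_mul_assoc)
  then have "diffeo_germ r (\<lambda>y. A *v G y)" using G(1) by (rule diffeo_germ_compose)
  moreover have "\<forall>\<^sub>0y. A *v G y = F y"
  proof -
    have "\<forall>\<^sub>0x. F (\<phi> 1 x) = A *v x"
      unfolding eventually_nhds_metric using d(1) radius(1) key
      by (intro exI[of _ "min d e"]) (auto simp: dist_commute)
    from map_germ_tendsto_0[OF _ _ this, of r G] G show ?thesis
      unfolding diffeo_germ_def by (auto elim: eventually_elim2)
  qed
  ultimately show ?thesis by (rule diffeo_germ_cong)
qed

section \<open>Two-forms\<close>

lemma bilinear_coordinates:
  fixes B :: "real ^ 'm \<Rightarrow> real ^ 'n \<Rightarrow> real"
  assumes "bilinear B"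
  shows "B u v = (\<Sum>i\<in>UNIV. \<Sum>j\<in>UNIV. B (axis i 1) (axis j 1) * u $ i * v $ j)"
proof -
  have "B u v = B (\<Sum>i\<in>UNIV. u $ i *\<^sub>R axis i 1) (\<Sum>j\<in>UNIV. v $ j *\<^sub>R axis j 1)"
    using basis_expansion[of u] basis_expansion[of v] by (simp add: scalar_mult_eq_scaleR)
  also have "\<dots> = (\<Sum>(i, j)\<in>UNIV \<times> UNIV. B (u $ i *\<^sub>R axis i 1) (v $ j *\<^sub>R axis j 1))"
    by (rule bilinear_sum[OF assms])
  also have "\<dots> = (\<Sum>i\<in>UNIV. \<Sum>j\<in>UNIV. B (axis i 1) (axis j 1) * u $ i * v $ j)"
    unfolding sum.cartesian_product[symmetric]
    by (simp add: bilinear_lmul[OF assms] bilinear_rmul[OF assms] algebra_simps)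
  finally show ?thesis .
qed

lemma bilinear_alternating_skew:
  fixes B :: "'a::real_vector \<Rightarrow> 'a \<Rightarrow> real"
  assumes B: "bilinear B" and alt: "\<And>u. B u u = 0"
  shows "B v u = - B u v"
proof -
  have "B (u + v) (u + v) = B u u + B u v + (B v u + B v v)"
    by (simp add: bilinear_ladd[OF B] bilinear_radd[OF B])
  then show ?thesis by (simp add: alt)
qed

text \<open>Product rule for a form evaluated on moving vectors, obtained from its coefficients in
  the standard basis. It is applied both along curves in time and in space.\<close>

lemma two_form_chain:
  fixes \<omega> :: "'n::finite two_form" and y U V :: "'a::real_normed_vector \<Rightarrow> real ^ 'n"
  assumes lin: "\<And>q. q \<in> T \<Longrightarrow> bilinear (\<omega> q)" and T: "open T"
    and d: "\<And>u v. ((\<lambda>q. \<omega> q u v) has_derivative (\<lambda>h. \<omega>' h u v)) (at (y x))"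
    and y: "(y has_derivative y') (at x within S)" "x \<in> S" "\<And>s. s \<in> S \<Longrightarrow> y s \<in> T"
    and U: "(U has_derivative U') (at x within S)" and V: "(V has_derivative V') (at x within S)"
  shows "((\<lambda>s. \<omega> (y s) (U s) (V s)) has_derivative
    (\<lambda>h. \<omega>' (y' h) (U x) (V x) + \<omega> (y x) (U' h) (V x) + \<omega> (y x) (U x) (V' h))) (at x within S)"
proof -
  let ?e = "\<lambda>i. axis i 1 :: real ^ 'n"
  have yx: "y x \<in> T" using y(2,3) by simp
  \<comment> \<open>The derivative of the form inherits the expansion in the two vector arguments,
    because the form is bilinear on a whole neighbourhood.\<close>
  have coeff: "\<omega>' h u v = (\<Sum>i\<in>UNIV. \<Sum>j\<in>UNIV. \<omega>' h (?e i) (?e j) * u $ i * v $ j)" for h u v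
  proof -
    have "((\<lambda>q. \<Sum>i\<in>UNIV. \<Sum>j\<in>UNIV. \<omega> q (?e i) (?e j) * u $ i * v $ j) has_derivative
        (\<lambda>h. \<Sum>i\<in>UNIV. \<Sum>j\<in>UNIV. \<omega>' h (?e i) (?e j) * u $ i * v $ j)) (at (y x))"
      by (intro has_derivative_sum has_derivative_mult_left d)
    then have "((\<lambda>q. \<omega> q u v) has_derivative
        (\<lambda>h. \<Sum>i\<in>UNIV. \<Sum>j\<in>UNIV. \<omega>' h (?e i) (?e j) * u $ i * v $ j)) (at (y x))"
      by (rule has_derivative_transform_within_open[OF _ T yx]) (rule bilinear_coordinates[OF lin, symmetric])
    from has_derivative_unique[OF d this] show ?thesis by (rule fun_cong)
  qed
  have c: "((\<lambda>s. \<omega> (y s) (?e i) (?e j)) has_derivative (\<lambda>h. \<omega>' (y' h) (?e i) (?e j))) (at x within S)" for i j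
    using has_derivative_compose[OF y(1) d] by simp
  have U_nth: "((\<lambda>s. U s $ i) has_derivative (\<lambda>h. U' h $ i)) (at x within S)" for i
    by (rule bounded_linear.has_derivative[OF bounded_linear_vec_nth U])
  have V_nth: "((\<lambda>s. V s $ i) has_derivative (\<lambda>h. V' h $ i)) (at x within S)" for i
    by (rule bounded_linear.has_derivative[OF bounded_linear_vec_nth V])
  have "((\<lambda>s. \<Sum>i\<in>UNIV. \<Sum>j\<in>UNIV. \<omega> (y s) (?e i) (?e j) * U s $ i * V s $ j) has_derivative
      (\<lambda>h. \<Sum>i\<in>UNIV. \<Sum>j\<in>UNIV. \<omega> (y x) (?e i) (?e j) * U x $ i * V' h $ j +
        (\<omega> (y x) (?e i) (?e j) * U' h $ i + \<omega>' (y' h) (?e i) (?e j) * U x $ i) * V x $ j)) (at x within S)"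
    by (intro has_derivative_sum has_derivative_mult c U_nth V_nth)
  then have "((\<lambda>s. \<omega> (y s) (U s) (V s)) has_derivative
      (\<lambda>h. \<Sum>i\<in>UNIV. \<Sum>j\<in>UNIV. \<omega> (y x) (?e i) (?e j) * U x $ i * V' h $ j +
        (\<omega> (y x) (?e i) (?e j) * U' h $ i + \<omega>' (y' h) (?e i) (?e j) * U x $ i) * V x $ j)) (at x within S)"
    by (rule has_derivative_transform[OF y(2), rotated]) (rule bilinear_coordinates[OF lin[OF y(3)]])
  moreover have "(\<Sum>i\<in>UNIV. \<Sum>j\<in>UNIV. \<omega> (y x) (?e i) (?e j) * U x $ i * V' h $ j +
        (\<omega> (y x) (?e i) (?e j) * U' h $ i + \<omega>' (y' h) (?e i) (?e j) * U x $ i) * V x $ j)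
      = \<omega>' (y' h) (U x) (V x) + \<omega> (y x) (U' h) (V x) + \<omega> (y x) (U x) (V' h)" for h
    unfolding coeff[of "y' h" "U x"] bilinear_coordinates[OF lin[OF yx], of "U' h"] bilinear_coordinates[OF lin[OF yx], of "U x"]
    by (simp add: sum.distrib[symmetric] distrib_right add.commute add.left_commute)
  ultimately show ?thesis by simp
qed

section \<open>Closed two-form germs and Moser's method\<close>

lemma fun_germ_continuous:
  assumes "fun_germ r f"
  obtains e where "e > 0" "continuous_on (ball 0 e) f"
proof -
  have "germ_family r (\<lambda>_. f)" using assms by (simp add: germ_family_constant_iff)
  then obtain e where e: "e > 0" "cont_family (ball 0 e) (\<lambda>t x. f x)"
    by (rule germ_family_continuous) (rule that)
  have "continuous_on (ball 0 e) (\<lambda>x. (\<lambda>(t, x). f x) (0::real, x))"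
    by (rule continuous_on_compose2[OF e(2)]) (auto intro!: continuous_intros)
  then show ?thesis by (intro that[OF e(1)]) simp
qed

lemma map_germ_C1:
  fixes F :: "real ^ 'm \<Rightarrow> real ^ 'n"
  assumes F: "map_germ r F"
  obtains e J where "e > 0" "\<And>x. x \<in> ball 0 e \<Longrightarrow> (F has_derivative (*v) (J x)) (at x)"
    "\<And>h. continuous_on (ball 0 e) (\<lambda>x. J x *v h)"
proof -
  obtain e J where e: "e > 0" and J: "\<And>i j. fun_germ r (\<lambda>x. J x $ i $ j)"
    "\<And>x. x \<in> ball 0 e \<Longrightarrow> (F has_derivative (*v) (J x)) (at x)"
    by (rule map_germ_jacobian[OF F]) (rule that)
  have "\<exists>d>0. \<forall>k. continuous_on (ball 0 d) (\<lambda>x. J x $ fst k $ snd k)"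
  proof (rule uniform_radius)
    show "\<exists>d>0. continuous_on (ball 0 d) (\<lambda>x. J x $ fst k $ snd k)" for k
    proof -
      obtain d where "d > 0" "continuous_on (ball 0 d) (\<lambda>x. J x $ fst k $ snd k)"
        using J(1) by (rule fun_germ_continuous) (rule that)
      then show ?thesis by (intro exI[of _ d] conjI)
    qed
    show "continuous_on (ball 0 d') (\<lambda>x. J x $ fst k $ snd k)"
      if "continuous_on (ball 0 d) (\<lambda>x. J x $ fst k $ snd k)" "d' \<le> d" for k and d d' :: real
      by (rule continuous_on_subset[OF that(1) subset_ball[OF that(2)]])
  qed
  then obtain d where d: "d > 0" "\<And>k. continuous_on (ball 0 d) (\<lambda>x. J x $ fst k $ snd k)" by blast
  show ?thesis
  proof (rule that[of "min d e" J])
    have "continuous_on (ball 0 (min d e)) (\<lambda>x. J x $ i $ j)" for i j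
      by (rule continuous_on_subset[OF d(2)[of "(i, j)", simplified]]) auto
    then show "continuous_on (ball 0 (min d e)) (\<lambda>x. J x *v h)" for h
      by (intro continuous_on_vecI) (simp add: matrix_vector_mult_def continuous_on_sum continuous_on_mult)
  qed (use d(1) e J(2) in auto)
qed

lemma map_germs_C1:
  fixes F :: "'i::finite \<Rightarrow> real ^ 'm \<Rightarrow> real ^ 'n"
  assumes F: "\<And>i. map_germ r (F i)"
  obtains e J where "e > 0" "\<And>i x. x \<in> ball 0 e \<Longrightarrow> (F i has_derivative (*v) (J i x)) (at x)"
    "\<And>i h. continuous_on (ball 0 e) (\<lambda>x. J i x *v h)"
proof -
  let ?P = "\<lambda>i e J. (\<forall>x\<in>ball 0 e. (F i has_derivative (*v) (J x)) (at x)) \<and>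
      (\<forall>h. continuous_on (ball 0 e) (\<lambda>x. J x *v h))"
  have "\<exists>e>0. \<forall>i. \<exists>J. ?P i e J"
  proof (rule uniform_radius)
    fix i
    obtain e J where "e > 0" "\<And>x. x \<in> ball 0 e \<Longrightarrow> (F i has_derivative (*v) (J x)) (at x)"
      "\<And>h. continuous_on (ball 0 e) (\<lambda>x. J x *v h)" by (rule map_germ_C1[OF F]) (rule that)
    then show "\<exists>e>0. \<exists>J. ?P i e J" by (intro exI[of _ e] exI[of _ J] conjI ballI allI)
  next
    fix i and e e' :: real assume "\<exists>J. ?P i e J"
    then obtain J where J: "\<forall>x\<in>ball 0 e. (F i has_derivative (*v) (J x)) (at x)"
      "\<forall>h. continuous_on (ball 0 e) (\<lambda>x. J x *v h)" by (elim exE conjE)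
    assume "e' \<le> e"
    then have sub: "ball 0 e' \<subseteq> ball (0 :: real ^ 'm) e" by (rule subset_ball)
    show "\<exists>J. ?P i e' J"
      by (intro exI[of _ J] conjI ballI allI bspec[OF J(1)] subsetD[OF sub]
        continuous_on_subset[OF spec[OF J(2)] sub]) assumption
  qed
  then obtain e where e: "e > 0" "\<forall>i. \<exists>J. ?P i e J" by (elim exE conjE)
  from choice[OF e(2)] obtain J where "\<forall>i. ?P i e (J i)" by (elim exE)
  then show ?thesis by (intro that[OF e(1), of J]) auto
qed

lemma two_form_germ_calculus:
  fixes \<omega> :: "'n::finite two_form"
  assumes \<omega>: "two_form_germ r \<omega>"
  obtains e \<omega>' where "e > 0" "\<And>p. p \<in> ball 0 e \<Longrightarrow> bilinear (\<omega> p)" "\<And>p u. p \<in> ball 0 e \<Longrightarrow> \<omega> p u u = 0"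
    "\<And>p u v. p \<in> ball 0 e \<Longrightarrow> ((\<lambda>q. \<omega> q u v) has_derivative (\<lambda>h. \<omega>' p h u v)) (at p)"
    "\<And>h u v. continuous_on (ball 0 e) (\<lambda>p. \<omega>' p h u v)"
proof -
  let ?e = "\<lambda>i. axis i 1 :: real ^ 'n"
  obtain d where d: "d > 0" "\<And>p. dist p 0 < d \<Longrightarrow> bilinear (\<omega> p) \<and> (\<forall>u. \<omega> p u u = 0)"
    using \<omega> unfolding two_form_germ_def eventually_nhds_metric by blast
  \<comment> \<open>The coefficients are grouped into finitely many row vectors, each a map germ, so
    that one ball serves all of them.\<close>
  define a where "a = (\<lambda>i p. \<chi> j. \<omega> p (?e i) (?e j))"
  have a: "map_germ r (a i)" for i
    using \<omega> unfolding two_form_germ_def map_germ_def a_def by simp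
  obtain e J where e: "e > 0" and J: "\<And>i p. p \<in> ball 0 e \<Longrightarrow> (a i has_derivative (*v) (J i p)) (at p)"
    and J_cont: "\<And>i h. continuous_on (ball 0 e) (\<lambda>p. J i p *v h)"
    by (rule map_germs_C1[OF a]) (rule that)
  let ?e = "min d e" and ?\<omega>' = "\<lambda>p h u v. \<Sum>i\<in>UNIV. \<Sum>j\<in>UNIV. (J i p *v h) $ j * u $ i * v $ j"
  show ?thesis
  proof (rule that[of ?e ?\<omega>'])
    fix p :: "real ^ 'n" and u v :: "real ^ 'n" assume p: "p \<in> ball 0 ?e"
    have "((\<lambda>q. \<omega> q (axis i 1) (axis j 1)) has_derivative (\<lambda>h. (J i p *v h) $ j)) (at p)" for i j
      using bounded_linear.has_derivative[OF bounded_linear_vec_nth J, of p i j] p by (simp add: a_def)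
    then have "((\<lambda>q. \<Sum>i\<in>UNIV. \<Sum>j\<in>UNIV. \<omega> q (axis i 1) (axis j 1) * u $ i * v $ j) has_derivative (\<lambda>h. ?\<omega>' p h u v)) (at p)"
      by (intro has_derivative_sum has_derivative_mult_left)
    then show "((\<lambda>q. \<omega> q u v) has_derivative (\<lambda>h. ?\<omega>' p h u v)) (at p)"
      by (rule has_derivative_transform_within_open[OF _ open_ball p])
        (use d(2) in \<open>simp add: bilinear_coordinates[symmetric] dist_commute\<close>)
  next
    have "continuous_on (ball 0 ?e) (\<lambda>p. (J i p *v h) $ j)" for i j h
      by (rule continuous_on_subset[OF continuous_on_component[OF J_cont]]) auto
    then show "continuous_on (ball 0 ?e) (\<lambda>p. ?\<omega>' p h u v)" for h u v
      by (intro continuous_on_sum continuous_on_mult continuous_on_const)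
  qed (use d e in \<open>auto simp: dist_commute\<close>)
qed

text \<open>A representative on a ball where all conditions hold pointwise. The first vector after
  the point in \<open>\<omega>'\<close> is the direction of differentiation.\<close>

locale closed_form =
  fixes \<omega> :: "'n::finite two_form" and e :: real and \<omega>' :: "real ^ 'n \<Rightarrow> 'n two_form"
  assumes radius: "e > 0"
    and bilinear: "\<And>p. p \<in> ball 0 e \<Longrightarrow> bilinear (\<omega> p)"
    and alternating: "\<And>p u. p \<in> ball 0 e \<Longrightarrow> \<omega> p u u = 0"
    and deriv: "\<And>p u v. p \<in> ball 0 e \<Longrightarrow> ((\<lambda>q. \<omega> q u v) has_derivative (\<lambda>h. \<omega>' p h u v)) (at p)"
    and closed: "\<And>p u v w. p \<in> ball 0 e \<Longrightarrow> \<omega>' p u v w - \<omega>' p v u w + \<omega>' p w u v = 0"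
    and deriv_cont: "\<And>h u v. continuous_on (ball 0 e) (\<lambda>p. \<omega>' p h u v)"

lemma closed_germ_form:
  fixes \<omega> :: "'n::finite two_form"
  assumes \<omega>: "two_form_germ r \<omega>" and closed: "closed_germ \<omega>"
  obtains e \<omega>' where "closed_form \<omega> e \<omega>'"
proof -
  obtain e \<omega>' where e: "e > 0" "\<And>p. p \<in> ball 0 e \<Longrightarrow> bilinear (\<omega> p)" "\<And>p u. p \<in> ball 0 e \<Longrightarrow> \<omega> p u u = 0"
    "\<And>p u v. p \<in> ball 0 e \<Longrightarrow> ((\<lambda>q. \<omega> q u v) has_derivative (\<lambda>h. \<omega>' p h u v)) (at p)"
    "\<And>h u v. continuous_on (ball 0 e) (\<lambda>p. \<omega>' p h u v)"
    by (rule two_form_germ_calculus[OF \<omega>]) (rule that)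
  obtain d where d: "d > 0" "\<And>p. dist p 0 < d \<Longrightarrow> \<forall>u v w. ext_deriv \<omega> p u v w = 0"
    using closed unfolding closed_germ_def eventually_nhds_metric by blast
  show ?thesis
  proof (rule that[of "min d e" \<omega>'], rule closed_form.intro)
    fix p u v w :: "real ^ 'n" assume p: "p \<in> ball 0 (min d e)"
    have "frechet_derivative (\<lambda>q. \<omega> q u v) (at p) = (\<lambda>h. \<omega>' p h u v)" for u v
      by (rule frechet_derivative_at[OF e(4), symmetric]) (use p in simp)
    then show "\<omega>' p u v w - \<omega>' p v u w + \<omega>' p w u v = 0"
      using d(2)[of p] p by (simp add: ext_deriv_def dist_commute)
  next
    fix u v w show "continuous_on (ball 0 (min d e)) (\<lambda>p. \<omega>' p u v w)" by (rule continuous_on_subset[OF e(5)]) auto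
  qed (use d(1) e(1-4) in auto)
qed

text \<open>With the vector field \<eta> read as a one-form, the hypotheses say that
  \<open>\<omega>1 - \<omega>0\<close> is its exterior derivative and that contracting the
  interpolated form with \<open>X\<close> gives minus \<eta>. The pullback of the interpolated form
  under the flow is then constant in t; differentiating it with the variational equation takes the
  place of Cartan's formula.\<close>

theorem moser:
  fixes \<omega>0 \<omega>1 :: "'n::finite two_form" and X :: "real \<Rightarrow> real ^ 'n \<Rightarrow> real ^ 'n"
  assumes \<omega>0: "two_form_germ r \<omega>0" "closed_germ \<omega>0" and \<omega>1: "two_form_germ r \<omega>1" "closed_germ \<omega>1"
    and d: "d > 0"
    and \<eta>: "\<And>p. p \<in> ball 0 d \<Longrightarrow> (\<eta> has_derivative \<eta>' p) (at p)"
      "\<And>p u v. p \<in> ball 0 d \<Longrightarrow> \<eta>' p u \<bullet> v - \<eta>' p v \<bullet> u = \<omega>1 p u v - \<omega>0 p u v"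
    and X: "\<And>j. germ_family r (\<lambda>t x. X t x $ j)" "\<And>t. t \<in> {0..1} \<Longrightarrow> X t 0 = 0"
      "\<And>t p v. t \<in> {0..1} \<Longrightarrow> p \<in> ball 0 d \<Longrightarrow> (1 - t) * \<omega>0 p (X t p) v + t * \<omega>1 p (X t p) v = - (\<eta> p \<bullet> v)"
  obtains \<Psi> where "diffeo_germ r \<Psi>" "two_form_germ_eq (pullback \<Psi> \<omega>1) \<omega>0"
proof -
  obtain e \<rho> \<phi> Z D where flow: "flow_germ r X e \<rho> \<phi> Z D" by (rule germ_flow[OF X(1,2)]) (assumption | rule that)+
  interpret flow_germ r X e \<rho> \<phi> Z D by (rule flow)
  obtain e0 a where "closed_form \<omega>0 e0 a" by (rule closed_germ_form[OF \<omega>0]) (rule that)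
  then interpret A: closed_form \<omega>0 e0 a .
  obtain e1 b where "closed_form \<omega>1 e1 b" by (rule closed_germ_form[OF \<omega>1]) (rule that)
  then interpret B: closed_form \<omega>1 e1 b .
  define B where "B = ball (0 :: real ^ 'n) (min (min d \<rho>) (min e0 e1))"
  have B: "open B" "\<And>p. p \<in> B \<Longrightarrow> p \<in> ball 0 d" "\<And>p. p \<in> B \<Longrightarrow> p \<in> ball 0 \<rho>"
    "\<And>p. p \<in> B \<Longrightarrow> p \<in> ball 0 e0" "\<And>p. p \<in> B \<Longrightarrow> p \<in> ball 0 e1" by (auto simp: B_def)
  \<comment> \<open>The equation for \<open>X\<close>, differentiated in the direction h. The
    derivative \<open>D\<close> of the field that enters is the one of the variational
    equation.\<close>
  have contraction: "(1 - t) * a p h (X t p) v + t * b p h (X t p) v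
      + ((1 - t) * \<omega>0 p (D t p h) v + t * \<omega>1 p (D t p h) v) = - (\<eta>' p h \<bullet> v)"
    if t: "t \<in> {0..1}" and p: "p \<in> B" for t p h v
  proof -
    note XD = has_derivative_at_withinI[OF field_deriv[OF t B(3)[OF p]], of B]
    note c = has_derivative_const[of v "at p within B"]
    have 0: "((\<lambda>q. \<omega>0 q (X t q) v) has_derivative
        (\<lambda>h. a p h (X t p) v + \<omega>0 p (D t p h) v + \<omega>0 p (X t p) 0)) (at p within B)"
      by (rule two_form_chain[OF A.bilinear[OF B(4)] B(1) A.deriv[OF B(4)] has_derivative_ident _ _ XD c]) (use p in auto)
    have 1: "((\<lambda>q. \<omega>1 q (X t q) v) has_derivative
        (\<lambda>h. b p h (X t p) v + \<omega>1 p (D t p h) v + \<omega>1 p (X t p) 0)) (at p within B)"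
      by (rule two_form_chain[OF B.bilinear[OF B(5)] B(1) B.deriv[OF B(5)] has_derivative_ident _ _ XD c]) (use p in auto)
    have "((\<lambda>q. (1 - t) * \<omega>0 q (X t q) v + t * \<omega>1 q (X t q) v) has_derivative
        (\<lambda>h. (1 - t) * (a p h (X t p) v + \<omega>0 p (D t p h) v + \<omega>0 p (X t p) 0)
          + t * (b p h (X t p) v + \<omega>1 p (D t p h) v + \<omega>1 p (X t p) 0))) (at p)"
      using has_derivative_add[OF has_derivative_mult_right[OF 0] has_derivative_mult_right[OF 1]]
      by (simp add: at_within_open[OF p B(1)])
    moreover have "((\<lambda>q. (1 - t) * \<omega>0 q (X t q) v + t * \<omega>1 q (X t q) v) has_derivative (\<lambda>h. - (\<eta>' p h \<bullet> v))) (at p)"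
    proof -
      have "((\<lambda>q. - (\<eta> q \<bullet> v)) has_derivative (\<lambda>h. - (\<eta>' p h \<bullet> v))) (at p)"
        by (intro has_derivative_minus has_derivative_inner_left \<eta>(1) B(2) p)
      then show ?thesis
        by (rule has_derivative_transform_within_open[OF _ B(1) p]) (rule X(3)[OF t B(2), symmetric])
    qed
    ultimately have "(1 - t) * (a p h (X t p) v + \<omega>0 p (D t p h) v + \<omega>0 p (X t p) 0)
        + t * (b p h (X t p) v + \<omega>1 p (D t p h) v + \<omega>1 p (X t p) 0) = - (\<eta>' p h \<bullet> v)"
      by (rule fun_cong[OF has_derivative_unique])
    then show ?thesis
      by (simp add: bilinear_rzero[OF A.bilinear[OF B(4)[OF p]]] bilinear_rzero[OF B.bilinear[OF B(5)[OF p]]] distrib_left)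
  qed
  obtain c where c: "c > 0" "\<And>t x. t \<in> {0..1} \<Longrightarrow> x \<in> ball 0 c \<Longrightarrow> \<phi> t x \<in> ball 0 (min (min d \<rho>) (min e0 e1))"
    by (rule germ_family_small[OF flow_family flow_0, of "min (min d \<rho>) (min e0 e1)"]) (use d radius A.radius B.radius that in auto)
  have pull: "\<omega>1 (\<phi> 1 x) (Z 1 x u) (Z 1 x v) = \<omega>0 x u v" if x: "x \<in> ball 0 c" "x \<in> ball 0 e" for x u v
  proof -
    let ?y = "\<lambda>t. \<phi> t x" and ?U = "\<lambda>t. Z t x u" and ?V = "\<lambda>t. Z t x v"
    have y: "?y t \<in> B" if "t \<in> {0..1}" for t using c(2)[OF that x(1)] by (simp add: B_def)
    let ?Q = "\<lambda>t. (1 - t) * \<omega>0 (?y t) (?U t) (?V t) + t * \<omega>1 (?y t) (?U t) (?V t)"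
    have "(?Q has_vector_derivative 0) (at t within {0..1})" if t: "t \<in> {0..1}" for t
    proof -
      let ?X = "X t (?y t)" and ?D = "D t (?y t)"
      note p = y[OF t]
      note y' = flow_ode[OF t x(2), unfolded has_vector_derivative_def]
        and U' = deriv_ode[OF t x(2), of u, unfolded has_vector_derivative_def]
        and V' = deriv_ode[OF t x(2), of v, unfolded has_vector_derivative_def]
      note bil0 = A.bilinear[OF B(4)[OF p]] and bil1 = B.bilinear[OF B(5)[OF p]]
      have 0: "((\<lambda>t. \<omega>0 (?y t) (?U t) (?V t)) has_vector_derivative
          a (?y t) ?X (?U t) (?V t) + \<omega>0 (?y t) (?D (?U t)) (?V t) + \<omega>0 (?y t) (?U t) (?D (?V t))) (at t within {0..1})"
      proof -
        have sc: "a (?y t) (s *\<^sub>R h) u v = s *\<^sub>R a (?y t) h u v" for s h u v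
          using linear_scale[OF has_derivative_linear[OF A.deriv[OF B(4)[OF p]]]] .
        show ?thesis
          using two_form_chain[OF A.bilinear[OF B(4)] B(1) A.deriv[OF B(4)[OF p]] y' t y U' V']
          unfolding has_vector_derivative_def
          by (simp add: sc bilinear_lmul[OF bil0] bilinear_rmul[OF bil0] distrib_left)
      qed
      have 1: "((\<lambda>t. \<omega>1 (?y t) (?U t) (?V t)) has_vector_derivative
          b (?y t) ?X (?U t) (?V t) + \<omega>1 (?y t) (?D (?U t)) (?V t) + \<omega>1 (?y t) (?U t) (?D (?V t))) (at t within {0..1})"
      proof -
        have sc: "b (?y t) (s *\<^sub>R h) u v = s *\<^sub>R b (?y t) h u v" for s h u v
          using linear_scale[OF has_derivative_linear[OF B.deriv[OF B(5)[OF p]]]] .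
        show ?thesis
          using two_form_chain[OF B.bilinear[OF B(5)] B(1) B.deriv[OF B(5)[OF p]] y' t y U' V']
          unfolding has_vector_derivative_def
          by (simp add: sc bilinear_lmul[OF bil1] bilinear_rmul[OF bil1] distrib_left)
      qed
      have s0: "((\<lambda>t. 1 - t) has_vector_derivative - 1) (at t within {0..1})"
        and s1: "((\<lambda>t. t) has_vector_derivative 1) (at t within {0..1})"
        by (auto intro!: derivative_eq_intros)
      let ?d0 = "a (?y t) ?X (?U t) (?V t) + \<omega>0 (?y t) (?D (?U t)) (?V t) + \<omega>0 (?y t) (?U t) (?D (?V t))"
      let ?d1 = "b (?y t) ?X (?U t) (?V t) + \<omega>1 (?y t) (?D (?U t)) (?V t) + \<omega>1 (?y t) (?U t) (?D (?V t))"
      have "(?Q has_vector_derivative ((1 - t) * ?d0 + - 1 * \<omega>0 (?y t) (?U t) (?V t))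
          + (t * ?d1 + 1 * \<omega>1 (?y t) (?U t) (?V t))) (at t within {0..1})"
        by (intro has_vector_derivative_add has_vector_derivative_mult s0 s1 0 1)
      \<comment> \<open>Closedness trades the derivative along \<open>X\<close> for derivatives
        along the two transported vectors. Two instances of \<open>contraction\<close> then combine
        to minus the exterior derivative of \<eta>, which cancels the contribution
        \<open>\<omega>1 - \<omega>0\<close> of the explicit time dependence.\<close>
      moreover have "((1 - t) * ?d0 + - 1 * \<omega>0 (?y t) (?U t) (?V t)) + (t * ?d1 + 1 * \<omega>1 (?y t) (?U t) (?V t)) = 0"
      proof -
        have skew0: "\<omega>0 (?y t) (?U t) (?D (?V t)) = - \<omega>0 (?y t) (?D (?V t)) (?U t)"
          by (rule bilinear_alternating_skew[OF bil0 A.alternating[OF B(4)[OF p]]])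
        have skew1: "\<omega>1 (?y t) (?U t) (?D (?V t)) = - \<omega>1 (?y t) (?D (?V t)) (?U t)"
          by (rule bilinear_alternating_skew[OF bil1 B.alternating[OF B(5)[OF p]]])
        have cl0: "a (?y t) ?X (?U t) (?V t) = a (?y t) (?U t) ?X (?V t) - a (?y t) (?V t) ?X (?U t)"
          using A.closed[OF B(4)[OF p], of ?X "?U t" "?V t"] by linarith
        have cl1: "b (?y t) ?X (?U t) (?V t) = b (?y t) (?U t) ?X (?V t) - b (?y t) (?V t) ?X (?U t)"
          using B.closed[OF B(5)[OF p], of ?X "?U t" "?V t"] by linarith
        show ?thesis
          unfolding skew0 skew1 cl0 cl1
          using contraction[OF t p, of "?U t" "?V t"] contraction[OF t p, of "?V t" "?U t"] \<eta>(2)[OF B(2)[OF p], of "?U t" "?V t"]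
          by (simp add: algebra_simps)
      qed
      ultimately show ?thesis by simp
    qed
    then obtain k where "\<And>t. t \<in> {0..1} \<Longrightarrow> ?Q t = k"
      by (rule has_vector_derivative_zero_constant[rotated]) (use that in auto)
    from this[of 0] this[of 1] show ?thesis using flow_start[OF x(2)] deriv_start[OF x(2)] by simp
  qed
  have "two_form_germ_eq (pullback (\<phi> 1) \<omega>1) \<omega>0"
    unfolding two_form_germ_eq_def eventually_nhds_metric
  proof (intro exI[of _ "min c e"] conjI allI impI)
    fix x u v :: "real ^ 'n" assume "dist x 0 < min c e"
    then have x: "x \<in> ball 0 c" "x \<in> ball 0 e" by (auto simp: dist_commute)
    have "frechet_derivative (\<phi> 1) (at x) = Z 1 x"
      by (rule frechet_derivative_at[OF flow_deriv[OF _ x(2)], symmetric]) simp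
    then show "pullback (\<phi> 1) \<omega>1 x u v = \<omega>0 x u v" using pull[OF x] by (simp add: pullback_def)
  qed (use c radius in auto)
  from that[OF flow_diffeo[OF X(1,2) flow] this] show ?thesis .
qed

section \<open>Symmetry of second derivatives and pullbacks of closed forms\<close>

lemma segment_in_ball:
  fixes x u v :: "'a::real_normed_vector"
  assumes x: "x \<in> ball 0 e"
  obtains c :: real where "c > 0" "\<And>s t. \<bar>s\<bar> \<le> c \<Longrightarrow> \<bar>t\<bar> \<le> c \<Longrightarrow> x + s *\<^sub>R u + t *\<^sub>R v \<in> ball 0 e"
proof -
  \<comment> \<open>The summand 1 keeps \<open>N\<close> positive when both vectors vanish.\<close>
  define N where "N = 1 + norm u + norm v"
  define c where "c = (e - norm x) / N / 2"
  have d: "N > 0" unfolding N_def using norm_ge_zero[of u] norm_ge_zero[of v] by linarith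
  have c: "c > 0" using x d by (simp add: c_def)
  have small: "c * (norm u + norm v) < e - norm x"
  proof -
    have "c * (norm u + norm v) \<le> c * N" unfolding N_def using c by (intro mult_left_mono) auto
    also have "\<dots> = (e - norm x) / 2" using d by (simp add: c_def)
    also have "\<dots> < e - norm x" using x by simp
    finally show ?thesis .
  qed
  show ?thesis
  proof (rule that[OF c])
    fix s t :: real assume st: "\<bar>s\<bar> \<le> c" "\<bar>t\<bar> \<le> c"
    have "norm (x + s *\<^sub>R u + t *\<^sub>R v) \<le> norm x + \<bar>s\<bar> * norm u + \<bar>t\<bar> * norm v"
      using norm_triangle_ineq[of "x + s *\<^sub>R u" "t *\<^sub>R v"] norm_triangle_ineq[of x "s *\<^sub>R u"] by simp
    also have "\<dots> \<le> norm x + c * norm u + c * norm v"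
      using mult_right_mono[OF st(1) norm_ge_zero[of u]] mult_right_mono[OF st(2) norm_ge_zero[of v]] by linarith
    also have "\<dots> < e" using small by (simp add: algebra_simps)
    finally show "x + s *\<^sub>R u + t *\<^sub>R v \<in> ball 0 e" by simp
  qed
qed

text \<open>Differentiating \<open>f (x + t v) - f x = \<integral>\<^sub>0\<^sup>t D\<^sub>v f (x + \<tau> v) d\<tau>\<close> first in the direction \<open>u\<close>, then in \<open>t\<close>.\<close>

lemma mixed_derivatives_commute:
  fixes f :: "'a::real_normed_vector \<Rightarrow> real"
  assumes f: "\<And>x. x \<in> ball 0 e \<Longrightarrow> (f has_derivative f' x) (at x)"
    and f': "\<And>x h. x \<in> ball 0 e \<Longrightarrow> ((\<lambda>x. f' x h) has_derivative (\<lambda>k. f'' x k h)) (at x)"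
    and cont: "\<And>k h. continuous_on (ball 0 e) (\<lambda>x. f'' x k h)"
    and x: "x \<in> ball 0 e"
  shows "f'' x u v = f'' x v u"
proof -
  obtain c :: real where c: "c > 0" "\<And>s t. \<bar>s\<bar> \<le> c \<Longrightarrow> \<bar>t\<bar> \<le> c \<Longrightarrow> x + s *\<^sub>R u + t *\<^sub>R v \<in> ball 0 e"
    by (rule segment_in_ball[OF x, of u v]) (rule that)
  let ?p = "\<lambda>s t. x + s *\<^sub>R u + t *\<^sub>R v"
  have lin: "linear (f' y)" if "y \<in> ball 0 e" for y using f[OF that] by (rule has_derivative_linear)
  have lin': "linear (\<lambda>k. f'' y k h)" if "y \<in> ball 0 e" for y h using f'[OF that] by (rule has_derivative_linear)
  have ps: "((\<lambda>s. ?p s t) has_derivative (\<lambda>h. h *\<^sub>R u)) (at s within S)"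
    and pt: "((\<lambda>t. ?p s t) has_derivative (\<lambda>h. h *\<^sub>R v)) (at t within S)" for s t S
    by (auto intro!: derivative_eq_intros)
  have zero: "0 \<in> {-c<..<c}" using c(1) by simp
  have in_ball: "?p s t \<in> ball 0 e" if "s \<in> {-c<..<c}" "t \<in> {0..c}" for s t using c that by auto
  have "integral {0..t} (\<lambda>\<tau>. f'' (?p 0 \<tau>) u v) = f' (?p 0 t) u - f' (?p 0 0) u" if t: "t \<in> {0..c}" for t
  proof -
    have F1: "((\<lambda>s. f' (?p s \<tau>) v) has_field_derivative f'' (?p s \<tau>) u v) (at s within {-c<..<c})"
      if "s \<in> {-c<..<c}" "\<tau> \<in> cbox 0 t" for s \<tau>
    proof -
      have b: "?p s \<tau> \<in> ball 0 e" by (rule in_ball) (use that t in auto)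
      show ?thesis
        using has_derivative_compose[OF ps f'[OF b]]
        by (simp add: has_field_derivative_def linear_scale[OF lin'[OF b]] mult.commute[of _ "f'' _ _ _"])
    qed
    have slice: "((\<lambda>\<tau>. f' (?p s \<tau>) v) has_integral f (?p s t) - f (?p s 0)) {0..t}" if s: "s \<in> {-c<..<c}" for s
    proof (rule fundamental_theorem_of_calculus)
      fix \<tau> assume "\<tau> \<in> {0..t}"
      then have b: "?p s \<tau> \<in> ball 0 e" by (intro in_ball s) (use t in auto)
      show "((\<lambda>t. f (?p s t)) has_vector_derivative f' (?p s \<tau>) v) (at \<tau> within {0..t})"
        using has_derivative_compose[OF pt f[OF b]]
        by (simp add: has_vector_derivative_def linear_scale[OF lin[OF b]])
    qed (use t in auto)
    have "continuous_on ({-c<..<c} \<times> cbox 0 t) (\<lambda>q. f'' (?p (fst q) (snd q)) u v)"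
    proof (rule continuous_on_compose2[OF cont, of _ "\<lambda>q. ?p (fst q) (snd q)"])
      show "continuous_on ({-c<..<c} \<times> cbox 0 t) (\<lambda>q. ?p (fst q) (snd q))" by (intro continuous_intros)
      show "(\<lambda>q. ?p (fst q) (snd q)) ` ({-c<..<c} \<times> cbox 0 t) \<subseteq> ball 0 e"
        using in_ball t by (auto simp del: mem_ball mem_ball_0)
    qed
    then have cf: "continuous_on ({-c<..<c} \<times> cbox 0 t) (\<lambda>(s, \<tau>). f'' (?p s \<tau>) u v)" by (simp add: case_prod_beta)
    have "((\<lambda>s. integral (cbox 0 t) (\<lambda>\<tau>. f' (?p s \<tau>) v)) has_field_derivative
        integral (cbox 0 t) (\<lambda>\<tau>. f'' (?p 0 \<tau>) u v)) (at 0 within {-c<..<c})"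
    proof (rule leibniz_rule_field_derivative[OF F1 _ cf])
      show "(\<lambda>\<tau>. f' (?p s \<tau>) v) integrable_on cbox 0 t" if "s \<in> {-c<..<c}" for s
        using slice[OF that] unfolding box_real by (rule has_integral_integrable)
    qed (use zero in simp_all)
    then have d1: "((\<lambda>s. integral {0..t} (\<lambda>\<tau>. f' (?p s \<tau>) v)) has_field_derivative
        integral {0..t} (\<lambda>\<tau>. f'' (?p 0 \<tau>) u v)) (at 0)"
      unfolding box_real at_within_open[OF zero open_greaterThanLessThan] .
    have fd: "((\<lambda>s. f (?p s \<tau>)) has_field_derivative f' (?p 0 \<tau>) u) (at 0)" if "\<tau> \<in> {0..c}" for \<tau>
    proof -
      have b: "?p 0 \<tau> \<in> ball 0 e" by (rule in_ball) (use that c in auto)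
      have "(\<lambda>h. f' (?p 0 \<tau>) (h *\<^sub>R u)) = (*) (f' (?p 0 \<tau>) u)"
        by (rule ext) (unfold linear_scale[OF lin[OF b]], simp)
      with has_derivative_compose[OF ps f[OF b]] show ?thesis
        unfolding has_field_derivative_def by simp
    qed
    have "((\<lambda>s. f (?p s t) - f (?p s 0)) has_field_derivative f' (?p 0 t) u - f' (?p 0 0) u) (at 0)"
      by (intro DERIV_diff fd) (use t c in auto)
    then have "((\<lambda>s. integral {0..t} (\<lambda>\<tau>. f' (?p s \<tau>) v)) has_field_derivative f' (?p 0 t) u - f' (?p 0 0) u) (at 0)"
    proof (rule has_field_derivative_transform_within_open)
      show "open {-c<..<c}" "0 \<in> {-c<..<c}" using c(1) by auto
      show "f (?p s t) - f (?p s 0) = integral {0..t} (\<lambda>\<tau>. f' (?p s \<tau>) v)" if "s \<in> {-c<..<c}" for s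
        using slice[OF that] by (simp add: integral_unique)
    qed
    from DERIV_unique[OF d1 this] show ?thesis .
  qed
  moreover have "((\<lambda>t. integral {0..t} (\<lambda>\<tau>. f'' (?p 0 \<tau>) u v)) has_vector_derivative f'' (?p 0 0) u v) (at 0 within {0..c})"
  proof (rule integral_has_vector_derivative)
    show "continuous_on {0..c} (\<lambda>\<tau>. f'' (?p 0 \<tau>) u v)"
    proof (rule continuous_on_compose2[OF cont])
      show "continuous_on {0..c} (?p 0)" by (intro continuous_intros)
      show "?p 0 ` {0..c} \<subseteq> ball 0 e" using in_ball[of 0] c(1) by (auto simp del: mem_ball mem_ball_0)
    qed
  qed (use c in auto)
  ultimately have d1: "((\<lambda>t. f' (?p 0 t) u - f' (?p 0 0) u) has_vector_derivative f'' x u v) (at 0 within {0..c})"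
    by (intro has_vector_derivative_transform[of 0 "{0..c}" "\<lambda>t. f' (?p 0 t) u - f' (?p 0 0) u"]) (use c(1) in auto)
  have "((\<lambda>t. f' (?p 0 t) u - f' (?p 0 0) u) has_derivative (\<lambda>h. f'' x (h *\<^sub>R v) u - 0)) (at 0 within {0..c})"
    using has_derivative_compose[OF pt f'[of "?p 0 0" u], of "{0..c}"] x
    by (intro has_derivative_diff has_derivative_const) simp
  then have d2: "((\<lambda>t. f' (?p 0 t) u - f' (?p 0 0) u) has_vector_derivative f'' x v u) (at 0 within {0..c})"
    by (simp add: has_vector_derivative_def linear_scale[OF lin'[OF x]])
  show ?thesis
    by (rule vector_derivative_unique_within[OF _ d1 d2]) (use c(1) in \<open>simp add: trivial_limit_within islimpt_Icc\<close>)
qed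

text \<open>\<open>C\<close> is the second derivative; its symmetry is what makes pullbacks of
  closed forms closed.\<close>

lemma map_germ_C2:
  fixes F :: "real ^ 'm \<Rightarrow> real ^ 'n"
  assumes F: "map_germ r F"
  obtains e J C where "e > 0" "\<And>i j. fun_germ r (\<lambda>x. J x $ i $ j)"
    "\<And>x. x \<in> ball 0 e \<Longrightarrow> (F has_derivative (*v) (J x)) (at x)"
    "\<And>x u. x \<in> ball 0 e \<Longrightarrow> ((\<lambda>x. J x *v u) has_derivative (\<lambda>h. C x h u)) (at x)"
    "\<And>x u v. x \<in> ball 0 e \<Longrightarrow> C x u v = C x v u"
proof -
  obtain e J where e: "e > 0" and J: "\<And>i j. fun_germ r (\<lambda>x. J x $ i $ j)"
    "\<And>x. x \<in> ball 0 e \<Longrightarrow> (F has_derivative (*v) (J x)) (at x)"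
    by (rule map_germ_jacobian[OF F]) (rule that)
  have "map_germ r (\<lambda>x. column l (J x))" for l using J(1) by (simp add: map_germ_def column_def)
  then obtain d K where d: "d > 0" and K: "\<And>l x. x \<in> ball 0 d \<Longrightarrow> ((\<lambda>x. column l (J x)) has_derivative (*v) (K l x)) (at x)"
    and K_cont: "\<And>l h. continuous_on (ball 0 d) (\<lambda>x. K l x *v h)" by (rule map_germs_C1) (rule that)
  define C where "C = (\<lambda>x h u. \<Sum>l\<in>UNIV. u $ l *\<^sub>R (K l x *v h))"
  have JC: "((\<lambda>x. J x *v u) has_derivative (\<lambda>h. C x h u)) (at x)" if "x \<in> ball 0 d" for x u
  proof -
    have "((\<lambda>x. \<Sum>l\<in>UNIV. u $ l *\<^sub>R column l (J x)) has_derivative (\<lambda>h. C x h u)) (at x)"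
      unfolding C_def by (intro has_derivative_sum has_derivative_scaleR_right K that)
    moreover have "J x *v u = (\<Sum>l\<in>UNIV. u $ l *\<^sub>R column l (J x))" for x
      by (simp add: matrix_mult_sum scalar_mult_eq_scaleR)
    ultimately show ?thesis by simp
  qed
  have C_cont: "continuous_on (ball 0 d) (\<lambda>x. C x h u)" for h u
    unfolding C_def by (intro continuous_on_sum continuous_on_scaleR continuous_on_const K_cont)
  show ?thesis
  proof (rule that[of "min d e" J C])
    fix x u v :: "real ^ 'm" assume x: "x \<in> ball 0 (min d e)"
    have "C x u v $ k = C x v u $ k" for k
    proof (rule mixed_derivatives_commute[of "min d e" "\<lambda>x. F x $ k" "\<lambda>x h. (J x *v h) $ k"])
      show "((\<lambda>x. F x $ k) has_derivative (\<lambda>h. (J x *v h) $ k)) (at x)" if "x \<in> ball 0 (min d e)" for x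
        by (rule bounded_linear.has_derivative[OF bounded_linear_vec_nth J(2)]) (use that in simp)
      show "((\<lambda>x. (J x *v h) $ k) has_derivative (\<lambda>h'. C x h' h $ k)) (at x)" if "x \<in> ball 0 (min d e)" for x h
        by (rule bounded_linear.has_derivative[OF bounded_linear_vec_nth JC]) (use that in simp)
      show "continuous_on (ball 0 (min d e)) (\<lambda>x. C x h h' $ k)" for h h'
        by (rule continuous_on_subset[OF continuous_on_component[OF C_cont]]) auto
    qed (rule x)
    then show "C x u v = C x v u" by (simp add: vec_eq_iff)
  qed (use d e J JC in auto)
qed

lemma pullback_germ:
  fixes \<omega> :: "'n::finite two_form" and F :: "real ^ 'm \<Rightarrow> real ^ 'n"
  assumes \<omega>: "two_form_germ r \<omega>" and F: "map_germ r F" "F 0 = 0"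
  shows "two_form_germ r (pullback F \<omega>)"
proof -
  obtain e J where e: "e > 0" and J: "\<And>i j. fun_germ r (\<lambda>x. J x $ i $ j)"
    "\<And>x. x \<in> ball 0 e \<Longrightarrow> (F has_derivative (*v) (J x)) (at x)"
    by (rule map_germ_jacobian[OF F(1)]) (rule that)
  have "\<forall>\<^sub>0p. p \<in> ball (0 :: real ^ 'm) e" using e by (intro eventually_nhds_in_open) auto
  moreover have "\<forall>\<^sub>0p. bilinear (\<omega> (F p)) \<and> (\<forall>u. \<omega> (F p) u u = 0)"
    by (rule map_germ_tendsto_0[OF F]) (use \<omega> in \<open>simp add: two_form_germ_def\<close>)
  ultimately have near: "\<forall>\<^sub>0p. bilinear (\<omega> (F p)) \<and> (\<forall>u. \<omega> (F p) u u = 0) \<and>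
      pullback F \<omega> p = (\<lambda>u v. \<omega> (F p) (J p *v u) (J p *v v))"
  proof eventually_elim
    case (elim p)
    have "frechet_derivative F (at p) = (*v) (J p)" using frechet_derivative_at[OF J(2)[OF elim(1)]] ..
    then show ?case using elim by (simp add: pullback_def fun_eq_iff)
  qed
  show ?thesis unfolding two_form_germ_def
  proof (intro conjI allI)
    show "\<forall>\<^sub>0p. bilinear (pullback F \<omega> p) \<and> (\<forall>u. pullback F \<omega> p u u = 0)"
      using near
    proof eventually_elim
      case (elim p)
      then have "bilinear (\<omega> (F p))" by simp
      then have "bilinear (\<lambda>u v. \<omega> (F p) (J p *v u) (J p *v v))"
        unfolding bilinear_def
        by (auto intro!: linear_compose[OF matrix_vector_mul_linear, unfolded o_def])
      then show ?case using elim by simp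
    qed
    fix i j
    have "fun_germ r (\<lambda>p. \<Sum>k\<in>UNIV. \<Sum>l\<in>UNIV. \<omega> (F p) (axis k 1) (axis l 1) * J p $ k $ i * J p $ l $ j)"
      using \<omega> by (intro fun_germ_sum fun_germ_mult J(1) fun_germ_compose[OF _ F]) (simp add: two_form_germ_def)
    then show "fun_germ r (\<lambda>p. pullback F \<omega> p (axis i 1) (axis j 1))"
    proof (rule fun_germ_cong)
      show "\<forall>\<^sub>0p. (\<Sum>k\<in>UNIV. \<Sum>l\<in>UNIV. \<omega> (F p) (axis k 1) (axis l 1) * J p $ k $ i * J p $ l $ j)
          = pullback F \<omega> p (axis i 1) (axis j 1)"
        using near
      proof eventually_elim
        case (elim p)
        have "(J p *v axis m 1) $ k = J p $ k $ m" for k m by (simp add: matrix_vector_mul_component inner_axis)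
        then show ?case
          using elim bilinear_coordinates[of "\<omega> (F p)" "J p *v axis i 1" "J p *v axis j 1"] by simp
      qed
    qed
  qed
qed

text \<open>The second derivatives of \<open>F\<close> enter the exterior derivative in pairs that
  cancel, since \<open>C\<close> is symmetric and the form skew. What remains is the closedness of
  \<omega> at \<open>F p\<close>, evaluated on the images of the three vectors.\<close>

lemma closed_germ_pullback:
  fixes \<omega> :: "'n::finite two_form" and F :: "real ^ 'm \<Rightarrow> real ^ 'n"
  assumes \<omega>: "two_form_germ r \<omega>" "closed_germ \<omega>" and F: "map_germ r F" "F 0 = 0"
  shows "closed_germ (pullback F \<omega>)"
proof -
  obtain e J C where e: "e > 0" and J: "\<And>i j. fun_germ r (\<lambda>x. J x $ i $ j)"
    "\<And>x. x \<in> ball 0 e \<Longrightarrow> (F has_derivative (*v) (J x)) (at x)"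
    and C: "\<And>x u. x \<in> ball 0 e \<Longrightarrow> ((\<lambda>x. J x *v u) has_derivative (\<lambda>h. C x h u)) (at x)"
    "\<And>x u v. x \<in> ball 0 e \<Longrightarrow> C x u v = C x v u"
    by (rule map_germ_C2[OF F(1)]) (rule that)
  obtain d a where "closed_form \<omega> d a" by (rule closed_germ_form[OF \<omega>]) (rule that)
  then interpret closed_form \<omega> d a .
  have "\<forall>\<^sub>0p. F p \<in> ball 0 d"
    by (rule map_germ_tendsto_0[OF F]) (use radius in \<open>intro eventually_nhds_in_open, auto\<close>)
  then obtain c where c: "c > 0" "\<And>p. dist p 0 < c \<Longrightarrow> F p \<in> ball 0 d" unfolding eventually_nhds_metric by auto
  define B where "B = ball (0 :: real ^ 'm) (min c e)"
  have B: "open B" "\<And>p. p \<in> B \<Longrightarrow> p \<in> ball 0 e" "\<And>p. p \<in> B \<Longrightarrow> F p \<in> ball 0 d"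
    using c(2) by (auto simp: B_def dist_commute simp del: mem_ball_0)
  have eq: "pullback F \<omega> p u v = \<omega> (F p) (J p *v u) (J p *v v)" if "p \<in> B" for p u v
    using frechet_derivative_at[OF J(2)[OF B(2)[OF that]]] by (simp add: pullback_def)
  have D: "frechet_derivative (\<lambda>q. pullback F \<omega> q u v) (at p) h = a (F p) (J p *v h) (J p *v u) (J p *v v)
      + \<omega> (F p) (C p h u) (J p *v v) + \<omega> (F p) (J p *v u) (C p h v)" if p: "p \<in> B" for p u v h
  proof -
    note p' = B(2)[OF p]
    have "((\<lambda>q. \<omega> (F q) (J q *v u) (J q *v v)) has_derivative (\<lambda>h. a (F p) (J p *v h) (J p *v u) (J p *v v)
      + \<omega> (F p) (C p h u) (J p *v v) + \<omega> (F p) (J p *v u) (C p h v))) (at p within B)"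
      by (rule two_form_chain[OF bilinear open_ball deriv[OF B(3)[OF p]] has_derivative_at_withinI[OF J(2)[OF p']] p B(3)
        has_derivative_at_withinI[OF C(1)[OF p']] has_derivative_at_withinI[OF C(1)[OF p']]])
    then have "((\<lambda>q. \<omega> (F q) (J q *v u) (J q *v v)) has_derivative (\<lambda>h. a (F p) (J p *v h) (J p *v u) (J p *v v)
      + \<omega> (F p) (C p h u) (J p *v v) + \<omega> (F p) (J p *v u) (C p h v))) (at p)"
      by (simp add: at_within_open[OF p B(1)])
    then have "((\<lambda>q. pullback F \<omega> q u v) has_derivative (\<lambda>h. a (F p) (J p *v h) (J p *v u) (J p *v v)
      + \<omega> (F p) (C p h u) (J p *v v) + \<omega> (F p) (J p *v u) (C p h v))) (at p)"
      by (rule has_derivative_transform_within_open[OF _ B(1) p]) (simp add: eq)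
    from fun_cong[OF frechet_derivative_at[OF this], of h] show ?thesis by simp
  qed
  have "ext_deriv (pullback F \<omega>) p u v w = 0" if p: "p \<in> B" for p u v w
  proof -
    note p' = B(2)[OF p] and Fp = B(3)[OF p]
    note skew = bilinear_alternating_skew[OF bilinear[OF Fp] alternating[OF Fp]]
    show ?thesis
      unfolding ext_deriv_def D[OF p] C(2)[OF p', of v u] C(2)[OF p', of w u] C(2)[OF p', of w v]
      using closed[OF Fp, of "J p *v u" "J p *v v" "J p *v w"] skew[of "J p *v u" "C p v w"]
        skew[of "J p *v v" "C p u w"] skew[of "J p *v w" "C p u v"] by linarith
  qed
  moreover have "0 \<in> B" using c(1) e by (simp add: B_def)
  ultimately show ?thesis
    unfolding closed_germ_def by (intro eventually_nhds[THEN iffD2] exI[of _ B]) (use B(1) in blast)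
qed

lemma pullback_compose:
  fixes \<omega> :: "'n::finite two_form" and F :: "real ^ 'm \<Rightarrow> real ^ 'n" and G :: "real ^ 'l \<Rightarrow> real ^ 'm"
  assumes F: "map_germ r F" and G: "map_germ r G" "G 0 = 0"
  shows "two_form_germ_eq (pullback (\<lambda>x. F (G x)) \<omega>) (pullback G (pullback F \<omega>))"
proof -
  obtain e J where e: "e > 0" and J: "\<And>i j. fun_germ r (\<lambda>x. J x $ i $ j)"
    "\<And>x. x \<in> ball 0 e \<Longrightarrow> (F has_derivative (*v) (J x)) (at x)"
    by (rule map_germ_jacobian[OF F]) (rule that)
  obtain d K where d: "d > 0" and K: "\<And>i j. fun_germ r (\<lambda>x. K x $ i $ j)"
    "\<And>x. x \<in> ball 0 d \<Longrightarrow> (G has_derivative (*v) (K x)) (at x)"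
    by (rule map_germ_jacobian[OF G(1)]) (rule that)
  have "\<forall>\<^sub>0x. x \<in> ball (0 :: real ^ 'l) d" using d by (intro eventually_nhds_in_open) auto
  moreover have "\<forall>\<^sub>0x. G x \<in> ball 0 e"
    by (rule map_germ_tendsto_0[OF G]) (use e in \<open>intro eventually_nhds_in_open, auto\<close>)
  ultimately show ?thesis unfolding two_form_germ_eq_def
  proof eventually_elim
    case (elim x)
    have "frechet_derivative (\<lambda>x. F (G x)) (at x) = (\<lambda>h. J (G x) *v (K x *v h))"
      using frechet_derivative_at[OF has_derivative_compose[OF K(2)[OF elim(1)] J(2)[OF elim(2)]]] by simp
    moreover have "frechet_derivative G (at x) = (*v) (K x)" "frechet_derivative F (at (G x)) = (*v) (J (G x))"
      using frechet_derivative_at[OF K(2)[OF elim(1)]] frechet_derivative_at[OF J(2)[OF elim(2)]] by simp_all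
    ultimately show ?case by (simp add: pullback_def)
  qed
qed

lemma pullback_cong:
  assumes "two_form_germ_eq \<omega> \<eta>" "map_germ r G" "G 0 = 0"
  shows "two_form_germ_eq (pullback G \<omega>) (pullback G \<eta>)"
proof -
  have "\<forall>\<^sub>0x. \<forall>u v. \<omega> (G x) u v = \<eta> (G x) u v"
    by (rule map_germ_tendsto_0[OF assms(2,3) assms(1)[unfolded two_form_germ_eq_def]])
  then show ?thesis
    unfolding two_form_germ_eq_def pullback_def by (rule eventually_mono) simp
qed

section \<open>Squeezing onto a coordinate hyperplane: division by a coordinate and relative
  primitives\<close>

definition squeeze :: "'n::finite \<Rightarrow> real \<Rightarrow> real ^ 'n \<Rightarrow> real ^ 'n" where
  "squeeze i \<tau> x = x + ((\<tau> - 1) * x $ i) *\<^sub>R axis i 1"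

lemma squeeze_nth: "squeeze i \<tau> x $ j = (if j = i then \<tau> * x $ i else x $ j)"
  by (simp add: squeeze_def axis_def algebra_simps)

lemma squeeze_1 [simp]: "squeeze i 1 x = x" by (simp add: squeeze_def)

lemma squeeze_zero [simp]: "squeeze i \<tau> 0 = 0" by (simp add: squeeze_def)

lemma norm_squeeze_le: "\<tau> \<in> {0..1} \<Longrightarrow> norm (squeeze i \<tau> x) \<le> norm x"
  by (rule norm_le_componentwise_cart) (auto simp: squeeze_nth abs_mult mult_left_le_one_le)

lemma squeeze_in_ball: "x \<in> ball 0 e \<Longrightarrow> \<tau> \<in> {0..1} \<Longrightarrow> squeeze i \<tau> x \<in> ball 0 e"
  using norm_squeeze_le[of \<tau> i x] by simp

lemma linear_squeeze: "linear (squeeze i \<tau>)"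
  by (rule linearI) (simp_all add: squeeze_def algebra_simps)

lemma squeeze_has_vector_derivative:
  "((\<lambda>\<tau>. squeeze i \<tau> x) has_vector_derivative x $ i *\<^sub>R axis i 1) (at \<tau> within S)"
proof -
  have "((\<lambda>\<tau>. x + ((\<tau> - 1) * x $ i) *\<^sub>R axis i 1) has_derivative (\<lambda>h. 0 + ((h - 0) * x $ i) *\<^sub>R axis i 1)) (at \<tau> within S)"
    by (intro has_derivative_add has_derivative_const has_derivative_scaleR_left has_derivative_mult_left
      has_derivative_diff has_derivative_ident)
  then show ?thesis by (simp add: squeeze_def has_vector_derivative_def)
qed

lemma continuous_on_squeeze:
  assumes "continuous_on S \<tau>" "continuous_on S x"
  shows "continuous_on S (\<lambda>s. squeeze i (\<tau> s) (x s))"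
  unfolding squeeze_def using assms by (intro continuous_intros)

lemma germ_family_squeeze: "germ_family r (\<lambda>\<tau> x. squeeze i \<tau> x $ j)"
  by (cases "j = i") (simp_all add: squeeze_nth germ_family_coordinate
    germ_family_mult[OF germ_family_time[OF continuous_on_id] germ_family_coordinate])

text \<open>The squeezing factor acts as time, so closure of families under time integrals
  applies.\<close>

lemma fun_germ_squeeze_integral:
  assumes "fun_germ r f"
  shows "fun_germ r (\<lambda>x. integral {0..1} (\<lambda>\<tau>. f (squeeze i \<tau> x)))"
proof -
  have "germ_family r (\<lambda>_. f)" using assms by (simp add: germ_family_constant_iff)
  then have "germ_family r (\<lambda>\<tau> x. f (squeeze i \<tau> x))"
    by (rule germ_family_compose) (rule germ_family_squeeze, simp)
  from fun_germ_at_time[OF germ_family_integral[OF this], of 1] show ?thesis by simp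
qed

text \<open>The fundamental theorem of calculus along
  \<open>\<tau> \<mapsto> squeeze i \<tau> x\<close>: this segment starts on the hyperplane, where
  \<open>f\<close> vanishes, and its velocity supplies the factor \<open>x $ i\<close>.\<close>

lemma hadamard:
  fixes f :: "real ^ 'n \<Rightarrow> real"
  assumes f: "fun_germ r f" and zero: "\<forall>\<^sub>0x. x $ i = 0 \<longrightarrow> f x = 0"
  obtains u where "fun_germ r u" "\<forall>\<^sub>0x. f x = x $ i * u x"
proof -
  obtain e g where e: "e > 0" and g: "\<And>i. fun_germ r (g i)"
    "\<And>x. x \<in> ball 0 e \<Longrightarrow> has_gradient f (\<lambda>i. g i x) x"
    by (rule fun_germ_partials[OF f]) (rule that)
  obtain d where d: "d > 0" "\<And>x. dist x 0 < d \<Longrightarrow> x $ i = 0 \<longrightarrow> f x = 0"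
    using zero unfolding eventually_nhds_metric by blast
  show ?thesis
  proof (rule that[OF fun_germ_squeeze_integral[OF g(1)], of i i])
    show "\<forall>\<^sub>0x. f x = x $ i * integral {0..1} (\<lambda>\<tau>. g i (squeeze i \<tau> x))"
      unfolding eventually_nhds_metric
    proof (intro exI[of _ "min d e"] conjI allI impI)
      fix x :: "real ^ 'n" assume "dist x 0 < min d e"
      then have x: "x \<in> ball 0 e" "x \<in> ball 0 d" by (auto simp: dist_commute)
      have "((\<lambda>\<tau>. g i (squeeze i \<tau> x) * x $ i) has_integral f (squeeze i 1 x) - f (squeeze i 0 x)) {0..1}"
      proof (rule fundamental_theorem_of_calculus)
        fix \<tau> :: real assume \<tau>: "\<tau> \<in> {0..1}"
        note \<tau>' = squeeze_has_vector_derivative[of i x \<tau> "{0..1}", unfolded has_vector_derivative_def]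
        have "(\<Sum>j\<in>UNIV. g j (squeeze i \<tau> x) * (h *\<^sub>R x $ i *\<^sub>R axis i 1) $ j) = h * (g i (squeeze i \<tau> x) * x $ i)" for h :: real
          by (simp add: axis_def if_distrib sum.delta cong: if_cong)
        then show "((\<lambda>\<tau>. f (squeeze i \<tau> x)) has_vector_derivative g i (squeeze i \<tau> x) * x $ i) (at \<tau> within {0..1})"
          using has_derivative_compose[OF \<tau>' g(2)[OF squeeze_in_ball[OF x(1) \<tau>]]]
          by (simp add: has_vector_derivative_def)
      qed simp
      moreover have "f (squeeze i 0 x) = 0"
        using d(2)[of "squeeze i 0 x"] squeeze_in_ball[OF x(2), of 0 i] by (simp add: squeeze_nth dist_norm)
      ultimately have I: "((\<lambda>\<tau>. g i (squeeze i \<tau> x) * x $ i) has_integral f x) {0..1}" by simp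
      show "f x = x $ i * integral {0..1} (\<lambda>\<tau>. g i (squeeze i \<tau> x))"
        using integral_unique[OF I] by (simp add: mult.commute)
    qed (use d e in auto)
  qed
qed

lemma two_form_germ_diff:
  fixes \<omega> \<eta> :: "'n::finite two_form"
  assumes "two_form_germ r \<omega>" "two_form_germ r \<eta>"
  shows "two_form_germ r (\<lambda>p u v. \<omega> p u v - \<eta> p u v)"
proof -
  have "\<forall>\<^sub>0p. bilinear (\<lambda>u v. \<omega> p u v - \<eta> p u v) \<and> (\<forall>u. \<omega> p u u - \<eta> p u u = 0)"
    using assms[unfolded two_form_germ_def, THEN conjunct1]
    by eventually_elim (auto simp: bilinear_def intro!: linear_compose_sub)
  then show ?thesis
    using assms unfolding two_form_germ_def by (auto intro!: fun_germ_diff)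
qed

lemma closed_germ_diff:
  fixes \<omega> \<eta> :: "'n::finite two_form"
  assumes \<omega>: "two_form_germ r \<omega>" "closed_germ \<omega>" and \<eta>: "two_form_germ r \<eta>" "closed_germ \<eta>"
  shows "closed_germ (\<lambda>p u v. \<omega> p u v - \<eta> p u v)"
proof -
  obtain d a where "closed_form \<omega> d a" by (rule closed_germ_form[OF \<omega>]) (rule that)
  then interpret A: closed_form \<omega> d a .
  obtain e b where "closed_form \<eta> e b" by (rule closed_germ_form[OF \<eta>]) (rule that)
  then interpret B: closed_form \<eta> e b .
  have "\<forall>\<^sub>0p. p \<in> ball (0 :: real ^ 'n) (min d e)"
    using A.radius B.radius by (intro eventually_nhds_in_open) auto
  then show ?thesis unfolding closed_germ_def
  proof (rule eventually_mono, intro allI)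
    fix p u v w :: "real ^ 'n" assume "p \<in> ball 0 (min d e)"
    then have p: "p \<in> ball 0 d" "p \<in> ball 0 e" by auto
    have "frechet_derivative (\<lambda>q. \<omega> q u v - \<eta> q u v) (at p) = (\<lambda>h. a p h u v - b p h u v)" for u v
      by (rule frechet_derivative_at[symmetric]) (intro has_derivative_diff A.deriv B.deriv p)
    then show "ext_deriv (\<lambda>p u v. \<omega> p u v - \<eta> p u v) p u v w = 0"
      using A.closed[OF p(1), of u v w] B.closed[OF p(2), of u v w] by (simp add: ext_deriv_def)
  qed
qed

text \<open>Homotopy formula for the squeezing. The usual primitive evaluates \<delta> at the
  squeezed point on the velocity and on the squeezed vector; the latter may be replaced by the
  vector itself, as the two differ by a multiple of \<open>axis i 1\<close>, to which the velocity
  is parallel. The velocity contributes the factor \<open>x $ i\<close>, and \<open>h\<close> is the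
  integral that remains.\<close>

lemma relative_poincare:
  fixes \<delta> :: "'n::finite two_form"
  assumes \<delta>: "two_form_germ r \<delta>" "closed_germ \<delta>"
    and zero: "\<forall>\<^sub>0x. \<forall>u v. x $ i = 0 \<longrightarrow> u $ i = 0 \<longrightarrow> v $ i = 0 \<longrightarrow> \<delta> x u v = 0"
  obtains e h \<eta>' where "e > 0" "map_germ r h" "\<And>x. x \<in> ball 0 e \<Longrightarrow> h x $ i = 0"
    "\<And>k. h 0 $ k = \<delta> 0 (axis i 1) (axis k 1)"
    "\<And>x. x \<in> ball 0 e \<Longrightarrow> ((\<lambda>x. x $ i *\<^sub>R h x) has_derivative \<eta>' x) (at x)"
    "\<And>x u v. x \<in> ball 0 e \<Longrightarrow> \<eta>' x u \<bullet> v - \<eta>' x v \<bullet> u = \<delta> x u v"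
proof -
  let ?E = "axis i 1 :: real ^ 'n" and ?T = "squeeze i"
  obtain d \<delta>' where "closed_form \<delta> d \<delta>'" by (rule closed_germ_form[OF \<delta>]) (rule that)
  then interpret closed_form \<delta> d \<delta>' .
  obtain z where z: "z > 0" "\<And>x. dist x 0 < z \<Longrightarrow> \<forall>u v. x $ i = 0 \<longrightarrow> u $ i = 0 \<longrightarrow> v $ i = 0 \<longrightarrow> \<delta> x u v = 0"
    using zero unfolding eventually_nhds_metric by blast
  define H where "H = (\<lambda>v x. integral {0..1} (\<lambda>\<tau>. \<delta> (?T \<tau> x) ?E v))"
  define h where "h = (\<lambda>x. \<chi> k. H (axis k 1) x)"
  have h: "map_germ r h"
    unfolding map_germ_def
  proof
    fix k
    have "fun_germ r (\<lambda>p. \<delta> p ?E (axis k 1))" using \<delta>(1) by (simp add: two_form_germ_def)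
    from fun_germ_squeeze_integral[OF this, of i] show "fun_germ r (\<lambda>x. h x $ k)" by (simp add: h_def H_def)
  qed
  have "map_germ r (\<lambda>x. x $ i *\<^sub>R h x)"
    using h by (simp add: map_germ_def fun_germ_mult fun_germ_coordinate)
  then obtain c J where c: "c > 0" and J: "\<And>j k. fun_germ r (\<lambda>x. J x $ j $ k)"
    "\<And>x. x \<in> ball 0 c \<Longrightarrow> ((\<lambda>x. x $ i *\<^sub>R h x) has_derivative (*v) (J x)) (at x)"
    by (rule map_germ_jacobian) (rule that)
  have cont: "continuous_on (ball 0 d) (\<lambda>p. \<delta> p u v)" for u v
    by (rule continuous_at_imp_continuous_on) (use has_derivative_continuous[OF deriv] in blast)
  have path: "continuous_on {0..1} (\<lambda>\<tau>. F (?T \<tau> x))" if "continuous_on (ball 0 d) F" "x \<in> ball 0 d" for x and F :: "real ^ 'n \<Rightarrow> real"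
    by (rule continuous_on_compose2[OF that(1) continuous_on_squeeze[OF continuous_on_id continuous_on_const]])
      (use squeeze_in_ball[OF that(2)] in auto)
  have H_inner: "h x \<bullet> v = H v x" if x: "x \<in> ball 0 d" for x v
  proof -
    have "h x \<bullet> v = (\<Sum>k\<in>UNIV. integral {0..1} (\<lambda>\<tau>. \<delta> (?T \<tau> x) ?E (axis k 1) * v $ k))"
      by (simp add: inner_vec_def h_def H_def)
    also have "\<dots> = integral {0..1} (\<lambda>\<tau>. \<Sum>k\<in>UNIV. \<delta> (?T \<tau> x) ?E (axis k 1) * v $ k)"
      by (rule integral_sum[symmetric])
        (auto intro!: integrable_continuous_real continuous_on_mult path[OF cont x])
    also have "\<dots> = H v x" unfolding H_def
    proof (rule integral_cong)
      fix \<tau> :: real assume "\<tau> \<in> {0..1}"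
      then have "bilinear (\<delta> (?T \<tau> x))" by (intro bilinear squeeze_in_ball x)
      then have L: "linear (\<delta> (?T \<tau> x) ?E)" by (simp add: bilinear_def)
      have "v = (\<Sum>k\<in>UNIV. v $ k *\<^sub>R axis k 1)"
        using basis_expansion[of v] by (simp add: scalar_mult_eq_scaleR)
      then have "\<delta> (?T \<tau> x) ?E v = \<delta> (?T \<tau> x) ?E (\<Sum>k\<in>UNIV. v $ k *\<^sub>R axis k 1)" by (rule arg_cong)
      then show "(\<Sum>k\<in>UNIV. \<delta> (?T \<tau> x) ?E (axis k 1) * v $ k) = \<delta> (?T \<tau> x) ?E v"
        by (simp add: linear_sum[OF L] linear_scale[OF L] mult.commute)
    qed
    finally show ?thesis .
  qed
  have lin: "linear (\<lambda>h. \<delta>' p h u v)" if "p \<in> ball 0 d" for p u v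
    using deriv[OF that] by (rule has_derivative_linear)
  have lin3: "\<delta>' p h u (v + b *\<^sub>R w) = \<delta>' p h u v + b * \<delta>' p h u w" if p: "p \<in> ball 0 d" for p h u v b w
  proof -
    have "((\<lambda>q. \<delta> q u v + b * \<delta> q u w) has_derivative (\<lambda>h. \<delta>' p h u v + b * \<delta>' p h u w)) (at p)"
      by (intro has_derivative_add has_derivative_mult_right deriv p)
    then have "((\<lambda>q. \<delta> q u (v + b *\<^sub>R w)) has_derivative (\<lambda>h. \<delta>' p h u v + b * \<delta>' p h u w)) (at p)"
      by (rule has_derivative_transform_within_open[OF _ open_ball p])
        (simp add: bilinear_radd[OF bilinear] bilinear_rmul[OF bilinear])
    from fun_cong[OF has_derivative_unique[OF deriv[OF p] this]] show ?thesis .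
  qed
  have diag: "\<delta>' p h u u = 0" if p: "p \<in> ball 0 d" for p h u
  proof -
    have "((\<lambda>q. \<delta> q u u) has_derivative (\<lambda>h. 0)) (at p)"
      by (rule has_derivative_transform_within_open[OF has_derivative_const[of 0] open_ball p]) (simp add: alternating)
    from fun_cong[OF has_derivative_unique[OF deriv[OF p] this]] show ?thesis .
  qed
  have T': "?T \<tau> v = v + ((\<tau> - 1) * v $ i) *\<^sub>R ?E" for \<tau> v by (simp add: squeeze_def)
  define m where "m = min (min c d) z"
  \<comment> \<open>The primitive is a map germ, so its derivative \<open>J x\<close> is known to
    exist; it can therefore be computed along the line \<open>x + a *\<^sub>R u\<close> by the
    Leibniz rule in the single variable a.\<close>
  have directional: "(J x *v u) \<bullet> v = integral {0..1} (\<lambda>\<tau>. u $ i * \<delta> (?T \<tau> x) ?E v + x $ i * \<delta>' (?T \<tau> x) (?T \<tau> u) ?E v)"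
    and integrable: "(\<lambda>\<tau>. u $ i * \<delta> (?T \<tau> x) ?E v + x $ i * \<delta>' (?T \<tau> x) (?T \<tau> u) ?E v) integrable_on {0..1}"
    if x: "x \<in> ball 0 m" for x u v
  proof -
    have x': "x \<in> ball 0 c" "x \<in> ball 0 d" using x by (auto simp: m_def)
    obtain s where s: "s > 0" "\<And>a b. \<bar>a\<bar> \<le> s \<Longrightarrow> \<bar>b\<bar> \<le> s \<Longrightarrow> x + a *\<^sub>R u + b *\<^sub>R u \<in> ball 0 d"
      by (rule segment_in_ball[OF x'(2), of u u]) (rule that)
    let ?S = "{-s<..<s}" and ?y = "\<lambda>a. x + a *\<^sub>R u"
    have y: "?y a \<in> ball 0 d" if "a \<in> ?S" for a
    proof -
      have "\<bar>a\<bar> \<le> s" using that by auto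
      then show ?thesis using s(2)[of a 0] s(1) by simp
    qed
    have zeroS: "0 \<in> ?S" using s(1) by simp
    have ya: "(?y has_derivative (\<lambda>b. b *\<^sub>R u)) (at a within S)" for a S
      by (auto intro!: derivative_eq_intros)
    have lin_T: "(\<lambda>b. ?T \<tau> (b *\<^sub>R u)) = (\<lambda>b. b *\<^sub>R ?T \<tau> u)" for \<tau> by (simp add: linear_scale[OF linear_squeeze])
    have Ty: "((\<lambda>a. ?T \<tau> (?y a)) has_derivative (\<lambda>b. b *\<^sub>R ?T \<tau> u)) (at a within S)" for \<tau> a S
      using has_derivative_compose[OF ya bounded_linear_imp_has_derivative[OF linear_conv_bounded_linear[THEN iffD1, OF linear_squeeze]],
        of i \<tau> a S]
      unfolding lin_T .
    have F: "((\<lambda>a. \<delta> (?T \<tau> (?y a)) ?E v) has_field_derivative \<delta>' (?T \<tau> (?y a)) (?T \<tau> u) ?E v) (at a within ?S)"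
      if "a \<in> ?S" "\<tau> \<in> cbox 0 1" for a \<tau>
    proof -
      have b: "?T \<tau> (?y a) \<in> ball 0 d" by (rule squeeze_in_ball[OF y[OF that(1)]]) (use that(2) in simp)
      have "(\<lambda>h. \<delta>' (?T \<tau> (?y a)) (h *\<^sub>R ?T \<tau> u) ?E v) = (*) (\<delta>' (?T \<tau> (?y a)) (?T \<tau> u) ?E v)"
        by (rule ext) (unfold linear_scale[OF lin[OF b]], simp)
      with has_derivative_compose[OF Ty[where \<tau>=\<tau> and a=a and S="?S"] deriv[OF b, of ?E v]] show ?thesis
        unfolding has_field_derivative_def by simp
    qed
    \<comment> \<open>Separates \<tau> from the direction in which \<delta> is differentiated, since
      \<open>deriv_cont\<close> concerns fixed vectors.\<close>
    have split: "\<delta>' p (?T \<tau> u) ?E v = \<delta>' p u ?E v + (\<tau> - 1) * u $ i * \<delta>' p ?E ?E v" if "p \<in> ball 0 d" for p \<tau>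
      unfolding T' by (simp add: linear_add[OF lin[OF that]] linear_scale[OF lin[OF that]])
    have Tc: "continuous_on (?S \<times> cbox 0 1) (\<lambda>q. ?T (snd q) (?y (fst q)))"
      by (intro continuous_on_squeeze continuous_intros)
    have Tim: "(\<lambda>q. ?T (snd q) (?y (fst q))) ` (?S \<times> cbox 0 1) \<subseteq> ball 0 d"
    proof (rule image_subsetI)
      fix q assume "q \<in> ?S \<times> cbox 0 (1::real)"
      then show "?T (snd q) (?y (fst q)) \<in> ball 0 d" by (intro squeeze_in_ball y) (auto simp: mem_Times_iff)
    qed
    have "continuous_on (?S \<times> cbox 0 1) (\<lambda>q. \<delta>' (?T (snd q) (?y (fst q))) u ?E v + (snd q - 1) * u $ i * \<delta>' (?T (snd q) (?y (fst q))) ?E ?E v)"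
      by (intro continuous_intros continuous_on_compose2[OF deriv_cont Tc Tim])
    then have "continuous_on (?S \<times> cbox 0 1) (\<lambda>q. \<delta>' (?T (snd q) (?y (fst q))) (?T (snd q) u) ?E v)"
    proof (rule continuous_on_eq)
      fix q assume "q \<in> ?S \<times> cbox 0 (1::real)"
      then have "?T (snd q) (?y (fst q)) \<in> ball 0 d" using Tim by blast
      from split[OF this] show "\<delta>' (?T (snd q) (?y (fst q))) u ?E v + (snd q - 1) * u $ i * \<delta>' (?T (snd q) (?y (fst q))) ?E ?E v
        = \<delta>' (?T (snd q) (?y (fst q))) (?T (snd q) u) ?E v" by simp
    qed
    then have cf: "continuous_on (?S \<times> cbox 0 1) (\<lambda>(a, \<tau>). \<delta>' (?T \<tau> (?y a)) (?T \<tau> u) ?E v)" by (simp add: case_prod_beta)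
    have "((\<lambda>a. integral (cbox 0 1) (\<lambda>\<tau>. \<delta> (?T \<tau> (?y a)) ?E v)) has_field_derivative
        integral (cbox 0 1) (\<lambda>\<tau>. \<delta>' (?T \<tau> (?y 0)) (?T \<tau> u) ?E v)) (at 0 within ?S)"
    proof (rule leibniz_rule_field_derivative[OF F _ cf])
      show "(\<lambda>\<tau>. \<delta> (?T \<tau> (?y a)) ?E v) integrable_on cbox 0 1" if "a \<in> ?S" for a
        unfolding box_real by (intro integrable_continuous_real path[OF cont y[OF that]])
    qed (use zeroS in simp_all)
    then have "((\<lambda>a. H v (?y a)) has_field_derivative integral {0..1} (\<lambda>\<tau>. \<delta>' (?T \<tau> (?y 0)) (?T \<tau> u) ?E v)) (at 0)"
      unfolding box_real at_within_open[OF zeroS open_greaterThanLessThan] H_def .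
    then have dH: "((\<lambda>a. H v (?y a)) has_field_derivative integral {0..1} (\<lambda>\<tau>. \<delta>' (?T \<tau> x) (?T \<tau> u) ?E v)) (at 0)"
      by simp
    have "((\<lambda>a. ?y a $ i * H v (?y a)) has_field_derivative u $ i * H v (?y 0)
        + integral {0..1} (\<lambda>\<tau>. \<delta>' (?T \<tau> x) (?T \<tau> u) ?E v) * ?y 0 $ i) (at 0)"
      by (rule DERIV_mult[OF _ dH]) (auto intro!: derivative_eq_intros)
    moreover have "((\<lambda>a. ?y a $ i * H v (?y a)) has_field_derivative (J x *v u) \<bullet> v) (at 0)"
    proof -
      have "((\<lambda>a. ?y a $ i *\<^sub>R h (?y a)) has_derivative (\<lambda>b. J (?y 0) *v (b *\<^sub>R u))) (at 0)"
        by (rule has_derivative_compose[OF ya J(2)]) (use x' in simp)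
      then have "((\<lambda>a. (?y a $ i *\<^sub>R h (?y a)) \<bullet> v) has_derivative (\<lambda>b. (J (?y 0) *v (b *\<^sub>R u)) \<bullet> v)) (at 0)"
        by (rule has_derivative_inner_left)
      moreover have "(\<lambda>b. (J (?y 0) *v (b *\<^sub>R u)) \<bullet> v) = (*) ((J x *v u) \<bullet> v)"
        by (rule ext) (simp add: matrix_vector_mult_scaleR)
      ultimately have "((\<lambda>a. (?y a $ i *\<^sub>R h (?y a)) \<bullet> v) has_field_derivative (J x *v u) \<bullet> v) (at 0)"
        unfolding has_field_derivative_def by (simp only:)
      then show ?thesis
        by (rule has_field_derivative_transform_within_open[OF _ open_greaterThanLessThan zeroS])
          (simp add: H_inner[OF y])
    qed
    ultimately have "(J x *v u) \<bullet> v = u $ i * H v x + integral {0..1} (\<lambda>\<tau>. \<delta>' (?T \<tau> x) (?T \<tau> u) ?E v) * x $ i"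
      by (rule DERIV_unique[symmetric, THEN trans]) simp
    moreover have I1: "(\<lambda>\<tau>. \<delta> (?T \<tau> x) ?E v) integrable_on {0..1}"
      by (intro integrable_continuous_real path[OF cont x'(2)])
    moreover have I2: "(\<lambda>\<tau>. \<delta>' (?T \<tau> x) (?T \<tau> u) ?E v) integrable_on {0..1}"
    proof (rule integrable_continuous_real)
      have "continuous_on {0..1} (\<lambda>\<tau>. (\<lambda>(a, \<tau>). \<delta>' (?T \<tau> (?y a)) (?T \<tau> u) ?E v) (0, \<tau>))"
        by (rule continuous_on_compose2[OF cf]) (use zeroS in \<open>auto intro!: continuous_intros\<close>)
      then show "continuous_on {0..1} (\<lambda>\<tau>. \<delta>' (?T \<tau> x) (?T \<tau> u) ?E v)" by simp
    qed
    moreover note integral_add[OF integrable_on_mult_right[OF I1] integrable_on_mult_right[OF I2], of "u $ i" "x $ i"]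
    ultimately show "(J x *v u) \<bullet> v = integral {0..1} (\<lambda>\<tau>. u $ i * \<delta> (?T \<tau> x) ?E v + x $ i * \<delta>' (?T \<tau> x) (?T \<tau> u) ?E v)"
      by (simp add: H_def mult.commute)
    show "(\<lambda>\<tau>. u $ i * \<delta> (?T \<tau> x) ?E v + x $ i * \<delta>' (?T \<tau> x) (?T \<tau> u) ?E v) integrable_on {0..1}"
      by (intro integrable_add integrable_on_mult_right I1 I2)
  qed
  have d_eta: "(J x *v u) \<bullet> v - (J x *v v) \<bullet> u = \<delta> x u v" if x: "x \<in> ball 0 m" for x u v
  proof -
    have x': "x \<in> ball 0 d" "x \<in> ball 0 z" using x by (auto simp: m_def)
    let ?G = "\<lambda>\<tau>. (u $ i * \<delta> (?T \<tau> x) ?E v + x $ i * \<delta>' (?T \<tau> x) (?T \<tau> u) ?E v)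
      - (v $ i * \<delta> (?T \<tau> x) ?E u + x $ i * \<delta>' (?T \<tau> x) (?T \<tau> v) ?E u)"
    \<comment> \<open>The integrand is the \<tau>-derivative of the pullback of \<delta> under
      squeezing, which runs from the restriction to the hyperplane, equal to zero, to \<delta>
      itself.\<close>
    have "(?G has_integral \<delta> (?T 1 x) (?T 1 u) (?T 1 v) - \<delta> (?T 0 x) (?T 0 u) (?T 0 v)) {0..1}"
    proof (rule fundamental_theorem_of_calculus)
      fix \<tau> :: real assume \<tau>: "\<tau> \<in> {0..1}"
      have b: "?T s x \<in> ball 0 d" if "s \<in> {0..1}" for s by (rule squeeze_in_ball[OF x'(1) that])
      note p = b[OF \<tau>]
      note vd = squeeze_has_vector_derivative[of i _ \<tau> "{0..1}", unfolded has_vector_derivative_def]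
      have "((\<lambda>\<tau>. \<delta> (?T \<tau> x) (?T \<tau> u) (?T \<tau> v)) has_derivative
          (\<lambda>s. \<delta>' (?T \<tau> x) (s *\<^sub>R x $ i *\<^sub>R ?E) (?T \<tau> u) (?T \<tau> v) + \<delta> (?T \<tau> x) (s *\<^sub>R u $ i *\<^sub>R ?E) (?T \<tau> v)
            + \<delta> (?T \<tau> x) (?T \<tau> u) (s *\<^sub>R v $ i *\<^sub>R ?E))) (at \<tau> within {0..1})"
        by (rule two_form_chain[OF bilinear open_ball deriv[OF p] vd \<tau> b vd vd])
      moreover have "\<delta>' (?T \<tau> x) (s *\<^sub>R x $ i *\<^sub>R ?E) (?T \<tau> u) (?T \<tau> v) + \<delta> (?T \<tau> x) (s *\<^sub>R u $ i *\<^sub>R ?E) (?T \<tau> v)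
            + \<delta> (?T \<tau> x) (?T \<tau> u) (s *\<^sub>R v $ i *\<^sub>R ?E) = s *\<^sub>R ?G \<tau>" for s
      proof -
        note bil = bilinear[OF p]
        \<comment> \<open>Closedness, with the contributions of the components along
          \<open>axis i 1\<close> removed by \<open>diag\<close>.\<close>
        have E1: "\<delta>' (?T \<tau> x) ?E (?T \<tau> u) (?T \<tau> v) = \<delta>' (?T \<tau> x) (?T \<tau> u) ?E v - \<delta>' (?T \<tau> x) (?T \<tau> v) ?E u"
          using closed[OF p, of ?E "?T \<tau> u" "?T \<tau> v"] lin3[OF p, of "?T \<tau> u" ?E v _ ?E] lin3[OF p, of "?T \<tau> v" ?E u _ ?E]
          unfolding T'[of _ u] T'[of _ v] diag[OF p] by simp
        have E2: "\<delta> (?T \<tau> x) ?E (?T \<tau> v) = \<delta> (?T \<tau> x) ?E v"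
          unfolding T'[of _ v] by (simp add: bilinear_radd[OF bil] bilinear_rmul[OF bil] alternating[OF p])
        have E3: "\<delta> (?T \<tau> x) (?T \<tau> u) ?E = - \<delta> (?T \<tau> x) ?E u"
          unfolding T'[of _ u] bilinear_ladd[OF bil] bilinear_lmul[OF bil] alternating[OF p]
          using bilinear_alternating_skew[OF bil alternating[OF p], of u ?E] by simp
        show ?thesis
          by (simp add: linear_scale[OF lin[OF p]] bilinear_lmul[OF bil] bilinear_rmul[OF bil] E1 E2 E3)
            (simp add: algebra_simps)
      qed
      ultimately show "((\<lambda>\<tau>. \<delta> (?T \<tau> x) (?T \<tau> u) (?T \<tau> v)) has_vector_derivative ?G \<tau>) (at \<tau> within {0..1})"
        unfolding has_vector_derivative_def by (simp only:)
    qed simp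
    moreover have "\<delta> (?T 0 x) (?T 0 u) (?T 0 v) = 0"
      using z(2)[of "?T 0 x"] squeeze_in_ball[OF x'(2), of 0 i] by (simp add: squeeze_nth dist_norm)
    ultimately have "integral {0..1} ?G = \<delta> x u v" by (simp add: integral_unique)
    then show ?thesis
      unfolding directional[OF x] using integral_diff[OF integrable[OF x, of u v] integrable[OF x, of v u]] by simp
  qed
  show ?thesis
  proof (rule that[of m h "\<lambda>x. (*v) (J x)"])
    show "m > 0" using c radius z by (simp add: m_def)
    show "map_germ r h" by (rule h)
    show "h 0 $ k = \<delta> 0 ?E (axis k 1)" for k by (simp add: h_def H_def)
    fix x :: "real ^ 'n" assume x: "x \<in> ball 0 m"
    then have x': "x \<in> ball 0 c" "x \<in> ball 0 d" by (auto simp: m_def)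
    have "H ?E x = integral {0..1} (\<lambda>_::real. 0)"
      unfolding H_def by (rule integral_cong) (rule alternating, rule squeeze_in_ball[OF x'(2)])
    then show "h x $ i = 0" by (simp add: h_def)
    show "((\<lambda>x. x $ i *\<^sub>R h x) has_derivative (*v) (J x)) (at x)" by (rule J(2)[OF x'(1)])
    show "(J x *v u) \<bullet> v - (J x *v v) \<bullet> u = \<delta> x u v" for u v by (rule d_eta[OF x])
  qed
qed

section \<open>Regular sequences of germs\<close>

lemma (in cring) genideal_pair_elem:
  assumes a: "a \<in> carrier R" and b: "b \<in> carrier R" and x: "x \<in> Idl {a, b}"
  obtains u v where "u \<in> carrier R" "v \<in> carrier R" "x = u \<otimes> a \<oplus> v \<otimes> b"
proof -
  have sub: "PIdl c \<subseteq> PIdl a <+> PIdl b" if "c \<in> {a, b}" for c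
  proof -
    have "PIdl a <+> PIdl b = Idl (PIdl a \<union> PIdl b)"
      by (rule union_genideal[symmetric, OF cgenideal_ideal[OF a] cgenideal_ideal[OF b]])
    moreover have "PIdl a \<union> PIdl b \<subseteq> Idl (PIdl a \<union> PIdl b)"
      by (rule genideal_self) (use a b in \<open>auto simp: cgenideal_def\<close>)
    ultimately show ?thesis using that by auto
  qed
  have "a \<in> PIdl a <+> PIdl b" "b \<in> PIdl a <+> PIdl b"
    using sub[of a] sub[of b] cgenideal_self[OF a] cgenideal_self[OF b] by auto
  then have "Idl {a, b} \<subseteq> PIdl a <+> PIdl b"
    by (intro genideal_minimal add_ideals cgenideal_ideal a b) simp
  with x have "x \<in> PIdl a <+> PIdl b" by blast
  then obtain u v where "u \<in> carrier R" "v \<in> carrier R" "x = u \<otimes> a \<oplus> v \<otimes> b"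
    unfolding set_add_def' cgenideal_def by blast
  then show ?thesis by (rule that)
qed

lemma (in cring) genideal_triple_elem:
  assumes a: "a \<in> carrier R" and b: "b \<in> carrier R" and c: "c \<in> carrier R" and x: "x \<in> Idl {a, b, c}"
  obtains u v w where "u \<in> carrier R" "v \<in> carrier R" "w \<in> carrier R" "x = u \<otimes> a \<oplus> (v \<otimes> b \<oplus> w \<otimes> c)"
proof -
  have I: "ideal (Idl {b, c}) R" by (rule genideal_ideal) (use b c in simp)
  have U: "PIdl a <+> Idl {b, c} = Idl (PIdl a \<union> Idl {b, c})"
    by (rule union_genideal[symmetric, OF cgenideal_ideal[OF a] I])
  have sub: "PIdl a \<union> Idl {b, c} \<subseteq> PIdl a <+> Idl {b, c}"
    unfolding U by (rule genideal_self) (use a ideal.Icarr[OF I] in \<open>auto simp: cgenideal_def\<close>)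
  have "{b, c} \<subseteq> Idl {b, c}" by (rule genideal_self) (use b c in simp)
  with sub cgenideal_self[OF a] have "{a, b, c} \<subseteq> PIdl a <+> Idl {b, c}" by auto
  then have "Idl {a, b, c} \<subseteq> PIdl a <+> Idl {b, c}"
    by (intro genideal_minimal add_ideals cgenideal_ideal a I)
  with x have "x \<in> PIdl a <+> Idl {b, c}" by blast
  then obtain u y where u: "u \<in> carrier R" "y \<in> Idl {b, c}" "x = u \<otimes> a \<oplus> y"
    unfolding set_add_def' cgenideal_def by blast
  obtain v w where "v \<in> carrier R" "w \<in> carrier R" "y = v \<otimes> b \<oplus> w \<otimes> c"
    by (rule genideal_pair_elem[OF b c u(2)]) (rule that)
  with u show ?thesis by (intro that[of u v w]) auto
qed

text \<open>Regularity leaves only Koszul syzygies: y times b lies in the ideal of a, and b is a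
  non-zero-divisor modulo a, so y is a multiple of a; then the factor a is cancelled.\<close>

lemma (in cring) regular_sequence_syzygy:
  assumes reg: "regular_sequence R I [a, b]" and x: "x \<in> carrier R" and y: "y \<in> carrier R"
    and syz: "x \<otimes> a \<oplus> y \<otimes> b = \<zero>"
  obtains k where "k \<in> carrier R" "y = k \<otimes> a" "x = \<ominus> (k \<otimes> b)"
proof -
  have I: "ideal I R" "a \<in> I" "b \<in> I" using reg by (auto simp: regular_sequence_def)
  have ab: "a \<in> carrier R" "b \<in> carrier R" using ideal.Icarr[OF I(1)] I by auto
  have nzd: "non_zero_divisor R a" "non_zero_divisor (R Quot Idl {a}) (Idl {a} +> b)"
    using reg by (auto simp: regular_sequence_def Let_def)
  interpret J: ideal "Idl {a}" R by (rule genideal_ideal) (use ab in simp)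
  have J: "Idl {a} = PIdl a" by (rule cgenideal_eq_genideal[OF ab(1), symmetric])
  \<comment> \<open>The zero of the quotient ring is the ideal itself, so vanishing of a coset is
    turned into membership.\<close>
  have coset: "Idl {a} +> z = Idl {a} \<longleftrightarrow> z \<in> Idl {a}" if "z \<in> carrier R" for z
  proof -
    have "Idl {a} +> \<zero> = Idl {a}" by (rule a_coset_add_zero) (rule J.a_subset)
    with quotient_eq_iff_same_a_r_cos[OF J.is_ideal that zero_closed] that show ?thesis
      by (simp add: a_minus_def)
  qed
  have "y \<otimes> b = \<ominus> (x \<otimes> a)"
    using syz ab x y by (metis a_comm m_closed minus_equality)
  also have "\<dots> = (\<ominus> x) \<otimes> a" using ab x by (simp add: l_minus)
  finally have yb: "y \<otimes> b = (\<ominus> x) \<otimes> a" .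
  then have "b \<otimes> y = (\<ominus> x) \<otimes> a" using m_comm[OF ab(2) y] by simp
  then have "b \<otimes> y \<in> Idl {a}" unfolding J cgenideal_def using a_inv_closed[OF x] by blast
  then have "Idl {a} +> (b \<otimes> y) = Idl {a}" using coset ab y by simp
  then have "(Idl {a} +> b) \<otimes>\<^bsub>R Quot Idl {a}\<^esub> (Idl {a} +> y) = \<zero>\<^bsub>R Quot Idl {a}\<^esub>"
    using J.rcoset_mult_add[OF ab(2) y] by (simp add: FactRing_def)
  moreover have "Idl {a} +> y \<in> carrier (R Quot Idl {a})"
    using y by (auto simp: FactRing_def A_RCOSETS_def')
  ultimately have "Idl {a} +> y = \<zero>\<^bsub>R Quot Idl {a}\<^esub>"
    using nzd(2) by (auto simp: non_zero_divisor_def)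
  then have "y \<in> Idl {a}" using coset[OF y] by (simp add: FactRing_def)
  then obtain k where k: "k \<in> carrier R" "y = k \<otimes> a" unfolding J cgenideal_def by blast
  have "a \<otimes> (x \<oplus> k \<otimes> b) = x \<otimes> a \<oplus> y \<otimes> b"
    unfolding k(2) using ab x k(1) by algebra
  then have "x \<oplus> k \<otimes> b = \<zero>"
    using nzd(1) syz ab x k(1) by (auto simp: non_zero_divisor_def)
  then have "x = \<ominus> (k \<otimes> b)" using ab x k(1) by (metis m_closed minus_equality)
  with k show ?thesis by (rule that)
qed

section \<open>Rings of germs and syzygies of their elements\<close>

lemma germ0_eq_iff: "germ0 f = germ0 g \<longleftrightarrow> (\<forall>\<^sub>0x. f x = g x)"
proof
  assume "germ0 f = germ0 g"
  moreover have "f \<in> germ0 f" by (simp add: germ0_def)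
  ultimately show "\<forall>\<^sub>0x. f x = g x" by (simp add: germ0_def)
next
  assume eq: "\<forall>\<^sub>0x. f x = g x"
  have "(\<forall>\<^sub>0x. h x = f x) \<longleftrightarrow> (\<forall>\<^sub>0x. h x = g x)" for h
    by (rule eventually_subst) (use eq in \<open>auto elim: eventually_mono\<close>)
  then show "germ0 f = germ0 g" by (simp add: germ0_def)
qed

lemma germ0_lift: "{h. \<exists>f'\<in>germ0 f. \<exists>g'\<in>germ0 g. \<forall>\<^sub>0x. h x = p (f' x) (g' x)} = germ0 (\<lambda>x. p (f x) (g x))"
proof -
  have "(\<exists>f'\<in>germ0 f. \<exists>g'\<in>germ0 g. \<forall>\<^sub>0x. h x = p (f' x) (g' x)) \<longleftrightarrow> (\<forall>\<^sub>0x. h x = p (f x) (g x))" (is "?l \<longleftrightarrow> ?r") for h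
  proof
    assume ?l
    then obtain f' g' where "\<forall>\<^sub>0x. f' x = f x" "\<forall>\<^sub>0x. g' x = g x"
      "\<forall>\<^sub>0x. h x = p (f' x) (g' x)" by (auto simp: germ0_def)
    then show ?r by eventually_elim simp
  next
    assume ?r then show ?l by (intro bexI[of _ f] bexI[of _ g]) (auto simp: germ0_def)
  qed
  then show ?thesis by (simp add: germ0_def[of "\<lambda>x. p (f x) (g x)"])
qed

lemma germ_ring_mult: "germ0 f \<otimes>\<^bsub>germ_ring r\<^esub> germ0 g = germ0 (\<lambda>x. f x * g x)"
  and germ_ring_add: "germ0 f \<oplus>\<^bsub>germ_ring r\<^esub> germ0 g = germ0 (\<lambda>x. f x + g x)"
  using germ0_lift[of f g "(*)"] germ0_lift[of f g "(+)"] by (simp_all add: germ_ring_def)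

lemma germ_ring_carrier: "germ0 f \<in> carrier (germ_ring r)" if "fun_germ r f"
  using that by (auto simp: germ_ring_def)

lemma germ_ring_carrierE:
  assumes "A \<in> carrier (germ_ring r)"
  obtains f where "fun_germ r f" "A = germ0 f"
  using assms by (auto simp: germ_ring_def)

lemma germ_ring_one: "\<one>\<^bsub>germ_ring r\<^esub> = germ0 (\<lambda>_. 1)" and germ_ring_zero: "\<zero>\<^bsub>germ_ring r\<^esub> = germ0 (\<lambda>_. 0)"
  by (simp_all add: germ_ring_def)

lemma cring_germ_ring: "cring (germ_ring r :: (real ^ 'n \<Rightarrow> real) set ring)"
proof -
  let ?R = "germ_ring r :: (real ^ 'n \<Rightarrow> real) set ring"
  note ops = germ_ring_mult germ_ring_add germ_ring_one germ_ring_zero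
  note closed = germ_ring_carrier fun_germ_const fun_germ_add fun_germ_mult
  show ?thesis
  proof (intro cringI abelian_groupI comm_monoidI)
    fix A B C assume ABC: "A \<in> carrier ?R" "B \<in> carrier ?R" "C \<in> carrier ?R"
    obtain f where f: "fun_germ r f" "A = germ0 f" using ABC(1) by (rule germ_ring_carrierE)
    obtain g where g: "fun_germ r g" "B = germ0 g" using ABC(2) by (rule germ_ring_carrierE)
    obtain h where h: "fun_germ r h" "C = germ0 h" using ABC(3) by (rule germ_ring_carrierE)
    show "A \<oplus>\<^bsub>?R\<^esub> B \<oplus>\<^bsub>?R\<^esub> C = A \<oplus>\<^bsub>?R\<^esub> (B \<oplus>\<^bsub>?R\<^esub> C)" "A \<otimes>\<^bsub>?R\<^esub> B \<otimes>\<^bsub>?R\<^esub> C = A \<otimes>\<^bsub>?R\<^esub> (B \<otimes>\<^bsub>?R\<^esub> C)"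
      "(A \<oplus>\<^bsub>?R\<^esub> B) \<otimes>\<^bsub>?R\<^esub> C = A \<otimes>\<^bsub>?R\<^esub> C \<oplus>\<^bsub>?R\<^esub> B \<otimes>\<^bsub>?R\<^esub> C"
      unfolding f(2) g(2) h(2) ops by (simp_all add: algebra_simps)
  next
    fix A B assume AB: "A \<in> carrier ?R" "B \<in> carrier ?R"
    obtain f where f: "fun_germ r f" "A = germ0 f" using AB(1) by (rule germ_ring_carrierE)
    obtain g where g: "fun_germ r g" "B = germ0 g" using AB(2) by (rule germ_ring_carrierE)
    show "A \<oplus>\<^bsub>?R\<^esub> B \<in> carrier ?R" "A \<otimes>\<^bsub>?R\<^esub> B \<in> carrier ?R"
      unfolding f(2) g(2) ops by (intro closed f(1) g(1))+
    show "A \<oplus>\<^bsub>?R\<^esub> B = B \<oplus>\<^bsub>?R\<^esub> A" "A \<otimes>\<^bsub>?R\<^esub> B = B \<otimes>\<^bsub>?R\<^esub> A"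
      unfolding f(2) g(2) ops by (simp_all add: algebra_simps)
  next
    fix A assume A: "A \<in> carrier ?R"
    obtain f where f: "fun_germ r f" "A = germ0 f" using A by (rule germ_ring_carrierE)
    show "\<zero>\<^bsub>?R\<^esub> \<oplus>\<^bsub>?R\<^esub> A = A" "\<one>\<^bsub>?R\<^esub> \<otimes>\<^bsub>?R\<^esub> A = A" unfolding f(2) ops by simp_all
    show "\<exists>B\<in>carrier ?R. B \<oplus>\<^bsub>?R\<^esub> A = \<zero>\<^bsub>?R\<^esub>"
      unfolding f(2) ops
      by (rule bexI[OF _ germ_ring_carrier[OF fun_germ_minus[OF f(1)]]]) (simp add: germ_ring_add)
  qed (simp_all add: ops closed)
qed

text \<open>The algebra turned into identities of functions near \<open>0\<close>: \<open>N1\<close>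
  and \<open>N2\<close> express s through the generators, \<open>M1\<close> and \<open>M2\<close>
  express the generators through s, and the last clause leaves only multiples of the pair
  \<open>- G2\<close>, \<open>G1\<close> as syzygies.\<close>

lemma regular_generators:
  fixes s :: "real ^ 'n \<Rightarrow> real ^ 3" and I :: "(real ^ 'n \<Rightarrow> real) set set"
  assumes s: "map_germ r s" and g: "g1 \<in> carrier (germ_ring r)" "g2 \<in> carrier (germ_ring r)"
    and I: "I = Idl\<^bsub>germ_ring r\<^esub> {germ0 (\<lambda>q. s q $ 1), germ0 (\<lambda>q. s q $ 2), germ0 (\<lambda>q. s q $ 3)}"
      "I = Idl\<^bsub>germ_ring r\<^esub> {g1, g2}"
    and reg: "regular_sequence (germ_ring r) I [g1, g2]"
  obtains G1 G2 N1 N2 M1 M2 where "fun_germ r G1" "fun_germ r G2"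
    "map_germ r N1" "map_germ r N2" "map_germ r M1" "map_germ r M2"
    "\<forall>\<^sub>0q. s q = G1 q *\<^sub>R N1 q + G2 q *\<^sub>R N2 q"
    "\<forall>\<^sub>0q. G1 q = M1 q \<bullet> s q" "\<forall>\<^sub>0q. G2 q = M2 q \<bullet> s q"
    "\<And>x y. fun_germ r x \<Longrightarrow> fun_germ r y \<Longrightarrow> \<forall>\<^sub>0q. x q * G1 q + y q * G2 q = 0 \<Longrightarrow>
      \<exists>k. fun_germ r k \<and> (\<forall>\<^sub>0q. y q = k q * G1 q) \<and> (\<forall>\<^sub>0q. x q = - (k q * G2 q))"
proof -
  let ?R = "germ_ring r :: (real ^ 'n \<Rightarrow> real) set ring"
  interpret R: cring ?R by (rule cring_germ_ring)
  obtain G1 where G1: "fun_germ r G1" "g1 = germ0 G1" using g(1) by (rule germ_ring_carrierE)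
  obtain G2 where G2: "fun_germ r G2" "g2 = germ0 G2" using g(2) by (rule germ_ring_carrierE)
  have s_carrier: "germ0 (\<lambda>q. s q $ k) \<in> carrier ?R" for k
    using s by (intro germ_ring_carrier) (simp add: map_germ_def)
  have "\<exists>u v. fun_germ r u \<and> fun_germ r v \<and> (\<forall>\<^sub>0q. s q $ k = u q * G1 q + v q * G2 q)" for k
  proof -
    have "{germ0 (\<lambda>q. s q $ 1), germ0 (\<lambda>q. s q $ 2), germ0 (\<lambda>q. s q $ 3)} \<subseteq> I"
      unfolding I(1) by (rule R.genideal_self) (use s_carrier in simp)
    then have "germ0 (\<lambda>q. s q $ k) \<in> I" using exhaust_3[of k] by auto
    then obtain U V where UV: "U \<in> carrier ?R" "V \<in> carrier ?R"
      "germ0 (\<lambda>q. s q $ k) = U \<otimes>\<^bsub>?R\<^esub> g1 \<oplus>\<^bsub>?R\<^esub> V \<otimes>\<^bsub>?R\<^esub> g2"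
      unfolding I(2) by (rule R.genideal_pair_elem[OF g]) (rule that)
    obtain u where u: "fun_germ r u" "U = germ0 u" using UV(1) by (rule germ_ring_carrierE)
    obtain v where v: "fun_germ r v" "V = germ0 v" using UV(2) by (rule germ_ring_carrierE)
    show ?thesis
      using UV(3) u v unfolding G1(2) G2(2) germ_ring_mult germ_ring_add germ0_eq_iff u(2) v(2) by blast
  qed
  then have "\<forall>k. \<exists>u v. fun_germ r u \<and> fun_germ r v \<and> (\<forall>\<^sub>0q. s q $ k = u q * G1 q + v q * G2 q)" ..
  from choice[OF this] obtain n1 where "\<forall>k. \<exists>v. fun_germ r (n1 k) \<and> fun_germ r v \<and>
      (\<forall>\<^sub>0q. s q $ k = n1 k q * G1 q + v q * G2 q)" by (elim exE)
  from choice[OF this] obtain n2 where "\<forall>k. fun_germ r (n1 k) \<and> fun_germ r (n2 k) \<and>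
      (\<forall>\<^sub>0q. s q $ k = n1 k q * G1 q + n2 k q * G2 q)" by (elim exE)
  then have n: "\<And>k. fun_germ r (n1 k)" "\<And>k. fun_germ r (n2 k)"
    "\<And>k. \<forall>\<^sub>0q. s q $ k = n1 k q * G1 q + n2 k q * G2 q" by auto
  have gen: "\<exists>M. map_germ r M \<and> (\<forall>\<^sub>0q. G q = M q \<bullet> s q)" if "germ0 G \<in> I" for G
  proof -
    from that obtain U V W where UVW: "U \<in> carrier ?R" "V \<in> carrier ?R" "W \<in> carrier ?R"
      "germ0 G = U \<otimes>\<^bsub>?R\<^esub> germ0 (\<lambda>q. s q $ 1) \<oplus>\<^bsub>?R\<^esub> (V \<otimes>\<^bsub>?R\<^esub> germ0 (\<lambda>q. s q $ 2) \<oplus>\<^bsub>?R\<^esub> W \<otimes>\<^bsub>?R\<^esub> germ0 (\<lambda>q. s q $ 3))"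
      unfolding I(1) by (rule R.genideal_triple_elem[OF s_carrier s_carrier s_carrier]) (rule that)
    obtain u where u: "fun_germ r u" "U = germ0 u" using UVW(1) by (rule germ_ring_carrierE)
    obtain v where v: "fun_germ r v" "V = germ0 v" using UVW(2) by (rule germ_ring_carrierE)
    obtain w where w: "fun_germ r w" "W = germ0 w" using UVW(3) by (rule germ_ring_carrierE)
    have "map_germ r (\<lambda>q. vector [u q, v q, w q] :: real ^ 3)"
      using u v w by (simp add: map_germ_def forall_3)
    moreover have "\<forall>\<^sub>0q. G q = (vector [u q, v q, w q] :: real ^ 3) \<bullet> s q"
      using UVW(4) unfolding germ_ring_mult germ_ring_add germ0_eq_iff u(2) v(2) w(2)
      by (rule eventually_mono) (simp add: inner_vec_def sum_3)
    ultimately show ?thesis by blast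
  qed
  have "{g1, g2} \<subseteq> I" unfolding I(2) by (rule R.genideal_self) (use g in simp)
  then have "germ0 G1 \<in> I" "germ0 G2 \<in> I" using G1 G2 by auto
  from gen[OF this(1)] gen[OF this(2)] obtain M1 M2 where M: "map_germ r M1" "map_germ r M2"
    "\<forall>\<^sub>0q. G1 q = M1 q \<bullet> s q" "\<forall>\<^sub>0q. G2 q = M2 q \<bullet> s q" by (elim exE conjE)
  show ?thesis
  proof (rule that[of G1 G2 "\<lambda>q. \<chi> k. n1 k q" "\<lambda>q. \<chi> k. n2 k q" M1 M2])
    show "map_germ r (\<lambda>q. \<chi> k. n1 k q)" "map_germ r (\<lambda>q. \<chi> k. n2 k q)" using n by (simp_all add: map_germ_def)
    have "\<forall>\<^sub>0q. \<forall>k. s q $ k = n1 k q * G1 q + n2 k q * G2 q"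
      using n(3) by (intro eventually_all_finite)
    then show "\<forall>\<^sub>0q. s q = G1 q *\<^sub>R (\<chi> k. n1 k q) + G2 q *\<^sub>R (\<chi> k. n2 k q)"
      by (rule eventually_mono) (simp add: vec_eq_iff mult.commute)
    fix x y assume xy: "fun_germ r x" "fun_germ r y" "\<forall>\<^sub>0q. x q * G1 q + y q * G2 q = 0"
    have "germ0 x \<otimes>\<^bsub>?R\<^esub> g1 \<oplus>\<^bsub>?R\<^esub> germ0 y \<otimes>\<^bsub>?R\<^esub> g2 = \<zero>\<^bsub>?R\<^esub>"
      unfolding G1(2) G2(2) germ_ring_mult germ_ring_add germ_ring_zero germ0_eq_iff by (rule xy(3))
    then obtain K where K: "K \<in> carrier ?R" "germ0 y = K \<otimes>\<^bsub>?R\<^esub> g1" "germ0 x = \<ominus>\<^bsub>?R\<^esub> (K \<otimes>\<^bsub>?R\<^esub> g2)"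
      by (rule R.regular_sequence_syzygy[OF reg germ_ring_carrier[OF xy(1)] germ_ring_carrier[OF xy(2)]]) (rule that)
    obtain k where k: "fun_germ r k" "K = germ0 k" using K(1) by (rule germ_ring_carrierE)
    have "germ0 x \<oplus>\<^bsub>?R\<^esub> K \<otimes>\<^bsub>?R\<^esub> g2 = \<zero>\<^bsub>?R\<^esub>" unfolding K(3) by (rule R.l_neg) (simp add: K(1) g)
    then have "\<forall>\<^sub>0q. x q + k q * G2 q = 0"
      unfolding k(2) G2(2) germ_ring_mult germ_ring_add germ_ring_zero germ0_eq_iff .
    then have "\<forall>\<^sub>0q. x q = - (k q * G2 q)" by (rule eventually_mono) simp
    moreover have "\<forall>\<^sub>0q. y q = k q * G1 q"
      using K(2) unfolding k(2) G1(2) germ_ring_mult germ0_eq_iff .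
    ultimately show "\<exists>k. fun_germ r k \<and> (\<forall>\<^sub>0q. y q = k q * G1 q) \<and> (\<forall>\<^sub>0q. x q = - (k q * G2 q))"
      using k(1) by blast
  qed (use G1 G2 M in auto)
qed

section \<open>First derivatives at the origin and the curl\<close>

lemma has_derivative_germ_unique:
  assumes f: "(f has_derivative f') (at x)" and g: "(g has_derivative g') (at x)"
    and eq: "\<forall>\<^sub>F y in nhds x. f y = g y"
  shows "f' = g'"
proof -
  have "(g has_derivative f') (at x)"
    by (rule has_derivative_transform_eventually[OF f])
      (use eq eventually_nhds_x_imp_x[OF eq] in \<open>auto simp: eventually_at_filter elim: eventually_mono\<close>)
  then show ?thesis using g by (rule has_derivative_unique)
qed

lemma map_germ_differentiable:
  assumes "map_germ r F"
  obtains F' where "(F has_derivative F') (at 0)"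
proof -
  obtain e J where "e > 0" "\<And>x. x \<in> ball 0 e \<Longrightarrow> (F has_derivative (*v) (J x)) (at x)"
    "\<And>h. continuous_on (ball 0 e) (\<lambda>x. J x *v h)" by (rule map_germ_C1[OF assms]) (rule that)
  from this(2)[of 0] this(1) show ?thesis using that by simp
qed

lemma fun_germ_differentiable:
  assumes "fun_germ r f"
  obtains f' where "(f has_derivative f') (at 0)"
proof -
  obtain e g where "e > 0" "\<And>i. fun_germ r (g i)"
    "\<And>x. x \<in> ball 0 e \<Longrightarrow> has_gradient f (\<lambda>i. g i x) x"
    by (rule fun_germ_partials[OF assms]) (rule that)
  from this(3)[of 0] this(1) show ?thesis using that by simp
qed

lemma fun_germ_inner:
  assumes "map_germ r F" "map_germ r G"
  shows "fun_germ r (\<lambda>x. F x \<bullet> G x)"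
  unfolding inner_vec_def using assms by (simp add: map_germ_def fun_germ_sum fun_germ_mult)

text \<open>The curl at a point of a vector field whose derivative there is
  \<open>A\<close>.\<close>

definition curl :: "(real ^ 3 \<Rightarrow> real ^ 3) \<Rightarrow> real ^ 3" where
  "curl A = vector [A (axis 2 1) $ 3 - A (axis 3 1) $ 2, A (axis 3 1) $ 1 - A (axis 1 1) $ 3,
    A (axis 1 1) $ 2 - A (axis 2 1) $ 1]"

lemma linear_axis_expansion3:
  assumes "linear (A :: real ^ 3 \<Rightarrow> 'a::real_vector)"
  shows "A u = u $ 1 *\<^sub>R A (axis 1 1) + u $ 2 *\<^sub>R A (axis 2 1) + u $ 3 *\<^sub>R A (axis 3 1)"
proof -
  have "u = (\<Sum>k\<in>UNIV. u $ k *\<^sub>R axis k 1)"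
    using basis_expansion[of u] by (simp add: scalar_mult_eq_scaleR)
  then have "A u = A (\<Sum>k\<in>UNIV. u $ k *\<^sub>R axis k 1)" by (rule arg_cong)
  then show ?thesis by (simp add: linear_add[OF assms] linear_scale[OF assms] sum_3)
qed

text \<open>The curl represents the skew-symmetric part of \<open>A\<close> through the cross
  product.\<close>

lemma cross3_inner_curl:
  assumes A: "linear A"
  shows "cross3 u v \<bullet> curl A = A u \<bullet> v - A v \<bullet> u"
  unfolding linear_axis_expansion3[OF A, of u] linear_axis_expansion3[OF A, of v]
  by (simp add: cross3_def curl_def inner_vec_def sum_3 algebra_simps)

text \<open>By Lagrange's identity, \<open>a\<close> has zero cross product with
  \<open>cross3 u v\<close>, and a second application recovers the factor of
  proportionality.\<close>

lemma orthogonal_to_pair: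
  fixes u v a :: "real ^ 3"
  assumes n: "cross3 u v \<noteq> 0" and a: "a \<bullet> u = 0" "a \<bullet> v = 0"
  obtains c where "a = c *\<^sub>R cross3 u v"
proof -
  let ?n = "cross3 u v"
  have "cross3 a ?n = 0" using a by (simp add: cross_triple Lagrange)
  then have eq: "(?n \<bullet> ?n) *\<^sub>R a = (?n \<bullet> a) *\<^sub>R ?n"
    using Lagrange[of ?n a ?n] by (simp add: inner_commute)
  have "?n \<bullet> ?n \<noteq> 0" using n by simp
  then have "a = inverse (?n \<bullet> ?n) *\<^sub>R ((?n \<bullet> ?n) *\<^sub>R a)" by (simp del: inner_eq_zero_iff)
  then have "a = (inverse (?n \<bullet> ?n) * (?n \<bullet> a)) *\<^sub>R ?n" unfolding eq by simp
  then show ?thesis by (rule that)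
qed

text \<open>
  Both coefficient vectors annihilate \<open>s\<close>, so regularity makes \<open>a0 0\<close> and \<open>a1 0\<close> proportional to a
  vector \<open>n\<close>; the curl identity comes from the syzygy of \<open>c0 a1 - c1 a0\<close>, which vanishes at \<open>0\<close>.
\<close>

lemma annihilators_of_regular_ideal:
  fixes s a0 a1 :: "real ^ 3 \<Rightarrow> real ^ 3" and I :: "(real ^ 3 \<Rightarrow> real) set set"
  assumes s: "map_germ r s" and g: "g1 \<in> carrier (germ_ring r)" "g2 \<in> carrier (germ_ring r)"
    and I: "I = Idl\<^bsub>germ_ring r\<^esub> {germ0 (\<lambda>q. s q $ 1), germ0 (\<lambda>q. s q $ 2), germ0 (\<lambda>q. s q $ 3)}"
      "I = Idl\<^bsub>germ_ring r\<^esub> {g1, g2}"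
    and reg: "regular_sequence (germ_ring r) I [g1, g2]"
    and s0: "s 0 = 0" and S: "(s has_derivative S) (at 0)" "(\<Sum>k\<in>UNIV. S (axis k 1) $ k) = 0"
    and a0: "map_germ r a0" "(a0 has_derivative A0) (at 0)" "\<forall>\<^sub>0q. a0 q \<bullet> s q = 0"
    and a1: "map_germ r a1" "(a1 has_derivative A1) (at 0)" "\<forall>\<^sub>0q. a1 q \<bullet> s q = 0"
  obtains n c0 c1 where "a0 0 = c0 *\<^sub>R n" "a1 0 = c1 *\<^sub>R n" "c0 * (n \<bullet> curl A1) = c1 * (n \<bullet> curl A0)"
proof -
  obtain G1 G2 N1 N2 M1 M2 where G: "fun_germ r G1" "fun_germ r G2"
    and N: "map_germ r N1" "map_germ r N2" and M: "map_germ r M1" "map_germ r M2"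
    and sN: "\<forall>\<^sub>0q. s q = G1 q *\<^sub>R N1 q + G2 q *\<^sub>R N2 q"
    and GM: "\<forall>\<^sub>0q. G1 q = M1 q \<bullet> s q" "\<forall>\<^sub>0q. G2 q = M2 q \<bullet> s q"
    and syz: "\<And>x y. fun_germ r x \<Longrightarrow> fun_germ r y \<Longrightarrow> \<forall>\<^sub>0q. x q * G1 q + y q * G2 q = 0 \<Longrightarrow>
      \<exists>k. fun_germ r k \<and> (\<forall>\<^sub>0q. y q = k q * G1 q) \<and> (\<forall>\<^sub>0q. x q = - (k q * G2 q))"
    by (rule regular_generators[OF s g I reg]) (rule that)
  have G0: "G1 0 = 0" "G2 0 = 0"
    using eventually_nhds_x_imp_x[OF GM(1)] eventually_nhds_x_imp_x[OF GM(2)] s0 by simp_all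
  \<comment> \<open>Syzygies of the generators are multiples of the generators, so they vanish at
    \<open>0\<close> together with them.\<close>
  have syz0: "x 0 = 0 \<and> y 0 = 0"
    if "fun_germ r x" "fun_germ r y" "\<forall>\<^sub>0q. x q * G1 q + y q * G2 q = 0" for x y
  proof -
    from syz[OF that] obtain k where "\<forall>\<^sub>0q. y q = k q * G1 q" "\<forall>\<^sub>0q. x q = - (k q * G2 q)"
      by (elim exE conjE)
    from eventually_nhds_x_imp_x[OF this(1)] eventually_nhds_x_imp_x[OF this(2)] show ?thesis using G0 by simp
  qed
  \<comment> \<open>Substituting the expression of \<open>s\<close> into
    \<open>G1 = M1 \<bullet> s\<close> gives a syzygy. Its vanishing at \<open>0\<close>, with the
    analogous one for \<open>G2\<close>, makes \<open>M1 0\<close>, \<open>M2 0\<close> dual to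
    \<open>N1 0\<close>, \<open>N2 0\<close>, so the latter are linearly independent.\<close>
  have M1N: "M1 0 \<bullet> N1 0 - 1 = 0 \<and> M1 0 \<bullet> N2 0 = 0"
  proof (rule syz0)
    show "fun_germ r (\<lambda>q. M1 q \<bullet> N1 q - 1)" "fun_germ r (\<lambda>q. M1 q \<bullet> N2 q)"
      by (intro fun_germ_diff fun_germ_inner fun_germ_const M N)+
    show "\<forall>\<^sub>0q. (M1 q \<bullet> N1 q - 1) * G1 q + M1 q \<bullet> N2 q * G2 q = 0"
      using GM(1) sN by eventually_elim (simp add: inner_add_right algebra_simps)
  qed
  have M2N: "M2 0 \<bullet> N1 0 = 0 \<and> M2 0 \<bullet> N2 0 - 1 = 0"
  proof (rule syz0)
    show "fun_germ r (\<lambda>q. M2 q \<bullet> N1 q)" "fun_germ r (\<lambda>q. M2 q \<bullet> N2 q - 1)"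
      by (intro fun_germ_diff fun_germ_inner fun_germ_const M N)+
    show "\<forall>\<^sub>0q. M2 q \<bullet> N1 q * G1 q + (M2 q \<bullet> N2 q - 1) * G2 q = 0"
      using GM(2) sN by eventually_elim (simp add: inner_add_right algebra_simps)
  qed
  define n where "n = cross3 (N1 0) (N2 0)"
  have "n \<bullet> cross3 (M1 0) (M2 0) = 1"
    using M1N M2N dot_cross[of "N1 0" "N2 0" "M1 0" "M2 0"] by (simp add: n_def inner_commute)
  then have n: "n \<noteq> 0" by auto
  have syz_a: "\<exists>k. fun_germ r k \<and> (\<forall>\<^sub>0q. a q \<bullet> N2 q = k q * G1 q) \<and> (\<forall>\<^sub>0q. a q \<bullet> N1 q = - (k q * G2 q))"
    if "map_germ r a" "\<forall>\<^sub>0q. a q \<bullet> s q = 0" for a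
  proof (rule syz)
    show "fun_germ r (\<lambda>q. a q \<bullet> N1 q)" "fun_germ r (\<lambda>q. a q \<bullet> N2 q)" by (intro fun_germ_inner that N)+
    show "\<forall>\<^sub>0q. a q \<bullet> N1 q * G1 q + a q \<bullet> N2 q * G2 q = 0"
      using that(2) sN by eventually_elim (simp add: inner_add_right algebra_simps)
  qed
  have par: "\<exists>c. a 0 = c *\<^sub>R n" if a: "map_germ r a" "\<forall>\<^sub>0q. a q \<bullet> s q = 0" for a
  proof -
    obtain k where "\<forall>\<^sub>0q. a q \<bullet> N2 q = k q * G1 q" "\<forall>\<^sub>0q. a q \<bullet> N1 q = - (k q * G2 q)"
      using syz_a[OF a] by (elim exE conjE)
    from eventually_nhds_x_imp_x[OF this(1)] eventually_nhds_x_imp_x[OF this(2)]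
    have "a 0 \<bullet> N1 0 = 0" "a 0 \<bullet> N2 0 = 0" using G0 by simp_all
    then obtain c where "a 0 = c *\<^sub>R cross3 (N1 0) (N2 0)"
      by (rule orthogonal_to_pair[OF n[unfolded n_def]]) (rule that)
    then show ?thesis unfolding n_def by (rule exI)
  qed
  obtain c0 where c0: "a0 0 = c0 *\<^sub>R n" using par[OF a0(1,3)] by (elim exE)
  obtain c1 where c1: "a1 0 = c1 *\<^sub>R n" using par[OF a1(1,3)] by (elim exE)
  \<comment> \<open>This combination annihilates \<open>s\<close> and vanishes at \<open>0\<close>,
    both vectors being multiples of \<open>n\<close> there. In the derivative of its syzygy at
    \<open>0\<close> only \<open>k 0\<close> and the derivatives of the generators survive.\<close>
  define d where "d = (\<lambda>q. c0 *\<^sub>R a1 q - c1 *\<^sub>R a0 q)"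
  define D where "D = (\<lambda>h. c0 *\<^sub>R A1 h - c1 *\<^sub>R A0 h)"
  have d: "map_germ r d" using a0(1) a1(1) unfolding map_germ_def d_def
    by (simp add: fun_germ_diff fun_germ_mult fun_germ_const)
  have d0: "d 0 = 0" by (simp add: d_def c0 c1)
  have dD: "(d has_derivative D) (at 0)"
    unfolding d_def D_def by (intro has_derivative_diff has_derivative_scaleR_right a0 a1)
  have "\<forall>\<^sub>0q. d q \<bullet> s q = 0"
    using a0(3) a1(3) by eventually_elim (simp add: d_def inner_diff_left)
  from syz_a[OF d this] obtain k where k: "fun_germ r k" "\<forall>\<^sub>0q. d q \<bullet> N2 q = k q * G1 q"
    "\<forall>\<^sub>0q. d q \<bullet> N1 q = - (k q * G2 q)" by (elim exE conjE)
  obtain G1' where G1': "(G1 has_derivative G1') (at 0)" by (rule fun_germ_differentiable[OF G(1)]) (rule that)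
  obtain G2' where G2': "(G2 has_derivative G2') (at 0)" by (rule fun_germ_differentiable[OF G(2)]) (rule that)
  obtain k' where k': "(k has_derivative k') (at 0)" by (rule fun_germ_differentiable[OF k(1)]) (rule that)
  obtain N1' where N1': "(N1 has_derivative N1') (at 0)" by (rule map_germ_differentiable[OF N(1)]) (rule that)
  obtain N2' where N2': "(N2 has_derivative N2') (at 0)" by (rule map_germ_differentiable[OF N(2)]) (rule that)
  have e2: "D h \<bullet> N2 0 = k 0 * G1' h" for h
    using fun_cong[OF has_derivative_germ_unique[OF has_derivative_inner[OF dD N2'] has_derivative_mult[OF k' G1'] k(2)], of h]
    by (simp add: d0 G0)
  have e1: "D h \<bullet> N1 0 = - (k 0 * G2' h)" for h
    using fun_cong[OF has_derivative_germ_unique[OF has_derivative_inner[OF dD N1'] has_derivative_minus[OF has_derivative_mult[OF k' G2']] k(3)], of h]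
    by (simp add: d0 G0)
  have eS: "S h = G1' h *\<^sub>R N1 0 + G2' h *\<^sub>R N2 0" for h
    using fun_cong[OF has_derivative_germ_unique[OF S(1)
      has_derivative_add[OF has_derivative_scaleR[OF G1' N1'] has_derivative_scaleR[OF G2' N2']] sN], of h]
    by (simp add: G0)
  \<comment> \<open>The divergence of \<open>s\<close> at \<open>0\<close>, computed from its
    expression by the generators, which vanish there. The curl of \<open>d\<close> in the direction
    \<open>n\<close> turns out to be \<open>k 0\<close> times the same sum.\<close>
  have "G1' (N1 0) + G2' (N2 0) = 0"
    using S(2) unfolding sum_3 eS linear_axis_expansion3[OF has_derivative_linear[OF G1'], of "N1 0"]
      linear_axis_expansion3[OF has_derivative_linear[OF G2'], of "N2 0"]
    by (simp add: algebra_simps)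
  then have "k 0 * (G1' (N1 0) + G2' (N2 0)) = 0" by simp
  then have "n \<bullet> curl D = 0"
    unfolding n_def cross3_inner_curl[OF has_derivative_linear[OF dD]] e1 e2 by (simp add: algebra_simps)
  moreover have "n \<bullet> curl D = c0 * (n \<bullet> curl A1) - c1 * (n \<bullet> curl A0)"
    by (simp add: curl_def D_def inner_vec_def sum_3 algebra_simps)
  ultimately have "c0 * (n \<bullet> curl A1) = c1 * (n \<bullet> curl A0)" by simp
  with c0 c1 show ?thesis by (rule that)
qed

section \<open>The straightened situation\<close>

lemma vector_4 [simp]:
  "(vector [a, b, c, d] :: 'a::zero ^ 4) $ 1 = a" "(vector [a, b, c, d] :: 'a::zero ^ 4) $ 2 = b"
  "(vector [a, b, c, d] :: 'a::zero ^ 4) $ 3 = c" "(vector [a, b, c, d] :: 'a::zero ^ 4) $ 4 = d"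
  unfolding vector_def by simp_all

section \<open>The hyperplane x_1 = 0 and the parts of a form along it\<close>

definition slice :: "real ^ 3 \<Rightarrow> real ^ 4" where
  "slice q = vector [0, q $ 1, q $ 2, q $ 3]"

definition unslice :: "real ^ 4 \<Rightarrow> real ^ 3" where
  "unslice x = vector [x $ 2, x $ 3, x $ 4]"

lemma slice_nth [simp]: "slice q $ 1 = 0" "slice q $ 2 = q $ 1" "slice q $ 3 = q $ 2" "slice q $ 4 = q $ 3"
  by (simp_all add: slice_def)

lemma unslice_nth [simp]: "unslice x $ 1 = x $ 2" "unslice x $ 2 = x $ 3" "unslice x $ 3 = x $ 4"
  by (simp_all add: unslice_def)

lemma slice_unslice: "x $ 1 = 0 \<Longrightarrow> slice (unslice x) = x"
  by (simp add: vec_eq_iff forall_4)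

lemma unslice_slice [simp]: "unslice (slice q) = q"
  by (simp add: vec_eq_iff forall_3)

lemma slice_axis: "slice (axis 1 1) = axis 2 1" "slice (axis 2 1) = axis 3 1" "slice (axis 3 1) = axis 4 1"
  by (simp_all add: vec_eq_iff forall_4 axis_def)

lemma linear_slice: "linear slice" and linear_unslice: "linear unslice"
  by (auto intro!: linearI simp: vec_eq_iff forall_4 forall_3)

lemma slice_0 [simp]: "slice 0 = 0" and unslice_0 [simp]: "unslice 0 = 0"
  by (simp_all add: linear_0 linear_slice linear_unslice)

lemma map_germ_slice: "map_germ r slice" and map_germ_unslice: "map_germ r unslice"
  unfolding map_germ_def by (simp_all add: forall_4 forall_3 fun_germ_const fun_germ_coordinate)

text \<open>Half of the wedge square on the standard basis, see
  \<open>wedge_axis_pfaffian\<close>.\<close>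

definition pfaffian :: "(real ^ 4 \<Rightarrow> real ^ 4 \<Rightarrow> real) \<Rightarrow> real" where
  "pfaffian B = B (axis 1 1) (axis 2 1) * B (axis 3 1) (axis 4 1) - B (axis 1 1) (axis 3 1) * B (axis 2 1) (axis 4 1)
    + B (axis 1 1) (axis 4 1) * B (axis 2 1) (axis 3 1)"

text \<open>The contraction of \<open>W\<close> with the first basis vector, restricted to the
  hyperplane.\<close>

definition normal_part :: "4 two_form \<Rightarrow> real ^ 3 \<Rightarrow> real ^ 3" where
  "normal_part W q = vector [W (slice q) (axis 1 1) (axis 2 1), W (slice q) (axis 1 1) (axis 3 1),
    W (slice q) (axis 1 1) (axis 4 1)]"

definition coeff_vector :: "3 two_form \<Rightarrow> real ^ 3 \<Rightarrow> real ^ 3" where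
  "coeff_vector \<sigma> q = vector [\<sigma> q (axis 2 1) (axis 3 1), \<sigma> q (axis 3 1) (axis 1 1), \<sigma> q (axis 1 1) (axis 2 1)]"

text \<open>Coefficient vector of the restriction of \<open>W\<close> to the hyperplane directions,
  with the sign of \<open>dz \<and> dx\<close> in the middle. At points of the hyperplane its inner
  product with \<open>normal_part\<close> is the Pfaffian.\<close>

definition tangential_part :: "4 two_form \<Rightarrow> real ^ 4 \<Rightarrow> real ^ 3" where
  "tangential_part W x = vector [W x (axis 3 1) (axis 4 1), - W x (axis 2 1) (axis 4 1), W x (axis 2 1) (axis 3 1)]"

lemma has_derivative_vector3:
  assumes "(f has_derivative f') F" "(g has_derivative g') F" "(h has_derivative h') F"
  shows "((\<lambda>x. vector [f x, g x, h x] :: real ^ 3) has_derivative (\<lambda>k. vector [f' k, g' k, h' k])) F"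
proof -
  have *: "vector [a, b, c] = a *\<^sub>R axis 1 1 + b *\<^sub>R axis 2 1 + c *\<^sub>R (axis 3 1 :: real ^ 3)" for a b c :: real
    by (simp add: vec_eq_iff forall_3 axis_def)
  show ?thesis unfolding * by (intro has_derivative_add has_derivative_scaleR_left assms)
qed

text \<open>The components of \<open>dW = 0\<close> that involve the first direction give the curl,
  the remaining one gives the divergence; only their values at \<open>0\<close> enter.\<close>

lemma straightened_form:
  fixes W :: "4 two_form" and \<sigma> :: "3 two_form"
  assumes W: "two_form_germ r W" "closed_germ W"
    and restr: "\<forall>\<^sub>0q. \<forall>a b. W (slice q) (slice a) (slice b) = \<sigma> q a b"
    and pf: "\<forall>\<^sub>0q. pfaffian (W (slice q)) = 0"
  obtains S A w where "map_germ r (coeff_vector \<sigma>)" "(coeff_vector \<sigma> has_derivative S) (at 0)" "(\<Sum>k\<in>UNIV. S (axis k 1) $ k) = 0"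
    "map_germ r (normal_part W)" "(normal_part W has_derivative A) (at 0)" "\<forall>\<^sub>0q. normal_part W q \<bullet> coeff_vector \<sigma> q = 0"
    "\<forall>\<^sub>0q. tangential_part W (slice q) = coeff_vector \<sigma> q"
    "\<And>u v. ((\<lambda>q. W q u v) has_derivative (\<lambda>h. w h u v)) (at 0)"
    "vector [w (axis 1 1) (axis 3 1) (axis 4 1), - w (axis 1 1) (axis 2 1) (axis 4 1), w (axis 1 1) (axis 2 1) (axis 3 1)] = curl A"
proof -
  obtain e w where "closed_form W e w" by (rule closed_germ_form[OF W]) (rule that)
  then interpret closed_form W e w .
  have 0: "0 \<in> ball (0 :: real ^ 4) e" using radius by simp
  have "\<forall>\<^sub>0q. slice q \<in> ball 0 e"
    by (rule map_germ_tendsto_0[OF map_germ_slice]) (use radius in \<open>simp, intro eventually_nhds_in_open, auto\<close>)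
  with restr have tang: "\<forall>\<^sub>0q. tangential_part W (slice q) = coeff_vector \<sigma> q"
  proof eventually_elim
    case (elim q)
    have "W (slice q) (axis 2 1) (axis 4 1) = - W (slice q) (axis 4 1) (axis 2 1)"
      by (rule bilinear_alternating_skew[OF bilinear alternating]) (rule elim)+
    then show ?case
      using elim(1)[rule_format, of "axis 2 1" "axis 3 1"] elim(1)[rule_format, of "axis 3 1" "axis 1 1"]
        elim(1)[rule_format, of "axis 1 1" "axis 2 1"]
      by (simp add: tangential_part_def coeff_vector_def slice_axis)
  qed
  have Wij: "fun_germ r (\<lambda>q. W (slice q) (axis i 1) (axis j 1))" for i j
    using W(1) by (intro fun_germ_compose[OF _ map_germ_slice]) (simp_all add: two_form_germ_def)
  have dW: "((\<lambda>q. W (slice q) u v) has_derivative (\<lambda>h. w 0 (slice h) u v)) (at 0)" for u v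
    using has_derivative_compose[OF bounded_linear_imp_has_derivative[OF linear_conv_bounded_linear[THEN iffD1, OF linear_slice]], of "\<lambda>q. W q u v" "\<lambda>h. w 0 h u v" 0 UNIV] deriv[OF 0]
    by simp
  define S where "S = (\<lambda>h. vector [w 0 (slice h) (axis 3 1) (axis 4 1), - w 0 (slice h) (axis 2 1) (axis 4 1),
    w 0 (slice h) (axis 2 1) (axis 3 1)] :: real ^ 3)"
  define A where "A = (\<lambda>h. vector [w 0 (slice h) (axis 1 1) (axis 2 1), w 0 (slice h) (axis 1 1) (axis 3 1),
    w 0 (slice h) (axis 1 1) (axis 4 1)] :: real ^ 3)"
  have tang_germ: "map_germ r (\<lambda>q. tangential_part W (slice q))"
    unfolding map_germ_def forall_3 tangential_part_def by (simp add: Wij fun_germ_minus)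
  have "map_germ r (coeff_vector \<sigma>)" unfolding map_germ_def
  proof
    fix k show "fun_germ r (\<lambda>q. coeff_vector \<sigma> q $ k)"
      by (rule fun_germ_cong[of r "\<lambda>q. tangential_part W (slice q) $ k"])
        (use tang_germ tang in \<open>auto simp: map_germ_def elim: eventually_mono\<close>)
  qed
  moreover have "(coeff_vector \<sigma> has_derivative S) (at 0)"
  proof -
    have "((\<lambda>q. tangential_part W (slice q)) has_derivative S) (at 0)"
      unfolding tangential_part_def S_def by (intro has_derivative_vector3 has_derivative_minus dW)
    then show ?thesis
      by (rule has_derivative_transform_eventually)
        (use tang eventually_nhds_x_imp_x[OF tang] in \<open>auto simp: eventually_at_filter elim: eventually_mono\<close>)
  qed
  moreover have "(\<Sum>k\<in>UNIV. S (axis k 1) $ k) = 0"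
    using closed[OF 0, of "axis 2 1" "axis 3 1" "axis 4 1"] by (simp add: sum_3 S_def slice_axis)
  moreover have "map_germ r (normal_part W)"
    unfolding map_germ_def forall_3 normal_part_def by (simp add: Wij)
  moreover have "(normal_part W has_derivative A) (at 0)"
    unfolding normal_part_def A_def by (intro has_derivative_vector3 dW)
  moreover have "\<forall>\<^sub>0q. normal_part W q \<bullet> coeff_vector \<sigma> q = 0"
    using pf tang
  proof eventually_elim
    case (elim q)
    have "normal_part W q \<bullet> coeff_vector \<sigma> q = normal_part W q \<bullet> tangential_part W (slice q)" using elim by simp
    also have "\<dots> = pfaffian (W (slice q))"
      by (simp add: normal_part_def tangential_part_def pfaffian_def inner_vec_def sum_3)
    finally show ?case using elim by simp
  qed
  moreover have "vector [w 0 (axis 1 1) (axis 3 1) (axis 4 1), - w 0 (axis 1 1) (axis 2 1) (axis 4 1),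
      w 0 (axis 1 1) (axis 2 1) (axis 3 1)] = curl A"
    using closed[OF 0, of "axis 1 1" "axis 3 1" "axis 4 1"] closed[OF 0, of "axis 1 1" "axis 2 1" "axis 4 1"]
      closed[OF 0, of "axis 1 1" "axis 2 1" "axis 3 1"]
    by (simp add: curl_def A_def slice_axis vec_eq_iff forall_3)
  ultimately show ?thesis using tang deriv[OF 0] by (intro that[of S A "w 0"])
qed

text \<open>Since the tangential part vanishes at \<open>0\<close>, only the terms in which it is
  differentiated survive in the product rule.\<close>

lemma pfaffian_derivative:
  fixes W :: "4 two_form"
  assumes W: "\<And>u v. ((\<lambda>q. W q u v) has_derivative (\<lambda>h. w h u v)) (at 0)"
    and 0: "tangential_part W 0 = 0"
  shows "((\<lambda>x. pfaffian (W x)) has_derivative (\<lambda>h. normal_part W 0 \<bullet>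
    vector [w h (axis 3 1) (axis 4 1), - w h (axis 2 1) (axis 4 1), w h (axis 2 1) (axis 3 1)])) (at 0)"
proof -
  have z: "W 0 (axis 3 1) (axis 4 1) = 0" "W 0 (axis 2 1) (axis 4 1) = 0" "W 0 (axis 2 1) (axis 3 1) = 0"
    using 0 by (simp_all add: tangential_part_def vec_eq_iff forall_3)
  have "((\<lambda>x. pfaffian (W x)) has_derivative (\<lambda>h.
      W 0 (axis 1 1) (axis 2 1) * w h (axis 3 1) (axis 4 1) + w h (axis 1 1) (axis 2 1) * W 0 (axis 3 1) (axis 4 1)
      - (W 0 (axis 1 1) (axis 3 1) * w h (axis 2 1) (axis 4 1) + w h (axis 1 1) (axis 3 1) * W 0 (axis 2 1) (axis 4 1))
      + (W 0 (axis 1 1) (axis 4 1) * w h (axis 2 1) (axis 3 1) + w h (axis 1 1) (axis 4 1) * W 0 (axis 2 1) (axis 3 1)))) (at 0)"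
    unfolding pfaffian_def by (intro has_derivative_add has_derivative_diff has_derivative_mult W)
  then show ?thesis by (simp add: z normal_part_def inner_vec_def sum_3)
qed

text \<open>Polarization of the quadratic form \<open>pfaffian\<close>: the mixed term for a
  combination of two forms.\<close>

definition polar_pfaffian :: "(real ^ 4 \<Rightarrow> real ^ 4 \<Rightarrow> real) \<Rightarrow> (real ^ 4 \<Rightarrow> real ^ 4 \<Rightarrow> real) \<Rightarrow> real" where
  "polar_pfaffian B C =
    B (axis 1 1) (axis 2 1) * C (axis 3 1) (axis 4 1) + C (axis 1 1) (axis 2 1) * B (axis 3 1) (axis 4 1)
    - (B (axis 1 1) (axis 3 1) * C (axis 2 1) (axis 4 1) + C (axis 1 1) (axis 3 1) * B (axis 2 1) (axis 4 1))
    + (B (axis 1 1) (axis 4 1) * C (axis 2 1) (axis 3 1) + C (axis 1 1) (axis 4 1) * B (axis 2 1) (axis 3 1))"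

lemma pfaffian_combination:
  "pfaffian (\<lambda>u v. a * B u v + b * C u v) = a\<^sup>2 * pfaffian B + a * b * polar_pfaffian B C + b\<^sup>2 * pfaffian C"
  by (simp add: pfaffian_def polar_pfaffian_def power2_eq_square algebra_simps)

lemma fun_germ_pfaffian: "two_form_germ r W \<Longrightarrow> fun_germ r (\<lambda>x. pfaffian (W x))"
  unfolding pfaffian_def two_form_germ_def by (intro fun_germ_add fun_germ_diff fun_germ_mult) auto

lemma fun_germ_polar_pfaffian:
  "two_form_germ r W \<Longrightarrow> two_form_germ r W' \<Longrightarrow> fun_germ r (\<lambda>x. polar_pfaffian (W x) (W' x))"
  unfolding polar_pfaffian_def two_form_germ_def by (intro fun_germ_add fun_germ_diff fun_germ_mult) auto

lemma eventually_slice: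
  assumes "\<forall>\<^sub>0q. P (slice q)"
  shows "\<forall>\<^sub>0x. x $ 1 = 0 \<longrightarrow> P x"
proof -
  have "\<forall>\<^sub>0x. P (slice (unslice x))"
    by (rule map_germ_tendsto_0[OF map_germ_unslice _ assms]) simp
  then show ?thesis by (rule eventually_mono) (use slice_unslice in metis)
qed

text \<open>
  The vector \<open>X\<close> is \<open>- B\<^sup>* h / u\<close> for the Hodge dual \<open>B\<^sup>*\<close> of \<open>B\<close>, which satisfies
  \<open>B B\<^sup>* = - pfaffian B\<close> as matrices.
\<close>

lemma contraction_solution:
  assumes B: "bilinear B" "\<And>u. B u u = 0" and pf: "pfaffian B = c * u" and u: "u \<noteq> 0" and h: "h $ 1 = 0"
    and X: "X = vector [
      - (B (axis 3 1) (axis 4 1) * h $ 2 - B (axis 2 1) (axis 4 1) * h $ 3 + B (axis 2 1) (axis 3 1) * h $ 4) * inverse u,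
      - (B (axis 1 1) (axis 4 1) * h $ 3 - B (axis 1 1) (axis 3 1) * h $ 4) * inverse u,
      - (B (axis 1 1) (axis 2 1) * h $ 4 - B (axis 1 1) (axis 4 1) * h $ 2) * inverse u,
      - (B (axis 1 1) (axis 3 1) * h $ 2 - B (axis 1 1) (axis 2 1) * h $ 3) * inverse u]"
  shows "B X v = - ((c *\<^sub>R h) \<bullet> v)"
proof -
  let ?B = "\<lambda>i j. B (axis i 1) (axis j 1) :: real"
  have skew: "?B 2 1 = - ?B 1 2" "?B 3 1 = - ?B 1 3" "?B 4 1 = - ?B 1 4" "?B 3 2 = - ?B 2 3" "?B 4 2 = - ?B 2 4"
    "?B 4 3 = - ?B 3 4" by (rule bilinear_alternating_skew[OF B])+
  have pf': "(?B 1 2 * ?B 3 4 - ?B 1 3 * ?B 2 4 + ?B 1 4 * ?B 2 3) * inverse u = c"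
    using pf u by (simp add: pfaffian_def)
  let ?i = "inverse u"
  have X': "X $ 1 = - (?B 3 4 * h $ 2 - ?B 2 4 * h $ 3 + ?B 2 3 * h $ 4) * ?i" "X $ 2 = - (?B 1 4 * h $ 3 - ?B 1 3 * h $ 4) * ?i"
    "X $ 3 = - (?B 1 2 * h $ 4 - ?B 1 4 * h $ 2) * ?i" "X $ 4 = - (?B 1 3 * h $ 2 - ?B 1 2 * h $ 3) * ?i"
    unfolding X by (simp_all only: vector_4)
  have "B X v = - ((?B 1 2 * ?B 3 4 - ?B 1 3 * ?B 2 4 + ?B 1 4 * ?B 2 3) * ?i) * (h $ 2 * v $ 2 + h $ 3 * v $ 3 + h $ 4 * v $ 4)"
    unfolding bilinear_coordinates[OF B(1), of X v] sum_4 B(2) skew X' by (simp add: algebra_simps)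
  also have "\<dots> = - ((c *\<^sub>R h) \<bullet> v)" unfolding pf' using h by (simp add: inner_vec_def sum_4 algebra_simps)
  finally show ?thesis .
qed

theorem straightened_equivalence:
  fixes W0 W1 :: "4 two_form" and \<sigma> :: "3 two_form" and I :: "(real ^ 3 \<Rightarrow> real) set set"
  assumes W0: "two_form_germ r W0" "closed_germ W0" and W1: "two_form_germ r W1" "closed_germ W1"
    and restr: "\<forall>\<^sub>0q. \<forall>a b. W0 (slice q) (slice a) (slice b) = \<sigma> q a b"
      "\<forall>\<^sub>0q. \<forall>a b. W1 (slice q) (slice a) (slice b) = \<sigma> q a b"
    and pf: "\<forall>\<^sub>0q. pfaffian (W0 (slice q)) = 0" "\<forall>\<^sub>0q. pfaffian (W1 (slice q)) = 0"
    and pf0: "((\<lambda>x. pfaffian (W0 x)) has_derivative P0) (at 0)" "P0 (axis 1 1) \<noteq> 0"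
    and pf1: "((\<lambda>x. pfaffian (W1 x)) has_derivative P1) (at 0)" "P1 (axis 1 1) \<noteq> 0"
    and \<sigma>0: "coeff_vector \<sigma> 0 = 0"
    and orient: "normal_part W0 0 \<bullet> normal_part W1 0 \<ge> 0"
    and g: "g1 \<in> carrier (germ_ring r)" "g2 \<in> carrier (germ_ring r)"
    and I: "I = coeff_ideal r \<sigma>" "I = Idl\<^bsub>germ_ring r\<^esub> {g1, g2}"
    and reg: "regular_sequence (germ_ring r) I [g1, g2]"
  obtains \<Psi> where "diffeo_germ r \<Psi>" "two_form_germ_eq (pullback \<Psi> W1) W0"
proof -
  obtain S A0 w0 where s: "map_germ r (coeff_vector \<sigma>)" "(coeff_vector \<sigma> has_derivative S) (at 0)" "(\<Sum>k\<in>UNIV. S (axis k 1) $ k) = 0"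
    and a0: "map_germ r (normal_part W0)" "(normal_part W0 has_derivative A0) (at 0)" "\<forall>\<^sub>0q. normal_part W0 q \<bullet> coeff_vector \<sigma> q = 0"
    and tang0: "\<forall>\<^sub>0q. tangential_part W0 (slice q) = coeff_vector \<sigma> q"
    and w0: "\<And>u v. ((\<lambda>q. W0 q u v) has_derivative (\<lambda>h. w0 h u v)) (at 0)"
    "vector [w0 (axis 1 1) (axis 3 1) (axis 4 1), - w0 (axis 1 1) (axis 2 1) (axis 4 1), w0 (axis 1 1) (axis 2 1) (axis 3 1)] = curl A0"
    by (rule straightened_form[OF W0 restr(1) pf(1)]) (rule that)
  obtain S' A1 w1 where s': "map_germ r (coeff_vector \<sigma>)" "(coeff_vector \<sigma> has_derivative S') (at 0)" "(\<Sum>k\<in>UNIV. S' (axis k 1) $ k) = 0"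
    and a1: "map_germ r (normal_part W1)" "(normal_part W1 has_derivative A1) (at 0)" "\<forall>\<^sub>0q. normal_part W1 q \<bullet> coeff_vector \<sigma> q = 0"
    and tang1: "\<forall>\<^sub>0q. tangential_part W1 (slice q) = coeff_vector \<sigma> q"
    and w1: "\<And>u v. ((\<lambda>q. W1 q u v) has_derivative (\<lambda>h. w1 h u v)) (at 0)"
    "vector [w1 (axis 1 1) (axis 3 1) (axis 4 1), - w1 (axis 1 1) (axis 2 1) (axis 4 1), w1 (axis 1 1) (axis 2 1) (axis 3 1)] = curl A1"
    by (rule straightened_form[OF W1 restr(2) pf(2)]) (rule that)
  have I': "I = Idl\<^bsub>germ_ring r\<^esub> {germ0 (\<lambda>q. coeff_vector \<sigma> q $ 1), germ0 (\<lambda>q. coeff_vector \<sigma> q $ 2), germ0 (\<lambda>q. coeff_vector \<sigma> q $ 3)}"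
    by (simp add: I(1) coeff_ideal_def coeff_vector_def)
  obtain n c0 c1 where n: "normal_part W0 0 = c0 *\<^sub>R n" "normal_part W1 0 = c1 *\<^sub>R n"
    "c0 * (n \<bullet> curl A1) = c1 * (n \<bullet> curl A0)"
    by (rule annihilators_of_regular_ideal[OF s(1) g I' I(2) reg \<sigma>0 s(2,3) a0 a1]) (rule that)
  have t0: "tangential_part W0 0 = 0" "tangential_part W1 0 = 0"
    using eventually_nhds_x_imp_x[OF tang0] eventually_nhds_x_imp_x[OF tang1] \<sigma>0 by simp_all
  \<comment> \<open>The nonzero transversal derivative of the Pfaffian rules out
    \<open>c0 = 0\<close> here and \<open>c1 = 0\<close> below.\<close>
  have "c0 * (n \<bullet> curl A0) = P0 (axis 1 1)"
    using fun_cong[OF has_derivative_unique[OF pfaffian_derivative[OF w0(1) t0(1)] pf0(1)], of "axis 1 1"]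
    by (simp add: w0(2) n(1))
  then have c0: "c0 \<noteq> 0" "n \<bullet> curl A0 \<noteq> 0" using pf0(2) by auto
  have "c1 * (n \<bullet> curl A1) = P1 (axis 1 1)"
    using fun_cong[OF has_derivative_unique[OF pfaffian_derivative[OF w1(1) t0(2)] pf1(1)], of "axis 1 1"]
    by (simp add: w1(2) n(2))
  then have c1: "c1 \<noteq> 0" using pf1(2) by auto
  have "n \<noteq> 0" using c0(2) by auto
  then have nn: "n \<bullet> n > 0" by simp
  have "c0 * c1 * (n \<bullet> n) \<ge> 0" using orient by (simp add: n algebra_simps)
  then have "c0 * c1 \<ge> 0" using nn by (simp add: zero_le_mult_iff)
  then have c01: "c0 * c1 > 0" using c0(1) c1 by (simp add: less_le)
  define ct where "ct = (\<lambda>t. (1 - t) * c0 + t * c1)"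
  \<comment> \<open>Multiplied by \<open>c0\<close> it becomes a convex combination of the positive
    numbers \<open>c0\<^sup>2\<close> and \<open>c0 * c1\<close>.\<close>
  have ct: "ct t \<noteq> 0" if "t \<in> {0..1}" for t
  proof -
    have "(1 - t) * c0\<^sup>2 + t * (c0 * c1) > 0"
    proof (cases "t = 0")
      case False
      then have "t * (c0 * c1) > 0" using c01 that by simp
      moreover have "(1 - t) * c0\<^sup>2 \<ge> 0" using that by simp
      ultimately show ?thesis by linarith
    qed (use c0(1) in simp)
    moreover have "(1 - t) * c0\<^sup>2 + t * (c0 * c1) = c0 * ct t" by (simp add: ct_def power2_eq_square algebra_simps)
    ultimately show ?thesis by auto
  qed

  define Wt where "Wt = (\<lambda>t x u v. (1 - t) * W0 x u v + t * W1 x u v)"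
  have pf_t: "pfaffian (Wt t x) = (1 - t)\<^sup>2 * pfaffian (W0 x) + (1 - t) * t * polar_pfaffian (W0 x) (W1 x) + t\<^sup>2 * pfaffian (W1 x)" for t x
    unfolding Wt_def by (rule pfaffian_combination)
  have "\<forall>\<^sub>0q. polar_pfaffian (W0 (slice q)) (W1 (slice q)) = 0"
    using a0(3) a1(3) tang0 tang1
  proof eventually_elim
    case (elim q)
    have "polar_pfaffian (W0 (slice q)) (W1 (slice q))
        = normal_part W0 q \<bullet> tangential_part W1 (slice q) + normal_part W1 q \<bullet> tangential_part W0 (slice q)"
      by (simp add: polar_pfaffian_def normal_part_def tangential_part_def inner_vec_def sum_3)
    then show ?case using elim by simp
  qed
  note polar_zero = eventually_slice[OF this]
  \<comment> \<open>The factor \<open>x $ 1\<close> is divided out of the three coefficients of the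
    quadratic polynomial in t separately, so that the quotient is again polynomial in t and hence a
    family of germs.\<close>
  obtain u0 where u0: "fun_germ r u0" "\<forall>\<^sub>0x. pfaffian (W0 x) = x $ 1 * u0 x"
    by (rule hadamard[OF fun_germ_pfaffian[OF W0(1)] eventually_slice[OF pf(1)]]) (rule that)
  obtain u1 where u1: "fun_germ r u1" "\<forall>\<^sub>0x. pfaffian (W1 x) = x $ 1 * u1 x"
    by (rule hadamard[OF fun_germ_pfaffian[OF W1(1)] eventually_slice[OF pf(2)]]) (rule that)
  obtain u2 where u2: "fun_germ r u2" "\<forall>\<^sub>0x. polar_pfaffian (W0 x) (W1 x) = x $ 1 * u2 x"
    by (rule hadamard[OF fun_germ_polar_pfaffian[OF W0(1) W1(1)] polar_zero]) (rule that)
  define u where "u = (\<lambda>t x. (1 - t)\<^sup>2 * u0 x + (1 - t) * t * u2 x + t\<^sup>2 * u1 x)"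
  have pf_u: "\<forall>\<^sub>0x. \<forall>t. pfaffian (Wt t x) = x $ 1 * u t x"
    using u0(2) u1(2) u2(2) by eventually_elim (simp add: pf_t u_def algebra_simps)
  have const_family: "germ_family r (\<lambda>_. f)" if "fun_germ r f" for f :: "real ^ 4 \<Rightarrow> real"
    using that by (simp add: germ_family_constant_iff)
  have time_family: "germ_family r (\<lambda>t (x :: real ^ 4). c t)" if "continuous_on {0..1} c" for c
    using that by (rule germ_family_time)
  have u_family: "germ_family r u"
    unfolding u_def
    by (intro germ_family_add germ_family_mult[OF time_family const_family] u0 u1 u2 continuous_intros)
  have u_zero: "u t 0 \<noteq> 0" if t: "t \<in> {0..1}" for t
  proof -
    have dWt: "((\<lambda>q. Wt t q u v) has_derivative (\<lambda>h. (1 - t) * w0 h u v + t * w1 h u v)) (at 0)" for u v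
      unfolding Wt_def by (intro has_derivative_add has_derivative_mult_right w0 w1)
    have tang: "tangential_part (Wt t) 0 = 0"
      using t0 by (simp add: tangential_part_def Wt_def vec_eq_iff forall_3)
    have normal: "normal_part (Wt t) 0 = ct t *\<^sub>R n"
    proof -
      have "normal_part (Wt t) 0 = (1 - t) *\<^sub>R normal_part W0 0 + t *\<^sub>R normal_part W1 0"
        by (simp add: normal_part_def Wt_def vec_eq_iff forall_3)
      then show ?thesis by (simp add: n ct_def algebra_simps)
    qed
    have "u t differentiable (at 0)"
      using fun_germ_differentiable[OF fun_germ_at_time[OF u_family t]] unfolding differentiable_def by blast
    then obtain u' where u': "(u t has_derivative u') (at 0)" unfolding differentiable_def by (elim exE)
    \<comment> \<open>In the first direction this derivative at \<open>0\<close> is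
      \<open>u t 0\<close>, which is thereby identified with the transversal derivative of the
      Pfaffian.\<close>
    have "((\<lambda>x. x $ 1 * u t x) has_derivative (\<lambda>h. (0 :: real ^ 4) $ 1 * u' h + h $ 1 * u t 0)) (at 0)"
      by (intro has_derivative_mult u' bounded_linear_imp_has_derivative[OF bounded_linear_vec_nth])
    moreover have "\<forall>\<^sub>0x. pfaffian (Wt t x) = x $ 1 * u t x" using pf_u by (rule eventually_mono) blast
    ultimately have "(\<lambda>h. normal_part (Wt t) 0 \<bullet> vector [(1 - t) * w0 h (axis 3 1) (axis 4 1) + t * w1 h (axis 3 1) (axis 4 1),
        - ((1 - t) * w0 h (axis 2 1) (axis 4 1) + t * w1 h (axis 2 1) (axis 4 1)),
        (1 - t) * w0 h (axis 2 1) (axis 3 1) + t * w1 h (axis 2 1) (axis 3 1)]) = (\<lambda>h. (0 :: real ^ 4) $ 1 * u' h + h $ 1 * u t 0)"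
      by (rule has_derivative_germ_unique[OF pfaffian_derivative[OF dWt tang]])
    from fun_cong[OF this, of "axis 1 1"]
    have "ct t * (n \<bullet> ((1 - t) *\<^sub>R vector [w0 (axis 1 1) (axis 3 1) (axis 4 1), - w0 (axis 1 1) (axis 2 1) (axis 4 1), w0 (axis 1 1) (axis 2 1) (axis 3 1)]
      + t *\<^sub>R vector [w1 (axis 1 1) (axis 3 1) (axis 4 1), - w1 (axis 1 1) (axis 2 1) (axis 4 1), w1 (axis 1 1) (axis 2 1) (axis 3 1)])) = u t 0"
      unfolding normal by (simp add: inner_vec_def sum_3 algebra_simps)
    then have "u t 0 = ct t * ((1 - t) * (n \<bullet> curl A0) + t * (n \<bullet> curl A1))"
      unfolding w0(2) w1(2) by (simp add: inner_add_right)
    \<comment> \<open>Multiplication by \<open>c0\<close> lets \<open>n(3)\<close> replace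
      \<open>c0 * (n \<bullet> curl A1)\<close>, and the factor \<open>ct t\<close> appears a second
      time.\<close>
    then have "c0 * u t 0 = c0 * (ct t * ((1 - t) * (n \<bullet> curl A0) + t * (n \<bullet> curl A1)))" by (rule arg_cong)
    also have "\<dots> = ct t * ((1 - t) * c0 * (n \<bullet> curl A0) + t * (c0 * (n \<bullet> curl A1)))"
      by (simp add: algebra_simps)
    also have "\<dots> = ct t * ct t * (n \<bullet> curl A0)" unfolding n(3) by (simp add: ct_def algebra_simps)
    finally show ?thesis using ct[OF t] c0 by auto
  qed

  let ?\<delta> = "\<lambda>p u v. W1 p u v - W0 p u v"
  have "\<forall>\<^sub>0q. \<forall>a b. ?\<delta> (slice q) (slice a) (slice b) = 0" using restr by eventually_elim simp
  from eventually_slice[of "\<lambda>x. \<forall>a b. ?\<delta> x (slice a) (slice b) = 0", OF this]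
  have "\<forall>\<^sub>0x. \<forall>u v. x $ 1 = 0 \<longrightarrow> u $ 1 = 0 \<longrightarrow> v $ 1 = 0 \<longrightarrow> ?\<delta> x u v = 0"
  proof (rule eventually_mono, intro allI impI)
    fix x u v :: "real ^ 4"
    assume *: "x $ 1 = 0 \<longrightarrow> (\<forall>a b. ?\<delta> x (slice a) (slice b) = 0)" and xuv: "x $ 1 = 0" "u $ 1 = 0" "v $ 1 = 0"
    then have "?\<delta> x (slice (unslice u)) (slice (unslice v)) = 0" by blast
    then show "?\<delta> x u v = 0" by (simp add: slice_unslice xuv)
  qed
  then obtain e h \<eta>' where e: "e > 0" and h: "map_germ r h" "\<And>x. x \<in> ball 0 e \<Longrightarrow> h x $ 1 = 0"
    "\<And>k. h 0 $ k = ?\<delta> 0 (axis 1 1) (axis k 1)"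
    "\<And>x. x \<in> ball 0 e \<Longrightarrow> ((\<lambda>x. x $ 1 *\<^sub>R h x) has_derivative \<eta>' x) (at x)"
    "\<And>x u v. x \<in> ball 0 e \<Longrightarrow> \<eta>' x u \<bullet> v - \<eta>' x v \<bullet> u = ?\<delta> x u v"
    by (rule relative_poincare[OF two_form_germ_diff[OF W1(1) W0(1)] closed_germ_diff[OF W1 W0]]) (rule that)
  define X where "X = (\<lambda>t x. vector [
      - (Wt t x (axis 3 1) (axis 4 1) * h x $ 2 - Wt t x (axis 2 1) (axis 4 1) * h x $ 3 + Wt t x (axis 2 1) (axis 3 1) * h x $ 4) * inverse (u t x),
      - (Wt t x (axis 1 1) (axis 4 1) * h x $ 3 - Wt t x (axis 1 1) (axis 3 1) * h x $ 4) * inverse (u t x),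
      - (Wt t x (axis 1 1) (axis 2 1) * h x $ 4 - Wt t x (axis 1 1) (axis 4 1) * h x $ 2) * inverse (u t x),
      - (Wt t x (axis 1 1) (axis 3 1) * h x $ 2 - Wt t x (axis 1 1) (axis 2 1) * h x $ 3) * inverse (u t x)] :: real ^ 4)"
  have Wt_family: "germ_family r (\<lambda>t x. Wt t x (axis i 1) (axis j 1))" for i j
    using W0(1) W1(1) unfolding Wt_def two_form_germ_def
    by (intro germ_family_add germ_family_mult[OF time_family const_family] continuous_intros) auto
  have h_family: "germ_family r (\<lambda>t x. h x $ k)" for k using h(1) by (intro const_family) (simp add: map_germ_def)
  have u_inv: "germ_family r (\<lambda>t x. inverse (u t x))" by (rule germ_family_inverse[OF u_family u_zero])
  have X_family: "germ_family r (\<lambda>t x. X t x $ j)" for j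
    using exhaust_4[of j] unfolding X_def
    by (elim disjE; simp) (intro germ_family_mult[OF _ u_inv] germ_family_diff germ_family_mult[OF Wt_family h_family])+
  \<comment> \<open>The tangential part vanishes at \<open>0\<close>, so the first component is 0.
    The others are components of a cross product of the normal part with \<open>h 0\<close>, and
    both are multiples of \<open>n\<close>.\<close>
  have X_zero: "X t 0 = 0" for t
  proof -
    have n12: "W0 0 (axis 1 1) (axis 2 1) = c0 * n $ 1" "W0 0 (axis 1 1) (axis 3 1) = c0 * n $ 2" "W0 0 (axis 1 1) (axis 4 1) = c0 * n $ 3"
      "W1 0 (axis 1 1) (axis 2 1) = c1 * n $ 1" "W1 0 (axis 1 1) (axis 3 1) = c1 * n $ 2" "W1 0 (axis 1 1) (axis 4 1) = c1 * n $ 3"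
      using n(1,2) by (simp_all add: normal_part_def vec_eq_iff forall_3)
    have z: "W0 0 (axis 3 1) (axis 4 1) = 0" "W0 0 (axis 2 1) (axis 4 1) = 0" "W0 0 (axis 2 1) (axis 3 1) = 0"
      "W1 0 (axis 3 1) (axis 4 1) = 0" "W1 0 (axis 2 1) (axis 4 1) = 0" "W1 0 (axis 2 1) (axis 3 1) = 0"
      using t0 by (simp_all add: tangential_part_def vec_eq_iff forall_3)
    show ?thesis
      by (simp add: X_def Wt_def h(3) n12 z vec_eq_iff forall_4 del: mult_minus_left) (simp add: algebra_simps)
  qed
  obtain d where d: "d > 0" "\<And>x. dist x 0 < d \<Longrightarrow> \<forall>t. pfaffian (Wt t x) = x $ 1 * u t x"
    using pf_u unfolding eventually_nhds_metric by blast
  have "\<forall>\<^sub>0p. (bilinear (W0 p) \<and> (\<forall>u. W0 p u u = 0)) \<and> (bilinear (W1 p) \<and> (\<forall>u. W1 p u u = 0))"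
    by (rule eventually_conj[OF W0(1)[unfolded two_form_germ_def, THEN conjunct1] W1(1)[unfolded two_form_germ_def, THEN conjunct1]])
  then obtain b where b: "b > 0" "\<And>x. dist x 0 < b \<Longrightarrow> (bilinear (W0 x) \<and> (\<forall>u. W0 x u u = 0)) \<and> (bilinear (W1 x) \<and> (\<forall>u. W1 x u u = 0))"
    unfolding eventually_nhds_metric by blast
  obtain a where a: "a > 0" "cont_family (ball 0 a) u"
    by (rule germ_family_continuous[OF u_family]) (rule that)
  obtain a' where a': "a' > 0" "\<And>t x. t \<in> {0..1} \<Longrightarrow> x \<in> ball 0 a' \<Longrightarrow> (\<lambda>(t, x). u t x) (t, x) \<in> - {0}"
    by (rule tube_unit_interval[OF a(2) open_ball, of 0 "- {0}"]) (use a(1) u_zero that in auto)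
  define m where "m = min (min e d) (min b a')"
  have contraction: "(1 - t) * W0 x (X t x) v + t * W1 x (X t x) v = - ((x $ 1 *\<^sub>R h x) \<bullet> v)"
    if t: "t \<in> {0..1}" and x: "x \<in> ball 0 m" for t x v
  proof -
    have x': "x \<in> ball 0 e" "dist x 0 < d" "dist x 0 < b" "x \<in> ball 0 a'" using x by (auto simp: m_def dist_commute)
    have bil: "bilinear (W0 x)" "bilinear (W1 x)" "\<And>u. W0 x u u = 0" "\<And>u. W1 x u u = 0" using b(2)[OF x'(3)] by auto
    have "bilinear (Wt t x)"
      using bil(1,2) unfolding Wt_def bilinear_def
      by (auto intro!: linear_compose_add linear_compose_scale_right[where 'b = real, unfolded real_scaleR_def])
    moreover have "Wt t x u u = 0" for u by (simp add: Wt_def bil)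
    moreover have "pfaffian (Wt t x) = x $ 1 * u t x" using d(2)[OF x'(2)] by blast
    moreover have "u t x \<noteq> 0" using a'(2)[OF t x'(4)] by simp
    ultimately have "Wt t x (X t x) v = - ((x $ 1 *\<^sub>R h x) \<bullet> v)"
      by (rule contraction_solution[OF _ _ _ _ h(2)[OF x'(1)]]) (simp add: X_def)
    then show ?thesis by (simp add: Wt_def)
  qed
  have m: "m > 0" "\<And>x. x \<in> ball 0 m \<Longrightarrow> x \<in> ball 0 e" using e d(1) b(1) a'(1) by (auto simp: m_def)
  obtain \<Psi> where "diffeo_germ r \<Psi>" "two_form_germ_eq (pullback \<Psi> W1) W0"
    by (rule moser[OF W0 W1 m(1) h(4)[OF m(2)] h(5)[OF m(2)] X_family X_zero contraction]) (assumption | rule that)+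
  then show ?thesis by (rule that)
qed

section \<open>Straightening the hypersurface\<close>

lemma fun_germ_det:
  assumes "\<And>i j. fun_germ r (\<lambda>x. K x $ i $ j)"
  shows "fun_germ r (\<lambda>x. det (K x))"
proof -
  have "germ_family r (\<lambda>_ x. K x $ i $ j)" for i j using assms by (simp add: germ_family_constant_iff)
  then have "germ_family r (\<lambda>_ x. det (K x))"
    unfolding det_def by (intro germ_family_sum germ_family_mult germ_family_const germ_family_prod)
  then show ?thesis by (simp add: germ_family_constant_iff)
qed

lemma wedge_axis_pfaffian: "wedge B B (axis 1 1) (axis 2 1) (axis 3 1) (axis 4 1) = 2 * pfaffian B"
  by (simp add: wedge_def pfaffian_def)

text \<open>The coordinates are \<open>(x\<^sub>1, q) \<mapsto> \<iota> q + x\<^sub>1 v\<close> for a vector \<open>v\<close> transversal to the hypersurface.\<close>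

lemma straightening:
  fixes \<omega> :: "4 two_form" and \<iota> :: "real ^ 3 \<Rightarrow> real ^ 4"
  assumes \<omega>: "two_form_germ r \<omega>" "closed_germ \<omega>" and smooth: "structurally_smooth r \<omega>"
    and \<iota>: "map_germ r \<iota>" "\<iota> 0 = 0" "(\<iota> has_derivative L) (at 0)" "inj L"
    and S: "\<forall>\<^sub>0q. \<iota> q \<in> martinet \<omega>" and v: "v \<notin> range L"
  obtains \<Phi> P where "diffeo_germ r \<Phi>" "two_form_germ r (pullback \<Phi> \<omega>)" "closed_germ (pullback \<Phi> \<omega>)"
    "\<forall>\<^sub>0q. \<forall>a b. pullback \<Phi> \<omega> (slice q) (slice a) (slice b) = pullback \<iota> \<omega> q a b"
    "\<forall>\<^sub>0q. pfaffian (pullback \<Phi> \<omega> (slice q)) = 0"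
    "((\<lambda>x. pfaffian (pullback \<Phi> \<omega> x)) has_derivative P) (at 0)" "P (axis 1 1) \<noteq> 0"
    "\<And>b. pullback \<Phi> \<omega> 0 (axis 1 1) (slice b) = \<omega> 0 v (L b)"
proof -
  define \<Phi> where "\<Phi> = (\<lambda>x. \<iota> (unslice x) + x $ 1 *\<^sub>R v)"
  define M where "M = (\<lambda>h. L (unslice h) + h $ 1 *\<^sub>R v)"
  have \<Phi>_germ: "map_germ r \<Phi>"
    using map_germ_compose[OF \<iota>(1) map_germ_unslice unslice_0] unfolding map_germ_def \<Phi>_def
    by (simp add: fun_germ_add fun_germ_mult fun_germ_const fun_germ_coordinate)
  have \<Phi>0: "\<Phi> 0 = 0" by (simp add: \<Phi>_def \<iota>(2))
  have \<Phi>_slice: "\<Phi> (slice q) = \<iota> q" for q by (simp add: \<Phi>_def)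
  have unslice_deriv: "(unslice has_derivative unslice) F" for F
    by (rule bounded_linear_imp_has_derivative[OF linear_conv_bounded_linear[THEN iffD1, OF linear_unslice]])
  have \<Phi>_deriv: "(\<Phi> has_derivative (\<lambda>h. D (unslice h) + h $ 1 *\<^sub>R v)) (at x)"
    if "(\<iota> has_derivative D) (at (unslice x))" for D x
    unfolding \<Phi>_def
    by (intro has_derivative_add has_derivative_scaleR_left bounded_linear_imp_has_derivative[OF bounded_linear_vec_nth]
      has_derivative_compose[OF unslice_deriv that])
  have M_deriv: "(\<Phi> has_derivative M) (at 0)" unfolding M_def by (rule \<Phi>_deriv) (use \<iota>(3) in simp)
  have L_lin: "linear L" using \<iota>(3) by (rule has_derivative_linear)
  have M_lin: "linear M" using M_deriv by (rule has_derivative_linear)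
  \<comment> \<open>As \<open>v\<close> lies outside the range of \<open>L\<close>, a kernel vector
    has first coordinate 0, and injectivity of \<open>L\<close> does the rest.\<close>
  have M_inj: "inj M"
  proof (rule linear_injective_0[OF M_lin, THEN iffD2], intro allI impI)
    fix h assume "M h = 0"
    then have eq: "L (unslice h) = - (h $ 1 *\<^sub>R v)" by (simp add: M_def eq_neg_iff_add_eq_0)
    have h1: "h $ 1 = 0"
    proof (rule ccontr)
      assume "h $ 1 \<noteq> 0"
      then have "L ((- inverse (h $ 1)) *\<^sub>R unslice h) = v"
        unfolding linear_scale[OF L_lin] eq by simp
      then show False using v by (metis rangeI)
    qed
    then have "L (unslice h) = L 0" using eq by (simp add: linear_0[OF L_lin])
    then have "unslice h = 0" using \<iota>(4) by (simp add: inj_eq)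
    then show "h = 0" using slice_unslice[OF h1] by simp
  qed
  have M_matrix: "M = (*v) (matrix M)" by (rule matrix_vector_mul(2)[OF M_lin, symmetric])
  have M_det: "det (matrix M) \<noteq> 0" using M_inj det_nz_iff_inj[OF M_lin] by simp
  have "diffeo_germ r \<Phi>"
    by (rule inverse_function_germ[OF \<Phi>_germ \<Phi>0, of "matrix M"])
      (use M_deriv M_matrix M_det in \<open>simp_all add: invertible_det_nz\<close>)
  moreover have "two_form_germ r (pullback \<Phi> \<omega>)" by (rule pullback_germ[OF \<omega>(1) \<Phi>_germ \<Phi>0])
  moreover have "closed_germ (pullback \<Phi> \<omega>)" by (rule closed_germ_pullback[OF \<omega> \<Phi>_germ \<Phi>0])
  moreover have "\<forall>\<^sub>0q. \<forall>a b. pullback \<Phi> \<omega> (slice q) (slice a) (slice b) = pullback \<iota> \<omega> q a b"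
  proof -
    obtain e J where e: "e > 0" and J: "\<And>i j. fun_germ r (\<lambda>x. J x $ i $ j)"
      "\<And>x. x \<in> ball 0 e \<Longrightarrow> (\<iota> has_derivative (*v) (J x)) (at x)"
      by (rule map_germ_jacobian[OF \<iota>(1)]) (rule that)
    have "\<forall>\<^sub>0q. q \<in> ball (0 :: real ^ 3) e" using e by (intro eventually_nhds_in_open) auto
    then show ?thesis
    proof (rule eventually_mono, intro allI)
      fix q a b assume q: "q \<in> ball (0 :: real ^ 3) e"
      have "(\<Phi> has_derivative (\<lambda>h. J q *v unslice h + h $ 1 *\<^sub>R v)) (at (slice q))"
        by (rule \<Phi>_deriv) (use J(2)[OF q] in simp)
      then have "frechet_derivative \<Phi> (at (slice q)) = (\<lambda>h. J q *v unslice h + h $ 1 *\<^sub>R v)"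
        by (rule frechet_derivative_at[symmetric])
      moreover have "frechet_derivative \<iota> (at q) = (*v) (J q)" by (rule frechet_derivative_at[OF J(2)[OF q], symmetric])
      ultimately show "pullback \<Phi> \<omega> (slice q) (slice a) (slice b) = pullback \<iota> \<omega> q a b"
        by (simp add: pullback_def \<Phi>_slice)
    qed
  qed
  moreover have pf_slice: "\<forall>\<^sub>0q. pfaffian (pullback \<Phi> \<omega> (slice q)) = 0"
    using S
  proof eventually_elim
    case (elim q)
    then have "wedge (\<omega> (\<Phi> (slice q))) (\<omega> (\<Phi> (slice q))) a b c d = 0" for a b c d
      by (simp add: martinet_def \<Phi>_slice)
    then have "wedge (pullback \<Phi> \<omega> (slice q)) (pullback \<Phi> \<omega> (slice q)) (axis 1 1) (axis 2 1) (axis 3 1) (axis 4 1) = 0"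
      by (simp add: wedge_def pullback_def)
    then show ?case by (simp add: wedge_axis_pfaffian)
  qed
  moreover obtain P where P: "((\<lambda>x. pfaffian (pullback \<Phi> \<omega> x)) has_derivative P) (at 0)" "P (axis 1 1) \<noteq> 0"
  proof -
    obtain f \<Omega> where f: "fun_germ r f" "volume_form_germ r \<Omega>" "f 0 = 0" "frechet_derivative f (at 0) \<noteq> (\<lambda>_. 0)"
      and f\<Omega>: "\<forall>\<^sub>0p. \<forall>u v w x. wedge (\<omega> p) (\<omega> p) u v w x = f p * \<Omega> p u v w x"
      using smooth unfolding structurally_smooth_def by blast
    obtain h where h: "fun_germ r h" "h 0 \<noteq> 0"
      "\<forall>\<^sub>0p. \<forall>u v w x. \<Omega> p u v w x = h p * det (vector [u, v, w, x] :: real ^ 4 ^ 4)"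
      using f(2) unfolding volume_form_germ_def by blast
    obtain e K where e: "e > 0" and K: "\<And>i j. fun_germ r (\<lambda>x. K x $ i $ j)"
      "\<And>x. x \<in> ball 0 e \<Longrightarrow> (\<Phi> has_derivative (*v) (K x)) (at x)"
      by (rule map_germ_jacobian[OF \<Phi>_germ]) (rule that)
    \<comment> \<open>Pulling back the volume form multiplies it by the Jacobian determinant; so the
      Pfaffian of the pullback is half of \<open>f (\<Phi> x) * k x\<close>, and \<open>k\<close> is
      a unit at \<open>0\<close>.\<close>
    define k where "k = (\<lambda>x. h (\<Phi> x) * det (K x))"
    have "(*v) (K 0) = M" using has_derivative_unique[OF K(2)[of 0] M_deriv] e by simp
    then have "K 0 = matrix M" using M_matrix by (simp add: matrix_eq fun_eq_iff)
    then have k0: "k 0 \<noteq> 0" using h(2) M_det by (simp add: k_def \<Phi>0)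
    have k_germ: "fun_germ r k"
      unfolding k_def by (intro fun_germ_mult fun_germ_compose[OF h(1) \<Phi>_germ \<Phi>0] fun_germ_det K(1))
    obtain f' where f': "(f has_derivative f') (at 0)" by (rule fun_germ_differentiable[OF f(1)]) (rule that)
    obtain k' where k': "(k has_derivative k') (at 0)" by (rule fun_germ_differentiable[OF k_germ]) (rule that)
    have det_columns: "det (vector [A *v axis 1 1, A *v axis 2 1, A *v axis 3 1, A *v axis 4 1] :: real ^ 4 ^ 4) = det A"
      for A :: "real ^ 4 ^ 4"
    proof -
      have "vector [A *v axis 1 1, A *v axis 2 1, A *v axis 3 1, A *v axis 4 1] = transpose A"
        by (simp add: vec_eq_iff forall_4 transpose_def matrix_vector_mul_component inner_axis)
      then show ?thesis by (simp add: det_transpose)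
    qed
    have "\<forall>\<^sub>0x. x \<in> ball (0 :: real ^ 4) e" using e by (intro eventually_nhds_in_open) auto
    then have pf_eq: "\<forall>\<^sub>0x. (f (\<Phi> x) * k x) / 2 = pfaffian (pullback \<Phi> \<omega> x)"
      using map_germ_tendsto_0[OF \<Phi>_germ \<Phi>0 f\<Omega>] map_germ_tendsto_0[OF \<Phi>_germ \<Phi>0 h(3)]
    proof eventually_elim
      case (elim x)
      have D: "frechet_derivative \<Phi> (at x) = (*v) (K x)" by (rule frechet_derivative_at[OF K(2)[OF elim(1)], symmetric])
      have "2 * pfaffian (pullback \<Phi> \<omega> x) = wedge (\<omega> (\<Phi> x)) (\<omega> (\<Phi> x)) (K x *v axis 1 1) (K x *v axis 2 1) (K x *v axis 3 1) (K x *v axis 4 1)"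
        unfolding wedge_axis_pfaffian[symmetric] by (simp add: wedge_def pullback_def D)
      also have "\<dots> = f (\<Phi> x) * k x" using elim(2,3) by (simp add: det_columns k_def)
      finally show ?case by simp
    qed
    define P where "P = (\<lambda>y. (f' (M y) * k 0) / 2)"
    have f\<Phi>: "((\<lambda>x. f (\<Phi> x)) has_derivative (\<lambda>y. f' (M y))) (at 0)"
      by (rule has_derivative_compose[OF M_deriv]) (use f' \<Phi>0 in simp)
    have "((\<lambda>x. (f (\<Phi> x) * k x) / 2) has_derivative (\<lambda>y. (f (\<Phi> 0) * k' y + f' (M y) * k 0) / 2)) (at 0)"
      by (intro bounded_linear.has_derivative[OF bounded_linear_divide] has_derivative_mult f\<Phi> k')
    then have "((\<lambda>x. (f (\<Phi> x) * k x) / 2) has_derivative P) (at 0)" by (simp add: P_def \<Phi>0 f(3))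
    then have P_deriv: "((\<lambda>x. pfaffian (pullback \<Phi> \<omega> x)) has_derivative P) (at 0)"
      by (rule has_derivative_transform_eventually)
        (use pf_eq eventually_nhds_x_imp_x[OF pf_eq] in \<open>auto simp: eventually_at_filter elim: eventually_mono\<close>)
    have "((\<lambda>q. pfaffian (pullback \<Phi> \<omega> (slice q))) has_derivative (\<lambda>a. P (slice a))) (at 0)"
      by (rule has_derivative_compose[OF bounded_linear_imp_has_derivative[OF linear_conv_bounded_linear[THEN iffD1, OF linear_slice]]])
        (use P_deriv in simp)
    from has_derivative_germ_unique[OF this has_derivative_const pf_slice]
    have P_slice: "P (slice a) = 0" for a by (rule fun_cong)
    have P_lin: "linear P" using P_deriv by (rule has_derivative_linear)
    \<comment> \<open>\<open>P\<close> vanishes on the hyperplane directions. If it vanished on the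
      first one too, \<open>f'\<close> would vanish on the range of \<open>M\<close>, which is the
      whole space, against structural smoothness.\<close>
    have "P (axis 1 1) \<noteq> 0"
    proof
      assume P1: "P (axis 1 1) = 0"
      have "P y = 0" for y
      proof -
        have "y = y $ 1 *\<^sub>R axis 1 1 + slice (unslice y)" by (simp add: vec_eq_iff forall_4 axis_def)
        then have "P y = P (y $ 1 *\<^sub>R axis 1 1 + slice (unslice y))" by (rule arg_cong)
        then show ?thesis by (simp add: linear_add[OF P_lin] linear_scale[OF P_lin] P1 P_slice)
      qed
      then have "f' (M y) = 0" for y using k0 by (simp add: P_def)
      moreover have "surj M" by (rule linear_injective_imp_surjective[OF M_lin M_inj]) simp
      ultimately have "f' z = 0" for z by (metis surjD)
      then have "f' = (\<lambda>_. 0)" by (rule ext)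
      moreover have "frechet_derivative f (at 0) = f'" by (rule frechet_derivative_at[OF f', symmetric])
      ultimately show False using f(4) by simp
    qed
    with P_deriv show ?thesis by (rule that)
  qed
  moreover have "pullback \<Phi> \<omega> 0 (axis 1 1) (slice b) = \<omega> 0 v (L b)" for b
  proof -
    have "frechet_derivative \<Phi> (at 0) = M" by (rule frechet_derivative_at[OF M_deriv, symmetric])
    moreover have "unslice (axis 1 1) = 0" by (simp add: vec_eq_iff forall_3 axis_def)
    ultimately show ?thesis by (simp add: pullback_def \<Phi>0 M_def linear_0[OF L_lin])
  qed
  ultimately show ?thesis by (rule that)
qed

section \<open>Return to the original coordinates\<close>

lemma pullback_identity:
  fixes \<omega> :: "'n::finite two_form"
  assumes "\<forall>\<^sub>0x. F x = x"
  shows "two_form_germ_eq (pullback F \<omega>) \<omega>"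
proof -
  \<comment> \<open>The derivative at a nearby point needs the identity on a neighbourhood of that
    point, not only at the point.\<close>
  have "\<forall>\<^sub>0y. \<forall>\<^sub>F x in nhds y. F x = x" using assms by (simp add: eventually_eventually)
  then show ?thesis unfolding two_form_germ_eq_def
  proof (rule eventually_mono, intro allI)
    fix y u v assume y: "\<forall>\<^sub>F x in nhds y. F x = x"
    then have "(F has_derivative (\<lambda>h. h)) (at y)"
      by (intro has_derivative_transform_eventually[OF has_derivative_ident])
        (use eventually_nhds_x_imp_x[OF y] in \<open>auto simp: eventually_at_filter elim: eventually_mono\<close>)
    then have "frechet_derivative F (at y) = (\<lambda>h. h)" by (rule frechet_derivative_at[symmetric])
    then show "pullback F \<omega> y u v = \<omega> y u v" using eventually_nhds_x_imp_x[OF y] by (simp add: pullback_def)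
  qed
qed

lemma two_form_germ_eq_trans [trans]:
  assumes "two_form_germ_eq \<omega> \<eta>" "two_form_germ_eq \<eta> \<theta>"
  shows "two_form_germ_eq \<omega> \<theta>"
  using assms unfolding two_form_germ_eq_def by eventually_elim simp

lemma two_form_germ_eq_sym:
  assumes "two_form_germ_eq \<omega> \<eta>"
  shows "two_form_germ_eq \<eta> \<omega>"
  using assms unfolding two_form_germ_eq_def by eventually_elim simp

theorem theorem5p4:
  fixes r :: regularity
    and \<omega>0 \<omega>1 :: "4 two_form"
    and \<iota> :: "real ^ 3 \<Rightarrow> real ^ 4"
    and \<sigma> :: "3 two_form"
    and g1 g2 :: "(real ^ 3 \<Rightarrow> real) set"
  assumes "singular_symplectic r \<omega>0" and "singular_symplectic r \<omega>1"
    and "structurally_smooth r \<omega>0" and "structurally_smooth r \<omega>1"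
    and "set_germ_eq (martinet \<omega>0) (martinet \<omega>1)"
    and "hypersurface_chart r (martinet \<omega>0) \<iota>"
    and "form_rank (pullback \<iota> \<omega>0 0) = 0" and "form_rank (pullback \<iota> \<omega>1 0) = 0"
    and "two_form_germ_eq (pullback \<iota> \<omega>0) \<sigma>" and "two_form_germ_eq (pullback \<iota> \<omega>1) \<sigma>"
    and "g1 \<in> carrier (germ_ring r)" and "g2 \<in> carrier (germ_ring r)"
    and "coeff_ideal r \<sigma> = Idl\<^bsub>germ_ring r\<^esub> {g1, g2}"
    and "regular_sequence (germ_ring r) (coeff_ideal r \<sigma>) [g1, g2]"
  shows "\<exists>\<Psi>. diffeo_germ r \<Psi> \<and> two_form_germ_eq (pullback \<Psi> \<omega>1) \<omega>0"
proof -
  have \<omega>0: "two_form_germ r \<omega>0" "closed_germ \<omega>0" and \<omega>1: "two_form_germ r \<omega>1" "closed_germ \<omega>1"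
    using assms(1,2) by (simp_all add: singular_symplectic_def)
  define L where "L = frechet_derivative \<iota> (at 0)"
  have \<iota>: "map_germ r \<iota>" "\<iota> 0 = 0" "inj L"
    using assms(6) by (simp_all add: hypersurface_chart_def L_def)
  obtain L' where L': "(\<iota> has_derivative L') (at 0)" by (rule map_germ_differentiable[OF \<iota>(1)]) (rule that)
  then have L: "(\<iota> has_derivative L) (at 0)" unfolding L_def using frechet_derivative_at[OF L'] by simp
  have S0: "\<forall>\<^sub>0q. \<iota> q \<in> martinet \<omega>0"
  proof -
    obtain U V \<psi> where U: "open U" "0 \<in> U" "homeomorphism U (martinet \<omega>0 \<inter> V) \<iota> \<psi>"
      using assms(6) unfolding hypersurface_chart_def by blast
    have "\<forall>\<^sub>0q. q \<in> U" using U(1,2) by (rule eventually_nhds_in_open)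
    then show ?thesis by (rule eventually_mono) (use homeomorphism_image1[OF U(3)] in blast)
  qed
  have S1: "\<forall>\<^sub>0q. \<iota> q \<in> martinet \<omega>1"
    using S0 map_germ_tendsto_0[OF \<iota>(1,2) assms(5)[unfolded set_germ_eq_def]] by eventually_elim simp
  \<comment> \<open>A vector outside the tangent space of the hypersurface at \<open>0\<close>
    exists for reasons of dimension.\<close>
  have "range L \<noteq> UNIV"
  proof
    assume "range L = UNIV"
    then have "dim (UNIV :: (real ^ 4) set) \<le> dim (UNIV :: (real ^ 3) set)"
      using dim_image_le[OF has_derivative_linear[OF L], of UNIV] by simp
    then show False by (simp add: dim_UNIV)
  qed
  then obtain v where v: "v \<notin> range L" by blast
  have v': "- v \<notin> range L"
  proof
    assume "- v \<in> range L"
    then obtain a where "L a = - v" by force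
    then have "L (- a) = v" using linear_neg[OF has_derivative_linear[OF L]] by simp
    with v show False by blast
  qed
  have \<sigma>0: "coeff_vector \<sigma> 0 = 0"
  proof -
    let ?A = "\<chi> i j. pullback \<iota> \<omega>0 0 (axis i 1) (axis j 1) :: real ^ 3 ^ 3"
    have "rank ?A = 0" using assms(7) by (simp add: form_rank_def)
    then have "?A = 0" by (simp add: rank_eq_0)
    then have "pullback \<iota> \<omega>0 0 (axis i 1) (axis j 1) = 0" for i j by (simp add: vec_eq_iff)
    moreover have "pullback \<iota> \<omega>0 0 a b = \<sigma> 0 a b" for a b
      using eventually_nhds_x_imp_x[OF assms(9)[unfolded two_form_germ_eq_def]] by blast
    ultimately have "\<sigma> 0 (axis i 1) (axis j 1) = 0" for i j by simp
    then show ?thesis by (simp add: coeff_vector_def vec_eq_iff forall_3)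
  qed
  obtain \<Phi>0 P0 where \<Phi>0: "diffeo_germ r \<Phi>0" and W0: "two_form_germ r (pullback \<Phi>0 \<omega>0)" "closed_germ (pullback \<Phi>0 \<omega>0)"
    "\<forall>\<^sub>0q. \<forall>a b. pullback \<Phi>0 \<omega>0 (slice q) (slice a) (slice b) = pullback \<iota> \<omega>0 q a b"
    "\<forall>\<^sub>0q. pfaffian (pullback \<Phi>0 \<omega>0 (slice q)) = 0"
    "((\<lambda>x. pfaffian (pullback \<Phi>0 \<omega>0 x)) has_derivative P0) (at 0)" "P0 (axis 1 1) \<noteq> 0"
    "\<And>b. pullback \<Phi>0 \<omega>0 0 (axis 1 1) (slice b) = \<omega>0 0 v (L b)"
    by (rule straightening[OF \<omega>0 assms(3) \<iota>(1,2) L \<iota>(3) S0 v]) (rule that)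
  let ?n = "normal_part (pullback \<Phi>0 \<omega>0) 0"
  \<comment> \<open>\<open>N v\<close> is the normal part that \<open>\<omega>1\<close> receives
    when straightened along v. It is odd in v, so v or \<open>- v\<close> gives it a nonnegative
    inner product with the normal part of the straightened \<open>\<omega>0\<close>.\<close>
  define N where "N = (\<lambda>v. vector [\<omega>1 0 v (L (axis 1 1)), \<omega>1 0 v (L (axis 2 1)), \<omega>1 0 v (L (axis 3 1))] :: real ^ 3)"
  have "bilinear (\<omega>1 0)"
    using eventually_nhds_x_imp_x[OF \<omega>1(1)[unfolded two_form_germ_def, THEN conjunct1]] by simp
  then have "N (- v) = - N v" by (simp add: N_def bilinear_lneg vec_eq_iff forall_3)
  then have "?n \<bullet> N v \<ge> 0 \<or> ?n \<bullet> N (- v) \<ge> 0" by auto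
  then obtain v1 where v1: "v1 \<notin> range L" "?n \<bullet> N v1 \<ge> 0" using v v' by blast
  obtain \<Phi>1 P1 where \<Phi>1: "diffeo_germ r \<Phi>1" and W1: "two_form_germ r (pullback \<Phi>1 \<omega>1)" "closed_germ (pullback \<Phi>1 \<omega>1)"
    "\<forall>\<^sub>0q. \<forall>a b. pullback \<Phi>1 \<omega>1 (slice q) (slice a) (slice b) = pullback \<iota> \<omega>1 q a b"
    "\<forall>\<^sub>0q. pfaffian (pullback \<Phi>1 \<omega>1 (slice q)) = 0"
    "((\<lambda>x. pfaffian (pullback \<Phi>1 \<omega>1 x)) has_derivative P1) (at 0)" "P1 (axis 1 1) \<noteq> 0"
    "\<And>b. pullback \<Phi>1 \<omega>1 0 (axis 1 1) (slice b) = \<omega>1 0 v1 (L b)"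
    by (rule straightening[OF \<omega>1 assms(4) \<iota>(1,2) L \<iota>(3) S1 v1(1)]) (rule that)
  have "normal_part (pullback \<Phi>1 \<omega>1) 0 = N v1"
    using W1(7)[of "axis 1 1"] W1(7)[of "axis 2 1"] W1(7)[of "axis 3 1"]
    by (simp add: normal_part_def N_def slice_axis)
  with v1(2) have orient: "?n \<bullet> normal_part (pullback \<Phi>1 \<omega>1) 0 \<ge> 0" by simp
  \<comment> \<open>Both straightened forms restrict on the hyperplane to pullbacks under the same
    \<open>\<iota>\<close>, hence to the same \<sigma> in the same coordinates, although the two
    straightening maps may differ off the hyperplane.\<close>
  have restr0: "\<forall>\<^sub>0q. \<forall>a b. pullback \<Phi>0 \<omega>0 (slice q) (slice a) (slice b) = \<sigma> q a b"
    using W0(3) assms(9)[unfolded two_form_germ_eq_def] by eventually_elim simp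
  have restr1: "\<forall>\<^sub>0q. \<forall>a b. pullback \<Phi>1 \<omega>1 (slice q) (slice a) (slice b) = \<sigma> q a b"
    using W1(3) assms(10)[unfolded two_form_germ_eq_def] by eventually_elim simp
  obtain \<Psi> where \<Psi>: "diffeo_germ r \<Psi>" "two_form_germ_eq (pullback \<Psi> (pullback \<Phi>1 \<omega>1)) (pullback \<Phi>0 \<omega>0)"
    by (rule straightened_equivalence[OF W0(1,2) W1(1,2) restr0 restr1 W0(4) W1(4) W0(5,6) W1(5,6) \<sigma>0 orient assms(11,12) refl assms(13,14)])
      (rule that)
  obtain G where G: "diffeo_germ r G" "\<forall>\<^sub>0x. G (\<Phi>0 x) = x" "\<forall>\<^sub>0y. \<Phi>0 (G y) = y"
    by (rule diffeo_germ_inverse[OF \<Phi>0]) (rule that)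
  have germs: "map_germ r G" "G 0 = 0" "map_germ r \<Psi>" "\<Psi> 0 = 0" "map_germ r \<Phi>0" "map_germ r \<Phi>1"
    using G(1) \<Psi>(1) \<Phi>0 \<Phi>1 by (simp_all add: diffeo_germ_def)
  have \<Psi>G: "map_germ r (\<lambda>x. \<Psi> (G x))" "\<Psi> (G 0) = 0"
    using map_germ_compose[OF germs(3,1,2)] germs(2,4) by simp_all
  have "two_form_germ_eq (pullback (\<lambda>x. \<Phi>1 (\<Psi> (G x))) \<omega>1) (pullback (\<lambda>x. \<Psi> (G x)) (pullback \<Phi>1 \<omega>1))"
    by (rule pullback_compose[OF germs(6) \<Psi>G])
  also have "two_form_germ_eq \<dots> (pullback G (pullback \<Psi> (pullback \<Phi>1 \<omega>1)))"
    by (rule pullback_compose[OF germs(3,1,2)])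
  also have "two_form_germ_eq \<dots> (pullback G (pullback \<Phi>0 \<omega>0))" by (rule pullback_cong[OF \<Psi>(2) germs(1,2)])
  also have "two_form_germ_eq \<dots> (pullback (\<lambda>x. \<Phi>0 (G x)) \<omega>0)"
    by (rule two_form_germ_eq_sym[OF pullback_compose[OF germs(5,1,2)]])
  also have "two_form_germ_eq \<dots> \<omega>0" by (rule pullback_identity[OF G(3)])
  finally have "two_form_germ_eq (pullback (\<lambda>x. \<Phi>1 (\<Psi> (G x))) \<omega>1) \<omega>0" .
  moreover have "diffeo_germ r (\<lambda>x. \<Phi>1 (\<Psi> (G x)))"
    by (rule diffeo_germ_compose[OF \<Phi>1 diffeo_germ_compose[OF \<Psi>(1) G(1)]])
  ultimately show ?thesis by blast
qed

end
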